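(* Let $T>0$, $\phi\in C([0,T],\dot H^1)$ and $f\in C([0,T],L^{4/3})$ real-valued, and let $u\in C([0,T],\dot H^1)$ be the unique solution of $\Delta u-|\phi|^2u=f$ (on each time-slice). Let $m,M\ge0$ be integers. If $\partial_t^j\partial_x^\alpha\phi\in C([0,T],\dot H^1)$ and $\partial_t^j\partial_x^\alpha f\in C([0,T],L^{4/3})$ for all $j\le m$ and all spatial multi-indices $|\alpha|\le M$, then $\partial_t^j\partial_x^\alpha u\in C([0,T],\dot H^1)$ for all $j\le m$, $|\alpha|\le M$, and $\|\partial_t^j\partial_x^\alpha u\|_{L^\infty_t(\dot H^1)}\lesssim\|\partial_t^j\partial_x^\alpha\phi\|_{L^\infty_t(\dot H^1)}\|\phi\|_{L^\infty_t(\dot H^1)}\|f\|_{L^\infty_t(L^{4/3})}+\|\partial_t^j\partial_x^\alpha f\|_{L^\infty_t(L^{4/3})}+\eta_\alpha$, where $\eta_\alpha$ depends continuously on the norms $\|\partial_t^k\partial_x^\beta\phi\|_{L^\infty_t(\dot H^1)}$ and $\|\partial_t^k\partial_x^\beta f\|_{L^\infty_t(L^{4/3})}$ for $k\le j$, $|\beta|\le|\alpha|$ with $k+|\beta|<j+|\alpha|$. All $L^\infty$ norms are over $[0,T]$.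
   Context: $\dot H^1=\mathcal F^{-1}[L^2(|\xi|^2d\xi)]$ on $\mathbb{R}^4$ (no nonzero constants); $\phi$ is complex-valued. Derivatives are distributional on $(0,T)\times\mathbb{R}^4$. $L^\infty_t(X)$ denotes $\sup_{t\in[0,T]}\|\cdot\|_X$. *)

theory Defs
  imports "HOL-Analysis.Analysis"
begin

definition dd :: "'a::euclidean_space \<Rightarrow> ('a \<Rightarrow> real) \<Rightarrow> 'a \<Rightarrow> real" where
  "dd v g x = deriv (\<lambda>s. g (x + s *\<^sub>R v)) 0"

coinductive smooth :: "('a::euclidean_space \<Rightarrow> real) \<Rightarrow> bool" where
  "continuous_on UNIV g \<Longrightarrow>
   (\<forall>v\<in>Basis. \<forall>x. (\<lambda>s. g (x + s *\<^sub>R v)) differentiable (at 0)) \<Longrightarrow>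
   (\<forall>v\<in>Basis. smooth (dd v g)) \<Longrightarrow> smooth g"

definition tsupport :: "('a::real_normed_vector \<Rightarrow> real) \<Rightarrow> 'a set" where
  "tsupport g = closure {x. g x \<noteq> 0}"

definition test_x :: "(real^4 \<Rightarrow> real) \<Rightarrow> bool" where
  "test_x \<psi> \<longleftrightarrow> smooth \<psi> \<and> compact (tsupport \<psi>)"

definition test_st :: "real \<Rightarrow> (real \<times> (real^4) \<Rightarrow> real) \<Rightarrow> bool" where
  "test_st T \<psi> \<longleftrightarrow> smooth \<psi> \<and> compact (tsupport \<psi>) \<and> tsupport \<psi> \<subseteq> {0<..<T} \<times> UNIV"

definition mabs :: "(4 \<Rightarrow> nat) \<Rightarrow> nat" where
  "mabs \<alpha> = (\<Sum>i\<in>UNIV. \<alpha> i)"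

definition Dtx :: "nat \<Rightarrow> (4 \<Rightarrow> nat) \<Rightarrow> (real \<times> (real^4) \<Rightarrow> real) \<Rightarrow> real \<times> (real^4) \<Rightarrow> real" where
  "Dtx j \<alpha> \<psi> = (dd (1, 0) ^^ j)
     (foldr (\<lambda>i g. (dd (0, axis i 1) ^^ \<alpha> i) g) [0, 1, 2, 3] \<psi>)"

definition lap :: "(real^4 \<Rightarrow> real) \<Rightarrow> real^4 \<Rightarrow> real" where
  "lap \<psi> x = (\<Sum>i\<in>UNIV. dd (axis i 1) (dd (axis i 1) \<psi>) x)"

definition in_Lp :: "real \<Rightarrow> (real^4 \<Rightarrow> 'b::{banach,second_countable_topology}) \<Rightarrow> bool" where
  "in_Lp p g \<longleftrightarrow> g \<in> borel_measurable lborel \<and> integrable lborel (\<lambda>x. norm (g x) powr p)"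

definition Lp_norm :: "real \<Rightarrow> (real^4 \<Rightarrow> 'b::{banach,second_countable_topology}) \<Rightarrow> real" where
  "Lp_norm p g = (LINT x|lborel. norm (g x) powr p) powr (1 / p)"

definition wgrad_ok :: "(real^4 \<Rightarrow> complex) \<Rightarrow> 4 \<Rightarrow> (real^4 \<Rightarrow> complex) \<Rightarrow> bool" where
  "wgrad_ok g i G \<longleftrightarrow> in_Lp 2 G \<and>
     (\<forall>\<psi>. test_x \<psi> \<longrightarrow>
        (LINT x|lborel. \<psi> x *\<^sub>R G x) = - (LINT x|lborel. dd (axis i 1) \<psi> x *\<^sub>R g x))"

text \<open>Homogeneous Sobolev space on R^4 (realised as L^4 functions with L^2 weak gradient).\<close>
definition Hdot1 :: "(real^4 \<Rightarrow> complex) \<Rightarrow> bool" where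
  "Hdot1 g \<longleftrightarrow> in_Lp 4 g \<and> (\<forall>i. \<exists>G. wgrad_ok g i G)"

definition hnorm :: "(real^4 \<Rightarrow> complex) \<Rightarrow> real" where
  "hnorm g = sqrt (\<Sum>i\<in>UNIV. (Lp_norm 2 (SOME G. wgrad_ok g i G))\<^sup>2)"

definition cont_H :: "real \<Rightarrow> (real \<Rightarrow> real^4 \<Rightarrow> complex) \<Rightarrow> bool" where
  "cont_H T G \<longleftrightarrow> (\<forall>t\<in>{0..T}. Hdot1 (G t)) \<and>
     (\<forall>t\<in>{0..T}. ((\<lambda>s. hnorm (\<lambda>x. G s x - G t x)) \<longlongrightarrow> 0) (at t within {0..T}))"

definition cont_L :: "real \<Rightarrow> (real \<Rightarrow> real^4 \<Rightarrow> real) \<Rightarrow> bool" where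
  "cont_L T F \<longleftrightarrow> (\<forall>t\<in>{0..T}. in_Lp (4/3) (F t)) \<and>
     (\<forall>t\<in>{0..T}. ((\<lambda>s. Lp_norm (4/3) (\<lambda>x. F s x - F t x)) \<longlongrightarrow> 0) (at t within {0..T}))"

definition supH :: "real \<Rightarrow> (real \<Rightarrow> real^4 \<Rightarrow> complex) \<Rightarrow> real" where
  "supH T G = (SUP t\<in>{0..T}. hnorm (G t))"

definition supL :: "real \<Rightarrow> (real \<Rightarrow> real^4 \<Rightarrow> real) \<Rightarrow> real" where
  "supL T F = (SUP t\<in>{0..T}. Lp_norm (4/3) (F t))"

definition pair :: "real \<Rightarrow> (real \<Rightarrow> real^4 \<Rightarrow> 'b::{banach,second_countable_topology})
    \<Rightarrow> (real \<times> (real^4) \<Rightarrow> real) \<Rightarrow> 'b" where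
  "pair T g \<psi> = integral {0..T} (\<lambda>t. LINT x|lborel. \<psi> (t, x) *\<^sub>R g t x)"

definition is_dtx :: "real \<Rightarrow> nat \<Rightarrow> (4 \<Rightarrow> nat) \<Rightarrow> (real \<Rightarrow> real^4 \<Rightarrow> 'b::{banach,second_countable_topology})
    \<Rightarrow> (real \<Rightarrow> real^4 \<Rightarrow> 'b) \<Rightarrow> bool" where
  "is_dtx T j \<alpha> g G \<longleftrightarrow> (\<forall>\<psi>. test_st T \<psi> \<longrightarrow>
     pair T G \<psi> = ((-1) ^ (j + mabs \<alpha>)) *\<^sub>R pair T g (Dtx j \<alpha> \<psi>))"

definition solves_ell :: "(real^4 \<Rightarrow> complex) \<Rightarrow> (real^4 \<Rightarrow> real) \<Rightarrow> (real^4 \<Rightarrow> complex) \<Rightarrow> bool" where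
  "solves_ell \<phi> f u \<longleftrightarrow> Hdot1 u \<and>
     (\<forall>\<psi>. test_x \<psi> \<longrightarrow>
        (LINT x|lborel. lap \<psi> x *\<^sub>R u x) - (LINT x|lborel. (\<psi> x * (cmod (\<phi> x))\<^sup>2) *\<^sub>R u x)
        = complex_of_real (LINT x|lborel. \<psi> x * f x))"

end

theory Submission
  imports Defs
begin

text \<open>
The equation is linear in the real and imaginary parts, so \<open>u\<close> is real, and testing it against (an
approximation of) \<open>u\<close> gives \<open>\<parallel>\<nabla>u\<parallel>\<^sub>2 \<le> \<parallel>f\<parallel>\<close> in \<open>L\<^bsup>4/3\<^esup>\<close>, by Hoelder and the Sobolev embedding of the
homogeneous Sobolev space in \<open>L\<^sup>4\<close>; the potential has the good sign. A weak derivative of \<open>\<phi>\<close> or \<open>f\<close> that is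
continuous in time is the limit in norm of difference quotients. The difference quotients of \<open>u\<close> solve the same
equation with convergent right-hand sides, so by the energy estimate they converge, and their limit \<open>\<partial>u\<close> solves
\<open>\<Delta>\<partial>u - |\<phi>|\<^sup>2\<partial>u = \<partial>f + \<partial>(|\<phi>|\<^sup>2)u\<close>. Iterating along a word of derivatives, the right-hand side is the corresponding
derivative of \<open>f\<close> plus the Leibniz terms with at least one derivative on \<open>|\<phi>|\<^sup>2\<close>. The terms with all derivatives
on a single factor \<open>\<phi>\<close> give the product in the estimate; all others involve lower-order norms only.
\<close>

section \<open>Smooth functions and test functions\<close>

text \<open>Each given derivative is tied to \<open>phi\<close> or \<open>f\<close> itself through
  \<open>Dtx\<close>, which fixes one order of the partial derivatives; nothing relates two given
  derivatives directly. Derivatives are therefore indexed by decreasing words of directions, whose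
  head is the innermost derivative of \<open>Dtx\<close>. Subwords of decreasing words are
  decreasing, so the Leibniz terms stay in this class, and a word and its tail differ by a single
  weak derivative. Time and space are treated alike, through shifts tending to zero, one-sided at
  the ends of \<open>[0,T]\<close>. Convergence of difference quotients comes from duality: tested
  against a fixed function, a quotient is by the mean value theorem a value of the derivative
  nearby, and the resulting bound is uniform over test functions. The Sobolev inequality is proved
  with constant one. Hence the energy estimate carries no constant, \<open>C\<close> only counts
  Leibniz terms, twice for the real and imaginary parts of \<open>phi\<close>, and the remainder is
  a polynomial in the lower-order norms.\<close>

lemma smooth_continuous: "smooth g \<Longrightarrow> continuous_on UNIV g"
  by (erule smooth.cases) auto

lemma smooth_dd: "smooth g \<Longrightarrow> v \<in> Basis \<Longrightarrow> smooth (dd v g)"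
  by (erule smooth.cases) auto

lemma dd_eqI: "((\<lambda>s. g (x + s *\<^sub>R v)) has_real_derivative D) (at 0) \<Longrightarrow> dd v g x = D"
  unfolding dd_def by (rule DERIV_imp_deriv)

lemma smooth_has_derivative_0:
  assumes "smooth g" "v \<in> Basis"
  shows "((\<lambda>s. g (x + s *\<^sub>R v)) has_real_derivative dd v g x) (at 0)"
proof -
  have "(\<lambda>s. g (x + s *\<^sub>R v)) differentiable (at 0)"
    using assms by (auto elim: smooth.cases)
  then obtain D where "((\<lambda>s. g (x + s *\<^sub>R v)) has_real_derivative D) (at 0)"
    using real_differentiable_def by blast
  then show ?thesis using dd_eqI by metis
qed

lemma real_differentiableI: "(f has_real_derivative D) F \<Longrightarrow> f differentiable F"
  using differentiableI has_field_derivative_imp_has_derivative by blast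

lemma smooth_has_derivative:
  assumes "smooth g" "v \<in> Basis"
  shows "((\<lambda>s. g (x + s *\<^sub>R v)) has_real_derivative dd v g (x + r *\<^sub>R v)) (at r)"
proof -
  have "((\<lambda>s. g ((x + r *\<^sub>R v) + s *\<^sub>R v)) has_real_derivative dd v g (x + r *\<^sub>R v)) (at 0)"
    by (rule smooth_has_derivative_0[OF assms])
  then have "((\<lambda>s. g (x + (s + r) *\<^sub>R v)) has_real_derivative dd v g (x + r *\<^sub>R v)) (at 0)"
    by (simp add: algebra_simps)
  then show ?thesis
    using DERIV_shift[of "\<lambda>s. g (x + s *\<^sub>R v)" "dd v g (x + r *\<^sub>R v)" 0 r] by simp
qed

text \<open>For \<open>n = 0\<close> this is the standard function \<open>exp (- 1/t)\<close>
  extended by zero. The powers of \<open>1/t\<close> are built in so that derivatives are linear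
  combinations of members of the same family.\<close>

definition flat :: "nat \<Rightarrow> real \<Rightarrow> real" where
  "flat n t = (if t > 0 then inverse t ^ n * exp (- inverse t) else 0)"

text \<open>A single term of the exponential series suffices:
  \<open>(1/t)^(n+k) / (n+k)! \<le> exp (1/t)\<close>. The free exponent \<open>k\<close> expresses
  vanishing of every order at 0.\<close>

lemma flat_bound: "\<bar>flat n t\<bar> \<le> fact (n + k) * \<bar>t\<bar> ^ k"
proof (cases "t > 0")
  case True
  have "inverse t ^ (n + k) / fact (n + k) \<le> exp (inverse t)"
  proof -
    have "(\<Sum>i\<in>{n+k}. inverse (fact i) *\<^sub>R inverse t ^ i) \<le> exp (inverse t)"
      unfolding exp_def using True
      by (intro sum_le_suminf summable_exp_generic) auto
    then show ?thesis by (simp add: field_simps)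
  qed
  then have "inverse t ^ (n + k) * exp (- inverse t) \<le> fact (n + k)"
    by (simp only: exp_minus divide_inverse[symmetric] pos_divide_le_eq exp_gt_zero fact_gt_zero mult.commute[of "fact (n + k)"])
  then have "t ^ k * (inverse t ^ (n + k) * exp (- inverse t)) \<le> t ^ k * fact (n + k)"
    using True by (intro mult_left_mono) auto
  moreover have "t ^ k * inverse t ^ (n + k) = inverse t ^ n"
    using True by (simp add: power_add field_simps)
  ultimately have "inverse t ^ n * exp (- inverse t) \<le> t ^ k * fact (n + k)"
    by (simp only: mult.assoc[symmetric])
  then show ?thesis using True by (simp add: flat_def mult_ac)
next
  case False
  then show ?thesis by (simp add: flat_def)
qed

lemma flat_has_derivative:
  "(flat n has_real_derivative flat (n + 2) t - real n * flat (n + 1) t) (at t)"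
proof -
  consider "t < 0" | "t = 0" | "t > 0" by linarith
  then show ?thesis
  proof cases
    case 1
    have "((\<lambda>_. 0) has_real_derivative 0) (at t)" by simp
    then have "(flat n has_real_derivative 0) (at t)"
      by (rule has_field_derivative_transform_within_open[of _ _ _ "{..<0}"])
        (use 1 in \<open>auto simp: flat_def\<close>)
    then show ?thesis using 1 by (simp add: flat_def)
  next
    case 2
    \<comment> \<open>Order of vanishing \<open>k = 2\<close> leaves one factor \<open>|h|\<close>
      after the division by \<open>h\<close>.\<close>
    have "((\<lambda>h. flat n h / h) \<longlongrightarrow> 0) (at 0)"
    proof (rule Lim_null_comparison)
      show "eventually (\<lambda>h. norm (flat n h / h) \<le> fact (n + 2) * \<bar>h\<bar>) (at 0)"
      proof (rule eventually_at_filter[THEN iffD2], rule always_eventually, intro allI impI)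
        fix h :: real assume "h \<noteq> 0"
        then show "norm (flat n h / h) \<le> fact (n + 2) * \<bar>h\<bar>"
          using flat_bound[of n h 2]
          by (simp only: abs_divide real_norm_def pos_divide_le_eq zero_less_abs_iff power2_eq_square mult.assoc simp_thms)
      qed
      show "((\<lambda>h. fact (n + 2) * \<bar>h\<bar>) \<longlongrightarrow> 0) (at (0::real))"
        by (rule tendsto_eq_intros refl | simp)+
    qed
    then show ?thesis using 2 by (simp add: has_field_derivative_iff flat_def)
  next
    case 3
    have "((\<lambda>t. inverse t ^ n * exp (- inverse t)) has_real_derivative
        (real n * inverse t ^ (n - 1) * (- (inverse t ^ 2)) * exp (- inverse t)
        + inverse t ^ n * (exp (- inverse t) * inverse t ^ 2))) (at t)"
      using 3 by (auto intro!: derivative_eq_intros simp: power2_eq_square)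
    moreover have "real n * inverse t ^ (n - 1) * (- (inverse t ^ 2)) * exp (- inverse t)
        + inverse t ^ n * (exp (- inverse t) * inverse t ^ 2) = flat (n + 2) t - real n * flat (n + 1) t"
      using 3 by (cases n) (auto simp: flat_def power_add power2_eq_square algebra_simps)
    ultimately have "((\<lambda>t. inverse t ^ n * exp (- inverse t)) has_real_derivative
        flat (n + 2) t - real n * flat (n + 1) t) (at t)" by metis
    then show ?thesis
      by (rule has_field_derivative_transform_within_open[of _ _ _ "{0<..}"])
        (use 3 in \<open>auto simp: flat_def\<close>)
  qed
qed

text \<open>Coinduction up to the ring generated by smooth functions, linear functions and flat functions.\<close>

inductive smooth_ring :: "('a::euclidean_space \<Rightarrow> real) \<Rightarrow> bool" where
  base: "smooth g \<Longrightarrow> smooth_ring g"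
| const: "smooth_ring (\<lambda>x. c)"
| linear: "bounded_linear g \<Longrightarrow> smooth_ring g"
| flat: "smooth_ring (\<lambda>x. flat n (x \<bullet> a + c))"
| add: "smooth_ring g \<Longrightarrow> smooth_ring h \<Longrightarrow> smooth_ring (\<lambda>x. g x + h x)"
| mult: "smooth_ring g \<Longrightarrow> smooth_ring h \<Longrightarrow> smooth_ring (\<lambda>x. g x * h x)"

text \<open>This closure is what the coinduction in \<open>smooth_ring_smooth\<close> consumes. A
  ring is needed because the product rule turns a product into a sum of products.\<close>

lemma smooth_ring_step:
  assumes "smooth_ring g"
  shows "continuous_on UNIV g \<and> (\<forall>v\<in>Basis. (\<forall>x. (\<lambda>s. g (x + s *\<^sub>R v)) differentiable (at 0)) \<and> smooth_ring (dd v g))"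
  using assms
proof induction
  case (base g)
  then show ?case
    by (auto intro: smooth_ring.base smooth_dd smooth_continuous real_differentiableI smooth_has_derivative_0)
next
  case (const c)
  have "dd v (\<lambda>x. c) = (\<lambda>x. 0)" for v :: 'a by (rule ext, rule dd_eqI) simp
  then show ?case by (auto intro: smooth_ring.const)
next
  case (linear g)
  interpret bounded_linear g by fact
  have D: "((\<lambda>s. g (x + s *\<^sub>R v)) has_real_derivative g v) (at 0)" for x v
    unfolding add scaleR by (auto intro!: derivative_eq_intros)
  then have "dd v g = (\<lambda>x. g v)" for v by (intro ext dd_eqI)
  then show ?case
    using D linear.hyps by (auto intro: smooth_ring.const linear_continuous_on real_differentiableI)
next
  case (flat n a c)
  have D: "((\<lambda>s. flat n ((x + s *\<^sub>R v) \<bullet> a + c)) has_real_derivative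
     (flat (n + 2) (x \<bullet> a + c) + (- real n) * flat (n + 1) (x \<bullet> a + c)) * (v \<bullet> a)) (at 0)" for x v
  proof -
    have 1: "((\<lambda>s. (x + s *\<^sub>R v) \<bullet> a + c) has_real_derivative (v \<bullet> a)) (at 0)"
      unfolding inner_add_left inner_scaleR_left by (auto intro!: derivative_eq_intros)
    have "(flat n has_real_derivative flat (n + 2) (x \<bullet> a + c) + (- real n) * flat (n + 1) (x \<bullet> a + c))
       (at ((x + 0 *\<^sub>R v) \<bullet> a + c))"
      using flat_has_derivative[of n "x \<bullet> a + c"] by simp
    from DERIV_chain2[OF this 1] show ?thesis by simp
  qed
  then have "dd v (\<lambda>x. flat n (x \<bullet> a + c)) = (\<lambda>x.
     (flat (n + 2) (x \<bullet> a + c) + (- real n) * flat (n + 1) (x \<bullet> a + c)) * (v \<bullet> a))" for v by (intro ext dd_eqI)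
  moreover have "continuous_on UNIV (\<lambda>x. flat n (x \<bullet> a + c))"
  proof (rule continuous_on_compose2[of UNIV "flat n"])
    show "continuous_on UNIV (flat n)"
      using flat_has_derivative DERIV_isCont continuous_at_imp_continuous_on by blast
  qed (auto intro!: continuous_intros)
  moreover have "smooth_ring (\<lambda>x.
     (flat (n + 2) (x \<bullet> a + c) + (- real n) * flat (n + 1) (x \<bullet> a + c)) * (v \<bullet> a))" for v
    by (intro smooth_ring.add smooth_ring.mult smooth_ring.flat smooth_ring.const)
  ultimately show ?case using real_differentiableI[OF D] by (simp only: simp_thms Ball_def)
next
  case (add g h)
  have D: "((\<lambda>s. g (x + s *\<^sub>R v) + h (x + s *\<^sub>R v)) has_real_derivative dd v g x + dd v h x) (at 0)"
    if "v \<in> Basis" for x v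
    using add.IH that unfolding dd_def
    by (intro derivative_intros) (auto simp: DERIV_deriv_iff_real_differentiable)
  then have "dd v (\<lambda>x. g x + h x) = (\<lambda>x. dd v g x + dd v h x)" if "v \<in> Basis" for v
    using that by (intro ext dd_eqI)
  then show ?case using add.IH real_differentiableI[OF D] by (simp add: smooth_ring.add continuous_on_add)
next
  case (mult g h)
  have D: "((\<lambda>s. g (x + s *\<^sub>R v) * h (x + s *\<^sub>R v)) has_real_derivative dd v g x * h x + dd v h x * g x) (at 0)"
    if "v \<in> Basis" for x v
  proof -
    have "((\<lambda>s. g (x + s *\<^sub>R v)) has_real_derivative dd v g x) (at 0)"
       "((\<lambda>s. h (x + s *\<^sub>R v)) has_real_derivative dd v h x) (at 0)"
      using mult.IH that unfolding dd_def by (auto simp: DERIV_deriv_iff_real_differentiable)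
    from DERIV_mult[OF this] show ?thesis by simp
  qed
  then have "dd v (\<lambda>x. g x * h x) = (\<lambda>x. dd v g x * h x + dd v h x * g x)" if "v \<in> Basis" for v
    using that by (intro ext dd_eqI)
  then show ?case using mult real_differentiableI[OF D]
    by (simp add: smooth_ring.add smooth_ring.mult continuous_on_mult)
qed

lemma smooth_ring_smooth: "smooth_ring g \<Longrightarrow> smooth g"
proof (coinduction arbitrary: g rule: smooth.coinduct)
  case (smooth g)
  then show ?case using smooth_ring_step[of g] by auto
qed

lemma smooth_const: "smooth (\<lambda>x. c)"
  and smooth_linear: "bounded_linear g \<Longrightarrow> smooth g"
  and smooth_flat: "smooth (\<lambda>x. flat n (x \<bullet> a + c))"
  and smooth_add: "smooth g \<Longrightarrow> smooth h \<Longrightarrow> smooth (\<lambda>x. g x + h x)"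
  and smooth_mult: "smooth g \<Longrightarrow> smooth h \<Longrightarrow> smooth (\<lambda>x. g x * h x)"
  by (auto intro!: smooth_ring_smooth smooth_ring.flat intro: smooth_ring.intros)

lemma smooth_prod: "finite A \<Longrightarrow> (\<And>i. i \<in> A \<Longrightarrow> smooth (g i)) \<Longrightarrow> smooth (\<lambda>x. \<Prod>i\<in>A. g i x)"
  by (induction A rule: finite_induct) (auto intro: smooth_const smooth_mult)

lemma smooth_polynomial: "real_polynomial_function g \<Longrightarrow> smooth g"
  by (induction rule: real_polynomial_function.induct)
    (auto intro: smooth_const smooth_linear smooth_add smooth_mult)

lemma dd_mult:
  assumes "smooth g" "smooth h" "v \<in> Basis"
  shows "dd v (\<lambda>x. g x * h x) x = dd v g x * h x + g x * dd v h x"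
  using DERIV_mult[OF smooth_has_derivative_0[OF assms(1,3)] smooth_has_derivative_0[OF assms(2,3)], of x x]
  by (intro dd_eqI) (simp add: mult_ac)

lemma dd_affine:
  assumes "smooth g" "v \<in> Basis"
  shows "dd v (\<lambda>x. g (c *\<^sub>R x + a)) x = c * dd v g (c *\<^sub>R x + a)"
proof (rule dd_eqI)
  have i: "((\<lambda>s. s * c) has_real_derivative c) (at 0)" by (auto intro!: derivative_eq_intros)
  have "((\<lambda>s. g ((c *\<^sub>R x + a) + s *\<^sub>R v)) has_real_derivative dd v g (c *\<^sub>R x + a)) (at (0 * c))"
    using smooth_has_derivative_0[OF assms] by simp
  from DERIV_chain2[OF this i]
  show "((\<lambda>s. g (c *\<^sub>R (x + s *\<^sub>R v) + a)) has_real_derivative c * dd v g (c *\<^sub>R x + a)) (at 0)"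
    by (simp add: algebra_simps)
qed

lemma smooth_affine: "smooth g \<Longrightarrow> smooth (\<lambda>x. g (c *\<^sub>R x + a))"
proof -
  \<comment> \<open>The extra factor \<open>k\<close> absorbs the constant \<open>c\<close> that
    every differentiation produces, so that the coinduction ranges over a family closed under
    derivatives.\<close>
  have "smooth (\<lambda>x. k * g (c *\<^sub>R x + a))" if "smooth g" for k g
    using that
  proof (coinduction arbitrary: k g rule: smooth.coinduct)
    case (smooth k g)
    have c: "continuous_on UNIV (\<lambda>x. k * g (c *\<^sub>R x + a))"
      by (intro continuous_intros continuous_on_compose2[OF smooth_continuous[OF smooth]]) auto
    have D: "((\<lambda>s. k * g (c *\<^sub>R (x + s *\<^sub>R v) + a)) has_real_derivative k * (c * dd v g (c *\<^sub>R x + a))) (at 0)"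
      if "v \<in> Basis" for x v
    proof -
      have i: "((\<lambda>s. s * c) has_real_derivative c) (at 0)" by (auto intro!: derivative_eq_intros)
  have "((\<lambda>s. g ((c *\<^sub>R x + a) + s *\<^sub>R v)) has_real_derivative dd v g (c *\<^sub>R x + a)) (at (0 * c))"
        using smooth_has_derivative_0[OF smooth that] by simp
      from DERIV_cmult[OF DERIV_chain2[OF this i], of k]
      show ?thesis by (simp add: algebra_simps)
    qed
    then have e: "dd v (\<lambda>x. k * g (c *\<^sub>R x + a)) = (\<lambda>x. (k * c) * dd v g (c *\<^sub>R x + a))" if "v \<in> Basis" for v
      using that by (intro ext dd_eqI) (simp add: mult.assoc)
    have "\<exists>k' g'. dd v (\<lambda>x. k * g (c *\<^sub>R x + a)) = (\<lambda>x. k' * g' (c *\<^sub>R x + a)) \<and> smooth g'" if "v \<in> Basis" for v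
      using e[OF that] smooth_dd[OF smooth that] by blast
    then show ?case using c real_differentiableI[OF D]
      by (intro exI[of _ "\<lambda>x. k * g (c *\<^sub>R x + a)"]) blast
  qed
  from this[of g 1] show "smooth g \<Longrightarrow> ?thesis" by simp
qed

lemma dd_fst: "dd (v, w) (\<lambda>z. g (fst z)) z = dd v g (fst z)"
  and dd_snd: "dd (v, w) (\<lambda>z. k (snd z)) z = dd w k (snd z)"
  by (simp_all add: dd_def)

text \<open>A basis vector of the product has one component equal to zero. Along it the derivative
  is a derivative of \<open>g\<close> or zero; in both cases it depends on the first component only,
  which closes the coinduction.\<close>

lemma smooth_fst:
  fixes g :: "'a::euclidean_space \<Rightarrow> real"
  shows "smooth g \<Longrightarrow> smooth (\<lambda>z::'a \<times> 'b::euclidean_space. g (fst z))"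
proof (coinduction arbitrary: g rule: smooth.coinduct)
  case (smooth g)
  have "continuous_on UNIV (\<lambda>z::'a \<times> 'b. g (fst z))"
    by (rule continuous_on_compose2[OF smooth_continuous[OF smooth]]) (auto intro: continuous_intros)
  moreover have "(\<lambda>s. g (fst (x + s *\<^sub>R v))) differentiable (at 0)" if "v \<in> Basis" for x v :: "'a \<times> 'b"
    using smooth_has_derivative_0[OF smooth, of "fst v" "fst x"] that
    by (auto simp: Basis_prod_def intro: real_differentiableI)
  moreover have "(\<exists>g'. dd v (\<lambda>z. g (fst z)) = (\<lambda>z. g' (fst z)) \<and> smooth g')" if "v \<in> Basis" for v :: "'a \<times> 'b"
  proof (cases "fst v = 0")
    case True
    then show ?thesis by (intro exI[of _ "\<lambda>x. 0"]) (simp add: dd_def smooth_const fun_eq_iff)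
  next
    case False
    then have "fst v \<in> Basis" using that by (auto simp: Basis_prod_def)
    from smooth_dd[OF smooth this] show ?thesis
      by (intro exI[of _ "dd (fst v) g"]) (simp add: dd_def fun_eq_iff)
  qed
  ultimately show ?case by (intro exI[of _ "\<lambda>z. g (fst z)"]) auto
qed

lemma smooth_snd:
  fixes g :: "'a::euclidean_space \<Rightarrow> real"
  shows "smooth g \<Longrightarrow> smooth (\<lambda>z::'b::euclidean_space \<times> 'a. g (snd z))"
proof (coinduction arbitrary: g rule: smooth.coinduct)
  case (smooth g)
  have "continuous_on UNIV (\<lambda>z::'b \<times> 'a. g (snd z))"
    by (rule continuous_on_compose2[OF smooth_continuous[OF smooth]]) (auto intro: continuous_intros)
  moreover have "(\<lambda>s. g (snd (x + s *\<^sub>R v))) differentiable (at 0)" if "v \<in> Basis" for x v :: "'b \<times> 'a"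
    using smooth_has_derivative_0[OF smooth, of "snd v" "snd x"] that
    by (auto simp: Basis_prod_def intro: real_differentiableI)
  moreover have "(\<exists>g'. dd v (\<lambda>z. g (snd z)) = (\<lambda>z. g' (snd z)) \<and> smooth g')" if "v \<in> Basis" for v :: "'b \<times> 'a"
  proof (cases "snd v = 0")
    case True
    then show ?thesis by (intro exI[of _ "\<lambda>x. 0"]) (simp add: dd_def smooth_const fun_eq_iff)
  next
    case False
    then have "snd v \<in> Basis" using that by (auto simp: Basis_prod_def)
    from smooth_dd[OF smooth this] show ?thesis
      by (intro exI[of _ "dd (snd v) g"]) (simp add: dd_def fun_eq_iff)
  qed
  ultimately show ?case by (intro exI[of _ "\<lambda>z. g (snd z)"]) auto
qed

text \<open>Compact support is stated through some compact \<open>K\<close> rather than through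
  \<open>tsupport\<close>: such a set is easily supplied for sums, products and convolutions,
  without computing closures. \<open>test_x_iff\<close> gives the agreement with
  \<open>test_x\<close>.\<close>

definition test :: "('a::euclidean_space \<Rightarrow> real) \<Rightarrow> bool" where
  "test g \<longleftrightarrow> smooth g \<and> (\<exists>K. compact K \<and> (\<forall>x. x \<notin> K \<longrightarrow> g x = 0))"

lemma compact_tsupportI: "compact K \<Longrightarrow> (\<And>x. x \<notin> K \<Longrightarrow> g x = 0) \<Longrightarrow> compact (tsupport g) \<and> tsupport g \<subseteq> K"
proof -
  assume K: "compact K" "\<And>x. x \<notin> K \<Longrightarrow> g x = 0"
  then have "{x. g x \<noteq> 0} \<subseteq> K" by auto
  then have "tsupport g \<subseteq> K" unfolding tsupport_def
    using K(1) by (simp add: closure_minimal compact_imp_closed)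
  then show ?thesis using K(1) unfolding tsupport_def
    by (metis closed_closure compact_Int_closed inf.absorb_iff2)
qed

lemma not_in_tsupport: "x \<notin> tsupport g \<Longrightarrow> g x = 0"
  unfolding tsupport_def using closure_subset[of "{x. g x \<noteq> 0}"] by auto

lemma test_x_iff: "test_x g \<longleftrightarrow> test g"
  unfolding test_x_def test_def using compact_tsupportI not_in_tsupport by metis

lemma test_smooth: "test g \<Longrightarrow> smooth g"
  by (simp add: test_def)

lemma test_continuous: "test g \<Longrightarrow> continuous_on UNIV g"
  by (simp add: test_def smooth_continuous)

lemma dd_eq_0_outside:
  assumes "closed K" "\<And>x. x \<notin> K \<Longrightarrow> g x = 0" "x \<notin> K"
  shows "dd v g x = 0"
proof (rule dd_eqI)
  have "open ((\<lambda>s. x + s *\<^sub>R v) -` (- K))"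
    using assms(1) by (intro continuous_open_vimage) (auto intro!: continuous_intros)
  from has_field_derivative_transform_within_open[OF DERIV_const this, of 0 0]
  show "((\<lambda>s. g (x + s *\<^sub>R v)) has_real_derivative 0) (at 0)" using assms by auto
qed

lemma test_dd: "test g \<Longrightarrow> v \<in> Basis \<Longrightarrow> test (dd v g)"
  unfolding test_def using dd_eq_0_outside smooth_dd compact_imp_closed by metis

lemma test_add:
  assumes "test g" "test h"
  shows "test (\<lambda>x. g x + h x)"
proof -
  obtain K L where "compact K" "\<And>x. x \<notin> K \<Longrightarrow> g x = 0" "compact L" "\<And>x. x \<notin> L \<Longrightarrow> h x = 0"
    using assms unfolding test_def by auto
  then have "compact (K \<union> L)" "\<And>x. x \<notin> K \<union> L \<Longrightarrow> g x + h x = 0" by auto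
  then show ?thesis using assms unfolding test_def by (blast intro: smooth_add)
qed

lemma test_mult_left: "test g \<Longrightarrow> smooth h \<Longrightarrow> test (\<lambda>x. h x * g x)"
  unfolding test_def by (auto intro!: smooth_mult)

lemma test_cmult: "test g \<Longrightarrow> test (\<lambda>x. c * g x)"
  by (rule test_mult_left[OF _ smooth_const])

lemma test_diff: "test g \<Longrightarrow> test h \<Longrightarrow> test (\<lambda>x. g x - h x)"
  using test_add[OF _ test_cmult[of h "-1"], of g] by simp

lemma test_affine:
  assumes "test g" "c \<noteq> 0"
  shows "test (\<lambda>x. g (c *\<^sub>R x + a))"
proof -
  obtain K where K: "compact K" "\<And>x. x \<notin> K \<Longrightarrow> g x = 0" using assms by (auto simp: test_def)
  have "compact ((\<lambda>y. (1/c) *\<^sub>R (y - a)) ` K)"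
    by (intro compact_continuous_image continuous_intros K)
  moreover have "g (c *\<^sub>R x + a) = 0" if "x \<notin> (\<lambda>y. (1/c) *\<^sub>R (y - a)) ` K" for x
  proof (rule K(2))
    show "c *\<^sub>R x + a \<notin> K"
    proof
      assume "c *\<^sub>R x + a \<in> K"
      moreover have "x = (1/c) *\<^sub>R ((c *\<^sub>R x + a) - a)" using assms(2) by simp
      ultimately show False using that by blast
    qed
  qed
  ultimately show ?thesis using assms by (auto simp: test_def smooth_affine)
qed

text \<open>A product over the coordinates rather than a radial function: every factor has the form
  treated in \<open>smooth_flat\<close>, and the set of positivity is an open cube.\<close>

definition bump :: "real \<Rightarrow> 'a::euclidean_space \<Rightarrow> real" where
  "bump r x = (\<Prod>b\<in>Basis. flat 0 (x \<bullet> b + r) * flat 0 (x \<bullet> (- b) + r))"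

lemma bump_nonneg: "0 \<le> bump r x"
  unfolding bump_def by (intro prod_nonneg) (auto simp: flat_def)

lemma bump_pos_iff: "0 < bump r x \<longleftrightarrow> (\<forall>b\<in>Basis. \<bar>x \<bullet> b\<bar> < r)"
proof
  assume "0 < bump r x"
  show "\<forall>b\<in>Basis. \<bar>x \<bullet> b\<bar> < r"
  proof (rule ccontr)
    assume "\<not> (\<forall>b\<in>Basis. \<bar>x \<bullet> b\<bar> < r)"
    then obtain b where "b \<in> Basis" "\<not> \<bar>x \<bullet> b\<bar> < r" by blast
    then have "flat 0 (x \<bullet> b + r) * flat 0 (x \<bullet> (- b) + r) = 0" by (auto simp: flat_def)
    then have "bump r x = 0" unfolding bump_def using \<open>b \<in> Basis\<close>
      by (meson finite_Basis prod_zero)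
    with \<open>0 < bump r x\<close> show False by simp
  qed
next
  assume "\<forall>b\<in>Basis. \<bar>x \<bullet> b\<bar> < r"
  then show "0 < bump r x"
    unfolding bump_def by (intro prod_pos) (auto simp: flat_def abs_less_iff)
qed

lemma bump_le_1: "bump r x \<le> 1"
  unfolding bump_def by (intro prod_le_1) (auto simp: flat_def intro!: mult_le_one)

lemma test_bump: "test (bump r :: 'a::euclidean_space \<Rightarrow> real)"
proof -
  have "bump r x = 0" if out: "x \<notin> cbox (- r *\<^sub>R One) (r *\<^sub>R One :: 'a)" for x :: 'a
  proof -
    obtain b where "b \<in> Basis" "\<not> (- r \<le> x \<bullet> b \<and> x \<bullet> b \<le> r)"
      using out by (auto simp: mem_box)
    then have "\<not> (\<forall>b\<in>Basis. \<bar>x \<bullet> b\<bar> < r)" by (auto simp: abs_less_iff intro!: bexI[of _ b])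
    then show ?thesis using bump_pos_iff[of r x] bump_nonneg[of r x] by linarith
  qed
  moreover have "smooth (bump r :: 'a \<Rightarrow> real)"
    unfolding bump_def by (intro smooth_prod smooth_mult smooth_flat) auto
  ultimately show ?thesis unfolding test_def by (meson compact_cbox)
qed

section \<open>\<open>L\<^sup>p\<close> norms\<close>

lemma in_Lp_measurable: "in_Lp p g \<Longrightarrow> g \<in> borel_measurable borel"
  by (simp add: in_Lp_def)

lemma in_Lp_integrable: "in_Lp p g \<Longrightarrow> integrable lborel (\<lambda>x. norm (g x) powr p)"
  by (simp add: in_Lp_def)

lemma Lp_norm_nonneg: "0 \<le> Lp_norm p g"
  by (simp add: Lp_norm_def)

lemma Lp_norm_powr: "p > 0 \<Longrightarrow> Lp_norm p g powr p = (LINT x|lborel. norm (g x) powr p)"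
  by (simp add: Lp_norm_def powr_powr Bochner_Integration.integral_nonneg)

lemma Lp_norm_leI:
  assumes "p > 0" "0 \<le> K" "(LINT x|lborel. norm (g x) powr p) \<le> K powr p"
  shows "Lp_norm p g \<le> K"
proof -
  have "Lp_norm p g \<le> (K powr p) powr (1 / p)"
    unfolding Lp_norm_def using assms by (intro powr_mono2 Bochner_Integration.integral_nonneg) auto
  then show ?thesis using assms by (simp add: powr_powr)
qed

lemma Lp_mono:
  assumes "p > 0" "in_Lp p g" "f \<in> borel_measurable borel" "AE x in lborel. norm (f x) \<le> norm (g x)"
  shows "in_Lp p f" "Lp_norm p f \<le> Lp_norm p g"
proof -
  note [measurable] = assms(3)
  have le: "AE x in lborel. norm (f x) powr p \<le> norm (g x) powr p"
    using assms(4) by eventually_elim (use assms(1) in \<open>auto intro: powr_mono2\<close>)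
  have i: "integrable lborel (\<lambda>x. norm (f x) powr p)"
    by (rule Bochner_Integration.integrable_bound[OF in_Lp_integrable[OF assms(2)]]) (use le in auto)
  then show "in_Lp p f" using assms by (simp add: in_Lp_def)
  show "Lp_norm p f \<le> Lp_norm p g"
    unfolding Lp_norm_def using assms(1) i in_Lp_integrable[OF assms(2)] le
    by (intro powr_mono2 integral_mono_AE Bochner_Integration.integral_nonneg) auto
qed

lemma Lp_cong_AE:
  assumes "p > 0" "in_Lp p g" "f \<in> borel_measurable borel" "AE x in lborel. f x = g x"
  shows "in_Lp p f" "Lp_norm p f = Lp_norm p g"
proof -
  show 1: "in_Lp p f" using assms(4) by (intro Lp_mono(1)[OF assms(1,2,3)]) auto
  show "Lp_norm p f = Lp_norm p g"
  proof (rule antisym)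
    show "Lp_norm p f \<le> Lp_norm p g"
      by (rule Lp_mono(2)[OF assms(1,2,3)]) (use assms(4) in eventually_elim, simp)
    show "Lp_norm p g \<le> Lp_norm p f"
      by (rule Lp_mono(2)[OF assms(1) 1 in_Lp_measurable[OF assms(2)]]) (use assms(4) in eventually_elim, simp)
  qed
qed

lemma in_Lp_scaleR: "in_Lp p g \<Longrightarrow> in_Lp p (\<lambda>x. c *\<^sub>R g x)"
  by (auto simp: in_Lp_def powr_mult)

lemma Lp_norm_scaleR: "p > 0 \<Longrightarrow> Lp_norm p (\<lambda>x. c *\<^sub>R g x) = \<bar>c\<bar> * Lp_norm p g"
  by (simp add: Lp_norm_def powr_mult powr_powr Bochner_Integration.integral_nonneg)

lemma in_Lp_cmult: "in_Lp p g \<Longrightarrow> in_Lp p (\<lambda>x. c * g x :: real)"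
  using in_Lp_scaleR[of p g c] by simp

lemma Lp_norm_cmult: "p > 0 \<Longrightarrow> Lp_norm p (\<lambda>x. c * g x :: real) = \<bar>c\<bar> * Lp_norm p g"
  using Lp_norm_scaleR[of p c g] by simp

lemma Lp_norm_minus_commute: "Lp_norm p (\<lambda>x. f x - g x) = Lp_norm p (\<lambda>x. g x - f x)"
  by (simp add: Lp_norm_def norm_minus_commute)

lemma in_Lp_zero: "in_Lp p (\<lambda>x. 0)"
  by (simp add: in_Lp_def)

lemma Lp_norm_zero: "p > 0 \<Longrightarrow> Lp_norm p (\<lambda>x. 0) = 0"
  by (simp add: Lp_norm_def)

lemma Lp_norm_eq_0_AE:
  assumes "p > 0" "in_Lp p g" "Lp_norm p g = 0"
  shows "AE x in lborel. g x = 0"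
proof -
  have "(LINT x|lborel. norm (g x) powr p) = 0"
    using Lp_norm_powr[of p g] assms by simp
  then show ?thesis
    using integral_nonneg_eq_0_iff_AE[OF in_Lp_integrable[OF assms(2)]] by simp
qed

text \<open>Young's inequality gives integrability, and, applied to the functions divided by their
  norms, the bound. A zero norm cannot be divided by, but then the product vanishes almost
  everywhere.\<close>

lemma Holder_norm:
  assumes pq: "p > 1" "q > 1" "1 / p + 1 / q = 1" and f: "in_Lp p f" and g: "in_Lp q g"
  shows "integrable lborel (\<lambda>x. norm (f x) * norm (g x))"
    and "(LINT x|lborel. norm (f x) * norm (g x)) \<le> Lp_norm p f * Lp_norm q g"
proof -
  note [measurable] = in_Lp_measurable[OF f] in_Lp_measurable[OF g]
  have i: "integrable lborel (\<lambda>x. norm (f x) powr p / p + norm (g x) powr q / q)"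
    using in_Lp_integrable[OF f] in_Lp_integrable[OF g] by auto
  show fg: "integrable lborel (\<lambda>x. norm (f x) * norm (g x))"
    by (rule Bochner_Integration.integrable_bound[OF i])
      (use pq Youngs_inequality[OF pq, of "norm (f _)" "norm (g _)"] in \<open>auto intro!: AE_I2\<close>)
  let ?A = "Lp_norm p f" and ?B = "Lp_norm q g"
  show "(LINT x|lborel. norm (f x) * norm (g x)) \<le> ?A * ?B"
  proof (cases "?A = 0 \<or> ?B = 0")
    case True
    then have "AE x in lborel. norm (f x) * norm (g x) = 0"
      using Lp_norm_eq_0_AE[OF _ f] Lp_norm_eq_0_AE[OF _ g] pq by auto
    then have "(LINT x|lborel. norm (f x) * norm (g x)) = 0" by (rule integral_eq_zero_AE)
    then show ?thesis by (simp add: Lp_norm_nonneg)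
  next
    case False
    then have A: "?A > 0" and B: "?B > 0" using Lp_norm_nonneg[of p f] Lp_norm_nonneg[of q g] by auto
    have le: "(norm (f x) * norm (g x)) / (?A * ?B)
       \<le> norm (f x) powr p / (p * ?A powr p) + norm (g x) powr q / (q * ?B powr q)" for x
      using Youngs_inequality[OF pq, of "norm (f x) / ?A" "norm (g x) / ?B"] A B
      by (simp add: powr_divide mult.commute)
    have "(LINT x|lborel. (norm (f x) * norm (g x)) / (?A * ?B)) \<le>
       (LINT x|lborel. norm (f x) powr p / (p * ?A powr p) + norm (g x) powr q / (q * ?B powr q))"
      using fg in_Lp_integrable[OF f] in_Lp_integrable[OF g] by (intro integral_mono le) auto
    also have "\<dots> = (LINT x|lborel. norm (f x) powr p) / (p * ?A powr p) + (LINT x|lborel. norm (g x) powr q) / (q * ?B powr q)"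
      using in_Lp_integrable[OF f] in_Lp_integrable[OF g] by simp
    also have "\<dots> = 1 / p + 1 / q"
      using A B pq Lp_norm_powr[of p f, symmetric] Lp_norm_powr[of q g, symmetric] by simp
    finally have "(LINT x|lborel. norm (f x) * norm (g x)) / (?A * ?B) \<le> 1" using pq by simp
    then show ?thesis using A B by (simp add: divide_le_eq)
  qed
qed

lemma Holder:
  fixes f g :: "real^4 \<Rightarrow> real"
  assumes pq: "p > 1" "q > 1" "1 / p + 1 / q = 1" and f: "in_Lp p f" and g: "in_Lp q g"
  shows "integrable lborel (\<lambda>x. f x * g x)" "\<bar>LINT x|lborel. f x * g x\<bar> \<le> Lp_norm p f * Lp_norm q g"
proof -
  note [measurable] = in_Lp_measurable[OF f] in_Lp_measurable[OF g]
  note H = Holder_norm[OF assms]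
  show i: "integrable lborel (\<lambda>x. f x * g x)"
    by (rule Bochner_Integration.integrable_bound[OF H(1)]) (auto simp: abs_mult)
  have "\<bar>LINT x|lborel. f x * g x\<bar> \<le> (LINT x|lborel. norm (f x) * norm (g x))"
    by (rule integral_abs_bound_integral[OF i H(1)]) (simp add: abs_mult)
  with H(2) show "\<bar>LINT x|lborel. f x * g x\<bar> \<le> Lp_norm p f * Lp_norm q g" by linarith
qed

lemma in_Lp_add:
  assumes p: "p > 0" and f: "in_Lp p f" and g: "in_Lp p g"
  shows "in_Lp p (\<lambda>x. f x + g x)"
proof -
  note [measurable] = in_Lp_measurable[OF f] in_Lp_measurable[OF g]
  have i: "integrable lborel (\<lambda>x. 2 powr p * (norm (f x) powr p + norm (g x) powr p))"
    using in_Lp_integrable[OF f] in_Lp_integrable[OF g] by auto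
  have "norm (f x + g x) powr p \<le> 2 powr p * (norm (f x) powr p + norm (g x) powr p)" for x
  proof -
    have "norm (f x + g x) powr p \<le> (2 * max (norm (f x)) (norm (g x))) powr p"
      using norm_triangle_ineq[of "f x" "g x"] p by (intro powr_mono2) auto
    also have "\<dots> = 2 powr p * max (norm (f x)) (norm (g x)) powr p"
      by (simp add: powr_mult max_def)
    also have "\<dots> \<le> 2 powr p * (norm (f x) powr p + norm (g x) powr p)"
      by (intro mult_left_mono) (auto simp: max_def)
    finally show ?thesis .
  qed
  then have "integrable lborel (\<lambda>x. norm (f x + g x) powr p)"
    by (intro Bochner_Integration.integrable_bound[OF i]) (auto intro!: AE_I2)
  then show ?thesis by (simp add: in_Lp_def)
qed

lemma Minkowski:
  assumes p: "p > 1" and f: "in_Lp p f" and g: "in_Lp p g"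
  shows "Lp_norm p (\<lambda>x. f x + g x) \<le> Lp_norm p f + Lp_norm p g"
proof (cases "Lp_norm p (\<lambda>x. f x + g x) = 0")
  case True
  then show ?thesis using Lp_norm_nonneg[of p f] Lp_norm_nonneg[of p g] by simp
next
  case False
  note [measurable] = in_Lp_measurable[OF f] in_Lp_measurable[OF g]
  have s: "in_Lp p (\<lambda>x. f x + g x)" using in_Lp_add[OF _ f g] p by auto
  define q where "q = p / (p - 1)"
  have q: "q > 1" "1 / p + 1 / q = 1" "(p - 1) * q = p" "p / q = p - 1"
    using p by (auto simp: q_def field_simps)
  let ?S = "Lp_norm p (\<lambda>x. f x + g x)"
  \<comment> \<open>Hoelder's inequality is applied to each summand against this power of the sum,
    which lies in the dual space with norm \<open>?S powr (p - 1)\<close>. That factor cancels at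
    the end because \<open>?S\<close> is positive.\<close>
  let ?h = "\<lambda>x. norm (f x + g x) powr (p - 1)"
  have S: "?S > 0" using False Lp_norm_nonneg[of p "\<lambda>x. f x + g x"] by linarith
  have hq: "norm (?h x) powr q = norm (f x + g x) powr p" for x by (simp add: powr_powr q)
  have h: "in_Lp q ?h" using in_Lp_integrable[OF s] unfolding in_Lp_def hq by simp
  have hn: "Lp_norm q ?h = ?S powr (p - 1)"
  proof -
    have "1 / q = 1 / p * (p - 1)" by (simp add: q_def)
    then show ?thesis unfolding Lp_norm_def hq by (simp only: powr_powr)
  qed
  have e: "norm (f x + g x) powr p \<le> norm (f x) * norm (?h x) + norm (g x) * norm (?h x)" for x
  proof -
    have "norm (f x + g x) powr p = norm (f x + g x) * ?h x"
      using powr_mult_base[of "norm (f x + g x)" "p - 1"] by simp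
    also have "\<dots> \<le> (norm (f x) + norm (g x)) * ?h x" by (intro mult_right_mono norm_triangle_ineq) auto
    finally show ?thesis by (simp add: distrib_right)
  qed
  have "?S * ?S powr (p - 1) = ?S powr p" using powr_mult_base[of ?S "p - 1"] S by simp
  also have "\<dots> = (LINT x|lborel. norm (f x + g x) powr p)" by (rule Lp_norm_powr) (use p in simp)
  also have "\<dots> \<le> (LINT x|lborel. norm (f x) * norm (?h x) + norm (g x) * norm (?h x))"
    by (rule integral_mono[OF in_Lp_integrable[OF s]]) (use e Holder_norm(1)[OF p q(1,2) f h] Holder_norm(1)[OF p q(1,2) g h] in auto)
  also have "\<dots> = (LINT x|lborel. norm (f x) * norm (?h x)) + (LINT x|lborel. norm (g x) * norm (?h x))"
    by (rule Bochner_Integration.integral_add[OF Holder_norm(1)[OF p q(1,2) f h] Holder_norm(1)[OF p q(1,2) g h]])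
  also have "\<dots> \<le> Lp_norm p f * ?S powr (p - 1) + Lp_norm p g * ?S powr (p - 1)"
    using Holder_norm(2)[OF p q(1,2) f h] Holder_norm(2)[OF p q(1,2) g h] unfolding hn by (rule add_mono)
  finally have "?S * ?S powr (p - 1) \<le> (Lp_norm p f + Lp_norm p g) * ?S powr (p - 1)"
    by (simp add: distrib_right)
  then show ?thesis using S by simp
qed

lemma in_Lp_diff:
  assumes "p > 0" "in_Lp p f" "in_Lp p g"
  shows "in_Lp p (\<lambda>x. f x - g x)"
  using in_Lp_add[OF assms(1,2) in_Lp_scaleR[OF assms(3), of "-1"]] by simp

lemma Minkowski_diff:
  assumes "p > 1" "in_Lp p f" "in_Lp p g"
  shows "Lp_norm p (\<lambda>x. f x - g x) \<le> Lp_norm p f + Lp_norm p g"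
  using Minkowski[OF assms(1,2) in_Lp_scaleR[OF assms(3), of "-1"]] assms(1) by (simp add: Lp_norm_def)

lemma Lp_triangle:
  assumes p: "p > 1" and fgh: "in_Lp p f" "in_Lp p g" "in_Lp p h"
  shows "Lp_norm p (\<lambda>x. f x - h x) \<le> Lp_norm p (\<lambda>x. f x - g x) + Lp_norm p (\<lambda>x. g x - h x)"
  using Minkowski[OF p in_Lp_diff[OF _ fgh(1,2)] in_Lp_diff[OF _ fgh(2,3)]] p by simp

lemma Lp_norm_le_add_diff:
  assumes p: "p > 1" and fg: "in_Lp p f" "in_Lp p g"
  shows "Lp_norm p f \<le> Lp_norm p g + Lp_norm p (\<lambda>x. f x - g x)"
  using Minkowski[OF p fg(2) in_Lp_diff[OF _ fg(1,2)]] p by simp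

lemma in_Lp_sum:
  assumes "p > 0" "finite I" "\<And>i. i \<in> I \<Longrightarrow> in_Lp p (f i)"
  shows "in_Lp p (\<lambda>x. \<Sum>i\<in>I. f i x)"
  using assms(2,3) by (induction I rule: finite_induct) (auto intro: in_Lp_zero in_Lp_add[OF assms(1)])

lemma Minkowski_sum:
  assumes "p > 1" "finite I" "\<And>i. i \<in> I \<Longrightarrow> in_Lp p (f i)"
  shows "Lp_norm p (\<lambda>x. \<Sum>i\<in>I. f i x) \<le> (\<Sum>i\<in>I. Lp_norm p (f i))"
  using assms(2,3)
proof (induction I rule: finite_induct)
  case empty
  then show ?case using assms(1) by (simp add: Lp_norm_zero)
next
  case (insert i I)
  have "Lp_norm p (\<lambda>x. f i x + (\<Sum>i\<in>I. f i x)) \<le> Lp_norm p (f i) + Lp_norm p (\<lambda>x. \<Sum>i\<in>I. f i x)"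
    using insert assms(1) by (intro Minkowski in_Lp_sum) auto
  also have "\<dots> \<le> Lp_norm p (f i) + (\<Sum>i\<in>I. Lp_norm p (f i))" using insert by simp
  finally show ?case using insert by simp
qed

text \<open>Hoelder's inequality with the conjugate exponents \<open>p / r\<close> and
  \<open>q / r\<close>, applied to the powers \<open>|f|^r\<close> and \<open>|g|^r\<close>.\<close>

lemma Lp_mult:
  fixes f g :: "real^4 \<Rightarrow> real"
  assumes r: "r > 0" "p > r" "q > r" "1 / p + 1 / q = 1 / r" and f: "in_Lp p f" and g: "in_Lp q g"
  shows "in_Lp r (\<lambda>x. f x * g x)" "Lp_norm r (\<lambda>x. f x * g x) \<le> Lp_norm p f * Lp_norm q g"
proof -
  note [measurable] = in_Lp_measurable[OF f] in_Lp_measurable[OF g]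
  let ?f = "\<lambda>x. \<bar>f x\<bar> powr r" and ?g = "\<lambda>x. \<bar>g x\<bar> powr r"
  have F: "norm (?f x) powr (p / r) = norm (f x) powr p" and G: "norm (?g x) powr (q / r) = norm (g x) powr q" for x
    using r by (simp_all add: powr_powr)
  have f': "in_Lp (p / r) ?f" and g': "in_Lp (q / r) ?g"
    using in_Lp_integrable[OF f] in_Lp_integrable[OF g] unfolding in_Lp_def F G by simp_all
  have c: "p / r > 1" "q / r > 1" "1 / (p / r) + 1 / (q / r) = 1"
  proof -
    have "1 / (p / r) + 1 / (q / r) = r * (1 / p + 1 / q)" by (simp add: field_simps)
    also have "\<dots> = 1" using r by simp
    finally show "1 / (p / r) + 1 / (q / r) = 1" .
  qed (use r in auto)
  have e: "norm (f x * g x) powr r = norm (?f x) * norm (?g x)" for x by (simp add: abs_mult powr_mult)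
  note H = Holder_norm[OF c f' g', folded e]
  show "in_Lp r (\<lambda>x. f x * g x)" using H(1) by (simp add: in_Lp_def)
  have "Lp_norm (p / r) ?f = Lp_norm p f powr r" "Lp_norm (q / r) ?g = Lp_norm q g powr r"
    unfolding Lp_norm_def F G using r by (simp_all add: powr_powr)
  then have "(LINT x|lborel. norm (f x * g x) powr r) \<le> (Lp_norm p f * Lp_norm q g) powr r"
    using H(2) by (simp add: powr_mult)
  then show "Lp_norm r (\<lambda>x. f x * g x) \<le> Lp_norm p f * Lp_norm q g"
    using r by (intro Lp_norm_leI) (auto simp: Lp_norm_nonneg)
qed

text \<open>Since \<open>1/4 + 1/4 + 1/4 = 3/4\<close>, the term \<open>|phi|^2 u\<close> lies in
  the space of \<open>f\<close> as soon as \<open>phi\<close> and \<open>u\<close> are in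
  \<open>L^4\<close>. This is the only product estimate that the nonlinearity requires.\<close>

lemma L4_mult3:
  fixes f g h :: "real^4 \<Rightarrow> real"
  assumes f: "in_Lp 4 f" and g: "in_Lp 4 g" and h: "in_Lp 4 h"
  shows "in_Lp (4/3) (\<lambda>x. f x * g x * h x)"
    "Lp_norm (4/3) (\<lambda>x. f x * g x * h x) \<le> Lp_norm 4 f * Lp_norm 4 g * Lp_norm 4 h"
proof -
  have 2: "in_Lp 2 (\<lambda>x. f x * g x)" "Lp_norm 2 (\<lambda>x. f x * g x) \<le> Lp_norm 4 f * Lp_norm 4 g"
    using Lp_mult[of 2 4 4, OF _ _ _ _ f g] by auto
  have 3: "in_Lp (4/3) (\<lambda>x. f x * g x * h x)"
     "Lp_norm (4/3) (\<lambda>x. f x * g x * h x) \<le> Lp_norm 2 (\<lambda>x. f x * g x) * Lp_norm 4 h"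
    using Lp_mult[of "4/3" 2 4, OF _ _ _ _ 2(1) h] by auto
  show "in_Lp (4/3) (\<lambda>x. f x * g x * h x)" by (rule 3(1))
  show "Lp_norm (4/3) (\<lambda>x. f x * g x * h x) \<le> Lp_norm 4 f * Lp_norm 4 g * Lp_norm 4 h"
    using 3(2) mult_right_mono[OF 2(2) Lp_norm_nonneg[of 4 h]] by linarith
qed

lemma Lp_dominated_convergence:
  fixes f :: "nat \<Rightarrow> real^4 \<Rightarrow> real"
  assumes p: "p > 0" and w: "in_Lp p w" and f: "\<And>n. f n \<in> borel_measurable borel" and g: "g \<in> borel_measurable borel"
    and lim: "AE x in lborel. (\<lambda>n. f n x) \<longlonglongrightarrow> g x" and bd: "\<And>n. AE x in lborel. \<bar>f n x\<bar> \<le> \<bar>w x\<bar>"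
  shows "in_Lp p g" "(\<lambda>n. Lp_norm p (\<lambda>x. f n x - g x)) \<longlonglongrightarrow> 0"
proof -
  note [measurable] = f g in_Lp_measurable[OF w]
  have bd': "AE x in lborel. \<forall>n. \<bar>f n x\<bar> \<le> \<bar>w x\<bar>" using bd by (simp add: AE_all_countable)
  have bg: "AE x in lborel. norm (g x) \<le> norm (w x)"
    using lim bd'
  proof eventually_elim
    case (elim x)
    then show ?case using tendsto_upperbound[OF tendsto_rabs[OF elim(1)], of "\<bar>w x\<bar>"] by auto
  qed
  show "in_Lp p g" by (rule Lp_mono(1)[OF p w g bg])
  have "(\<lambda>n. LINT x|lborel. norm (f n x - g x) powr p) \<longlonglongrightarrow> (LINT x|(lborel :: (real^4) measure). 0)"
  proof (rule integral_dominated_convergence[where w="\<lambda>x. norm (2 * w x) powr p"])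
    show "integrable lborel (\<lambda>x. norm (2 * w x) powr p)" using in_Lp_cmult[OF w, of 2] by (simp add: in_Lp_def)
    show "AE x in lborel. (\<lambda>n. norm (f n x - g x) powr p) \<longlonglongrightarrow> 0"
      using lim
    proof eventually_elim
      case (elim x)
      then have "(\<lambda>n. norm (f n x - g x)) \<longlonglongrightarrow> 0" by (intro tendsto_norm_zero LIM_zero)
      from tendsto_powr'[OF this tendsto_const[of p]] show ?case using p by simp
    qed
    show "AE x in lborel. norm (norm (f n x - g x) powr p) \<le> norm (2 * w x) powr p" for n
      using bd[of n] bg
    proof eventually_elim
      case (elim x)
      then have "norm (f n x - g x) \<le> norm (2 * w x)" by (simp add: abs_mult)
      then show ?case using p by (auto intro: powr_mono2)
    qed
  qed auto
  then have "(\<lambda>n. (LINT x|lborel. norm (f n x - g x) powr p) powr (1/p)) \<longlonglongrightarrow> 0 powr (1/p)"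
    using p by (intro tendsto_powr') auto
  then show "(\<lambda>n. Lp_norm p (\<lambda>x. f n x - g x)) \<longlonglongrightarrow> 0" by (simp add: Lp_norm_def)
qed

section \<open>Density, duality and translations in \<open>L\<^sup>p\<close>\<close>

lemma indicator_in_Lp: "compact K \<Longrightarrow> p > 0 \<Longrightarrow> in_Lp p (indicator K :: real^4 \<Rightarrow> real)"
proof -
  assume K: "compact K" "p > 0"
  have [measurable]: "K \<in> sets borel" using K by (simp add: borel_compact)
  have "norm (indicator K x :: real) powr p = indicator K x" for x using K by (simp add: indicator_def)
  then show ?thesis using K emeasure_compact_finite[of K] by (simp add: in_Lp_def)
qed

lemma Lp_le_uniform:
  fixes f :: "real^4 \<Rightarrow> real"
  assumes p: "p > 0" and K: "compact K" and f: "f \<in> borel_measurable borel"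
    and le: "\<And>x. \<bar>f x\<bar> \<le> e" and out: "\<And>x. x \<notin> K \<Longrightarrow> f x = 0"
  shows "in_Lp p f" "Lp_norm p f \<le> e * Lp_norm p (indicator K :: real^4 \<Rightarrow> real)"
proof -
  have e: "0 \<le> e" using le[of 0] by linarith
  have b: "AE x in lborel. norm (f x) \<le> norm (e * indicator K x)"
    using le out e by (intro AE_I2) (auto simp: indicator_def abs_mult)
  note i = in_Lp_cmult[OF indicator_in_Lp[OF K p], of e]
  show "in_Lp p f" by (rule Lp_mono(1)[OF p i f b])
  show "Lp_norm p f \<le> e * Lp_norm p (indicator K :: real^4 \<Rightarrow> real)"
    using Lp_mono(2)[OF p i f b] e p by (simp add: Lp_norm_cmult)
qed

lemma continuous_compact_bounded:
  fixes f :: "'a::euclidean_space \<Rightarrow> real"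
  assumes "continuous_on UNIV f" "compact K" "\<And>x. x \<notin> K \<Longrightarrow> f x = 0"
  obtains B where "\<And>x. \<bar>f x\<bar> \<le> B"
proof -
  have "bounded (f ` K)"
    using assms by (meson compact_continuous_image compact_imp_bounded continuous_on_subset subset_UNIV)
  then obtain B where "\<And>x. x \<in> K \<Longrightarrow> \<bar>f x\<bar> \<le> B" by (auto simp: bounded_iff)
  then have "\<bar>f x\<bar> \<le> \<bar>B\<bar>" for x using assms(3)[of x] by (cases "x \<in> K") force+
  then show ?thesis using that by blast
qed

lemma continuous_compact_in_Lp:
  fixes f :: "real^4 \<Rightarrow> real"
  assumes "p > 0" "continuous_on UNIV f" "compact K" "\<And>x. x \<notin> K \<Longrightarrow> f x = 0"
  shows "in_Lp p f"
proof -
  obtain B where "\<And>x. \<bar>f x\<bar> \<le> B" using continuous_compact_bounded assms by blast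
  then show ?thesis using assms
    by (intro Lp_le_uniform(1)[of p K]) (auto intro: borel_measurable_continuous_onI)
qed

lemma test_bounded: "test g \<Longrightarrow> \<exists>B. \<forall>x. \<bar>g x\<bar> \<le> B"
  using continuous_compact_bounded[of g] test_continuous[of g] unfolding test_def by metis

lemma test_in_Lp: "test g \<Longrightarrow> p > 0 \<Longrightarrow> in_Lp p g"
  using continuous_compact_in_Lp[of p g] test_continuous[of g] unfolding test_def by blast

lemma test_measurable: "test g \<Longrightarrow> g \<in> borel_measurable borel"
  by (intro borel_measurable_continuous_onI test_continuous)

text \<open>The quotient of \<open>c\<close> by a bump function that is positive around the support
  of \<open>c\<close> is continuous, hence uniformly close to a polynomial on a cube. Multiplying
  back by the bump yields a test function: the polynomial is smooth and the bump supplies the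
  compact support.\<close>

lemma continuous_compact_test_approx:
  fixes c :: "real^4 \<Rightarrow> real"
  assumes p: "p > 0" and c: "continuous_on UNIV c" and out: "\<And>x. norm x \<ge> R \<Longrightarrow> c x = 0" and e: "e > 0"
  shows "\<exists>\<rho>. test \<rho> \<and> Lp_norm p (\<lambda>x. c x - \<rho> x) < e"
proof -
  define r where "r = \<bar>R\<bar> + 1"
  let ?b = "bump r :: real^4 \<Rightarrow> real"
  let ?K = "cbox (- r *\<^sub>R One) (r *\<^sub>R One :: real^4)"
  have pos: "?b x > 0" if "norm x < r" for x
    using that Basis_le_norm[of _ x] by (auto simp: bump_pos_iff intro: le_less_trans)
  define d where "d x = c x / ?b x" for x
  have bc: "continuous_on UNIV ?b" by (intro test_continuous test_bump)
  \<comment> \<open>The two open sets cover the space: on the ball the bump is positive, and off the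
    smaller closed ball the numerator vanishes, so that \<open>d = 0\<close> even where the bump is
    zero.\<close>
  have "continuous_on (ball 0 r \<union> - cball 0 \<bar>R\<bar>) d"
  proof (rule continuous_on_open_Un)
    show "continuous_on (ball 0 r) d" unfolding d_def
      by (intro continuous_on_divide continuous_on_subset[OF c] continuous_on_subset[OF bc])
        (use pos in \<open>force simp: dist_norm\<close>)+
    have "continuous_on (- cball 0 \<bar>R\<bar>) (\<lambda>x. 0 :: real)" by simp
    then show "continuous_on (- cball 0 \<bar>R\<bar>) d"
      by (rule continuous_on_eq) (use out in \<open>auto simp: d_def\<close>)
  qed auto
  moreover have "ball 0 r \<union> - cball 0 \<bar>R\<bar> = (UNIV :: (real^4) set)" by (auto simp: r_def)
  ultimately have d: "continuous_on UNIV d" by simp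
  define e' where "e' = e / (Lp_norm p (indicator ?K :: real^4 \<Rightarrow> real) + 1)"
  have e': "e' > 0" using e Lp_norm_nonneg[of p "indicator ?K :: real^4 \<Rightarrow> real"] by (simp add: e'_def add_nonneg_pos)
  obtain P where P: "real_polynomial_function P" "\<And>x. x \<in> ?K \<Longrightarrow> \<bar>d x - P x\<bar> < e'"
    using Stone_Weierstrass_real_polynomial_function[OF compact_cbox continuous_on_subset[OF d] e'] by blast
  have t: "test (\<lambda>x. P x * ?b x)" by (intro test_mult_left test_bump smooth_polynomial P)
  have b0: "?b x = 0" if "x \<notin> ?K" for x
  proof -
    obtain b where "b \<in> Basis" "\<not> (- r \<le> x \<bullet> b \<and> x \<bullet> b \<le> r)"
      using \<open>x \<notin> ?K\<close> by (auto simp: mem_box)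
    then have "\<not> (\<forall>b\<in>Basis. \<bar>x \<bullet> b\<bar> < r)" by (auto simp: abs_less_iff intro!: bexI[of _ b])
    then show ?thesis using bump_pos_iff[of r x] bump_nonneg[of r x] by linarith
  qed
  have cd: "c x = d x * ?b x" for x
    using pos[of x] out[of x] by (cases "norm x < r") (auto simp: d_def r_def)
  have "\<bar>c x - P x * ?b x\<bar> \<le> e'" for x
  proof (cases "x \<in> ?K")
    case True
    have "\<bar>c x - P x * ?b x\<bar> = \<bar>d x - P x\<bar> * ?b x"
      using bump_nonneg[of r x] by (simp add: cd left_diff_distrib[symmetric] abs_mult)
    also have "\<dots> \<le> e' * 1" using P(2)[OF True] e' bump_nonneg bump_le_1 by (intro mult_mono) auto
    finally show ?thesis by simp
  next
    case False
    then show ?thesis using e' by (simp add: cd b0)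
  qed
  moreover have "(\<lambda>x. c x - P x * ?b x) \<in> borel_measurable borel"
    by (intro borel_measurable_diff borel_measurable_continuous_onI[OF c] test_measurable[OF t])
  moreover have "c x - P x * ?b x = 0" if "x \<notin> ?K" for x using b0[OF that] cd[of x] by simp
  ultimately have "Lp_norm p (\<lambda>x. c x - P x * ?b x) \<le> e' * Lp_norm p (indicator ?K :: real^4 \<Rightarrow> real)"
    using p by (intro Lp_le_uniform(2)) auto
  also have "\<dots> < e"
    using e Lp_norm_nonneg[of p "indicator ?K :: real^4 \<Rightarrow> real"] by (simp add: e'_def field_simps)
  finally show ?thesis using t by blast
qed

text \<open>Three approximations with error \<open>e/3\<close> each: truncation \<open>G k\<close>
  in value and in space, continuous functions \<open>C n\<close> converging almost everywhere to the
  truncation, and a test function near one of these. The truncation level \<open>k\<close> also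
  supplies the compactly supported majorant that dominated convergence needs for
  \<open>C n\<close>.\<close>

lemma Lp_test_approx:
  fixes g :: "real^4 \<Rightarrow> real"
  assumes p: "p > 1" and g: "in_Lp p g" and e: "e > 0"
  shows "\<exists>\<rho>. test \<rho> \<and> Lp_norm p (\<lambda>x. g x - \<rho> x) < e"
proof -
  note gm[measurable] = in_Lp_measurable[OF g]
  define \<kappa> where "\<kappa> k x = max 0 (min 1 (real k + 1 - norm x))" for k and x :: "real^4"
  define cl where "cl k y = max (- real k) (min (real k) y)" for k y
  have \<kappa>: "0 \<le> \<kappa> k x" "\<kappa> k x \<le> 1" "continuous_on UNIV (\<kappa> k)" "real k + 1 \<le> norm x \<Longrightarrow> \<kappa> k x = 0" for k x
    by (auto simp: \<kappa>_def intro!: continuous_intros)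
  have cl: "\<bar>cl k y\<bar> \<le> \<bar>y\<bar>" "\<bar>cl k y\<bar> \<le> real k" "continuous_on UNIV (cl k)" for k y
    by (auto simp: cl_def intro!: continuous_intros)
  have [measurable]: "\<kappa> k \<in> borel_measurable borel" "cl k \<in> borel_measurable borel" for k
    using \<kappa> cl by (auto intro: borel_measurable_continuous_onI)
  define G where "G k x = cl k (g x) * \<kappa> k x" for k x
  have "(\<lambda>k. G k x) \<longlonglongrightarrow> g x" for x
  proof (rule tendsto_eventually)
    obtain N where N: "\<bar>g x\<bar> + norm x \<le> real N" using real_arch_simple by blast
    have "G k x = g x" if "k \<ge> N" for k
    proof -
      have "real N \<le> real k" using that by simp
      moreover have "\<bar>g x\<bar> \<le> real N" "norm x \<le> real N"
        using N norm_ge_zero[of x] abs_ge_zero[of "g x"] by linarith+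
      ultimately have "cl k (g x) = g x" "\<kappa> k x = 1"
        unfolding cl_def \<kappa>_def by (auto simp: min_def max_def)
      then show ?thesis by (simp add: G_def)
    qed
    then show "\<forall>\<^sub>F k in sequentially. G k x = g x" by (auto simp: eventually_sequentially)
  qed
  moreover have "\<bar>G k x\<bar> \<le> \<bar>g x\<bar>" for k x
  proof -
    have "\<bar>G k x\<bar> = \<bar>cl k (g x)\<bar> * \<kappa> k x" using \<kappa> by (simp add: G_def abs_mult)
    also have "\<dots> \<le> \<bar>g x\<bar> * 1" using \<kappa> cl by (intro mult_mono) auto
    finally show ?thesis by simp
  qed
  ultimately have "(\<lambda>k. Lp_norm p (\<lambda>x. G k x - g x)) \<longlonglongrightarrow> 0"
    using p by (intro Lp_dominated_convergence(2)[OF _ g]) (auto simp: G_def)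
  from order_tendstoD(2)[OF this, of "e/3"] obtain k where k: "Lp_norm p (\<lambda>x. G k x - g x) < e / 3"
    using e by (auto simp: eventually_sequentially)
  have "g \<in> borel_measurable lebesgue" using gm by (simp add: measurable_completion)
  from lebesgue_measurable_imp_measurable_on_real[OF this, of UNIV]
  obtain N c where N: "negligible N" and c: "\<And>n. continuous_on UNIV (c n)"
    and lim: "\<And>x. x \<notin> N \<Longrightarrow> (\<lambda>n. c n x) \<longlonglongrightarrow> g x" unfolding measurable_on_def by auto
  define C where "C n x = cl k (c n x) * \<kappa> k x" for n x
  have Cc: "continuous_on UNIV (C n)" for n unfolding C_def
    by (intro continuous_intros \<kappa> continuous_on_compose2[OF cl(3) c]) auto
  have "N \<in> null_sets lebesgue" using N by (simp add: negligible_iff_null_sets)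
  then have "AE x in lebesgue. x \<notin> N" by (rule AE_not_in)
  then have "AE x in lebesgue. (\<lambda>n. C n x) \<longlonglongrightarrow> G k x"
  proof eventually_elim
    case (elim x)
    have "(\<lambda>n. cl k (c n x)) \<longlonglongrightarrow> cl k (g x)"
      using cl(3)[of k] lim[OF elim] continuous_on_tendsto_compose[of UNIV "cl k"] by auto
    then show ?case unfolding C_def G_def by (intro tendsto_mult tendsto_const)
  qed
  moreover have [measurable]: "C n \<in> borel_measurable borel" "G k \<in> borel_measurable borel" for n
    by (auto simp: G_def[abs_def] intro: borel_measurable_continuous_onI[OF Cc])
  ultimately have "AE x in lborel. (\<lambda>n. C n x) \<longlonglongrightarrow> G k x"
    by (subst (asm) AE_completion_iff) auto
  moreover have "in_Lp p (\<lambda>x. real k * \<kappa> k x)"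
    using p \<kappa> by (intro continuous_compact_in_Lp[of _ _ "cball 0 (real k + 1)"] continuous_intros) auto
  moreover have "\<bar>C n x\<bar> \<le> \<bar>real k * \<kappa> k x\<bar>" for n x
    using cl(2)[of k "c n x"] \<kappa>(1)[of k x] unfolding C_def abs_mult by (intro mult_mono) auto
  ultimately have "(\<lambda>n. Lp_norm p (\<lambda>x. C n x - G k x)) \<longlonglongrightarrow> 0" and Gin: "in_Lp p (G k)"
    using p by (auto intro!: Lp_dominated_convergence[where f=C and w="\<lambda>x. real k * \<kappa> k x" and g="G k"])
  from order_tendstoD(2)[OF this(1), of "e/3"] obtain n where n: "Lp_norm p (\<lambda>x. C n x - G k x) < e / 3"
    using e by (auto simp: eventually_sequentially)
  have C0: "C n x = 0" if "norm x \<ge> real k + 1" for x using \<kappa>(4)[OF that] by (simp add: C_def)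
  then obtain \<rho> where \<rho>: "test \<rho>" "Lp_norm p (\<lambda>x. C n x - \<rho> x) < e / 3"
    using continuous_compact_test_approx[of p "C n" "real k + 1" "e/3"] Cc p e by auto
  have Cin: "in_Lp p (C n)"
    using p C0 by (intro continuous_compact_in_Lp[of _ _ "cball 0 (real k + 1)"] Cc) auto
  have "Lp_norm p (\<lambda>x. g x - \<rho> x) \<le> Lp_norm p (\<lambda>x. g x - G k x) + Lp_norm p (\<lambda>x. G k x - \<rho> x)"
    by (rule Lp_triangle[OF p g Gin test_in_Lp]) (use \<rho> p in auto)
  moreover have "Lp_norm p (\<lambda>x. G k x - \<rho> x) \<le> Lp_norm p (\<lambda>x. G k x - C n x) + Lp_norm p (\<lambda>x. C n x - \<rho> x)"
    by (rule Lp_triangle[OF p Gin Cin test_in_Lp]) (use \<rho> p in auto)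
  ultimately show ?thesis using k n \<rho> Lp_norm_minus_commute[of p g "G k"] Lp_norm_minus_commute[of p "G k" "C n"]
    by (intro exI[of _ \<rho>]) auto
qed

text \<open>The function \<open>sgn g |g|^(p-1)\<close> attains equality in Hoelder's inequality. It
  is replaced by a nearby test function, at the price of an arbitrarily small error
  \<open>e\<close>. Later norm bounds for difference quotients and convolutions are all obtained in
  this dual form.\<close>

lemma Lp_norm_le_dual:
  fixes g :: "real^4 \<Rightarrow> real"
  assumes pq: "p > 1" "q > 1" "1 / p + 1 / q = 1" and g: "in_Lp p g" and K: "K \<ge> 0"
    and dual: "\<And>\<rho>. test \<rho> \<Longrightarrow> \<bar>LINT x|lborel. g x * \<rho> x\<bar> \<le> K * Lp_norm q \<rho>"
  shows "Lp_norm p g \<le> K"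
proof (cases "Lp_norm p g = 0")
  case True
  then show ?thesis using K by simp
next
  case False
  let ?N = "Lp_norm p g"
  have N: "?N > 0" using False Lp_norm_nonneg[of p g] by linarith
  note [measurable] = in_Lp_measurable[OF g]
  define w where "w x = sgn (g x) * \<bar>g x\<bar> powr (p - 1)" for x
  have qp: "(p - 1) * q = p" "1 / q = 1 / p * (p - 1)" using pq by (simp_all add: field_simps)
  have wq: "norm (w x) powr q = norm (g x) powr p" for x
    by (cases "g x = 0") (use pq in \<open>auto simp: w_def abs_mult abs_sgn_eq powr_powr qp\<close>)
  have w: "in_Lp q w" using in_Lp_integrable[OF g] unfolding in_Lp_def wq by (simp add: w_def[abs_def])
  have wn: "Lp_norm q w = ?N powr (p - 1)"
    unfolding Lp_norm_def wq qp(2) by (simp only: powr_powr)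
  have "g x * w x = norm (g x) powr p" for x
  proof -
    have "g x * w x = \<bar>g x\<bar> * \<bar>g x\<bar> powr (p - 1)" by (simp add: w_def abs_sgn mult.assoc[symmetric])
    then show ?thesis using powr_mult_base[of "\<bar>g x\<bar>" "p - 1"] by simp
  qed
  then have gw: "(LINT x|lborel. g x * w x) = ?N powr p" using Lp_norm_powr[of p g] pq by simp
  have "?N powr p \<le> K * ?N powr (p - 1) + e" if e: "e > 0" for e
  proof -
    define d where "d = e / (K + ?N)"
    have KN: "K + ?N > 0" using K N by simp
    have d: "d > 0" "(K + ?N) * d = e" using e KN by (auto simp: d_def)
    obtain \<rho> where \<rho>: "test \<rho>" "Lp_norm q (\<lambda>x. w x - \<rho> x) < d"
      using Lp_test_approx[OF pq(2) w d(1)] by auto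
    have ti: "in_Lp q \<rho>" using \<rho> pq by (intro test_in_Lp) auto
    have wd: "in_Lp q (\<lambda>x. w x - \<rho> x)" using in_Lp_diff[OF _ w ti] pq by auto
    have "(LINT x|lborel. g x * w x) = (LINT x|lborel. g x * \<rho> x + g x * (w x - \<rho> x))"
      by (simp add: right_diff_distrib)
    also have "\<dots> = (LINT x|lborel. g x * \<rho> x) + (LINT x|lborel. g x * (w x - \<rho> x))"
      by (intro Bochner_Integration.integral_add Holder[OF pq g] ti wd)
    also have "\<dots> \<le> K * Lp_norm q \<rho> + ?N * Lp_norm q (\<lambda>x. w x - \<rho> x)"
      using dual[OF \<rho>(1)] Holder(2)[OF pq g wd] by linarith
    also have "\<dots> \<le> K * (?N powr (p - 1) + d) + ?N * d"
    proof -
      have "Lp_norm q \<rho> \<le> ?N powr (p - 1) + d"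
        using Lp_norm_le_add_diff[OF pq(2) ti w] \<rho>(2) wn Lp_norm_minus_commute[of q \<rho> w] by linarith
      then show ?thesis using K N \<rho>(2) by (intro add_mono mult_left_mono) auto
    qed
    also have "\<dots> = K * ?N powr (p - 1) + (K + ?N) * d" by (simp add: algebra_simps)
    finally show ?thesis using gw d(2) by simp
  qed
  then have "?N powr p \<le> K * ?N powr (p - 1)" by (rule field_le_epsilon)
  moreover have "?N powr p = ?N * ?N powr (p - 1)" using powr_mult_base[of ?N "p - 1"] N by simp
  ultimately show ?thesis using N by simp
qed

lemma Lp_weak_zero_AE:
  fixes g :: "real^4 \<Rightarrow> real"
  assumes p: "p > 1" and g: "in_Lp p g" and dual: "\<And>\<rho>. test \<rho> \<Longrightarrow> (LINT x|lborel. g x * \<rho> x) = 0"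
  shows "AE x in lborel. g x = 0"
proof -
  define q where "q = p / (p - 1)"
  have q: "q > 1" "1 / p + 1 / q = 1" using p by (auto simp: q_def field_simps)
  have "Lp_norm p g \<le> 0" by (rule Lp_norm_le_dual[OF p q g]) (use dual in auto)
  then show ?thesis using Lp_norm_eq_0_AE[OF _ g] Lp_norm_nonneg[of p g] p by auto
qed

section \<open>Translations and difference quotients in \<open>L^p\<close>\<close>

lemma lborel_translate:
  fixes f :: "'a::euclidean_space \<Rightarrow> 'b::{banach,second_countable_topology}"
  assumes "f \<in> borel_measurable borel"
  shows "(LINT x|lborel. f (x + a)) = (LINT x|lborel. f x)"
    and "integrable lborel (\<lambda>x. f (x + a)) \<longleftrightarrow> integrable lborel f"
proof -
  have "(LINT x|lborel. f x) = (LINT x|distr lborel borel ((+) a). f x)" by (simp add: lborel_distr_plus)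
  also have "\<dots> = (LINT x|lborel. f (a + x))" using assms by (intro integral_distr) auto
  finally show "(LINT x|lborel. f (x + a)) = (LINT x|lborel. f x)" by (simp add: add.commute)
  have "integrable lborel f \<longleftrightarrow> integrable (distr lborel borel ((+) a)) f" by (simp add: lborel_distr_plus)
  also have "\<dots> \<longleftrightarrow> integrable lborel (\<lambda>x. f (a + x))" using assms by (intro integrable_distr_eq) auto
  finally show "integrable lborel (\<lambda>x. f (x + a)) \<longleftrightarrow> integrable lborel f" by (simp add: add.commute)
qed

lemma Lp_translate:
  shows "in_Lp p g \<Longrightarrow> in_Lp p (\<lambda>x. g (x + a))"
    and "in_Lp p g \<Longrightarrow> Lp_norm p (\<lambda>x. g (x + a)) = Lp_norm p g"
proof -
  assume g: "in_Lp p g"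
  note [measurable] = in_Lp_measurable[OF g]
  have m: "(\<lambda>x. norm (g x) powr p) \<in> borel_measurable borel" by simp
  show "in_Lp p (\<lambda>x. g (x + a))" "Lp_norm p (\<lambda>x. g (x + a)) = Lp_norm p g"
    using in_Lp_integrable[OF g] lborel_translate[OF m, of a] by (auto simp: in_Lp_def Lp_norm_def)
qed

lemma test_uniformly_continuous:
  assumes "test g"
  shows "uniformly_continuous_on UNIV g"
proof -
  obtain K where K: "compact K" "\<And>x. x \<notin> K \<Longrightarrow> g x = 0" using assms by (auto simp: test_def)
  then obtain R where R: "\<And>x. x \<in> K \<Longrightarrow> norm x \<le> R" using compact_imp_bounded[OF K(1)] by (auto simp: bounded_iff)
  have "uniformly_continuous_on (cball 0 (R + 1)) g"
    by (rule compact_uniformly_continuous[OF continuous_on_subset[OF test_continuous[OF assms]]]) auto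
  show ?thesis unfolding uniformly_continuous_on_def
  proof (intro allI impI)
    fix e :: real assume e: "e > 0"
    obtain d where d: "d > 0" "\<And>x y. x \<in> cball 0 (R + 1) \<Longrightarrow> y \<in> cball 0 (R + 1) \<Longrightarrow> dist y x < d \<Longrightarrow> dist (g y) (g x) < e"
      using \<open>uniformly_continuous_on (cball 0 (R + 1)) g\<close> e unfolding uniformly_continuous_on_def by blast
    \<comment> \<open>Because of the bound 1, two such points either both lie in the ball of radius
      \<open>R + 1\<close> or both lie outside the support.\<close>
    have "dist (g y) (g x) < e" if "dist y x < min d 1" for x y
    proof (cases "x \<in> cball 0 (R + 1) \<and> y \<in> cball 0 (R + 1)")
      case True
      then show ?thesis using d(2)[of x y] that by auto
    next
      case False
      then have "norm x > R" "norm y > R"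
        using that norm_triangle_ineq2[of x y] norm_triangle_ineq2[of y x] by (auto simp: dist_norm norm_minus_commute)
      then have "x \<notin> K" "y \<notin> K" using R by force+
      then show ?thesis using K(2) e by simp
    qed
    then show "\<exists>d>0. \<forall>x\<in>UNIV. \<forall>x'\<in>UNIV. dist x' x < d \<longrightarrow> dist (g x') (g x) < e"
      using d(1) by (intro exI[of _ "min d 1"]) auto
  qed
qed

lemma test_uniformly_continuous_ex:
  assumes "test g" "e > 0"
  shows "\<exists>d>0. \<forall>x y. dist y x < d \<longrightarrow> dist (g y) (g x) < e"
  using test_uniformly_continuous[OF assms(1)] assms(2) unfolding uniformly_continuous_on_def by auto

lemma Lp_tendsto_uniform:
  fixes f :: "'i \<Rightarrow> real^4 \<Rightarrow> real"
  assumes p: "p > 0" and K: "compact K"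
    and out: "\<forall>\<^sub>F h in F. f h \<in> borel_measurable borel \<and> (\<forall>x. x \<notin> K \<longrightarrow> f h x = 0)"
    and small: "\<And>e. e > 0 \<Longrightarrow> \<forall>\<^sub>F h in F. \<forall>x. \<bar>f h x\<bar> \<le> e"
  shows "((\<lambda>h. Lp_norm p (f h)) \<longlongrightarrow> 0) F"
proof (rule tendstoI)
  fix e :: real assume e: "e > 0"
  let ?c = "Lp_norm p (indicator K :: real^4 \<Rightarrow> real)"
  have c: "?c \<ge> 0" by (rule Lp_norm_nonneg)
  have "\<forall>\<^sub>F h in F. \<forall>x. \<bar>f h x\<bar> \<le> e / (?c + 1)" using e c by (intro small) auto
  with out show "\<forall>\<^sub>F h in F. dist (Lp_norm p (f h)) 0 < e"
  proof eventually_elim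
    case (elim h)
    then have "Lp_norm p (f h) \<le> e / (?c + 1) * ?c" using p K by (intro Lp_le_uniform(2)) auto
    also have "\<dots> < e" using e c by (simp add: field_simps)
    finally show ?case using Lp_norm_nonneg[of p "f h"] by simp
  qed
qed

lemma test_compact_enlarge:
  fixes g :: "'a::euclidean_space \<Rightarrow> real"
  assumes "test g"
  obtains R where "\<And>x a. norm x > R \<Longrightarrow> norm a \<le> 1 \<Longrightarrow> g (x + a) = 0"
proof -
  obtain K where K: "compact K" "\<And>x. x \<notin> K \<Longrightarrow> g x = 0" using assms by (auto simp: test_def)
  then obtain R where R: "\<And>x. x \<in> K \<Longrightarrow> norm x \<le> R" using compact_imp_bounded[OF K(1)] by (auto simp: bounded_iff)
  have "g (x + a) = 0" if "norm x > R + 1" "norm a \<le> 1" for x a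
  proof -
    have "norm (x + a) > R" using that norm_triangle_ineq2[of x "- a"] by simp
    then show ?thesis using R[of "x + a"] K(2)[of "x + a"] by linarith
  qed
  then show ?thesis using that by blast
qed

lemma test_translate_tendsto:
  assumes p: "p > 0" and g: "test g"
  shows "((\<lambda>a. Lp_norm p (\<lambda>x. g (x + a) - g x)) \<longlongrightarrow> 0) (at 0)"
proof -
  obtain R where R: "\<And>x a. norm x > R \<Longrightarrow> norm a \<le> 1 \<Longrightarrow> g (x + a) = 0" using test_compact_enlarge[OF g] by blast
  have "\<forall>\<^sub>F a in at (0::real^4). norm a < 1" by (rule order_tendstoD[OF tendsto_norm_zero[OF tendsto_ident_at]]) simp
  then have a: "\<forall>\<^sub>F a in at (0::real^4). norm a \<le> 1" by eventually_elim simp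
  note [measurable] = test_measurable[OF g]
  show ?thesis
  proof (rule Lp_tendsto_uniform[OF p compact_cball[of 0 R]])
    show "\<forall>\<^sub>F a in at 0. (\<lambda>x. g (x + a) - g x) \<in> borel_measurable borel \<and> (\<forall>x. x \<notin> cball 0 R \<longrightarrow> g (x + a) - g x = 0)"
      using a
    proof eventually_elim
      case (elim a)
      then show ?case using R[of _ a] R[of _ 0] by auto
    qed
    fix e :: real assume "e > 0"
    from test_uniformly_continuous_ex[OF g this] obtain d where d: "d > 0" "\<And>x y. dist y x < d \<Longrightarrow> dist (g y) (g x) < e"
      by auto
    have "\<forall>\<^sub>F a in at (0::real^4). norm a < d" using d(1) by (intro order_tendstoD[OF tendsto_norm_zero[OF tendsto_ident_at]])
    then show "\<forall>\<^sub>F a in at 0. \<forall>x. \<bar>g (x + a) - g x\<bar> \<le> e"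
    proof eventually_elim
      case (elim a)
      then have "dist (x + a) x < d" for x by (simp add: dist_norm)
      then show ?case using d(2) by (auto simp: dist_real_def intro: less_imp_le)
    qed
  qed
qed

text \<open>The mean value theorem rewrites the quotient as the derivative at a nearby point;
  uniform continuity of the derivative makes the error uniformly small, and the common compact
  support turns this into smallness in norm.\<close>

lemma test_difference_quotient_tendsto:
  assumes p: "p > 0" and g: "test g" and v: "v \<in> Basis"
  shows "((\<lambda>h. Lp_norm p (\<lambda>x. (g (x + h *\<^sub>R v) - g x) / h - dd v g x)) \<longlongrightarrow> 0) (at 0)"
proof -
  note s = test_smooth[OF g]
  note tdd = test_dd[OF g v]
  obtain R where R: "\<And>x a. norm x > R \<Longrightarrow> norm a \<le> 1 \<Longrightarrow> g (x + a) = 0" using test_compact_enlarge[OF g] by blast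
  obtain R' where R': "\<And>x a. norm x > R' \<Longrightarrow> norm a \<le> 1 \<Longrightarrow> dd v g (x + a) = 0" using test_compact_enlarge[OF tdd] by blast
  have h: "\<forall>\<^sub>F h in at (0::real). \<bar>h\<bar> < d" if "d > 0" for d
    using that by (intro order_tendstoD[OF tendsto_rabs_zero[OF tendsto_ident_at]])
  note [measurable] = test_measurable[OF g] test_measurable[OF tdd]
  show ?thesis
  proof (rule Lp_tendsto_uniform[OF p compact_cball[of 0 "max R R'"]])
    show "\<forall>\<^sub>F h in at 0. (\<lambda>x. (g (x + h *\<^sub>R v) - g x) / h - dd v g x) \<in> borel_measurable borel
       \<and> (\<forall>x. x \<notin> cball 0 (max R R') \<longrightarrow> (g (x + h *\<^sub>R v) - g x) / h - dd v g x = 0)"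
      using h[of 1, simplified]
    proof eventually_elim
      case (elim h)
      then show ?case using R[of _ "h *\<^sub>R v"] R[of _ 0] R'[of _ 0] v by (auto simp: norm_Basis)
    qed
    fix e :: real assume "e > 0"
    from test_uniformly_continuous_ex[OF tdd this] obtain d where d: "d > 0" "\<And>x y. dist y x < d \<Longrightarrow> dist (dd v g y) (dd v g x) < e"
      by auto
    have "\<forall>\<^sub>F h in at (0::real). h \<noteq> 0" by (simp add: eventually_at_filter)
    with h[OF d(1)] show "\<forall>\<^sub>F h in at 0. \<forall>x. \<bar>(g (x + h *\<^sub>R v) - g x) / h - dd v g x\<bar> \<le> e"
    proof eventually_elim
      case (elim h)
      show ?case
      proof
        fix x
        obtain r where r: "\<bar>r\<bar> \<le> \<bar>h\<bar>" "g (x + h *\<^sub>R v) - g x = h * dd v g (x + r *\<^sub>R v)"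
        proof (cases "h > 0")
          case True
          from MVT2[OF this, of "\<lambda>s. g (x + s *\<^sub>R v)" "\<lambda>s. dd v g (x + s *\<^sub>R v)"] smooth_has_derivative[OF s v, of x]
          obtain z where "0 < z" "z < h" "g (x + h *\<^sub>R v) - g x = h * dd v g (x + z *\<^sub>R v)" by auto
          then show ?thesis using that[of z] by simp
        next
          case False
          then have "h < 0" using elim by simp
          from MVT2[OF this, of "\<lambda>s. g (x + s *\<^sub>R v)" "\<lambda>s. dd v g (x + s *\<^sub>R v)"] smooth_has_derivative[OF s v, of x]
          obtain z where "h < z" "z < 0" "g x - g (x + h *\<^sub>R v) = - h * dd v g (x + z *\<^sub>R v)" by auto
          then show ?thesis using that[of z] by simp
        qed
        then have "(g (x + h *\<^sub>R v) - g x) / h = dd v g (x + r *\<^sub>R v)" using elim by simp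
        moreover have "dist (x + r *\<^sub>R v) x < d" using r(1) elim v by (simp add: dist_norm norm_Basis)
        ultimately show "\<bar>(g (x + h *\<^sub>R v) - g x) / h - dd v g x\<bar> \<le> e"
          using d(2)[of "x + r *\<^sub>R v" x] by (simp add: dist_real_def)
      qed
    qed
  qed
qed

lemma Lp_translate_tendsto:
  fixes g :: "real^4 \<Rightarrow> real"
  assumes p: "p > 1" and g: "in_Lp p g"
  shows "((\<lambda>a. Lp_norm p (\<lambda>x. g (x + a) - g x)) \<longlongrightarrow> 0) (at 0)"
proof (rule tendstoI)
  fix e :: real assume e: "e > 0"
  then obtain \<rho> where \<rho>: "test \<rho>" "Lp_norm p (\<lambda>x. g x - \<rho> x) < e / 3"
    using Lp_test_approx[OF p g, of "e/3"] by auto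
  have ti: "in_Lp p \<rho>" using \<rho> p by (intro test_in_Lp) auto
  have p0: "p > 0" using p by simp
  have "\<forall>\<^sub>F a in at 0. Lp_norm p (\<lambda>x. \<rho> (x + a) - \<rho> x) < e / 3"
    using test_translate_tendsto[OF p0 \<rho>(1)] e by (intro order_tendstoD) auto
  then show "\<forall>\<^sub>F a in at 0. dist (Lp_norm p (\<lambda>x. g (x + a) - g x)) 0 < e"
  proof eventually_elim
    case (elim a)
    have "Lp_norm p (\<lambda>x. g (x + a) - \<rho> (x + a)) = Lp_norm p (\<lambda>x. g x - \<rho> x)"
      by (rule Lp_translate(2)[OF in_Lp_diff[OF p0 g ti]])
    moreover have "Lp_norm p (\<lambda>x. g (x + a) - g x) \<le> Lp_norm p (\<lambda>x. g (x + a) - \<rho> (x + a)) + Lp_norm p (\<lambda>x. \<rho> (x + a) - g x)"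
      by (rule Lp_triangle[OF p Lp_translate(1)[OF g] Lp_translate(1)[OF ti] g])
    moreover have "Lp_norm p (\<lambda>x. \<rho> (x + a) - g x) \<le> Lp_norm p (\<lambda>x. \<rho> (x + a) - \<rho> x) + Lp_norm p (\<lambda>x. \<rho> x - g x)"
      by (rule Lp_triangle[OF p Lp_translate(1)[OF ti] ti g])
    ultimately show ?case
      using elim \<rho>(2) Lp_norm_minus_commute[of p \<rho> g] Lp_norm_nonneg[of p "\<lambda>x. g (x + a) - g x"] by simp
  qed
qed

text \<open>The Riesz-Fischer argument: a rapidly converging subsequence converges almost
  everywhere, and Fatou's lemma identifies its limit as the limit in norm of the whole
  sequence.\<close>

lemma Lp_complete:
  fixes f :: "nat \<Rightarrow> real^4 \<Rightarrow> real"
  assumes p: "p > 1" and f: "\<And>n. in_Lp p (f n)"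
    and Cauchy: "\<And>e. e > 0 \<Longrightarrow> \<exists>N. \<forall>m\<ge>N. \<forall>n\<ge>N. Lp_norm p (\<lambda>x. f m x - f n x) < e"
  shows "\<exists>g. in_Lp p g \<and> (\<lambda>n. Lp_norm p (\<lambda>x. f n x - g x)) \<longlonglongrightarrow> 0"
proof -
  have p0: "p > 0" using p by simp
  note [measurable] = in_Lp_measurable[OF f]
  have nn: "(\<integral>\<^sup>+x. ennreal (norm (h x) powr p) \<partial>lborel) = ennreal (Lp_norm p h powr p)" if "in_Lp p h" for h :: "real^4 \<Rightarrow> real"
    using nn_integral_eq_integral[OF in_Lp_integrable[OF that]] Lp_norm_powr[OF p0, of h] by simp
  have "\<forall>k::nat. \<exists>N. \<forall>m\<ge>N. \<forall>n\<ge>N. Lp_norm p (\<lambda>x. f m x - f n x) < (1/4)^k" using Cauchy by simp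
  then obtain N where N: "\<And>k m n. m \<ge> N k \<Longrightarrow> n \<ge> N k \<Longrightarrow> Lp_norm p (\<lambda>x. f m x - f n x) < (1/4)^k" by metis
  \<comment> \<open>Summing the indices makes \<open>r\<close> exceed every earlier
    \<open>N i\<close>, and the added ones give \<open>r k \<ge> k\<close>, so that the subsequence
    goes to infinity.\<close>
  define r where "r k = (\<Sum>i\<le>k. N i + 1)" for k
  have rN: "r l \<ge> N k" if "l \<ge> k" for k l proof -
    have "N k + 1 \<le> r l" unfolding r_def using that by (intro member_le_sum) auto
    then show ?thesis by simp
  qed
  have rk: "r k \<ge> k" for k
    unfolding r_def using sum_mono[of "{..k}" "\<lambda>_. 1" "\<lambda>i. N i + 1"] by simp
  define d where "d k x = f (r (Suc k)) x - f (r k) x" for k x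
  have din: "in_Lp p (d k)" for k unfolding d_def by (rule in_Lp_diff[OF p0 f f])
  have dn: "Lp_norm p (d k) \<le> (1/4)^k" for k
    unfolding d_def using N[of k "r (Suc k)" "r k"] rN[of k "Suc k"] rN[of k k] by simp
  note [measurable] = in_Lp_measurable[OF din]
  \<comment> \<open>The weight \<open>2^k\<close> against norms at most \<open>4^-k\<close> leaves a
    geometric series of ratio \<open>2^-p\<close>. Where the sum is finite, \<open>|d k x|\<close>
    is at most a constant times \<open>2^-k\<close>, so that the telescoping series converges at
    \<open>x\<close>.\<close>
  have "(\<integral>\<^sup>+x. (\<Sum>k. ennreal (norm (2^k * d k x) powr p)) \<partial>lborel) = (\<Sum>k. \<integral>\<^sup>+x. ennreal (norm (2^k * d k x) powr p) \<partial>lborel)"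
    by (intro nn_integral_suminf) simp
  also have "\<dots> \<le> (\<Sum>k. ennreal (((1/2) powr p)^k))"
  proof (intro suminf_le)
    fix k
    have "(\<integral>\<^sup>+x. ennreal (norm (2^k * d k x) powr p) \<partial>lborel) = ennreal ((2^k * Lp_norm p (d k)) powr p)"
      using nn[OF in_Lp_cmult[OF din], of "2^k" k] Lp_norm_cmult[OF p0, of "2^k" "d k"] by simp
    also have "(2^k * Lp_norm p (d k)) powr p \<le> (2^k * (1/4)^k) powr p"
      using p0 dn[of k] Lp_norm_nonneg[of p "d k"] by (intro powr_mono2 mult_left_mono) auto
    also have "(2::real)^k * (1/4)^k = (1/2)^k" by (simp add: power_mult_distrib[symmetric])
    also have "((1/2::real)^k) powr p = ((1/2) powr p)^k"
      by (simp add: powr_realpow[symmetric] powr_powr mult.commute)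
    finally show "(\<integral>\<^sup>+x. ennreal (norm (2^k * d k x) powr p) \<partial>lborel) \<le> ennreal (((1/2) powr p)^k)"
      by (simp add: ennreal_leI)
  qed auto
  also have "\<dots> < \<infinity>"
  proof -
    have "(1/2::real) powr p < 1 powr p" using p0 by (intro powr_less_mono2) auto
    then have "summable (\<lambda>k. ((1/2::real) powr p)^k)" by (intro summable_geometric) simp
    then show ?thesis by (subst suminf_ennreal2) auto
  qed
  finally have "AE x in lborel. (\<Sum>k. ennreal (norm (2^k * d k x) powr p)) \<noteq> \<infinity>"
    by (intro nn_integral_PInf_AE) auto
  then have conv: "AE x in lborel. (\<lambda>k. f (r k) x) \<longlonglongrightarrow> lim (\<lambda>k. f (r k) x)"
  proof eventually_elim
    case (elim x)
    then obtain S where S: "S \<ge> 0" "(\<Sum>k. ennreal (norm (2^k * d k x) powr p)) = ennreal S"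
      by (cases "\<Sum>k. ennreal (norm (2^k * d k x) powr p)") auto
    have B: "\<bar>d k x\<bar> \<le> S powr (1/p) * (1/2)^k" for k
    proof -
      have "(\<Sum>i\<in>{k}. ennreal (norm (2^i * d i x) powr p)) \<le> (\<Sum>k. ennreal (norm (2^k * d k x) powr p))"
        by (intro sum_le_suminf) auto
      then have "norm (2^k * d k x) powr p \<le> S" using S by (simp add: ennreal_le_iff)
      then have "(norm (2^k * d k x) powr p) powr (1/p) \<le> S powr (1/p)" using p0 by (intro powr_mono2) auto
      then show ?thesis using p0 by (simp add: powr_powr abs_mult power_one_over field_simps)
    qed
    have S2: "summable (\<lambda>k. S powr (1/p) * (1/2)^k)" by (intro summable_mult summable_geometric) simp
    have "summable (\<lambda>k. d k x)"
      by (rule summable_comparison_test'[OF S2, of 0]) (simp only: real_norm_def B)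
    then have "(\<lambda>n. f (r 0) x + (\<Sum>k<n. d k x)) \<longlonglongrightarrow> f (r 0) x + suminf (\<lambda>k. d k x)"
      by (intro tendsto_add tendsto_const summable_LIMSEQ)
    moreover have "f (r 0) x + (\<Sum>k<n. d k x) = f (r n) x" for n
      by (induction n) (auto simp: d_def)
    ultimately have "convergent (\<lambda>k. f (r k) x)" by (auto simp: convergent_def)
    then show ?case by (simp add: convergent_LIMSEQ_iff)
  qed
  define g where "g x = lim (\<lambda>k. f (r k) x)" for x
  have gm[measurable]: "g \<in> borel_measurable borel" unfolding g_def by (rule borel_measurable_lim_metric) simp
  \<comment> \<open>Fatou's lemma along the subsequence transfers the Cauchy bound from
    \<open>f m - f (r k)\<close> to \<open>f m - g\<close>; membership of \<open>g\<close> in the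
    space comes from the same estimate.\<close>
  have key: "in_Lp p (\<lambda>x. f m x - g x) \<and> Lp_norm p (\<lambda>x. f m x - g x) \<le> e"
    if e: "e > 0" and M: "\<And>n m. n \<ge> M \<Longrightarrow> m \<ge> M \<Longrightarrow> Lp_norm p (\<lambda>x. f m x - f n x) < e" and "m \<ge> M" for e M m
  proof -
    have "(\<integral>\<^sup>+x. ennreal (norm (f m x - g x) powr p) \<partial>lborel)
        = (\<integral>\<^sup>+x. liminf (\<lambda>k. ennreal (norm (f m x - f (r k) x) powr p)) \<partial>lborel)"
    proof (rule nn_integral_cong_AE)
      show "AE x in lborel. ennreal (norm (f m x - g x) powr p) = liminf (\<lambda>k. ennreal (norm (f m x - f (r k) x) powr p))"
        using conv
      proof eventually_elim
        case (elim x)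
        have "(\<lambda>k. ennreal (norm (f m x - f (r k) x) powr p)) \<longlonglongrightarrow> ennreal (norm (f m x - g x) powr p)"
          using elim p0 unfolding g_def by (intro tendsto_ennrealI tendsto_powr' tendsto_norm tendsto_diff tendsto_const) auto
        from lim_imp_Liminf[OF _ this] show ?case by simp
      qed
    qed
    also have "\<dots> \<le> liminf (\<lambda>k. \<integral>\<^sup>+x. ennreal (norm (f m x - f (r k) x) powr p) \<partial>lborel)"
      by (intro nn_integral_liminf) simp
    also have "\<dots> \<le> limsup (\<lambda>k. \<integral>\<^sup>+x. ennreal (norm (f m x - f (r k) x) powr p) \<partial>lborel)"
      by (intro Liminf_le_Limsup) simp
    also have "\<dots> \<le> ennreal (e powr p)"
    proof (rule Limsup_bounded)
      have "(\<integral>\<^sup>+x. ennreal (norm (f m x - f (r k) x) powr p) \<partial>lborel) \<le> ennreal (e powr p)" if "k \<ge> M" for k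
      proof -
        have "r k \<ge> M" using rk[of k] that by simp
        then have "Lp_norm p (\<lambda>x. f m x - f (r k) x) < e" using M \<open>m \<ge> M\<close> by blast
        then have "Lp_norm p (\<lambda>x. f m x - f (r k) x) powr p \<le> e powr p"
          using p0 Lp_norm_nonneg by (intro powr_mono2) auto
        then show ?thesis using nn[OF in_Lp_diff[OF p0 f f], of m "r k"] by (simp add: ennreal_leI)
      qed
      then show "\<forall>\<^sub>F k in sequentially. (\<integral>\<^sup>+x. ennreal (norm (f m x - f (r k) x) powr p) \<partial>lborel) \<le> ennreal (e powr p)"
        by (auto simp: eventually_sequentially)
    qed
    finally have le: "(\<integral>\<^sup>+x. ennreal (norm (f m x - g x) powr p) \<partial>lborel) \<le> ennreal (e powr p)" .
    have i: "integrable lborel (\<lambda>x. norm (f m x - g x) powr p)"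
      by (rule integrableI_bounded) (use le in \<open>auto simp: le_less_trans\<close>)
    have "(LINT x|lborel. norm (f m x - g x) powr p) \<le> e powr p"
      using le nn_integral_eq_integral[OF i] by (simp add: ennreal_le_iff)
    then show ?thesis using i p0 e by (auto simp: in_Lp_def intro!: Lp_norm_leI)
  qed
  show ?thesis
  proof (intro exI conjI)
    obtain M where M: "\<And>n m. n \<ge> M \<Longrightarrow> m \<ge> M \<Longrightarrow> Lp_norm p (\<lambda>x. f m x - f n x) < 1" using Cauchy[of 1] by auto
    have "in_Lp p (\<lambda>x. f M x - g x)" using key[OF _ M] by auto
    from in_Lp_diff[OF p0 f[of M] this] show "in_Lp p g" by simp
    show "(\<lambda>n. Lp_norm p (\<lambda>x. f n x - g x)) \<longlonglongrightarrow> 0"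
    proof (rule tendstoI)
      fix e :: real assume e: "e > 0"
      obtain M where M: "\<And>n m. n \<ge> M \<Longrightarrow> m \<ge> M \<Longrightarrow> Lp_norm p (\<lambda>x. f m x - f n x) < e/2"
        using Cauchy[of "e/2"] e by auto
      have "dist (Lp_norm p (\<lambda>x. f n x - g x)) 0 < e" if "n \<ge> M" for n
        using key[OF _ M that] e Lp_norm_nonneg[of p "\<lambda>x. f n x - g x"] by auto
      then show "\<forall>\<^sub>F n in sequentially. dist (Lp_norm p (\<lambda>x. f n x - g x)) 0 < e"
        by (auto simp: eventually_sequentially)
    qed
  qed
qed

section \<open>The Sobolev inequality in dimension four\<close>

lemma nn_integral_derivative_bound:
  fixes k k' :: "real \<Rightarrow> real"
  assumes d: "\<And>s. (k has_real_derivative k' s) (at s)" and c: "continuous_on UNIV k'" and ab: "a \<le> b"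
  shows "ennreal \<bar>k b - k a\<bar> \<le> (\<integral>\<^sup>+s. ennreal \<bar>k' s\<bar> * indicator {a..b} s \<partial>lborel)"
proof -
  have "has_bochner_integral lborel (\<lambda>x. indicator {a..b} x *\<^sub>R k' x) (k b - k a)"
    by (rule has_bochner_integral_FTC_Icc[OF ab _ continuous_on_subset[OF c]])
      (auto intro: has_field_derivative_at_within d simp: has_real_derivative_iff_has_vector_derivative[symmetric])
  then have i: "integrable lborel (\<lambda>x. indicator {a..b} x *\<^sub>R k' x)" and
    e: "(LINT x|lborel. indicator {a..b} x *\<^sub>R k' x) = k b - k a" by (auto simp: has_bochner_integral_iff)
  have "ennreal \<bar>k b - k a\<bar> \<le> (\<integral>\<^sup>+s. ennreal (norm (indicator {a..b} s *\<^sub>R k' s)) \<partial>lborel)"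
    using integral_norm_bound_ennreal[OF i] unfolding e by simp
  also have "\<dots> = (\<integral>\<^sup>+s. ennreal \<bar>k' s\<bar> * indicator {a..b} s \<partial>lborel)"
    by (intro nn_integral_cong) (auto simp: indicator_def)
  finally show ?thesis .
qed

text \<open>The function vanishes far out on both sides, so \<open>|k s|\<close> is bounded by the
  integral over the left half line and by the one over the right; adding them gives the factor 2.
  Through this factor the Sobolev constant drops below one.\<close>

lemma nn_integral_derivative_ge_twice:
  fixes k k' :: "real \<Rightarrow> real"
  assumes d: "\<And>s. (k has_real_derivative k' s) (at s)" and c: "continuous_on UNIV k'"
    and out: "\<And>s. \<bar>s\<bar> > R \<Longrightarrow> k s = 0"
  shows "ennreal (2 * \<bar>k s\<bar>) \<le> (\<integral>\<^sup>+s. ennreal \<bar>k' s\<bar> \<partial>lborel)"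
proof -
  define r where "r = \<bar>R\<bar> + \<bar>s\<bar> + 1"
  have r: "k r = 0" "k (- r) = 0" "- r \<le> s" "s \<le> r" by (auto simp: r_def intro!: out)
  have [measurable]: "k' \<in> borel_measurable borel" by (rule borel_measurable_continuous_onI[OF c])
  have "ennreal (2 * \<bar>k s\<bar>) = ennreal \<bar>k s - k (- r)\<bar> + ennreal \<bar>k r - k s\<bar>"
    using r by (simp add: ennreal_plus[symmetric] del: ennreal_plus)
  also have "\<dots> \<le> (\<integral>\<^sup>+x. ennreal \<bar>k' x\<bar> * indicator {- r..s} x \<partial>lborel) + (\<integral>\<^sup>+x. ennreal \<bar>k' x\<bar> * indicator {s..r} x \<partial>lborel)"
    by (intro add_mono nn_integral_derivative_bound d c r)
  also have "\<dots> = (\<integral>\<^sup>+x. ennreal \<bar>k' x\<bar> * indicator {- r..s} x + ennreal \<bar>k' x\<bar> * indicator {s..r} x \<partial>lborel)"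
    by (intro nn_integral_add[symmetric]) auto
  also have "\<dots> \<le> (\<integral>\<^sup>+s. ennreal \<bar>k' s\<bar> \<partial>lborel)"
  proof (rule nn_integral_mono_AE)
    show "AE x in lborel. ennreal \<bar>k' x\<bar> * indicator {- r..s} x + ennreal \<bar>k' x\<bar> * indicator {s..r} x \<le> ennreal \<bar>k' x\<bar>"
      using AE_lborel_singleton[of s] by eventually_elim (auto simp: indicator_def)
  qed
  finally show ?thesis .
qed

text \<open>The cube root on extended nonnegative reals, with value \<open>top\<close> at
  \<open>top\<close>, so that the Hoelder and Loomis-Whitney inequalities below hold without
  finiteness assumptions.\<close>

definition cbrt :: "ennreal \<Rightarrow> ennreal" where
  "cbrt x = (if x = top then top else ennreal (root 3 (enn2real x)))"

lemma cbrt_measurable[measurable]: "cbrt \<in> borel_measurable borel"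
  unfolding cbrt_def by measurable

lemma cbrt_ennreal: "0 \<le> r \<Longrightarrow> cbrt (ennreal r) = ennreal (root 3 r)"
  by (simp add: cbrt_def)

lemma cbrt_mono: "x \<le> y \<Longrightarrow> cbrt x \<le> cbrt y"
proof (cases "y = top")
  case False
  assume "x \<le> y"
  then have "x \<noteq> top" "enn2real x \<le> enn2real y" using False by (auto simp: top_unique intro: enn2real_mono simp: less_top)
  then show ?thesis using False by (simp add: cbrt_def ennreal_leI)
qed (simp add: cbrt_def)

lemma cbrt_eq_0: "cbrt x = 0 \<longleftrightarrow> x = 0"
  by (cases x) (auto simp: cbrt_def)

text \<open>Half of the nonnegative product
  \<open>(x + y + z) ((x - y)^2 + (y - z)^2 + (z - x)^2)\<close> equals
  \<open>x^3 + y^3 + z^3 - 3 x y z\<close>.\<close>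

lemma amgm3: "(3::real) * (x * y * z) \<le> x ^ 3 + y ^ 3 + z ^ 3" if "0 \<le> x" "0 \<le> y" "0 \<le> z"
proof -
  have "0 \<le> (x + y + z) * ((x - y)\<^sup>2 + (y - z)\<^sup>2 + (z - x)\<^sup>2)" using that by simp
  then show ?thesis by (simp add: power2_eq_square power3_eq_cube algebra_simps)
qed

text \<open>The arithmetic-geometric mean inequality for \<open>u/U\<close>, \<open>v/V\<close>,
  \<open>w/W\<close>. It plays the part of Young's inequality for three factors; \<open>U\<close>,
  \<open>V\<close>, \<open>W\<close> will be the three integrals.\<close>

lemma cbrt_amgm:
  assumes "0 < U" "0 < V" "0 < W"
  shows "cbrt u * cbrt v * cbrt w \<le> ennreal (root 3 U * root 3 V * root 3 W / 3) * (u / ennreal U + v / ennreal V + w / ennreal W)"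
proof (cases "u = top \<or> v = top \<or> w = top")
  case True
  then have t: "u / ennreal U + v / ennreal V + w / ennreal W = top" using assms
    by (auto simp: ennreal_top_divide)
  have nz: "ennreal (root 3 U * root 3 V * root 3 W / 3) \<noteq> 0" using assms by (simp add: ennreal_eq_0_iff not_le)
  show ?thesis unfolding t using nz by (simp only: ennreal_mult_top if_False top_greatest)
next
  case False
  then obtain a b c where abc: "u = ennreal a" "v = ennreal b" "w = ennreal c" "0 \<le> a" "0 \<le> b" "0 \<le> c"
    by (metis ennreal_cases)
  define x where "x = root 3 (a / U)"
  define y where "y = root 3 (b / V)"
  define z where "z = root 3 (c / W)"
  have pos: "0 \<le> x" "0 \<le> y" "0 \<le> z" using abc assms by (auto simp: x_def y_def z_def)
  have pw: "x ^ 3 = a / U" "y ^ 3 = b / V" "z ^ 3 = c / W" using abc assms by (auto simp: x_def y_def z_def)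
  have e: "root 3 a = root 3 U * x" "root 3 b = root 3 V * y" "root 3 c = root 3 W * z"
    using assms by (auto simp: x_def y_def z_def real_root_mult[symmetric])
  have "root 3 a * root 3 b * root 3 c = (root 3 U * root 3 V * root 3 W) * (x * y * z)" by (simp add: e)
  also have "\<dots> \<le> (root 3 U * root 3 V * root 3 W) * ((a / U + b / V + c / W) / 3)"
    using amgm3[OF pos] assms unfolding pw by (intro mult_left_mono) auto
  finally have "root 3 a * root 3 b * root 3 c \<le> (root 3 U * root 3 V * root 3 W / 3) * (a / U + b / V + c / W)" by simp
  then have "ennreal (root 3 a * root 3 b * root 3 c) \<le> ennreal ((root 3 U * root 3 V * root 3 W / 3) * (a / U + b / V + c / W))"
    by (rule ennreal_leI)
  then show ?thesis using abc assms
    by (simp add: cbrt_ennreal ennreal_mult[symmetric] divide_ennreal ennreal_plus[symmetric] del: ennreal_plus)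
qed

text \<open>Integration of \<open>cbrt_amgm\<close> with the three integrals as normalising
  constants: each normalised integral is 1, and their sum 3 cancels the denominator. Integrals equal
  to 0 or \<open>top\<close> cannot be divided by and are treated apart.\<close>

lemma Holder3_cbrt:
  assumes [measurable]: "u \<in> borel_measurable M" "v \<in> borel_measurable M" "w \<in> borel_measurable M"
  shows "(\<integral>\<^sup>+x. cbrt (u x) * cbrt (v x) * cbrt (w x) \<partial>M) \<le> cbrt (\<integral>\<^sup>+x. u x \<partial>M) * cbrt (\<integral>\<^sup>+x. v x \<partial>M) * cbrt (\<integral>\<^sup>+x. w x \<partial>M)"
proof -
  let ?U = "\<integral>\<^sup>+x. u x \<partial>M" and ?V = "\<integral>\<^sup>+x. v x \<partial>M" and ?W = "\<integral>\<^sup>+x. w x \<partial>M"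
  consider "?U = 0 \<or> ?V = 0 \<or> ?W = 0" | "?U \<noteq> 0" "?V \<noteq> 0" "?W \<noteq> 0" "?U = top \<or> ?V = top \<or> ?W = top"
    | "?U \<noteq> 0" "?V \<noteq> 0" "?W \<noteq> 0" "?U \<noteq> top" "?V \<noteq> top" "?W \<noteq> top" by blast
  then show ?thesis
  proof cases
    case 1
    then have "(AE x in M. u x = 0) \<or> (AE x in M. v x = 0) \<or> (AE x in M. w x = 0)"
      by (simp add: nn_integral_0_iff_AE)
    then have "AE x in M. cbrt (u x) * cbrt (v x) * cbrt (w x) = 0"
      by (auto simp: cbrt_eq_0 elim: eventually_mono)
    then have "(\<integral>\<^sup>+x. cbrt (u x) * cbrt (v x) * cbrt (w x) \<partial>M) = 0" by (simp add: nn_integral_0_iff_AE)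
    then show ?thesis by simp
  next
    case 2
    then have "cbrt ?U * cbrt ?V * cbrt ?W = top"
      by (auto simp: cbrt_eq_0 ennreal_mult_eq_top_iff) (auto simp: cbrt_def)
    then show ?thesis by simp
  next
    case 3
    then obtain U V W where UVW: "?U = ennreal U" "?V = ennreal V" "?W = ennreal W" "0 < U" "0 < V" "0 < W"
      by (metis ennreal_cases ennreal_eq_0_iff not_le)
    let ?c = "ennreal (root 3 U * root 3 V * root 3 W / 3)"
    have "(\<integral>\<^sup>+x. cbrt (u x) * cbrt (v x) * cbrt (w x) \<partial>M)
       \<le> (\<integral>\<^sup>+x. ?c * (u x / ennreal U + v x / ennreal V + w x / ennreal W) \<partial>M)"
      by (intro nn_integral_mono cbrt_amgm UVW)
    also have "\<dots> = ?c * (?U / ennreal U + ?V / ennreal V + ?W / ennreal W)"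
      by (simp add: nn_integral_cmult nn_integral_add nn_integral_divide)
    also have "\<dots> = ?c * 3" unfolding UVW using UVW(4-6) by simp
    also have "\<dots> = ennreal (root 3 U * root 3 V * root 3 W / 3 * 3)"
      using UVW(4-6) by (subst ennreal_mult) auto
    also have "\<dots> = cbrt ?U * cbrt ?V * cbrt ?W"
      unfolding UVW using UVW(4-6) by (simp add: cbrt_ennreal ennreal_mult)
    finally show ?thesis .
  qed
qed

text \<open>In the index type \<open>4\<close> the numeral 4 equals 0, so the four axes are those of
  the indices 1, 2, 3 and 0.\<close>

definition vec4 :: "real \<Rightarrow> real \<Rightarrow> real \<Rightarrow> real \<Rightarrow> real^4" where
  "vec4 a b c d = a *\<^sub>R axis 1 1 + b *\<^sub>R axis 2 1 + c *\<^sub>R axis 3 1 + d *\<^sub>R axis 4 1"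

lemma vec4_measurable[measurable]:
  "a \<in> borel_measurable M \<Longrightarrow> b \<in> borel_measurable M \<Longrightarrow> c \<in> borel_measurable M \<Longrightarrow> d \<in> borel_measurable M \<Longrightarrow>
   (\<lambda>x. vec4 (a x) (b x) (c x) (d x)) \<in> borel_measurable M"
  unfolding vec4_def by (intro borel_measurable_add borel_measurable_scaleR borel_measurable_const)

lemma borel_measurable_vec4_compose:
  fixes a b c d :: "'x::topological_space \<Rightarrow> real"
  assumes "g \<in> borel_measurable borel" "continuous_on UNIV a" "continuous_on UNIV b" "continuous_on UNIV c" "continuous_on UNIV d"
  shows "(\<lambda>x. g (vec4 (a x) (b x) (c x) (d x))) \<in> borel_measurable borel"
  by (rule measurable_compose[OF borel_measurable_continuous_onI assms(1)])
    (unfold vec4_def, intro continuous_intros assms)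

lemma vec4_nth: "vec4 a b c d $ 1 = a" "vec4 a b c d $ 2 = b" "vec4 a b c d $ 3 = c" "vec4 a b c d $ 4 = d"
  by (simp_all add: vec4_def axis_def)

lemma axis_in_Basis4: "axis (i::4) (1::real) \<in> Basis"
  by (simp add: axis_in_Basis_iff)

text \<open>Under \<open>V\<close> the fourfold product of one-dimensional Lebesgue measure gives
  every box its volume, hence is Lebesgue measure; then Tonelli's theorem is applied three
  times.\<close>

lemma nn_integral_vec4:
  assumes [measurable]: "g \<in> borel_measurable borel"
  shows "(\<integral>\<^sup>+x. g x \<partial>lborel) = (\<integral>\<^sup>+a. \<integral>\<^sup>+b. \<integral>\<^sup>+c. \<integral>\<^sup>+d. g (vec4 a b c d) \<partial>lborel \<partial>lborel \<partial>lborel \<partial>lborel)"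
proof -
  define V where "V z = vec4 (fst z) (fst (snd z)) (fst (snd (snd z))) (snd (snd (snd z)))" for z
  let ?P = "(lborel :: real measure) \<Otimes>\<^sub>M ((lborel :: real measure) \<Otimes>\<^sub>M ((lborel :: real measure) \<Otimes>\<^sub>M (lborel :: real measure)))"
  have P: "?P = lborel" by (simp add: lborel_prod)
  have [measurable]: "V \<in> ?P \<rightarrow>\<^sub>M borel" unfolding V_def by measurable
  have L: "lborel = distr ?P borel V"
  proof (rule lborel_eqI)
    fix l u :: "real^4" assume le: "\<And>b. b \<in> Basis \<Longrightarrow> l \<bullet> b \<le> u \<bullet> b"
    have le': "l $ i \<le> u $ i" for i
      unfolding cart_eq_inner_axis by (rule le[OF axis_in_Basis4])
    have "emeasure (distr ?P borel V) (box l u) = emeasure ?P (V -` box l u \<inter> space ?P)"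
      by (intro emeasure_distr) auto
    also have "V -` box l u \<inter> space ?P = {l $ 1<..<u $ 1} \<times> {l $ 2<..<u $ 2} \<times> {l $ 3<..<u $ 3} \<times> {l $ 4<..<u $ 4}"
      by (auto simp: V_def mem_box_cart forall_4 vec4_nth space_pair_measure)
    also have "emeasure ?P \<dots> = ennreal (u $ 1 - l $ 1) * (ennreal (u $ 2 - l $ 2) * (ennreal (u $ 3 - l $ 3) * ennreal (u $ 4 - l $ 4)))"
      using le' by (simp add: lborel_prod lborel.emeasure_pair_measure_Times[of _ lborel, unfolded lborel_prod] borel_Times)
    also have "\<dots> = ennreal (\<Prod>b\<in>Basis. (u - l) \<bullet> b)"
    proof -
      have B: "(Basis :: (real^4) set) = (\<lambda>i. axis i 1) ` UNIV" by (auto simp: Basis_vec_def)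
      have inj: "inj (\<lambda>i::4. axis i (1::real))" by (auto simp: inj_def axis_eq_axis)
      have "(\<Prod>b\<in>Basis. (u - l) \<bullet> b) = (\<Prod>i\<in>UNIV. (u - l) \<bullet> axis i 1)"
        unfolding B prod.reindex[OF inj] by (simp add: o_def)
      also have "\<dots> = (u $ 1 - l $ 1) * ((u $ 2 - l $ 2) * ((u $ 3 - l $ 3) * (u $ 4 - l $ 4)))"
        unfolding UNIV_4 by (simp add: inner_axis mult_ac)
      finally show ?thesis using le' by (simp add: ennreal_mult)
    qed
    finally show "emeasure (distr ?P borel V) (box l u) = ennreal (\<Prod>b\<in>Basis. (u - l) \<bullet> b)" .
  qed simp
  have "(\<integral>\<^sup>+x. g x \<partial>lborel) = (\<integral>\<^sup>+x. g x \<partial>distr ?P borel V)" by (subst L) simp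
  also have "\<dots> = (\<integral>\<^sup>+z. g (V z) \<partial>?P)" by (rule nn_integral_distr) auto
  also have "\<dots> = (\<integral>\<^sup>+a. \<integral>\<^sup>+z. g (V (a, z)) \<partial>((lborel :: real measure) \<Otimes>\<^sub>M ((lborel :: real measure) \<Otimes>\<^sub>M (lborel :: real measure))) \<partial>lborel)"
    unfolding P lborel_prod by (subst lborel.nn_integral_fst[of _ lborel, symmetric, unfolded lborel_prod]) (auto simp: V_def intro!: borel_measurable_vec4_compose continuous_intros)
  also have "\<dots> = (\<integral>\<^sup>+a. \<integral>\<^sup>+b. \<integral>\<^sup>+z. g (V (a, b, z)) \<partial>((lborel :: real measure) \<Otimes>\<^sub>M (lborel :: real measure)) \<partial>lborel \<partial>lborel)"
    unfolding lborel_prod by (subst lborel.nn_integral_fst[of _ lborel, symmetric, unfolded lborel_prod]) (auto simp: V_def intro!: borel_measurable_vec4_compose continuous_intros)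
  also have "\<dots> = (\<integral>\<^sup>+a. \<integral>\<^sup>+b. \<integral>\<^sup>+c. \<integral>\<^sup>+d. g (V (a, b, c, d)) \<partial>lborel \<partial>lborel \<partial>lborel \<partial>lborel)"
    unfolding lborel_prod by (subst lborel.nn_integral_fst[of _ lborel, symmetric, unfolded lborel_prod]) (auto simp: V_def intro!: borel_measurable_vec4_compose continuous_intros)
  finally show ?thesis by (simp add: V_def)
qed

lemma Holder3_cbrt_const:
  assumes [measurable]: "u \<in> borel_measurable M" "v \<in> borel_measurable M" "w \<in> borel_measurable M"
  shows "(\<integral>\<^sup>+x. cbrt (u x) * cbrt (v x) * cbrt (w x) * k \<partial>M) \<le> cbrt (\<integral>\<^sup>+x. u x \<partial>M) * cbrt (\<integral>\<^sup>+x. v x \<partial>M) * cbrt (\<integral>\<^sup>+x. w x \<partial>M) * k"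
  using mult_right_mono[OF Holder3_cbrt[OF assms], of k] by (subst nn_integral_multc) auto

lemma nn_integral_swap:
  fixes f :: "real \<Rightarrow> real \<Rightarrow> ennreal"
  assumes "case_prod f \<in> borel_measurable (lborel \<Otimes>\<^sub>M lborel)"
  shows "(\<integral>\<^sup>+x. \<integral>\<^sup>+y. f x y \<partial>lborel \<partial>lborel) = (\<integral>\<^sup>+y. \<integral>\<^sup>+x. f x y \<partial>lborel \<partial>lborel)"
  using lborel_pair.Fubini'[OF assms] by simp

text \<open>The Loomis-Whitney inequality in Gagliardo's form. The variables are integrated in the
  order \<open>d\<close>, \<open>c\<close>, \<open>b\<close>, \<open>a\<close>. Each time one factor
  is free of the current variable and is pulled out, and Hoelder's inequality with three exponents 3
  applies to the other three; the rearrangements in between move the free factor to the end.\<close>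

lemma Loomis_Whitney4:
  fixes f1 f2 f3 f4 :: "real^4 \<Rightarrow> ennreal"
  assumes [measurable]: "f1 \<in> borel_measurable borel" "f2 \<in> borel_measurable borel"
    "f3 \<in> borel_measurable borel" "f4 \<in> borel_measurable borel"
  shows "(\<integral>\<^sup>+a. \<integral>\<^sup>+b. \<integral>\<^sup>+c. \<integral>\<^sup>+d. cbrt (\<integral>\<^sup>+s. f1 (vec4 s b c d) \<partial>lborel) * cbrt (\<integral>\<^sup>+s. f2 (vec4 a s c d) \<partial>lborel)
      * cbrt (\<integral>\<^sup>+s. f3 (vec4 a b s d) \<partial>lborel) * cbrt (\<integral>\<^sup>+s. f4 (vec4 a b c s) \<partial>lborel) \<partial>lborel \<partial>lborel \<partial>lborel \<partial>lborel)
    \<le> cbrt (\<integral>\<^sup>+x. f1 x \<partial>lborel) * cbrt (\<integral>\<^sup>+x. f2 x \<partial>lborel) * cbrt (\<integral>\<^sup>+x. f3 x \<partial>lborel) * cbrt (\<integral>\<^sup>+x. f4 x \<partial>lborel)"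
    (is "?L \<le> ?R")
proof -
  let ?A1 = "\<lambda>b c d. \<integral>\<^sup>+s. f1 (vec4 s b c d) \<partial>lborel" and ?A2 = "\<lambda>a c d. \<integral>\<^sup>+s. f2 (vec4 a s c d) \<partial>lborel"
    and ?A3 = "\<lambda>a b d. \<integral>\<^sup>+s. f3 (vec4 a b s d) \<partial>lborel" and ?A4 = "\<lambda>a b c. \<integral>\<^sup>+s. f4 (vec4 a b c s) \<partial>lborel"
  let ?B1 = "\<lambda>b c. \<integral>\<^sup>+d. ?A1 b c d \<partial>lborel" and ?B2 = "\<lambda>a c. \<integral>\<^sup>+d. ?A2 a c d \<partial>lborel" and ?B3 = "\<lambda>a b. \<integral>\<^sup>+d. ?A3 a b d \<partial>lborel"
  let ?C1 = "\<lambda>b. \<integral>\<^sup>+c. ?B1 b c \<partial>lborel" and ?C2 = "\<lambda>a. \<integral>\<^sup>+c. ?B2 a c \<partial>lborel" and ?C4 = "\<lambda>a b. \<integral>\<^sup>+c. ?A4 a b c \<partial>lborel"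
  let ?D1 = "\<integral>\<^sup>+b. ?C1 b \<partial>lborel" and ?D3 = "\<lambda>a. \<integral>\<^sup>+b. ?B3 a b \<partial>lborel" and ?D4 = "\<lambda>a. \<integral>\<^sup>+b. ?C4 a b \<partial>lborel"
  have "?L \<le> (\<integral>\<^sup>+a. \<integral>\<^sup>+b. \<integral>\<^sup>+c. cbrt (?B1 b c) * cbrt (?B2 a c) * cbrt (?B3 a b) * cbrt (?A4 a b c) \<partial>lborel \<partial>lborel \<partial>lborel)"
    by (intro nn_integral_mono Holder3_cbrt_const) measurable
  also have "\<dots> = (\<integral>\<^sup>+a. \<integral>\<^sup>+b. \<integral>\<^sup>+c. cbrt (?B1 b c) * cbrt (?B2 a c) * cbrt (?A4 a b c) * cbrt (?B3 a b) \<partial>lborel \<partial>lborel \<partial>lborel)"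
    by (simp only: mult.assoc mult.commute[of "cbrt (?B3 _ _)"])
  also have "\<dots> \<le> (\<integral>\<^sup>+a. \<integral>\<^sup>+b. cbrt (?C1 b) * cbrt (?C2 a) * cbrt (?C4 a b) * cbrt (?B3 a b) \<partial>lborel \<partial>lborel)"
    by (intro nn_integral_mono Holder3_cbrt_const) measurable
  also have "\<dots> = (\<integral>\<^sup>+a. \<integral>\<^sup>+b. cbrt (?C1 b) * cbrt (?B3 a b) * cbrt (?C4 a b) * cbrt (?C2 a) \<partial>lborel \<partial>lborel)"
    by (intro nn_integral_cong) (simp only: mult_ac)
  also have "\<dots> \<le> (\<integral>\<^sup>+a. cbrt ?D1 * cbrt (?D3 a) * cbrt (?D4 a) * cbrt (?C2 a) \<partial>lborel)"
    by (intro nn_integral_mono Holder3_cbrt_const) measurable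
  also have "\<dots> = (\<integral>\<^sup>+a. cbrt (?C2 a) * cbrt (?D3 a) * cbrt (?D4 a) * cbrt ?D1 \<partial>lborel)"
    by (intro nn_integral_cong) (simp only: mult_ac)
  also have "\<dots> \<le> cbrt (\<integral>\<^sup>+a. ?C2 a \<partial>lborel) * cbrt (\<integral>\<^sup>+a. ?D3 a \<partial>lborel) * cbrt (\<integral>\<^sup>+a. ?D4 a \<partial>lborel) * cbrt ?D1"
    by (intro Holder3_cbrt_const) measurable
  also have "?D1 = (\<integral>\<^sup>+x. f1 x \<partial>lborel)"
  proof -
    have "?D1 = (\<integral>\<^sup>+b. \<integral>\<^sup>+c. \<integral>\<^sup>+s. \<integral>\<^sup>+d. f1 (vec4 s b c d) \<partial>lborel \<partial>lborel \<partial>lborel \<partial>lborel)"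
      by (intro nn_integral_cong nn_integral_swap) measurable
    also have "\<dots> = (\<integral>\<^sup>+b. \<integral>\<^sup>+s. \<integral>\<^sup>+c. \<integral>\<^sup>+d. f1 (vec4 s b c d) \<partial>lborel \<partial>lborel \<partial>lborel \<partial>lborel)"
      by (intro nn_integral_cong nn_integral_swap) measurable
    also have "\<dots> = (\<integral>\<^sup>+s. \<integral>\<^sup>+b. \<integral>\<^sup>+c. \<integral>\<^sup>+d. f1 (vec4 s b c d) \<partial>lborel \<partial>lborel \<partial>lborel \<partial>lborel)"
      by (intro nn_integral_swap) measurable
    finally show ?thesis by (subst nn_integral_vec4) simp_all
  qed
  also have "(\<integral>\<^sup>+a. ?C2 a \<partial>lborel) = (\<integral>\<^sup>+x. f2 x \<partial>lborel)"
  proof -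
    have "(\<integral>\<^sup>+a. ?C2 a \<partial>lborel) = (\<integral>\<^sup>+a. \<integral>\<^sup>+c. \<integral>\<^sup>+s. \<integral>\<^sup>+d. f2 (vec4 a s c d) \<partial>lborel \<partial>lborel \<partial>lborel \<partial>lborel)"
      by (intro nn_integral_cong nn_integral_swap) measurable
    also have "\<dots> = (\<integral>\<^sup>+a. \<integral>\<^sup>+s. \<integral>\<^sup>+c. \<integral>\<^sup>+d. f2 (vec4 a s c d) \<partial>lborel \<partial>lborel \<partial>lborel \<partial>lborel)"
      by (intro nn_integral_cong nn_integral_swap) measurable
    finally show ?thesis by (subst nn_integral_vec4) simp_all
  qed
  also have "(\<integral>\<^sup>+a. ?D3 a \<partial>lborel) = (\<integral>\<^sup>+x. f3 x \<partial>lborel)"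
  proof -
    have "(\<integral>\<^sup>+a. ?D3 a \<partial>lborel) = (\<integral>\<^sup>+a. \<integral>\<^sup>+b. \<integral>\<^sup>+s. \<integral>\<^sup>+d. f3 (vec4 a b s d) \<partial>lborel \<partial>lborel \<partial>lborel \<partial>lborel)"
      by (intro nn_integral_cong nn_integral_swap) measurable
    then show ?thesis by (subst nn_integral_vec4) simp_all
  qed
  also have "(\<integral>\<^sup>+a. ?D4 a \<partial>lborel) = (\<integral>\<^sup>+x. f4 x \<partial>lborel)"
    by (subst nn_integral_vec4[of f4]) simp_all
  finally show ?thesis by (simp only: mult_ac)
qed

text \<open>The one-dimensional bound for \<open>g^3\<close> along the line through \<open>y\<close>
  in direction \<open>i\<close>, parametrised by its own coordinate. The power is 3 because the four
  directions contribute four cube roots of \<open>|g|^3\<close>, whose product is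
  \<open>g^4\<close>.\<close>

lemma test_cube_line_bound:
  assumes g: "test g" and x: "\<And>s. y + s *\<^sub>R axis i 1 = w s" and i: "\<And>s. w s $ i = s"
  shows "ennreal (2 * \<bar>g (w r)\<bar> ^ 3) \<le> (\<integral>\<^sup>+s. ennreal \<bar>3 * (g (w s))\<^sup>2 * dd (axis (i::4) 1) g (w s)\<bar> \<partial>lborel)"
proof -
  obtain R where R: "\<And>x a. norm x > R \<Longrightarrow> norm a \<le> 1 \<Longrightarrow> g (x + a) = 0" using test_compact_enlarge[OF g] by blast
  have "((\<lambda>s. g (w s) ^ 3) has_real_derivative 3 * (g (w s))\<^sup>2 * dd (axis i 1) g (w s)) (at s)" for s
    using DERIV_power[OF smooth_has_derivative[OF test_smooth[OF g] axis_in_Basis4, of y i s], of 3]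
    by (simp add: x mult_ac)
  moreover have "continuous_on UNIV (\<lambda>s. 3 * (g (w s))\<^sup>2 * dd (axis i 1) g (w s))"
    unfolding x[symmetric]
    by (intro continuous_intros continuous_on_compose2[OF test_continuous[OF g]]
        continuous_on_compose2[OF test_continuous[OF test_dd[OF g axis_in_Basis4]]]) auto
  moreover have "g (w s) ^ 3 = 0" if "\<bar>s\<bar> > R" for s
    using R[of "w s" 0] that component_le_norm_cart[of "w s" i] i[of s] by simp
  ultimately have "ennreal (2 * \<bar>g (w r) ^ 3\<bar>) \<le> (\<integral>\<^sup>+s. ennreal \<bar>3 * (g (w s))\<^sup>2 * dd (axis i 1) g (w s)\<bar> \<partial>lborel)"
    by (rule nn_integral_derivative_ge_twice)
  then show ?thesis by (simp add: power_abs)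
qed

text \<open>The Gagliardo-Nirenberg argument. The line bounds and \<open>Loomis_Whitney4\<close>
  bound \<open>N\<close>, the integral of \<open>g^4\<close>, by the cube roots of the integrals
  \<open>J i\<close> of \<open>3 g^2 |dd g|\<close>. Cauchy-Schwarz estimates \<open>J i\<close> by
  \<open>3 sqrt N\<close> times the norm of the derivative, so that a factor \<open>N^2\<close>
  cancels and \<open>N\<close> is bounded by the four gradient norms.\<close>

lemma Sobolev_test:
  assumes g: "test g"
  shows "Lp_norm 4 g \<le> sqrt (\<Sum>i\<in>UNIV. (Lp_norm 2 (dd (axis i 1) g))\<^sup>2)"
proof -
  have gm[measurable]: "g \<in> borel_measurable borel" by (rule test_measurable[OF g])
  have tdd: "test (dd (axis i 1) g)" for i :: 4 by (rule test_dd[OF g axis_in_Basis4])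
  have dm[measurable]: "dd (axis i 1) g \<in> borel_measurable borel" for i :: 4 by (rule test_measurable[OF tdd])
  define F where "F i x = \<bar>3 * (g x)\<^sup>2 * dd (axis i 1) g x\<bar>" for i :: 4 and x
  define J where "J i = (LINT x|lborel. F i x)" for i
  define N where "N = (LINT x|lborel. g x ^ 4)"
  have i4: "in_Lp 4 g" and g2: "in_Lp 2 (\<lambda>x. g x ^ 2)" and d2: "\<And>i::4. in_Lp 2 (dd (axis i 1) g)"
  proof -
    show "in_Lp 4 g" "\<And>i::4. in_Lp 2 (dd (axis i 1) g)" using g tdd by (auto intro!: test_in_Lp)
    have "test (\<lambda>x. g x * g x)" by (rule test_mult_left[OF g test_smooth[OF g]])
    then show "in_Lp 2 (\<lambda>x. g x ^ 2)" by (auto intro!: test_in_Lp simp: power2_eq_square)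
  qed
  have p4: "norm (g x) powr 4 = g x ^ 4" for x
    by (simp add: powr_numeral power_even_abs)
  have iN: "integrable lborel (\<lambda>x. g x ^ 4)" and N: "Lp_norm 4 g powr 4 = N" "0 \<le> N"
    using in_Lp_integrable[OF i4] Lp_norm_powr[of 4 g] unfolding p4 N_def by (auto simp: Bochner_Integration.integral_nonneg)
  have n2: "Lp_norm 2 (\<lambda>x. g x ^ 2) = sqrt N"
  proof -
    have "norm (g x ^ 2) powr 2 = g x ^ 4" for x
      by (cases "g x = 0") (auto simp: powr_numeral power_mult[symmetric])
    then show ?thesis unfolding Lp_norm_def N_def by (simp add: powr_half_sqrt Bochner_Integration.integral_nonneg)
  qed
  have Fi: "integrable lborel (F i)" and Jle: "J i \<le> 3 * (sqrt N * Lp_norm 2 (dd (axis i 1) g))" for i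
  proof -
    have H: "integrable lborel (\<lambda>x. norm (g x ^ 2) * norm (dd (axis i 1) g x))"
      "(LINT x|lborel. norm (g x ^ 2) * norm (dd (axis i 1) g x)) \<le> sqrt N * Lp_norm 2 (dd (axis i 1) g)"
      using Holder_norm[OF _ _ _ g2 d2, of i] n2 by auto
    have e: "F i = (\<lambda>x. 3 * (norm (g x ^ 2) * norm (dd (axis i 1) g x)))" by (auto simp: F_def abs_mult)
    show "integrable lborel (F i)" unfolding e using H(1) by simp
    show "J i \<le> 3 * (sqrt N * Lp_norm 2 (dd (axis i 1) g))" unfolding J_def e using H(2) by simp
  qed
  have J0: "0 \<le> J i" for i unfolding J_def F_def by (intro Bochner_Integration.integral_nonneg) auto
  have nnF: "(\<integral>\<^sup>+x. ennreal (F i x) \<partial>lborel) = ennreal (J i)" for i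
    unfolding J_def by (rule nn_integral_eq_integral[OF Fi]) (auto simp: F_def)
  have FM[measurable]: "(\<lambda>x. ennreal (F i x)) \<in> borel_measurable borel" for i unfolding F_def by measurable
  \<comment> \<open>Four directions, each contributing the cube root of the 2 in
    \<open>2 * |g|^3\<close>; its cube is 16.\<close>
  let ?c = "root 3 2 ^ 4 :: real"
  have "ennreal (?c * N) = (\<integral>\<^sup>+x. ennreal (?c * g x ^ 4) \<partial>lborel)"
    using nn_integral_eq_integral[of lborel "\<lambda>x. ?c * g x ^ 4"] iN by (simp add: N_def)
  also have "\<dots> = (\<integral>\<^sup>+x. cbrt (ennreal (2 * \<bar>g x\<bar> ^ 3)) ^ 4 \<partial>lborel)"
  proof (intro nn_integral_cong)
    fix x
    have "root 3 (2 * \<bar>g x\<bar> ^ 3) = root 3 2 * \<bar>g x\<bar>" by (simp add: real_root_mult real_root_power_cancel)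
    then show "ennreal (?c * g x ^ 4) = cbrt (ennreal (2 * \<bar>g x\<bar> ^ 3)) ^ 4"
      by (simp add: cbrt_ennreal ennreal_power power_mult_distrib)
  qed
  also have "\<dots> = (\<integral>\<^sup>+a. \<integral>\<^sup>+b. \<integral>\<^sup>+c. \<integral>\<^sup>+d. cbrt (ennreal (2 * \<bar>g (vec4 a b c d)\<bar> ^ 3)) ^ 4 \<partial>lborel \<partial>lborel \<partial>lborel \<partial>lborel)"
    by (rule nn_integral_vec4) measurable
  also have "\<dots> \<le> (\<integral>\<^sup>+a. \<integral>\<^sup>+b. \<integral>\<^sup>+c. \<integral>\<^sup>+d. cbrt (\<integral>\<^sup>+s. ennreal (F 1 (vec4 s b c d)) \<partial>lborel) * cbrt (\<integral>\<^sup>+s. ennreal (F 2 (vec4 a s c d)) \<partial>lborel)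
      * cbrt (\<integral>\<^sup>+s. ennreal (F 3 (vec4 a b s d)) \<partial>lborel) * cbrt (\<integral>\<^sup>+s. ennreal (F 4 (vec4 a b c s)) \<partial>lborel) \<partial>lborel \<partial>lborel \<partial>lborel \<partial>lborel)"
  proof (intro nn_integral_mono)
    fix a b c d
    let ?z = "ennreal (2 * \<bar>g (vec4 a b c d)\<bar> ^ 3)"
    have 1: "?z \<le> (\<integral>\<^sup>+s. ennreal (F 1 (vec4 s b c d)) \<partial>lborel)"
      unfolding F_def by (rule test_cube_line_bound[OF g, of "vec4 0 b c d"]) (auto simp: vec4_def axis_def algebra_simps)
    have 2: "?z \<le> (\<integral>\<^sup>+s. ennreal (F 2 (vec4 a s c d)) \<partial>lborel)"
      unfolding F_def by (rule test_cube_line_bound[OF g, of "vec4 a 0 c d"]) (auto simp: vec4_def axis_def algebra_simps)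
    have 3: "?z \<le> (\<integral>\<^sup>+s. ennreal (F 3 (vec4 a b s d)) \<partial>lborel)"
      unfolding F_def by (rule test_cube_line_bound[OF g, of "vec4 a b 0 d"]) (auto simp: vec4_def axis_def algebra_simps)
    have 4: "?z \<le> (\<integral>\<^sup>+s. ennreal (F 4 (vec4 a b c s)) \<partial>lborel)"
      unfolding F_def by (rule test_cube_line_bound[OF g, of "vec4 a b c 0"]) (auto simp: vec4_def axis_def algebra_simps)
    have "cbrt ?z ^ 4 = cbrt ?z * cbrt ?z * cbrt ?z * cbrt ?z" by (simp add: numeral_eq_Suc mult_ac)
    also have "\<dots> \<le> cbrt (\<integral>\<^sup>+s. ennreal (F 1 (vec4 s b c d)) \<partial>lborel) * cbrt (\<integral>\<^sup>+s. ennreal (F 2 (vec4 a s c d)) \<partial>lborel)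
      * cbrt (\<integral>\<^sup>+s. ennreal (F 3 (vec4 a b s d)) \<partial>lborel) * cbrt (\<integral>\<^sup>+s. ennreal (F 4 (vec4 a b c s)) \<partial>lborel)"
      by (intro mult_mono cbrt_mono 1 2 3 4) auto
    finally show "cbrt ?z ^ 4 \<le> \<dots>" .
  qed
  also have "\<dots> \<le> cbrt (\<integral>\<^sup>+x. ennreal (F 1 x) \<partial>lborel) * cbrt (\<integral>\<^sup>+x. ennreal (F 2 x) \<partial>lborel)
     * cbrt (\<integral>\<^sup>+x. ennreal (F 3 x) \<partial>lborel) * cbrt (\<integral>\<^sup>+x. ennreal (F 4 x) \<partial>lborel)"
    by (rule Loomis_Whitney4) measurable
  also have "\<dots> = ennreal (root 3 (J 1) * root 3 (J 2) * root 3 (J 3) * root 3 (J 4))"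
    unfolding nnF using J0 by (simp add: cbrt_ennreal ennreal_mult)
  finally have "?c * N \<le> root 3 (J 1) * root 3 (J 2) * root 3 (J 3) * root 3 (J 4)"
    using J0 by (subst (asm) ennreal_le_iff) auto
  then have "(?c * N) ^ 3 \<le> (root 3 (J 1) * root 3 (J 2) * root 3 (J 3) * root 3 (J 4)) ^ 3"
    using N by (intro power_mono) auto
  also have "\<dots> = J 1 * J 2 * J 3 * J 4" using J0 by (simp add: power_mult_distrib)
  also have "(?c * N) ^ 3 = 16 * N ^ 3"
  proof -
    have "?c ^ 3 = (root 3 2 ^ 3) ^ 4" by (metis power_mult mult.commute)
    also have "root 3 2 ^ 3 = (2::real)" by simp
    finally have "?c ^ 3 = 16" by simp
    then show ?thesis by (simp only: power_mult_distrib)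
  qed
  finally have le: "16 * N ^ 3 \<le> J 1 * J 2 * J 3 * J 4" .
  define d where "d i = Lp_norm 2 (dd (axis i 1) g)" for i :: 4
  have d0: "0 \<le> d i" for i by (simp add: d_def Lp_norm_nonneg)
  have "J 1 * J 2 * J 3 * J 4 \<le> (3 * (sqrt N * d 1)) * (3 * (sqrt N * d 2)) * (3 * (sqrt N * d 3)) * (3 * (sqrt N * d 4))"
    using J0 Jle d0 N unfolding d_def[symmetric] by (intro mult_mono) auto
  also have "\<dots> = 81 * (sqrt N * sqrt N) * (sqrt N * sqrt N) * (d 1 * d 2 * (d 3 * d 4))" by (simp add: mult_ac)
  also have "\<dots> = 81 * N\<^sup>2 * (d 1 * d 2 * (d 3 * d 4))" using N by (simp add: power2_eq_square)
  finally have "16 * N ^ 3 \<le> 81 * N\<^sup>2 * (d 1 * d 2 * (d 3 * d 4))" using le by linarith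
  then have "N\<^sup>2 * (16 * N) \<le> N\<^sup>2 * (81 * (d 1 * d 2 * (d 3 * d 4)))" by (simp add: power2_eq_square power3_eq_cube mult_ac)
  then have N1: "16 * N \<le> 81 * (d 1 * d 2 * (d 3 * d 4))"
    using d0 by (cases "N = 0") (auto simp: mult_le_cancel_left)
  define S where "S = (\<Sum>i\<in>UNIV. (d i)\<^sup>2)"
  have S0: "0 \<le> S" unfolding S_def by (intro sum_nonneg) auto
  \<comment> \<open>The arithmetic-geometric mean inequality for two pairs and then for the two pair
    sums. With \<open>16 N \<le> 81 d 1 d 2 d 3 d 4\<close> this gives
    \<open>N \<le> 81/256 S^2\<close>, hence the Sobolev inequality with constant one.\<close>
  have "d 1 * d 2 * (d 3 * d 4) \<le> (((d 1)\<^sup>2 + (d 2)\<^sup>2) / 2) * (((d 3)\<^sup>2 + (d 4)\<^sup>2) / 2)"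
    using d0 sum_squares_bound[of "d 1" "d 2"] sum_squares_bound[of "d 3" "d 4"] by (intro mult_mono) auto
  also have "\<dots> \<le> (S / 4)\<^sup>2"
  proof -
    have "0 \<le> (((d 1)\<^sup>2 + (d 2)\<^sup>2) - ((d 3)\<^sup>2 + (d 4)\<^sup>2))\<^sup>2" by simp
    then show ?thesis unfolding S_def sum_4 by (simp add: power2_eq_square field_simps)
  qed
  finally have "N \<le> S\<^sup>2" using N1 S0 by (simp add: power2_eq_square) (smt (verit) mult_nonneg_nonneg)
  also have "S\<^sup>2 = sqrt S powr 4" using S0 by (simp add: powr_numeral power4_eq_xxxx power2_eq_square)
  finally have "Lp_norm 4 g powr 4 \<le> sqrt S powr 4" using N by simp
  then show ?thesis unfolding S_def d_def using Lp_norm_nonneg[of 4 g] S0[unfolded S_def d_def]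
    by (metis powr_less_mono2 not_le real_sqrt_ge_0_iff zero_less_numeral)
qed

section \<open>Weak derivatives and approximation by test functions\<close>

lemma Lp_reflect:
  fixes f :: "real^4 \<Rightarrow> real"
  assumes f: "in_Lp p f"
  shows "in_Lp p (\<lambda>y. f (x - y))" "Lp_norm p (\<lambda>y. f (x - y)) = Lp_norm p f"
proof -
  note [measurable] = in_Lp_measurable[OF f]
  have L: "lborel = distr lborel borel (\<lambda>y::real^4. x - y)"
    using lborel_affine[of "-1" x] by (simp add: density_1)
  have m: "(\<lambda>y. norm (f y) powr p) \<in> borel_measurable borel" by measurable
  have i: "integrable lborel (\<lambda>y. norm (f y) powr p) \<longleftrightarrow> integrable lborel (\<lambda>y. norm (f (x - y)) powr p)"
    by (subst L, subst integrable_distr_eq) auto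
  have e: "(LINT y|lborel. norm (f y) powr p) = (LINT y|lborel. norm (f (x - y)) powr p)"
    by (subst L, subst integral_distr) auto
  show "in_Lp p (\<lambda>y. f (x - y))" using in_Lp_integrable[OF f] i by (simp add: in_Lp_def)
  show "Lp_norm p (\<lambda>y. f (x - y)) = Lp_norm p f" unfolding Lp_norm_def e ..
qed

lemma integral_reflect:
  fixes f :: "real^4 \<Rightarrow> real"
  assumes [measurable]: "f \<in> borel_measurable borel"
  shows "(LINT y|lborel. f (x - y)) = (LINT y|lborel. f y)"
proof -
  have L: "lborel = distr lborel borel (\<lambda>y::real^4. x - y)"
    using lborel_affine[of "-1" x] by (simp add: density_1)
  show ?thesis by (subst (2) L, subst integral_distr) auto
qed

definition wderiv :: "(real^4 \<Rightarrow> real) \<Rightarrow> 4 \<Rightarrow> (real^4 \<Rightarrow> real) \<Rightarrow> bool" where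
  "wderiv g i G \<longleftrightarrow> (\<forall>\<psi>. test \<psi> \<longrightarrow>
     (LINT x|lborel. \<psi> x * G x) = - (LINT x|lborel. dd (axis i 1) \<psi> x * g x))"

text \<open>The real counterpart of \<open>Hdot1\<close>, with the weak gradient as an explicit
  argument, so that limits and differences can be taken of gradients without a choice
  operator.\<close>

definition H1 :: "(real^4 \<Rightarrow> real) \<Rightarrow> (4 \<Rightarrow> real^4 \<Rightarrow> real) \<Rightarrow> bool" where
  "H1 v G \<longleftrightarrow> in_Lp 4 v \<and> (\<forall>i. in_Lp 2 (G i) \<and> wderiv v i (G i))"

definition gnorm :: "(4 \<Rightarrow> real^4 \<Rightarrow> real) \<Rightarrow> real" where
  "gnorm G = sqrt (\<Sum>i\<in>UNIV. (Lp_norm 2 (G i))\<^sup>2)"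

lemma integrable_mult_test:
  fixes f :: "real^4 \<Rightarrow> real"
  assumes p: "p > 1" and f: "in_Lp p f" and g: "test g"
  shows "integrable lborel (\<lambda>x. f x * g x)" "integrable lborel (\<lambda>x. g x * f x)"
proof -
  define q where "q = p / (p - 1)"
  have q: "q > 1" "1 / p + 1 / q = 1" using p by (auto simp: q_def field_simps)
  show "integrable lborel (\<lambda>x. f x * g x)"
    by (rule Holder(1)[OF p q f test_in_Lp[OF g]]) (use q in auto)
  then show "integrable lborel (\<lambda>x. g x * f x)" by (simp add: mult.commute)
qed

lemma wderiv_diff:
  assumes "p > 1" "in_Lp p f" "in_Lp p g" "r > 1" "in_Lp r F" "in_Lp r G" "wderiv f i F" "wderiv g i G"
  shows "wderiv (\<lambda>x. f x - g x) i (\<lambda>x. F x - G x)"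
  unfolding wderiv_def
proof (intro allI impI)
  fix \<psi> :: "real^4 \<Rightarrow> real" assume \<psi>: "test \<psi>"
  note t = test_dd[OF \<psi> axis_in_Basis4, of i]
  show "(LINT x|lborel. \<psi> x * (F x - G x)) = - (LINT x|lborel. dd (axis i 1) \<psi> x * (f x - g x))"
    using assms(7,8) \<psi> integrable_mult_test(2)[OF assms(1,2) t] integrable_mult_test(2)[OF assms(1,3) t]
      integrable_mult_test(2)[OF assms(4,5) \<psi>] integrable_mult_test(2)[OF assms(4,6) \<psi>]
    by (simp add: right_diff_distrib wderiv_def)
qed

lemma wderiv_cmult: "wderiv f i F \<Longrightarrow> wderiv (\<lambda>x. c * f x) i (\<lambda>x. c * F x)"
  by (simp add: wderiv_def mult.left_commute)

lemma H1_diff: "H1 f F \<Longrightarrow> H1 g G \<Longrightarrow> H1 (\<lambda>x. f x - g x) (\<lambda>i x. F i x - G i x)"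
  unfolding H1_def by (auto intro!: in_Lp_diff wderiv_diff[of 4 _ _ 2])

lemma H1_cmult: "H1 f F \<Longrightarrow> H1 (\<lambda>x. c * f x) (\<lambda>i x. c * F i x)"
  unfolding H1_def by (auto intro: in_Lp_cmult wderiv_cmult)

lemma gnorm_nonneg: "0 \<le> gnorm G"
  unfolding gnorm_def by (simp add: sum_nonneg)

lemma gnorm_sq: "(gnorm G)\<^sup>2 = (\<Sum>i\<in>UNIV. (Lp_norm 2 (G i))\<^sup>2)"
  unfolding gnorm_def by (simp add: sum_nonneg)

lemma Lp_norm_le_gnorm: "Lp_norm 2 (G i) \<le> gnorm G"
  unfolding gnorm_def by (rule real_le_rsqrt) (rule member_le_sum, auto)

lemma gnorm_triangle:
  assumes "\<And>i. in_Lp 2 (F i)" "\<And>i. in_Lp 2 (G i)"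
  shows "gnorm (\<lambda>i x. F i x + G i x) \<le> gnorm F + gnorm G"
proof -
  have "gnorm (\<lambda>i x. F i x + G i x) \<le> sqrt (\<Sum>i\<in>UNIV. (Lp_norm 2 (F i) + Lp_norm 2 (G i))\<^sup>2)"
    unfolding gnorm_def using Minkowski[OF _ assms] Lp_norm_nonneg
    by (intro real_sqrt_le_mono sum_mono power_mono) auto
  also have "\<dots> \<le> gnorm F + gnorm G"
    using L2_set_triangle_ineq[of "\<lambda>i. Lp_norm 2 (F i)" "\<lambda>i. Lp_norm 2 (G i)" UNIV] by (simp add: gnorm_def L2_set_def)
  finally show ?thesis .
qed

section \<open>Mollification\<close>

definition conv4 :: "(real^4 \<Rightarrow> real) \<Rightarrow> (real^4 \<Rightarrow> real) \<Rightarrow> real^4 \<Rightarrow> real" where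
  "conv4 w k x = (LINT y|lborel. w y * k (x - y))"

lemma test_reflect: "test k \<Longrightarrow> test (\<lambda>y. k (x - y))"
  using test_affine[of k "-1" x] by simp

text \<open>All differences fall on the kernel: by Hoelder's inequality the error is at most the
  norm of \<open>w\<close> times the dual norm of the difference quotient error of \<open>k\<close>,
  which tends to zero.\<close>

lemma conv4_has_derivative:
  assumes p: "p > 1" and w: "in_Lp p w" and k: "test k" and v: "v \<in> Basis"
  shows "((\<lambda>s. conv4 w k (x + s *\<^sub>R v)) has_real_derivative conv4 w (dd v k) x) (at 0)"
proof -
  define q where "q = p / (p - 1)"
  have q: "q > 1" "1 / p + 1 / q = 1" using p by (auto simp: q_def field_simps)
  have q0: "q > 0" using q by simp
  have I: "integrable lborel (\<lambda>y. w y * u (z - y))" if "test u" for u z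
    by (rule integrable_mult_test(1)[OF p w test_reflect[OF that]])
  have "((\<lambda>h. (conv4 w k (x + h *\<^sub>R v) - conv4 w k x) / h - conv4 w (dd v k) x) \<longlongrightarrow> 0) (at 0)"
  proof (rule Lim_null_comparison)
    let ?u = "\<lambda>h x. (k (x + h *\<^sub>R v) - k x) / h - dd v k x"
    show "((\<lambda>h. Lp_norm p w * Lp_norm q (?u h)) \<longlongrightarrow> 0) (at 0)"
      using tendsto_mult_left[OF test_difference_quotient_tendsto[OF q0 k v], of "Lp_norm p w"] by simp
    show "\<forall>\<^sub>F h in at 0. norm ((conv4 w k (x + h *\<^sub>R v) - conv4 w k x) / h - conv4 w (dd v k) x) \<le> Lp_norm p w * Lp_norm q (?u h)"
    proof (rule always_eventually, rule allI)
      fix h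
      have ta: "test (\<lambda>x. k (x + h *\<^sub>R v))" using test_affine[OF k, of 1 "h *\<^sub>R v"] by simp
      have tu: "test (?u h)"
        using test_diff[OF test_cmult[OF test_diff[OF ta k], of "1/h"] test_dd[OF k v]] by simp
      have e: "(conv4 w k (x + h *\<^sub>R v) - conv4 w k x) / h - conv4 w (dd v k) x = (LINT y|lborel. w y * ?u h (x - y))"
      proof -
        have "(LINT y|lborel. w y * ?u h (x - y)) = (LINT y|lborel. (w y * k ((x + h *\<^sub>R v) - y) - w y * k (x - y)) / h - w y * dd v k (x - y))"
          by (rule Bochner_Integration.integral_cong) (auto simp: algebra_simps diff_divide_distrib)
        also have "\<dots> = (conv4 w k (x + h *\<^sub>R v) - conv4 w k x) / h - conv4 w (dd v k) x"
          unfolding conv4_def using I[OF k] I[OF test_dd[OF k v]] by simp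
        finally show ?thesis by simp
      qed
      have "\<bar>LINT y|lborel. w y * ?u h (x - y)\<bar> \<le> Lp_norm p w * Lp_norm q (\<lambda>y. ?u h (x - y))"
        by (rule Holder(2)[OF p q w Lp_reflect(1)[OF test_in_Lp[OF tu q0]]])
      then show "norm ((conv4 w k (x + h *\<^sub>R v) - conv4 w k x) / h - conv4 w (dd v k) x) \<le> Lp_norm p w * Lp_norm q (?u h)"
        unfolding e Lp_reflect(2)[OF test_in_Lp[OF tu q0]] real_norm_def .
    qed
  qed
  then show ?thesis by (simp add: has_field_derivative_iff LIM_zero_iff)
qed

lemma conv4_continuous:
  assumes p: "p > 1" and w: "in_Lp p w" and k: "test k"
  shows "continuous_on UNIV (conv4 w k)"
proof -
  define q where "q = p / (p - 1)"
  have q: "q > 1" "1 / p + 1 / q = 1" using p by (auto simp: q_def field_simps)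
  have q0: "q > 0" using q by simp
  have I: "integrable lborel (\<lambda>y. w y * u (z - y))" if "test u" for u z
    by (rule integrable_mult_test(1)[OF p w test_reflect[OF that]])
  have "((\<lambda>a. conv4 w k (x + a)) \<longlongrightarrow> conv4 w k x) (at 0)" for x
  proof -
    have "((\<lambda>a. conv4 w k (x + a) - conv4 w k x) \<longlongrightarrow> 0) (at 0)"
    proof (rule Lim_null_comparison)
      show "((\<lambda>a. Lp_norm p w * Lp_norm q (\<lambda>x. k (x + a) - k x)) \<longlongrightarrow> 0) (at 0)"
        using tendsto_mult_left[OF test_translate_tendsto[OF q0 k], of "Lp_norm p w"] by simp
      show "\<forall>\<^sub>F a in at 0. norm (conv4 w k (x + a) - conv4 w k x) \<le> Lp_norm p w * Lp_norm q (\<lambda>x. k (x + a) - k x)"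
      proof (rule always_eventually, rule allI)
        fix a
        have tu: "test (\<lambda>x. k (x + a) - k x)" using test_diff[OF test_affine[OF k, of 1 a] k] by simp
        have e: "conv4 w k (x + a) - conv4 w k x = (LINT y|lborel. w y * (k ((x - y) + a) - k (x - y)))"
        proof -
          have "(LINT y|lborel. w y * (k ((x - y) + a) - k (x - y))) = (LINT y|lborel. w y * k ((x + a) - y) - w y * k (x - y))"
            by (rule Bochner_Integration.integral_cong) (auto simp: algebra_simps)
          then show ?thesis unfolding conv4_def using I[OF k] by simp
        qed
        have "\<bar>LINT y|lborel. w y * (k ((x - y) + a) - k (x - y))\<bar> \<le> Lp_norm p w * Lp_norm q (\<lambda>y. k ((x - y) + a) - k (x - y))"
          by (rule Holder(2)[OF p q w Lp_reflect(1)[OF test_in_Lp[OF tu q0]]])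
        then show "norm (conv4 w k (x + a) - conv4 w k x) \<le> Lp_norm p w * Lp_norm q (\<lambda>x. k (x + a) - k x)"
          unfolding e Lp_reflect(2)[OF test_in_Lp[OF tu q0]] real_norm_def .
      qed
    qed
    then show ?thesis by (simp add: LIM_zero_iff)
  qed
  then have "isCont (conv4 w k) x" for x by (simp add: isCont_iff)
  then show ?thesis by (simp add: continuous_at_imp_continuous_on)
qed

lemma conv4_test:
  assumes p: "p > 1" and w: "in_Lp p w" and w0: "\<And>x. norm x > R \<Longrightarrow> w x = 0" and k: "test k"
  shows "test (conv4 w k)" and "v \<in> Basis \<Longrightarrow> dd v (conv4 w k) = conv4 w (dd v k)"
proof -
  have dd: "dd v (conv4 w k) = conv4 w (dd v k)" if "test k" "v \<in> Basis" for v k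
    by (intro ext dd_eqI conv4_has_derivative[OF p w that])
  show "v \<in> Basis \<Longrightarrow> dd v (conv4 w k) = conv4 w (dd v k)" by (rule dd[OF k])
  \<comment> \<open>For fixed \<open>w\<close> the convolutions with all test kernels form a family
    closed under derivatives, as a derivative falls on the kernel.\<close>
  have sm: "smooth (conv4 w k)" if "test k" for k using that
  proof (coinduction arbitrary: k rule: smooth.coinduct)
    case (smooth k)
    then show ?case
      using conv4_continuous[OF p w smooth] real_differentiableI[OF conv4_has_derivative[OF p w smooth]] dd[OF smooth] test_dd[OF smooth]
      by (intro exI[of _ "conv4 w k"]) blast
  qed
  obtain Q where Q: "\<And>x a. norm x > Q \<Longrightarrow> norm a \<le> 1 \<Longrightarrow> k (x + a) = 0" using test_compact_enlarge[OF k] by blast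
  have out: "conv4 w k x = 0" if "x \<notin> cball 0 (R + Q)" for x
  proof -
    have z: "w y * k (x - y) = 0" for y
    proof (cases "norm y > R")
      case False
      have "norm (x - y) > Q" using that False norm_triangle_ineq2[of x y] by (simp add: dist_norm)
      then show ?thesis using Q[of "x - y" 0] by simp
    qed (simp add: w0)
    show ?thesis unfolding conv4_def z by simp
  qed
  show "test (conv4 w k)" unfolding test_def using sm[OF k] out compact_cball by blast
qed

text \<open>The test function in the definition of \<open>wderiv\<close> is \<open>k (x - y)\<close>
  as a function of \<open>y\<close>; the sign that the reflection produces cancels the sign of the
  integration by parts.\<close>

lemma wderiv_conv4:
  assumes G: "wderiv w i G" and k: "test k"
  shows "conv4 w (dd (axis i 1) k) = conv4 G k"
proof
  fix x
  have "dd (axis i 1) (\<lambda>y. k (x - y)) y = - dd (axis i 1) k (x - y)" for y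
    using dd_affine[OF test_smooth[OF k] axis_in_Basis4, of i "-1" x y] by simp
  moreover have "(LINT y|lborel. k (x - y) * G y) = - (LINT y|lborel. dd (axis i 1) (\<lambda>y. k (x - y)) y * w y)"
    using G test_reflect[OF k, of x] unfolding wderiv_def by blast
  ultimately show "conv4 w (dd (axis i 1) k) x = conv4 G k x"
    unfolding conv4_def by (simp add: mult.commute)
qed

text \<open>Minkowski's inequality for integrals, obtained by duality. Since \<open>k\<close> has
  integral 1, the error is the average with weight \<open>k z\<close> of the translation errors
  \<open>g (x - z) - g x\<close>. Tested against \<open>\<rho>\<close>, Fubini's theorem allows each
  translation to be estimated separately.\<close>

lemma conv4_error:
  assumes p: "p > 1" and g: "in_Lp p g" and g0: "\<And>x. norm x > R \<Longrightarrow> g x = 0" and k: "test k"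
    and kpos: "\<And>x. 0 \<le> k x" and k1: "(LINT x|lborel. k x) = 1"
    and s: "\<And>z. k z \<noteq> 0 \<Longrightarrow> Lp_norm p (\<lambda>x. g (x - z) - g x) \<le> s" and s0: "0 \<le> s"
  shows "Lp_norm p (\<lambda>x. conv4 g k x - g x) \<le> s"
proof -
  define q where "q = p / (p - 1)"
  have q: "q > 1" "1 / p + 1 / q = 1" using p by (auto simp: q_def field_simps)
  have p0: "p > 0" and q0: "q > 0" using p q by auto
  note [measurable] = in_Lp_measurable[OF g] test_measurable[OF k]
  have ki: "integrable lborel k" using k1 by (metis not_integrable_integral_eq zero_neq_one)
  have ci: "in_Lp p (conv4 g k)" by (rule test_in_Lp[OF conv4_test(1)[OF p g g0 k] p0])
  have gz: "in_Lp p (\<lambda>x. g (x - z) - g x)" for z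
    using in_Lp_diff[OF p0 Lp_translate(1)[OF g, of "- z"] g] by simp
  have gz2: "Lp_norm p (\<lambda>x. g (x - z) - g x) \<le> 2 * Lp_norm p g" for z
    using Minkowski_diff[OF p Lp_translate(1)[OF g, of "- z"] g] Lp_translate(2)[OF g, of "- z"] by simp
  show ?thesis
  proof (rule Lp_norm_le_dual[OF p q in_Lp_diff[OF p0 ci g] s0])
    fix \<rho> :: "real^4 \<Rightarrow> real" assume \<rho>: "test \<rho>"
    note [measurable] = test_measurable[OF \<rho>]
    have \<rho>q: "in_Lp q \<rho>" by (rule test_in_Lp[OF \<rho> q0])
    define F where "F = (\<lambda>(x, z). \<rho> x * (k z * (g (x - z) - g x)))"
    have Fm: "F \<in> borel_measurable (lborel \<Otimes>\<^sub>M lborel)" unfolding F_def by measurable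
    have Fn: "(\<lambda>z. ennreal (norm (F z))) \<in> borel_measurable (lborel \<Otimes>\<^sub>M lborel)"
      by (rule measurable_compose[OF measurable_compose[OF Fm borel_measurable_norm] measurable_ennreal])
    have Fi: "integrable (lborel \<Otimes>\<^sub>M lborel) F"
    proof (rule integrableI_bounded[OF Fm])
      have "(\<integral>\<^sup>+z. ennreal (norm (F z)) \<partial>(lborel \<Otimes>\<^sub>M lborel)) = (\<integral>\<^sup>+z. \<integral>\<^sup>+x. ennreal (norm (F (x, z))) \<partial>lborel \<partial>lborel)"
        by (rule lborel_pair.nn_integral_snd[OF Fn, symmetric])
      also have "\<dots> \<le> (\<integral>\<^sup>+z. ennreal (k z * (2 * Lp_norm p g * Lp_norm q \<rho>)) \<partial>lborel)"
      proof (intro nn_integral_mono)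
        fix z
        have H: "integrable lborel (\<lambda>x. norm (g (x - z) - g x) * norm (\<rho> x))"
          "(LINT x|lborel. norm (g (x - z) - g x) * norm (\<rho> x)) \<le> Lp_norm p (\<lambda>x. g (x - z) - g x) * Lp_norm q \<rho>"
          using Holder_norm[OF p q gz \<rho>q] by auto
        have "(\<integral>\<^sup>+x. ennreal (norm (F (x, z))) \<partial>lborel) = (\<integral>\<^sup>+x. ennreal (k z * (norm (g (x - z) - g x) * norm (\<rho> x))) \<partial>lborel)"
          by (intro nn_integral_cong) (auto simp: F_def abs_mult kpos mult_ac)
        also have "\<dots> = ennreal (k z * (LINT x|lborel. norm (g (x - z) - g x) * norm (\<rho> x)))"
          using nn_integral_eq_integral[of lborel "\<lambda>x. k z * (norm (g (x - z) - g x) * norm (\<rho> x))"] H(1) kpos by simp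
        also have "\<dots> \<le> ennreal (k z * (2 * Lp_norm p g * Lp_norm q \<rho>))"
          using H(2) gz2[of z] kpos[of z] Lp_norm_nonneg[of q \<rho>]
          by (intro ennreal_leI mult_left_mono) (auto intro: order_trans mult_right_mono)
        finally show "(\<integral>\<^sup>+x. ennreal (norm (F (x, z))) \<partial>lborel) \<le> ennreal (k z * (2 * Lp_norm p g * Lp_norm q \<rho>))" .
      qed
      also have "\<dots> < \<infinity>"
      proof -
        have "0 \<le> k z * (2 * Lp_norm p g * Lp_norm q \<rho>)" for z
          by (intro mult_nonneg_nonneg kpos Lp_norm_nonneg) simp
        then show ?thesis using ki by (subst nn_integral_eq_integral) auto
      qed
      finally show "(\<integral>\<^sup>+z. ennreal (norm (F z)) \<partial>(lborel \<Otimes>\<^sub>M lborel)) < \<infinity>" .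
    qed
    have "(conv4 g k x - g x) * \<rho> x = (LINT z|lborel. F (x, z))" for x
    proof -
      have gi: "integrable lborel (\<lambda>y. g y * k (x - y))" by (rule integrable_mult_test(1)[OF p g test_reflect[OF k]])
      have m: "(\<lambda>y. g y * k (x - y)) \<in> borel_measurable borel" by measurable
      have e: "conv4 g k x = (LINT z|lborel. g (x - z) * k z)"
        unfolding conv4_def using integral_reflect[OF m, of x] by simp
      have i: "integrable lborel (\<lambda>z. g (x - z) * k z)"
      proof -
        have "in_Lp p (\<lambda>z. g (x - z))" by (rule Lp_reflect(1)[OF g])
        from integrable_mult_test(1)[OF p this k] show ?thesis .
      qed
      have "(LINT z|lborel. F (x, z)) = (LINT z|lborel. \<rho> x * (g (x - z) * k z - g x * k z))"
        by (rule Bochner_Integration.integral_cong) (auto simp: F_def algebra_simps)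
      also have "\<dots> = \<rho> x * ((LINT z|lborel. g (x - z) * k z) - g x * (LINT z|lborel. k z))"
        using i ki by simp
      finally show ?thesis by (simp add: e k1 mult.commute)
    qed
    then have "(LINT x|lborel. (conv4 g k x - g x) * \<rho> x) = (LINT x|lborel. LINT z|lborel. F (x, z))" by simp
    also have "\<dots> = (LINT z|lborel. LINT x|lborel. F (x, z))"
      using lborel_pair.Fubini_integral[of "\<lambda>x z. F (x, z)"] Fi by simp
    finally have e: "(LINT x|lborel. (conv4 g k x - g x) * \<rho> x) = (LINT z|lborel. LINT x|lborel. F (x, z))" .
    have "\<bar>LINT z|lborel. LINT x|lborel. F (x, z)\<bar> \<le> (LINT z|lborel. k z * (s * Lp_norm q \<rho>))"
    proof (rule integral_abs_bound_integral)
      show "integrable lborel (\<lambda>z. LINT x|lborel. F (x, z))" using lborel_pair.integrable_snd[of "\<lambda>x z. F (x, z)"] Fi by simp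
      show "integrable lborel (\<lambda>z. k z * (s * Lp_norm q \<rho>))" using ki by simp
      fix z
      have "(LINT x|lborel. F (x, z)) = (LINT x|lborel. k z * ((g (x - z) - g x) * \<rho> x))"
        by (rule Bochner_Integration.integral_cong) (auto simp: F_def)
      then have z: "\<bar>LINT x|lborel. F (x, z)\<bar> = k z * \<bar>LINT x|lborel. (g (x - z) - g x) * \<rho> x\<bar>"
        using kpos[of z] by (simp add: abs_mult)
      show "\<bar>LINT x|lborel. F (x, z)\<bar> \<le> k z * (s * Lp_norm q \<rho>)"
      proof (cases "k z = 0")
        case False
        have "\<bar>LINT x|lborel. (g (x - z) - g x) * \<rho> x\<bar> \<le> Lp_norm p (\<lambda>x. g (x - z) - g x) * Lp_norm q \<rho>"
          by (rule Holder(2)[OF p q gz \<rho>q])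
        also have "\<dots> \<le> s * Lp_norm q \<rho>" using s[OF False] Lp_norm_nonneg by (rule mult_right_mono)
        finally show ?thesis unfolding z using kpos[of z] by (rule mult_left_mono)
      qed (simp add: z)
    qed
    also have "\<dots> = s * Lp_norm q \<rho>" using k1 by simp
    finally show "\<bar>LINT x|lborel. (conv4 g k x - g x) * \<rho> x\<bar> \<le> s * Lp_norm q \<rho>" unfolding e .
  qed
qed

text \<open>The product \<open>\<psi> * c\<close> serves as test function for \<open>v\<close>; the
  extra term of its classical derivative is moved to the other side.\<close>

lemma wderiv_mult_test:
  assumes v: "in_Lp 4 v" and G: "in_Lp 2 G" and wd: "wderiv v i G" and c: "test c"
  shows "wderiv (\<lambda>x. c x * v x) i (\<lambda>x. c x * G x + dd (axis i 1) c x * v x)"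
  unfolding wderiv_def
proof (intro allI impI)
  fix \<psi> :: "real^4 \<Rightarrow> real" assume \<psi>: "test \<psi>"
  note sc = test_smooth[OF c] and sp = test_smooth[OF \<psi>]
  note tdc = test_dd[OF c axis_in_Basis4, of i] and tdp = test_dd[OF \<psi> axis_in_Basis4, of i]
  have t1: "test (\<lambda>x. \<psi> x * c x)" and t2: "test (\<lambda>x. \<psi> x * dd (axis i 1) c x)" and t3: "test (\<lambda>x. dd (axis i 1) \<psi> x * c x)"
    using test_mult_left[OF c sp] test_mult_left[OF tdc sp] test_mult_left[OF c test_smooth[OF tdp]] by auto
  have i1: "integrable lborel (\<lambda>x. \<psi> x * c x * G x)" by (rule integrable_mult_test(2)[OF _ G t1]) simp
  have i2: "integrable lborel (\<lambda>x. \<psi> x * dd (axis i 1) c x * v x)" by (rule integrable_mult_test(2)[OF _ v t2]) simp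
  have i3: "integrable lborel (\<lambda>x. dd (axis i 1) \<psi> x * c x * v x)" by (rule integrable_mult_test(2)[OF _ v t3]) simp
  have "(LINT x|lborel. \<psi> x * (c x * G x + dd (axis i 1) c x * v x)) = (LINT x|lborel. \<psi> x * c x * G x + \<psi> x * dd (axis i 1) c x * v x)"
    by (rule Bochner_Integration.integral_cong) (auto simp: algebra_simps)
  also have "\<dots> = (LINT x|lborel. \<psi> x * c x * G x) + (LINT x|lborel. \<psi> x * dd (axis i 1) c x * v x)"
    by (rule Bochner_Integration.integral_add[OF i1 i2])
  also have "(LINT x|lborel. \<psi> x * c x * G x) = - (LINT x|lborel. dd (axis i 1) (\<lambda>x. \<psi> x * c x) x * v x)"
    using wd t1 unfolding wderiv_def by blast
  also have "(LINT x|lborel. dd (axis i 1) (\<lambda>x. \<psi> x * c x) x * v x) = (LINT x|lborel. dd (axis i 1) \<psi> x * c x * v x + \<psi> x * dd (axis i 1) c x * v x)"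
    by (rule Bochner_Integration.integral_cong) (auto simp: dd_mult[OF sp sc axis_in_Basis4] algebra_simps)
  also have "\<dots> = (LINT x|lborel. dd (axis i 1) \<psi> x * c x * v x) + (LINT x|lborel. \<psi> x * dd (axis i 1) c x * v x)"
    by (rule Bochner_Integration.integral_add[OF i3 i2])
  finally show "(LINT x|lborel. \<psi> x * (c x * G x + dd (axis i 1) c x * v x)) = - (LINT x|lborel. dd (axis i 1) \<psi> x * (c x * v x))"
    by (simp add: mult.assoc)
qed

text \<open>In dimension four the \<open>L\<^sup>4\<close> norms of the gradients of the dilated cutoffs are bounded, and these
gradients tend to zero uniformly.\<close>

lemma cutoff_gradient_tendsto:
  fixes \<eta> v :: "real^4 \<Rightarrow> real"
  assumes v: "in_Lp 4 v" and \<eta>: "test \<eta>" and out: "\<And>x. x \<notin> cbox (- One) One \<Longrightarrow> \<eta> x = 0"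
  shows "(\<lambda>n. Lp_norm 2 (\<lambda>x. dd (axis i 1) (\<lambda>x. \<eta> ((1 / real (Suc n)) *\<^sub>R x)) x * v x)) \<longlonglongrightarrow> 0"
proof -
  define k where "k = dd (axis i 1) \<eta>"
  have tk: "test k" unfolding k_def by (rule test_dd[OF \<eta> axis_in_Basis4])
  have k0: "k x = 0" if "x \<notin> cbox (- One) One" for x
    unfolding k_def by (rule dd_eq_0_outside[of "cbox (- One) One"]) (use out that in auto)
  obtain B where B: "\<And>x. \<bar>k x\<bar> \<le> B" using test_bounded[OF tk] by blast
  have B0: "0 \<le> B" using B[of 0] by linarith
  define K where "K n x = dd (axis i 1) (\<lambda>x. \<eta> ((1 / real (Suc n)) *\<^sub>R x)) x" for n x
  have Ke: "K n x = (1 / real (Suc n)) * k ((1 / real (Suc n)) *\<^sub>R x)" for n x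
    using dd_affine[OF test_smooth[OF \<eta>] axis_in_Basis4, of i "1 / real (Suc n)" 0 x] by (simp add: K_def k_def)
  have Kb: "\<bar>K n x\<bar> \<le> B / real (Suc n)" for n x
    unfolding Ke using B[of "(1 / real (Suc n)) *\<^sub>R x"] by (simp add: abs_mult divide_right_mono)
  have tK: "test (K n)" for n
  proof -
    have "test (\<lambda>x. \<eta> ((1 / real (Suc n)) *\<^sub>R x))" using test_affine[OF \<eta>, of "1 / real (Suc n)" 0] by simp
    from test_dd[OF this axis_in_Basis4, of i] show ?thesis by (simp add: K_def[abs_def])
  qed
  have K4: "in_Lp 4 (K n)" "Lp_norm 4 (K n) \<le> 2 * B" for n
  proof -
    show "in_Lp 4 (K n)" by (rule test_in_Lp[OF tK]) simp
    let ?N = "real (Suc n)"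
    let ?C = "cbox (- ?N *\<^sub>R One) (?N *\<^sub>R One) :: (real^4) set"
    have "K n x = 0" if "x \<notin> ?C" for x
    proof -
      have "(1 / ?N) *\<^sub>R x \<notin> cbox (- One) One"
      proof
        assume "(1 / ?N) *\<^sub>R x \<in> cbox (- One) One"
        then have "- 1 \<le> (1 / ?N) * (x \<bullet> b) \<and> (1 / ?N) * (x \<bullet> b) \<le> 1" if "b \<in> Basis" for b
          using that by (auto simp: mem_box)
        then have "- ?N \<le> x \<bullet> b \<and> x \<bullet> b \<le> ?N" if "b \<in> Basis" for b
          using that by (auto simp: field_simps)
        then have "x \<in> ?C" by (auto simp: mem_box)
        with that show False by simp
      qed
      then show ?thesis using k0 by (simp add: Ke)
    qed
    then have "Lp_norm 4 (K n) \<le> B / ?N * Lp_norm 4 (indicator ?C :: real^4 \<Rightarrow> real)"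
      using Kb test_measurable[OF tK] by (intro Lp_le_uniform(2)) auto
    \<comment> \<open>The cube has volume \<open>(2 * ?N)^4\<close>. Its fourth root cancels the
      factor \<open>1 / ?N\<close> of the chain rule, because the exponent equals the
      dimension.\<close>
    also have "Lp_norm 4 (indicator ?C :: real^4 \<Rightarrow> real) = 2 * ?N"
    proof -
      have "norm (indicator ?C x :: real) powr 4 = indicator ?C x" for x by (simp add: indicator_def)
      moreover have "measure lborel ?C = (2 * ?N) ^ 4"
        by (simp add: measure_lborel_cbox_eq inner_diff_left)
      moreover have "((2 * ?N) ^ 4) powr (1/4) = 2 * ?N"
        using powr_powr[of "2 * ?N" 4 "1/4"] by (simp add: powr_numeral)
      ultimately show ?thesis by (simp add: Lp_norm_def)
    qed
    also have "B / ?N * (2 * ?N) = 2 * B" using of_nat_neq_0[of n] by (simp del: of_nat_Suc)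
    finally show "Lp_norm 4 (K n) \<le> 2 * B" .
  qed
  have "(\<lambda>n. Lp_norm 2 (\<lambda>x. K n x * v x)) \<longlonglongrightarrow> 0"
  proof (rule tendstoI)
    fix e :: real assume e: "e > 0"
    define e' where "e' = e / (2 * (2 * B + 1))"
    have e': "e' > 0" "2 * B * e' \<le> e / 2" using e B0 by (auto simp: e'_def field_simps)
    \<comment> \<open>The small error \<open>v - w\<close> meets the cutoff gradient in
      \<open>L^4\<close>, where it stays bounded; the test function \<open>w\<close> meets its
      supremum norm, which decays like \<open>1/n\<close>.\<close>
    obtain w where w: "test w" "Lp_norm 4 (\<lambda>x. v x - w x) < e'"
      using Lp_test_approx[OF _ v e'(1)] by auto
    have w4: "in_Lp 4 w" and w2: "in_Lp 2 w" using w by (auto intro: test_in_Lp)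
    note d4 = in_Lp_diff[OF _ v w4, simplified]
    have "(\<lambda>n. B * Lp_norm 2 w / real (Suc n)) \<longlonglongrightarrow> 0"
      by (rule LIMSEQ_Suc[OF lim_const_over_n])
    then have "\<forall>\<^sub>F n in sequentially. B * Lp_norm 2 w / real (Suc n) < e / 2"
      using e by (intro order_tendstoD) auto
    then show "\<forall>\<^sub>F n in sequentially. dist (Lp_norm 2 (\<lambda>x. K n x * v x)) 0 < e"
    proof eventually_elim
      case (elim n)
      have 1: "in_Lp 2 (\<lambda>x. K n x * (v x - w x))" "Lp_norm 2 (\<lambda>x. K n x * (v x - w x)) \<le> Lp_norm 4 (K n) * Lp_norm 4 (\<lambda>x. v x - w x)"
        using Lp_mult[of 2 4 4, OF _ _ _ _ K4(1)[of n] d4] by auto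
      have 2: "in_Lp 2 (\<lambda>x. K n x * w x)" "Lp_norm 2 (\<lambda>x. K n x * w x) \<le> Lp_norm 2 (\<lambda>x. (B / real (Suc n)) * w x)"
      proof -
        have m: "(\<lambda>x. K n x * w x) \<in> borel_measurable borel"
          by (intro borel_measurable_times test_measurable tK w)
        have b: "AE x in lborel. norm (K n x * w x) \<le> norm ((B / real (Suc n)) * w x)"
          using mult_right_mono[OF Kb[of n] abs_ge_zero[of "w _"]] B0 by (intro AE_I2) (simp add: abs_mult)
        show "in_Lp 2 (\<lambda>x. K n x * w x)" "Lp_norm 2 (\<lambda>x. K n x * w x) \<le> Lp_norm 2 (\<lambda>x. (B / real (Suc n)) * w x)"
          using Lp_mono[OF _ in_Lp_cmult[OF w2] m b] by auto
      qed
      have "Lp_norm 2 (\<lambda>x. K n x * v x) = Lp_norm 2 (\<lambda>x. K n x * (v x - w x) + K n x * w x)"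
        by (simp add: algebra_simps)
      also have "\<dots> \<le> Lp_norm 2 (\<lambda>x. K n x * (v x - w x)) + Lp_norm 2 (\<lambda>x. K n x * w x)"
        by (rule Minkowski[OF _ 1(1) 2(1)]) simp
      also have "\<dots> \<le> 2 * B * e' + B * Lp_norm 2 w / real (Suc n)"
      proof (rule add_mono)
        have "Lp_norm 4 (K n) * Lp_norm 4 (\<lambda>x. v x - w x) \<le> 2 * B * e'"
          using K4(2)[of n] w(2) B0 Lp_norm_nonneg by (intro mult_mono) auto
        then show "Lp_norm 2 (\<lambda>x. K n x * (v x - w x)) \<le> 2 * B * e'" using 1(2) by linarith
        show "Lp_norm 2 (\<lambda>x. K n x * w x) \<le> B * Lp_norm 2 w / real (Suc n)"
          by (rule ord_le_eq_trans[OF 2(2)], subst Lp_norm_cmult) (use B0 in simp_all)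
      qed
      also have "\<dots> < e" using elim e'(2) by linarith
      finally show ?case using Lp_norm_nonneg[of 2 "\<lambda>x. K n x * v x"] by simp
    qed
  qed
  then show ?thesis by (simp add: K_def)
qed

text \<open>Multiplication by the dilated cutoffs converges by dominated convergence. The gradient
  acquires the additional term of cutoff gradient times \<open>v\<close>, which is disposed of by
  \<open>cutoff_gradient_tendsto\<close>.\<close>

lemma H1_cutoff_approx:
  assumes H: "H1 v G" and e: "e > 0"
  shows "\<exists>c. test c \<and> Lp_norm 4 (\<lambda>x. c x * v x - v x) < e \<and>
    (\<forall>i. Lp_norm 2 (\<lambda>x. c x * G i x + dd (axis i 1) c x * v x - G i x) < e)"
proof -
  have v: "in_Lp 4 v" and G: "in_Lp 2 (G i)" for i using H by (auto simp: H1_def)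
  \<comment> \<open>Normalised to the value 1 at the origin, so that the dilated cutoffs tend to 1
    pointwise.\<close>
  define \<eta> where "\<eta> x = (1 / bump 1 (0::real^4)) * bump 1 x" for x :: "real^4"
  have b0: "bump 1 (0::real^4) > 0" by (simp add: bump_pos_iff)
  have t: "test \<eta>" unfolding \<eta>_def by (intro test_cmult test_bump)
  have out: "\<eta> x = 0" if "x \<notin> cbox (- One) One" for x
  proof -
    obtain b where "b \<in> Basis" "\<not> (- 1 \<le> x \<bullet> b \<and> x \<bullet> b \<le> 1)"
      using \<open>x \<notin> cbox (- One) One\<close> by (auto simp: mem_box)
    then have "\<not> (\<forall>b\<in>Basis. \<bar>x \<bullet> b\<bar> < 1)" by (auto simp: abs_less_iff intro!: bexI[of _ b])
    then have "bump 1 x = 0" using bump_pos_iff[of 1 x] bump_nonneg[of 1 x] by linarith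
    then show ?thesis by (simp add: \<eta>_def)
  qed
  define c where "c n x = \<eta> ((1 / real (Suc n)) *\<^sub>R x)" for n x
  have tc: "test (c n)" for n using test_affine[OF t, of "1 / real (Suc n)" 0] by (simp add: c_def[abs_def])
  have cb: "\<bar>c n x\<bar> \<le> 1 / bump 1 (0::real^4)" for n x
    unfolding c_def \<eta>_def
    using divide_right_mono[OF bump_le_1[of 1 "(1 / real (Suc n)) *\<^sub>R x"] less_imp_le[OF b0]]
    by (simp add: abs_mult abs_of_nonneg[OF bump_nonneg])
  have lim: "(\<lambda>n. c n x) \<longlonglongrightarrow> 1" for x
  proof -
    have "(\<lambda>n. (1 / real (Suc n)) *\<^sub>R x) \<longlonglongrightarrow> 0 *\<^sub>R x"
      by (intro tendsto_scaleR tendsto_const LIMSEQ_Suc[OF lim_const_over_n])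
    then have "(\<lambda>n. \<eta> ((1 / real (Suc n)) *\<^sub>R x)) \<longlonglongrightarrow> \<eta> (0 *\<^sub>R x)"
      using continuous_on_tendsto_compose[OF test_continuous[OF t]] by auto
    then show ?thesis using b0 by (simp add: c_def \<eta>_def)
  qed
  have L: "(\<lambda>n. Lp_norm p (\<lambda>x. c n x * g x - g x)) \<longlonglongrightarrow> 0" if "p > 0" "in_Lp p g" for p g
  proof (rule Lp_dominated_convergence(2)[OF that(1) in_Lp_cmult[OF that(2), of "1 / bump 1 (0::real^4)"]])
    show "AE x in lborel. (\<lambda>n. c n x * g x) \<longlonglongrightarrow> g x"
    proof (intro AE_I2)
      fix x
      have "(\<lambda>n. c n x * g x) \<longlonglongrightarrow> 1 * g x" by (intro tendsto_mult lim tendsto_const)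
      then show "(\<lambda>n. c n x * g x) \<longlonglongrightarrow> g x" by simp
    qed
    show "AE x in lborel. \<bar>c n x * g x\<bar> \<le> \<bar>1 / bump 1 (0::real^4) * g x\<bar>" for n
      using mult_right_mono[OF cb[of n] abs_ge_zero[of "g _"]] b0 by (intro AE_I2) (simp add: abs_mult)
  qed (use in_Lp_measurable[OF that(2)] test_measurable[OF tc] in auto)
  have A: "\<forall>\<^sub>F n in sequentially. Lp_norm 4 (\<lambda>x. c n x * v x - v x) < e"
    using L[OF _ v] e by (intro order_tendstoD) auto
  have "\<forall>\<^sub>F n in sequentially. Lp_norm 2 (\<lambda>x. c n x * G i x + dd (axis i 1) (c n) x * v x - G i x) < e" for i
  proof -
    have "\<forall>\<^sub>F n in sequentially. Lp_norm 2 (\<lambda>x. c n x * G i x - G i x) < e / 2"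
      using L[OF _ G] e by (intro order_tendstoD) auto
    moreover have "\<forall>\<^sub>F n in sequentially. Lp_norm 2 (\<lambda>x. dd (axis i 1) (c n) x * v x) < e / 2"
    proof -
      have ce: "c n = (\<lambda>x. \<eta> ((1 / real (Suc n)) *\<^sub>R x))" for n by (simp add: c_def[abs_def])
      show ?thesis unfolding ce
        by (rule order_tendstoD(2)[OF cutoff_gradient_tendsto[OF v t out]]) (use e in auto)
    qed
    ultimately show ?thesis
    proof eventually_elim
      case (elim n)
      have 1: "in_Lp 2 (\<lambda>x. c n x * G i x - G i x)"
      proof -
        have m: "(\<lambda>x. c n x * G i x) \<in> borel_measurable borel"
          by (intro borel_measurable_times test_measurable tc in_Lp_measurable[OF G])
        have b: "AE x in lborel. norm (c n x * G i x) \<le> norm (1 / bump 1 (0::real^4) * G i x)"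
          using mult_right_mono[OF cb[of n] abs_ge_zero[of "G i _"]] b0 by (intro AE_I2) (simp add: abs_mult)
        have "in_Lp 2 (\<lambda>x. c n x * G i x)" by (rule Lp_mono(1)[OF _ in_Lp_cmult[OF G] m b]) simp
        from in_Lp_diff[OF _ this G] show ?thesis by simp
      qed
      have 2: "in_Lp 2 (\<lambda>x. dd (axis i 1) (c n) x * v x)"
        by (rule Lp_mult(1)[of 2 4 4, OF _ _ _ _ test_in_Lp[OF test_dd[OF tc axis_in_Basis4]] v]) auto
      have "Lp_norm 2 (\<lambda>x. (c n x * G i x - G i x) + dd (axis i 1) (c n) x * v x) \<le>
          Lp_norm 2 (\<lambda>x. c n x * G i x - G i x) + Lp_norm 2 (\<lambda>x. dd (axis i 1) (c n) x * v x)"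
        by (rule Minkowski[OF _ 1 2]) simp
      then show ?case using elim by (simp add: algebra_simps)
    qed
  qed
  then have "\<forall>\<^sub>F n in sequentially. \<forall>i. Lp_norm 2 (\<lambda>x. c n x * G i x + dd (axis i 1) (c n) x * v x - G i x) < e"
    by (intro eventually_all_finite)
  with A have "\<forall>\<^sub>F n in sequentially. Lp_norm 4 (\<lambda>x. c n x * v x - v x) < e \<and>
     (\<forall>i. Lp_norm 2 (\<lambda>x. c n x * G i x + dd (axis i 1) (c n) x * v x - G i x) < e)"
    by (rule eventually_conj)
  then show ?thesis using tc by (auto simp: eventually_sequentially)
qed

lemma integral_bump_pos:
  assumes "r > 0"
  shows "(LINT x|lborel. bump r (x :: real^4)) > 0"
proof -
  have i: "integrable lborel (bump r :: real^4 \<Rightarrow> real)"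
  proof -
    have "integrable lborel (\<lambda>x::real^4. norm (bump r x) powr 1)" for r
      using test_in_Lp[OF test_bump, of 1 r] by (simp only: in_Lp_def)
    then show ?thesis by (simp add: bump_nonneg)
  qed
  have "(LINT x|lborel. bump r (x :: real^4)) \<noteq> 0"
  proof
    assume "(LINT x|lborel. bump r (x :: real^4)) = 0"
    then have ae: "AE x in lborel. bump r (x :: real^4) = 0"
      using integral_nonneg_eq_0_iff_AE[OF i] by (simp add: bump_nonneg)
    let ?B = "ball 0 r :: (real^4) set"
    have "AE x in lborel. x \<notin> ?B" using ae
    proof eventually_elim
      case (elim x)
      then obtain b where b: "b \<in> Basis" "\<not> \<bar>x \<bullet> b\<bar> < r" using bump_pos_iff[of r x] by auto
      then show ?case using Basis_le_norm[of b x] by simp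
    qed
    then have "?B \<in> null_sets lborel" by (subst AE_iff_null_sets) auto
    then have "measure lborel ?B = 0" by (simp add: null_sets_def measure_def)
    then show False using content_ball_pos[OF assms, of "0::real^4"] by simp
  qed
  moreover have "(LINT x|lborel. bump r (x :: real^4)) \<ge> 0"
    by (intro Bochner_Integration.integral_nonneg bump_nonneg)
  ultimately show ?thesis by linarith
qed

lemma mollifier_exists:
  assumes d: "d > 0"
  shows "\<exists>k :: real^4 \<Rightarrow> real. test k \<and> (\<forall>x. 0 \<le> k x) \<and> (LINT x|lborel. k x) = 1 \<and> (\<forall>z. k z \<noteq> 0 \<longrightarrow> norm z < d)"
proof -
  \<comment> \<open>The norm is at most the sum of four coordinates, each below \<open>r\<close>
    where the bump is nonzero.\<close>
  define r where "r = d / 4"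
  have r: "r > 0" using d by (simp add: r_def)
  let ?I = "LINT x|lborel. bump r (x :: real^4)"
  have I: "?I > 0" by (rule integral_bump_pos[OF r])
  have "norm z < d" if "bump r z \<noteq> 0" for z :: "real^4"
  proof -
    have "\<forall>b\<in>Basis. \<bar>z \<bullet> b\<bar> < r" using that bump_pos_iff[of r z] bump_nonneg[of r z] by force
    then have "(\<Sum>b\<in>Basis. \<bar>z \<bullet> b\<bar>) < (\<Sum>b\<in>(Basis :: (real^4) set). r)"
      by (intro sum_strict_mono) auto
    then show ?thesis using norm_le_l1[of z] by (simp add: r_def)
  qed
  then show ?thesis using I bump_nonneg[of r] test_cmult[OF test_bump, of "1 / ?I" r]
    by (intro exI[of _ "\<lambda>x. (1 / ?I) * bump r x"]) (auto intro!: divide_nonneg_pos)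
qed

lemma Lp_translate_small:
  fixes g :: "real^4 \<Rightarrow> real"
  assumes p: "p > 1" and g: "in_Lp p g" and e: "e > 0"
  shows "\<exists>d>0. \<forall>z. norm z < d \<longrightarrow> Lp_norm p (\<lambda>x. g (x - z) - g x) \<le> e"
proof -
  have "\<forall>\<^sub>F a in at 0. Lp_norm p (\<lambda>x. g (x + a) - g x) < e"
    using Lp_translate_tendsto[OF p g] e by (intro order_tendstoD) auto
  then obtain d where d: "d > 0" "\<And>a. a \<noteq> 0 \<Longrightarrow> norm a < d \<Longrightarrow> Lp_norm p (\<lambda>x. g (x + a) - g x) < e"
    unfolding eventually_at by (auto simp: dist_norm)
  have "Lp_norm p (\<lambda>x. g (x - z) - g x) \<le> e" if "norm z < d" for z
    using d(2)[of "- z"] that e p by (cases "z = 0") (auto simp: Lp_norm_zero)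
  then show ?thesis using d(1) by blast
qed

text \<open>Cutting off comes before mollifying, because the convolution has compact support only if
  the function has. The errors \<open>e/2\<close> and \<open>e/3\<close> add up to less than
  \<open>e\<close>, and one kernel scale \<open>\<delta>\<close> serves \<open>w\<close> and its
  four derivatives.\<close>

lemma H1_test_approx:
  assumes H: "H1 v G" and e: "e > 0"
  shows "\<exists>\<psi>. test \<psi> \<and> Lp_norm 4 (\<lambda>x. \<psi> x - v x) < e \<and> (\<forall>i. Lp_norm 2 (\<lambda>x. dd (axis i 1) \<psi> x - G i x) < e)"
proof -
  have v: "in_Lp 4 v" and G: "in_Lp 2 (G i)" and wd: "wderiv v i (G i)" for i using H by (auto simp: H1_def)
  have e2: "e / 2 > 0" using e by simp
  obtain c where c: "test c" "Lp_norm 4 (\<lambda>x. c x * v x - v x) < e / 2"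
    "\<And>i. Lp_norm 2 (\<lambda>x. c x * G i x + dd (axis i 1) c x * v x - G i x) < e / 2"
    using H1_cutoff_approx[OF H e2] by blast
  define w where "w x = c x * v x" for x
  define K where "K i x = c x * G i x + dd (axis i 1) c x * v x" for i x
  obtain R where R: "\<And>x a. norm x > R \<Longrightarrow> norm a \<le> 1 \<Longrightarrow> c (x + a) = 0" using test_compact_enlarge[OF c(1)] by blast
  have c0: "c x = 0" if "norm x > R" for x using R[of x 0] that by simp
  have dc0: "dd (axis i 1) c x = 0" if "norm x > R" for x i
    by (rule dd_eq_0_outside[of "cball 0 R"]) (use c0 that in auto)
  have w0: "w x = 0" and K0: "K i x = 0" if "norm x > R" for x i using c0[OF that] dc0[OF that] by (auto simp: w_def K_def)
  obtain B where B: "\<And>x. \<bar>c x\<bar> \<le> B" using test_bounded[OF c(1)] by blast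
  have B0: "0 \<le> B" using B[of 0] by linarith
  have cm: "in_Lp p (\<lambda>x. c x * g x)" if "p > 0" "in_Lp p g" for p g
    by (rule Lp_mono(1)[OF that(1) in_Lp_cmult[OF that(2), of B]])
      (use B B0 test_measurable[OF c(1)] in_Lp_measurable[OF that(2)] in \<open>auto simp: abs_mult intro!: AE_I2 mult_right_mono\<close>)
  have w4: "in_Lp 4 w" unfolding w_def by (rule cm[OF _ v]) simp
  have K2: "in_Lp 2 (K i)" for i
  proof -
    have "in_Lp 2 (\<lambda>x. dd (axis i 1) c x * v x)"
      by (rule Lp_mult(1)[of 2 4 4, OF _ _ _ _ test_in_Lp[OF test_dd[OF c(1) axis_in_Basis4]] v]) auto
    from in_Lp_add[OF _ cm[OF _ G[of i]] this] show ?thesis by (simp add: K_def[abs_def])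
  qed
  have wdK: "wderiv w i (K i)" for i unfolding w_def K_def by (rule wderiv_mult_test[OF v G wd c(1)])
  obtain d0 where d0: "d0 > 0" "\<And>z. norm z < d0 \<Longrightarrow> Lp_norm 4 (\<lambda>x. w (x - z) - w x) \<le> e / 3"
    using Lp_translate_small[OF _ w4, of "e/3"] e by auto
  have "\<forall>i. \<exists>d>0. \<forall>z. norm z < d \<longrightarrow> Lp_norm 2 (\<lambda>x. K i (x - z) - K i x) \<le> e / 3"
    using Lp_translate_small[OF _ K2, of "e/3"] e by auto
  then obtain d where d: "\<And>i. d i > 0" "\<And>i z. norm z < d i \<Longrightarrow> Lp_norm 2 (\<lambda>x. K i (x - z) - K i x) \<le> e / 3" by metis
  define \<delta> where "\<delta> = min d0 (Min (range d))"
  have \<delta>: "\<delta> > 0" "\<delta> \<le> d0" "\<delta> \<le> d i" for i using d0(1) d(1) by (auto simp: \<delta>_def min_le_iff_disj)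
  obtain k :: "real^4 \<Rightarrow> real" where k: "test k" "\<And>x. 0 \<le> k x" "(LINT x|lborel. k x) = 1" "\<And>z. k z \<noteq> 0 \<Longrightarrow> norm z < \<delta>"
    using mollifier_exists[OF \<delta>(1)] by blast
  have tw: "test (conv4 w k)" by (rule conv4_test(1)[OF _ w4 w0 k(1)]) auto
  have dw: "dd (axis i 1) (conv4 w k) = conv4 (K i) k" for i
    using conv4_test(2)[OF _ w4 w0 k(1) axis_in_Basis4, of R i] wderiv_conv4[OF wdK k(1)] by simp
  have tK: "test (conv4 (K i) k)" for i by (rule conv4_test(1)[OF _ K2 K0 k(1)]) auto
  have 1: "Lp_norm 4 (\<lambda>x. conv4 w k x - w x) \<le> e / 3"
    by (rule conv4_error[OF _ w4 w0 k(1-3)]) (use d0(2) k(4) \<delta> e in \<open>force+\<close>)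
  have 2: "Lp_norm 2 (\<lambda>x. conv4 (K i) k x - K i x) \<le> e / 3" for i
  proof (rule conv4_error[OF _ K2 K0 k(1-3)])
    show "Lp_norm 2 (\<lambda>x. K i (x - z) - K i x) \<le> e / 3" if "k z \<noteq> 0" for z
      using d(2)[of z i] k(4)[OF that] \<delta>(3)[of i] by linarith
  qed (use e in auto)
  have "Lp_norm 4 (\<lambda>x. conv4 w k x - v x) < e"
    using Lp_triangle[OF _ test_in_Lp[OF tw] w4 v] 1 c(2) e by (simp add: w_def)
  moreover have "Lp_norm 2 (\<lambda>x. conv4 (K i) k x - G i x) < e" for i
    using Lp_triangle[OF _ test_in_Lp[OF tK] K2 G, of i i i] 2[of i] c(3)[of i] e by (simp add: K_def)
  ultimately show ?thesis using tw dw by (intro exI[of _ "conv4 w k"]) simp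
qed

section \<open>The energy estimate\<close>

lemma Sobolev_H1:
  assumes H: "H1 v G"
  shows "Lp_norm 4 v \<le> gnorm G"
proof (rule field_le_epsilon)
  fix e :: real assume e: "e > 0"
  have v: "in_Lp 4 v" and G: "\<And>i. in_Lp 2 (G i)" using H by (auto simp: H1_def)
  obtain \<psi> where \<psi>: "test \<psi>" "Lp_norm 4 (\<lambda>x. \<psi> x - v x) < e / 3" "\<And>i. Lp_norm 2 (\<lambda>x. dd (axis i 1) \<psi> x - G i x) < e / 3"
    using H1_test_approx[OF H, of "e/3"] e by auto
  have d2: "in_Lp 2 (dd (axis i 1) \<psi>)" for i :: 4 by (rule test_in_Lp[OF test_dd[OF \<psi>(1) axis_in_Basis4]]) simp
  have \<psi>4: "in_Lp 4 \<psi>" by (rule test_in_Lp[OF \<psi>(1)]) simp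
  have "Lp_norm 4 v \<le> Lp_norm 4 \<psi> + Lp_norm 4 (\<lambda>x. v x - \<psi> x)"
    by (rule Lp_norm_le_add_diff[OF _ v \<psi>4]) simp
  moreover have "Lp_norm 4 \<psi> \<le> gnorm (\<lambda>i. dd (axis i 1) \<psi>)" using Sobolev_test[OF \<psi>(1)] by (simp add: gnorm_def)
  moreover have "gnorm (\<lambda>i. dd (axis i 1) \<psi>) \<le> gnorm G + gnorm (\<lambda>i x. dd (axis i 1) \<psi> x - G i x)"
    using gnorm_triangle[of G "\<lambda>i x. dd (axis i 1) \<psi> x - G i x"] G in_Lp_diff[OF _ d2 G] by simp
  \<comment> \<open>The factor 2 is the square root of the number of components.\<close>
  moreover have "gnorm (\<lambda>i x. dd (axis i 1) \<psi> x - G i x) \<le> 2 * (e / 3)"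
  proof -
    have "gnorm (\<lambda>i x. dd (axis i 1) \<psi> x - G i x) \<le> sqrt (\<Sum>i\<in>(UNIV :: 4 set). (e / 3)\<^sup>2)"
      unfolding gnorm_def using \<psi>(3) Lp_norm_nonneg by (intro real_sqrt_le_mono sum_mono power_mono) (auto intro: less_imp_le)
    also have "\<dots> = 2 * (e / 3)" using e by (simp add: real_sqrt_mult real_sqrt_abs)
    finally show ?thesis .
  qed
  ultimately show "Lp_norm 4 v \<le> gnorm G + e" using \<psi>(2) Lp_norm_minus_commute[of 4 \<psi> v] by linarith
qed

lemma wderiv_unique:
  assumes "wderiv v i G" "wderiv v i K" "in_Lp 2 G" "in_Lp 2 K"
  shows "AE x in lborel. G x = K x"
proof -
  have "AE x in lborel. G x - K x = 0"
  proof (rule Lp_weak_zero_AE[of 2])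
    show "in_Lp 2 (\<lambda>x. G x - K x)" using in_Lp_diff[OF _ assms(3,4)] by simp
    fix \<psi> :: "real^4 \<Rightarrow> real" assume \<psi>: "test \<psi>"
    have "(LINT x|lborel. \<psi> x * G x) = (LINT x|lborel. \<psi> x * K x)" using assms(1,2) \<psi> by (simp add: wderiv_def)
    then show "(LINT x|lborel. (G x - K x) * \<psi> x) = 0"
      using integrable_mult_test(1)[OF _ assms(3) \<psi>] integrable_mult_test(1)[OF _ assms(4) \<psi>]
      by (simp add: left_diff_distrib mult.commute[of "\<psi> _"])
  qed simp
  then show ?thesis by simp
qed

text \<open>Membership is demanded explicitly, because \<open>Lp_norm\<close> is 0 when the power is
  not integrable and convergence of norms alone would be vacuous. It is demanded only eventually,
  since shifted times may leave \<open>[0,T]\<close>.\<close>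

definition Lp_lim :: "'i filter \<Rightarrow> real \<Rightarrow> ('i \<Rightarrow> real^4 \<Rightarrow> real) \<Rightarrow> (real^4 \<Rightarrow> real) \<Rightarrow> bool" where
  "Lp_lim F p X x \<longleftrightarrow> (\<forall>\<^sub>F h in F. in_Lp p (X h)) \<and> in_Lp p x \<and> ((\<lambda>h. Lp_norm p (\<lambda>y. X h y - x y)) \<longlongrightarrow> 0) F"

lemma Lp_lim_in_Lp: "Lp_lim F p X x \<Longrightarrow> in_Lp p x"
  by (simp add: Lp_lim_def)

lemma Lp_lim_const: "p > 0 \<Longrightarrow> in_Lp p x \<Longrightarrow> Lp_lim F p (\<lambda>h. x) x"
  by (simp add: Lp_lim_def Lp_norm_zero)

lemma Lp_lim_cong:
  assumes "\<forall>\<^sub>F h in F. X h = Y h" "Lp_lim F p X x"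
  shows "Lp_lim F p Y x"
proof -
  have "\<forall>\<^sub>F h in F. in_Lp p (Y h)"
    using assms(1) assms(2)[unfolded Lp_lim_def, THEN conjunct1] by eventually_elim simp
  moreover have "((\<lambda>h. Lp_norm p (\<lambda>y. Y h y - x y)) \<longlongrightarrow> 0) F"
    using assms(2) unfolding Lp_lim_def
    by (elim conjE Lim_transform_eventually) (use assms(1) in eventually_elim, simp)
  ultimately show ?thesis using assms(2) by (simp add: Lp_lim_def)
qed

lemma Lp_lim_add:
  assumes p: "p > 1" and X: "Lp_lim F p X x" and Y: "Lp_lim F p Y y"
  shows "Lp_lim F p (\<lambda>h z. X h z + Y h z) (\<lambda>z. x z + y z)"
proof -
  have p0: "p > 0" using p by simp
  note XY = X[unfolded Lp_lim_def] Y[unfolded Lp_lim_def]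
  have ev: "\<forall>\<^sub>F h in F. in_Lp p (X h) \<and> in_Lp p (Y h)" using XY by (auto intro: eventually_conj)
  have "((\<lambda>h. Lp_norm p (\<lambda>z. X h z + Y h z - (x z + y z))) \<longlongrightarrow> 0) F"
  proof (rule Lim_null_comparison)
    show "((\<lambda>h. Lp_norm p (\<lambda>z. X h z - x z) + Lp_norm p (\<lambda>z. Y h z - y z)) \<longlongrightarrow> 0) F"
      using XY tendsto_add[of "\<lambda>h. Lp_norm p (\<lambda>z. X h z - x z)" 0 F "\<lambda>h. Lp_norm p (\<lambda>z. Y h z - y z)" 0] by simp
    show "\<forall>\<^sub>F h in F. norm (Lp_norm p (\<lambda>z. X h z + Y h z - (x z + y z))) \<le> Lp_norm p (\<lambda>z. X h z - x z) + Lp_norm p (\<lambda>z. Y h z - y z)"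
      using ev
    proof eventually_elim
      case (elim h)
      have "Lp_norm p (\<lambda>z. (X h z - x z) + (Y h z - y z)) \<le> Lp_norm p (\<lambda>z. X h z - x z) + Lp_norm p (\<lambda>z. Y h z - y z)"
        using elim XY by (intro Minkowski[OF p] in_Lp_diff[OF p0]) auto
      then show ?case by (simp add: Lp_norm_nonneg algebra_simps)
    qed
  qed
  moreover have "\<forall>\<^sub>F h in F. in_Lp p (\<lambda>z. X h z + Y h z)" using ev by eventually_elim (auto intro: in_Lp_add[OF p0])
  ultimately show ?thesis using XY by (auto simp: Lp_lim_def intro: in_Lp_add[OF p0])
qed

lemma Lp_lim_sum:
  assumes p: "p > 1" and "finite I" "\<And>i. i \<in> I \<Longrightarrow> Lp_lim F p (X i) (x i)"
  shows "Lp_lim F p (\<lambda>h z. \<Sum>i\<in>I. X i h z) (\<lambda>z. \<Sum>i\<in>I. x i z)"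
  using assms(2,3)
proof (induction I rule: finite_induct)
  case empty
  then show ?case using p by (simp add: Lp_lim_const in_Lp_zero)
next
  case (insert i I)
  then show ?case using Lp_lim_add[OF p, of F "X i" "x i"] by simp
qed

lemma Lp_lim_norm:
  assumes p: "p > 1" and X: "Lp_lim F p X x"
  shows "((\<lambda>h. Lp_norm p (X h)) \<longlongrightarrow> Lp_norm p x) F"
proof -
  note X' = X[unfolded Lp_lim_def]
  have "((\<lambda>h. Lp_norm p (X h) - Lp_norm p x) \<longlongrightarrow> 0) F"
  proof (rule Lim_null_comparison)
    show "((\<lambda>h. Lp_norm p (\<lambda>z. X h z - x z)) \<longlongrightarrow> 0) F" using X' by simp
    show "\<forall>\<^sub>F h in F. norm (Lp_norm p (X h) - Lp_norm p x) \<le> Lp_norm p (\<lambda>z. X h z - x z)"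
      using X'[THEN conjunct1]
    proof eventually_elim
      case (elim h)
      have x: "in_Lp p x" using X' by simp
      show ?case
        using Lp_norm_le_add_diff[OF p elim x] Lp_norm_le_add_diff[OF p x elim] Lp_norm_minus_commute[of p x "X h"] by simp
    qed
  qed
  then show ?thesis by (simp add: LIM_zero_iff)
qed

text \<open>The difference of the products is telescoped, changing one factor at a time; in each
  term one factor tends to zero while the norms of the others converge.\<close>

lemma Lp_lim_mult3:
  assumes X: "Lp_lim F 4 X x" and Y: "Lp_lim F 4 Y y" and Z: "Lp_lim F 4 Z z"
  shows "Lp_lim F (4/3) (\<lambda>h t. X h t * Y h t * Z h t) (\<lambda>t. x t * y t * z t)"
proof -
  note XYZ = X[unfolded Lp_lim_def] Y[unfolded Lp_lim_def] Z[unfolded Lp_lim_def]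
  have x: "in_Lp 4 x" "in_Lp 4 y" "in_Lp 4 z" using XYZ by auto
  have ev: "\<forall>\<^sub>F h in F. in_Lp 4 (X h) \<and> in_Lp 4 (Y h) \<and> in_Lp 4 (Z h)" using XYZ by (auto intro!: eventually_conj)
  have "((\<lambda>h. Lp_norm (4/3) (\<lambda>t. X h t * Y h t * Z h t - x t * y t * z t)) \<longlongrightarrow> 0) F"
  proof (rule Lim_null_comparison)
    let ?D = "\<lambda>X h x. Lp_norm 4 (\<lambda>t. X h t - x t)"
    let ?b = "\<lambda>h. ?D X h x * Lp_norm 4 (Y h) * Lp_norm 4 (Z h) + (Lp_norm 4 x * ?D Y h y * Lp_norm 4 (Z h) + Lp_norm 4 x * Lp_norm 4 y * ?D Z h z)"
    have "(?b \<longlongrightarrow> 0 * Lp_norm 4 y * Lp_norm 4 z + (Lp_norm 4 x * 0 * Lp_norm 4 z + Lp_norm 4 x * Lp_norm 4 y * 0)) F"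
      using XYZ Lp_lim_norm[OF _ Y] Lp_lim_norm[OF _ Z] by (intro tendsto_intros) auto
    then show "(?b \<longlongrightarrow> 0) F" by simp
    show "\<forall>\<^sub>F h in F. norm (Lp_norm (4/3) (\<lambda>t. X h t * Y h t * Z h t - x t * y t * z t)) \<le> ?b h"
      using ev
    proof eventually_elim
      case (elim h)
      have d: "in_Lp 4 (\<lambda>t. X h t - x t)" "in_Lp 4 (\<lambda>t. Y h t - y t)" "in_Lp 4 (\<lambda>t. Z h t - z t)"
        using elim x by (auto intro: in_Lp_diff)
      note 1 = L4_mult3[OF d(1) conjunct1[OF conjunct2[OF elim]] conjunct2[OF conjunct2[OF elim]]]
      note 2 = L4_mult3[OF x(1) d(2) conjunct2[OF conjunct2[OF elim]]]
      note 3 = L4_mult3[OF x(1) x(2) d(3)]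
      have "Lp_norm (4/3) (\<lambda>t. (X h t - x t) * Y h t * Z h t + (x t * (Y h t - y t) * Z h t + x t * y t * (Z h t - z t)))
          \<le> Lp_norm (4/3) (\<lambda>t. (X h t - x t) * Y h t * Z h t) + Lp_norm (4/3) (\<lambda>t. x t * (Y h t - y t) * Z h t + x t * y t * (Z h t - z t))"
        by (rule Minkowski[OF _ 1(1) in_Lp_add[OF _ 2(1) 3(1)]]) auto
      also have "Lp_norm (4/3) (\<lambda>t. x t * (Y h t - y t) * Z h t + x t * y t * (Z h t - z t))
          \<le> Lp_norm (4/3) (\<lambda>t. x t * (Y h t - y t) * Z h t) + Lp_norm (4/3) (\<lambda>t. x t * y t * (Z h t - z t))"
        by (rule Minkowski[OF _ 2(1) 3(1)]) auto
      finally have "Lp_norm (4/3) (\<lambda>t. (X h t - x t) * Y h t * Z h t + (x t * (Y h t - y t) * Z h t + x t * y t * (Z h t - z t))) \<le> ?b h"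
        using 1(2) 2(2) 3(2) by linarith
      then show ?case by (simp add: Lp_norm_nonneg algebra_simps)
    qed
  qed
  moreover have "\<forall>\<^sub>F h in F. in_Lp (4/3) (\<lambda>t. X h t * Y h t * Z h t)" using ev by eventually_elim (auto intro: L4_mult3)
  ultimately show ?thesis using L4_mult3(1)[OF x] by (simp add: Lp_lim_def)
qed

lemma Lp_lim_scale_null:
  fixes X :: "real \<Rightarrow> real^4 \<Rightarrow> real"
  assumes p: "p > 1" and X: "Lp_lim F p X x" and c: "(c \<longlongrightarrow> 0) F"
  shows "Lp_lim F p (\<lambda>h z. c h * X h z) (\<lambda>z. 0)"
proof -
  have "((\<lambda>h. \<bar>c h\<bar> * Lp_norm p (X h)) \<longlongrightarrow> \<bar>0\<bar> * Lp_norm p x) F"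
    by (intro tendsto_mult tendsto_rabs c Lp_lim_norm[OF p X])
  moreover have "\<forall>\<^sub>F h in F. in_Lp p (\<lambda>z. c h * X h z)"
    using X[unfolded Lp_lim_def, THEN conjunct1] by eventually_elim (rule in_Lp_cmult)
  ultimately show ?thesis using p by (simp add: Lp_lim_def in_Lp_zero Lp_norm_cmult)
qed

lemma Lp_lim_integral:
  assumes pq: "p > 1" "q > 1" "1 / p + 1 / q = 1" and X: "Lp_lim F p X x" and g: "in_Lp q g"
  shows "((\<lambda>h. LINT z|lborel. X h z * g z) \<longlongrightarrow> (LINT z|lborel. x z * g z)) F"
proof -
  note X' = X[unfolded Lp_lim_def]
  have x: "in_Lp p x" using X' by simp
  have "((\<lambda>h. (LINT z|lborel. X h z * g z) - (LINT z|lborel. x z * g z)) \<longlongrightarrow> 0) F"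
  proof (rule Lim_null_comparison)
    show "((\<lambda>h. Lp_norm p (\<lambda>z. X h z - x z) * Lp_norm q g) \<longlongrightarrow> 0) F"
      using X' tendsto_mult_right[of "\<lambda>h. Lp_norm p (\<lambda>z. X h z - x z)" 0 F "Lp_norm q g"] by simp
    show "\<forall>\<^sub>F h in F. norm ((LINT z|lborel. X h z * g z) - (LINT z|lborel. x z * g z)) \<le> Lp_norm p (\<lambda>z. X h z - x z) * Lp_norm q g"
      using X'[THEN conjunct1]
    proof eventually_elim
      case (elim h)
      have "(LINT z|lborel. X h z * g z) - (LINT z|lborel. x z * g z) = (LINT z|lborel. (X h z - x z) * g z)"
        using Holder(1)[OF pq elim g] Holder(1)[OF pq x g] by (simp add: left_diff_distrib)
      then show ?case using Holder(2)[OF pq in_Lp_diff[OF _ elim x] g] pq by simp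
    qed
  qed
  then show ?thesis by (simp add: LIM_zero_iff)
qed

lemma H1_test_lim:
  assumes "H1 v G"
  shows "\<exists>\<psi>::nat \<Rightarrow> _. (\<forall>n. test (\<psi> n)) \<and> Lp_lim sequentially 4 \<psi> v \<and> (\<forall>i. Lp_lim sequentially 2 (\<lambda>n. dd (axis i 1) (\<psi> n)) (G i))"
proof -
  have "\<forall>n. \<exists>\<psi>. test \<psi> \<and> Lp_norm 4 (\<lambda>x. \<psi> x - v x) < 1 / real (Suc n) \<and> (\<forall>i. Lp_norm 2 (\<lambda>x. dd (axis i 1) \<psi> x - G i x) < 1 / real (Suc n))"
    by (intro allI H1_test_approx[OF assms]) simp
  then obtain \<psi> where \<psi>: "\<And>n. test (\<psi> n)" "\<And>n. Lp_norm 4 (\<lambda>x. \<psi> n x - v x) < 1 / real (Suc n)"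
    "\<And>n i. Lp_norm 2 (\<lambda>x. dd (axis i 1) (\<psi> n) x - G i x) < 1 / real (Suc n)" by metis
  have lim: "(\<lambda>n. 1 / real (Suc n)) \<longlonglongrightarrow> 0" by (rule LIMSEQ_Suc[OF lim_const_over_n])
  have "Lp_lim sequentially 4 \<psi> v"
    unfolding Lp_lim_def using assms \<psi>(1,2)
    by (auto simp: H1_def Lp_norm_nonneg intro!: test_in_Lp always_eventually Lim_null_comparison[OF _ lim] less_imp_le)
  moreover have "Lp_lim sequentially 2 (\<lambda>n. dd (axis i 1) (\<psi> n)) (G i)" for i
    unfolding Lp_lim_def using assms \<psi>(1,3) test_dd[OF \<psi>(1) axis_in_Basis4]
    by (auto simp: H1_def Lp_norm_nonneg intro!: test_in_Lp always_eventually Lim_null_comparison[OF _ lim] less_imp_le)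
  ultimately show ?thesis using \<psi>(1) by blast
qed

section \<open>The weak equation and its energy identity\<close>

definition ell :: "(real^4 \<Rightarrow> real) \<Rightarrow> (real^4 \<Rightarrow> real) \<Rightarrow> (real^4 \<Rightarrow> real) \<Rightarrow> bool" where
  "ell q g v \<longleftrightarrow> (\<forall>\<psi>. test \<psi> \<longrightarrow>
     (LINT x|lborel. lap \<psi> x * v x) - (LINT x|lborel. \<psi> x * (q x * v x)) = (LINT x|lborel. \<psi> x * g x))"

lemma test_lap: "test \<psi> \<Longrightarrow> test (lap \<psi>)"
  unfolding lap_def[abs_def] sum_4
  by (intro test_add test_dd axis_in_Basis4)

lemma integral_lap:
  assumes H: "H1 v G" and \<psi>: "test \<psi>"
  shows "(LINT x|lborel. lap \<psi> x * v x) = - (\<Sum>i\<in>UNIV. LINT x|lborel. dd (axis i 1) \<psi> x * G i x)"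
proof -
  have v: "in_Lp 4 v" and wd: "wderiv v i (G i)" for i using H by (auto simp: H1_def)
  have t: "test (dd (axis i 1) \<psi>)" for i :: 4 by (rule test_dd[OF \<psi> axis_in_Basis4])
  have t2: "test (dd (axis i 1) (dd (axis i 1) \<psi>))" for i :: 4 by (rule test_dd[OF t axis_in_Basis4])
  have "(LINT x|lborel. lap \<psi> x * v x) = (\<Sum>i\<in>UNIV. LINT x|lborel. dd (axis i 1) (dd (axis i 1) \<psi>) x * v x)"
    unfolding lap_def sum_distrib_right
    by (intro Bochner_Integration.integral_sum integrable_mult_test(2)[OF _ v t2]) simp
  also have "\<dots> = (\<Sum>i\<in>UNIV. - (LINT x|lborel. dd (axis i 1) \<psi> x * G i x))"
    by (intro sum.cong) (use wd t in \<open>auto simp: wderiv_def\<close>)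
  finally show ?thesis by (simp add: sum_negf)
qed

text \<open>The equation holds against test functions only, so \<open>v\<close> is approached by
  test functions in \<open>L^4\<close> with gradients in \<open>L^2\<close>. The potential term
  passes to the limit because \<open>q v\<close> is in the dual space \<open>L^(4/3)\<close>, and it
  is then dropped by its sign.\<close>

lemma energy_estimate:
  assumes H: "H1 v G" and q0: "\<And>x. 0 \<le> q x" and qv: "in_Lp (4/3) (\<lambda>x. q x * v x)" and g: "in_Lp (4/3) g"
    and e: "ell q g v"
  shows "gnorm G \<le> Lp_norm (4/3) g"
proof -
  have v: "in_Lp 4 v" and G: "\<And>i. in_Lp 2 (G i)" using H by (auto simp: H1_def)
  obtain \<psi> where \<psi>: "\<And>n. test (\<psi> n)" "Lp_lim sequentially 4 \<psi> v" "\<And>i. Lp_lim sequentially 2 (\<lambda>n. dd (axis i 1) (\<psi> n)) (G i)"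
    using H1_test_lim[OF H] by blast
  have c4: "(4::real) > 1" "(4/3::real) > 1" "1 / 4 + 1 / (4/3) = (1::real)" by auto
  have c2: "(2::real) > 1" "1 / 2 + 1 / 2 = (1::real)" by auto
  have eq: "(\<Sum>i\<in>UNIV. LINT x|lborel. dd (axis i 1) (\<psi> n) x * G i x) + (LINT x|lborel. \<psi> n x * (q x * v x)) = - (LINT x|lborel. \<psi> n x * g x)" for n
  proof -
    have "- (\<Sum>i\<in>UNIV. LINT x|lborel. dd (axis i 1) (\<psi> n) x * G i x) - (LINT x|lborel. \<psi> n x * (q x * v x)) = (LINT x|lborel. \<psi> n x * g x)"
      using e \<psi>(1)[of n] unfolding ell_def integral_lap[OF H \<psi>(1)[of n], symmetric] by blast
    then show ?thesis by linarith
  qed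
  have "(\<lambda>n. (\<Sum>i\<in>UNIV. LINT x|lborel. dd (axis i 1) (\<psi> n) x * G i x) + (LINT x|lborel. \<psi> n x * (q x * v x)))
    \<longlonglongrightarrow> (\<Sum>i\<in>UNIV. LINT x|lborel. G i x * G i x) + (LINT x|lborel. v x * (q x * v x))"
    by (intro tendsto_add tendsto_sum Lp_lim_integral[OF c2(1,1,2) \<psi>(3) G] Lp_lim_integral[OF c4 \<psi>(2) qv])
  moreover have "(\<lambda>n. - (LINT x|lborel. \<psi> n x * g x)) \<longlonglongrightarrow> - (LINT x|lborel. v x * g x)"
    by (intro tendsto_minus Lp_lim_integral[OF c4 \<psi>(2) g])
  ultimately have "(\<Sum>i\<in>UNIV. LINT x|lborel. G i x * G i x) + (LINT x|lborel. v x * (q x * v x)) = - (LINT x|lborel. v x * g x)"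
    unfolding eq using LIMSEQ_unique by blast
  moreover have "(LINT x|lborel. v x * (q x * v x)) \<ge> 0"
  proof (intro Bochner_Integration.integral_nonneg)
    show "0 \<le> v x * (q x * v x)" for x using mult_nonneg_nonneg[OF q0[of x] zero_le_square[of "v x"]] by (simp add: mult_ac)
  qed
  moreover have "(LINT x|lborel. G i x * G i x) = (Lp_norm 2 (G i))\<^sup>2" for i
  proof -
    have "(LINT x|lborel. G i x * G i x) = (LINT x|lborel. norm (G i x) powr 2)"
      by (simp add: powr_numeral power2_eq_square[symmetric])
    also have "\<dots> = Lp_norm 2 (G i) powr 2" using Lp_norm_powr[of 2 "G i"] by simp
    finally show ?thesis using Lp_norm_nonneg[of 2 "G i"] by (simp add: powr_numeral)
  qed
  ultimately have "(gnorm G)\<^sup>2 \<le> - (LINT x|lborel. v x * g x)" by (simp add: gnorm_sq)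
  also have "\<dots> \<le> Lp_norm 4 v * Lp_norm (4/3) g" using Holder(2)[OF c4 v g] by linarith
  also have "\<dots> \<le> gnorm G * Lp_norm (4/3) g" by (intro mult_right_mono Sobolev_H1[OF H] Lp_norm_nonneg)
  \<comment> \<open>The Sobolev constant is one, so cancelling \<open>gnorm G\<close> leaves no
    constant in the estimate.\<close>
  finally have le: "gnorm G * gnorm G \<le> gnorm G * Lp_norm (4/3) g" by (simp add: power2_eq_square)
  then show ?thesis using gnorm_nonneg[of G] Lp_norm_nonneg[of "4/3" g]
    by (cases "gnorm G = 0") (auto simp: mult_le_cancel_left)
qed

text \<open>The Sobolev inequality for the differences turns a Cauchy sequence of gradients into a
  Cauchy sequence in \<open>L^4\<close>; the identity defining weak derivatives survives both
  limits.\<close>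

lemma H1_complete:
  fixes v :: "nat \<Rightarrow> real^4 \<Rightarrow> real"
  assumes H: "\<And>n. H1 (v n) (G n)"
    and Cauchy: "\<And>e. e > 0 \<Longrightarrow> \<exists>N. \<forall>m\<ge>N. \<forall>n\<ge>N. gnorm (\<lambda>i x. G m i x - G n i x) < e"
  shows "\<exists>w K. H1 w K \<and> Lp_lim sequentially 4 v w \<and> (\<forall>i. Lp_lim sequentially 2 (\<lambda>n. G n i) (K i))"
proof -
  have v: "in_Lp 4 (v n)" and G: "in_Lp 2 (G n i)" and wd: "wderiv (v n) i (G n i)" for n i using H by (auto simp: H1_def)
  have "\<exists>w. in_Lp 4 w \<and> (\<lambda>n. Lp_norm 4 (\<lambda>x. v n x - w x)) \<longlonglongrightarrow> 0"
  proof (rule Lp_complete)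
    fix e :: real assume "e > 0"
    from Cauchy[OF this] obtain N where N: "\<And>m n. m \<ge> N \<Longrightarrow> n \<ge> N \<Longrightarrow> gnorm (\<lambda>i x. G m i x - G n i x) < e" by blast
    show "\<exists>N. \<forall>m\<ge>N. \<forall>n\<ge>N. Lp_norm 4 (\<lambda>x. v m x - v n x) < e"
      using N Sobolev_H1[OF H1_diff[OF H H]] by (meson order_le_less_trans)
  qed (use v in auto)
  then obtain w where w: "in_Lp 4 w" "(\<lambda>n. Lp_norm 4 (\<lambda>x. v n x - w x)) \<longlonglongrightarrow> 0" by blast
  have "\<exists>K. in_Lp 2 K \<and> (\<lambda>n. Lp_norm 2 (\<lambda>x. G n i x - K x)) \<longlonglongrightarrow> 0" for i
  proof (rule Lp_complete)
    fix e :: real assume "e > 0"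
    from Cauchy[OF this] obtain N where N: "\<And>m n. m \<ge> N \<Longrightarrow> n \<ge> N \<Longrightarrow> gnorm (\<lambda>i x. G m i x - G n i x) < e" by blast
    show "\<exists>N. \<forall>m\<ge>N. \<forall>n\<ge>N. Lp_norm 2 (\<lambda>x. G m i x - G n i x) < e"
      using N Lp_norm_le_gnorm[of "\<lambda>i x. G _ i x - G _ i x" i] by (meson order_le_less_trans)
  qed (use G in auto)
  then have "\<forall>i. \<exists>K. in_Lp 2 K \<and> (\<lambda>n. Lp_norm 2 (\<lambda>x. G n i x - K x)) \<longlonglongrightarrow> 0" by (rule allI)
  from choice[OF this] obtain K where "\<forall>i. in_Lp 2 (K i) \<and> (\<lambda>n. Lp_norm 2 (\<lambda>x. G n i x - K i x)) \<longlonglongrightarrow> 0" ..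
  then have K: "\<And>i. in_Lp 2 (K i)" "\<And>i. (\<lambda>n. Lp_norm 2 (\<lambda>x. G n i x - K i x)) \<longlonglongrightarrow> 0" by auto
  have lw: "Lp_lim sequentially 4 v w" using v w by (simp add: Lp_lim_def)
  have lK: "Lp_lim sequentially 2 (\<lambda>n. G n i) (K i)" for i using G K by (simp add: Lp_lim_def)
  have "wderiv w i (K i)" for i unfolding wderiv_def
  proof (intro allI impI)
    fix \<psi> :: "real^4 \<Rightarrow> real" assume \<psi>: "test \<psi>"
    have a: "(\<lambda>n. LINT x|lborel. G n i x * \<psi> x) \<longlonglongrightarrow> (LINT x|lborel. K i x * \<psi> x)"
      by (rule Lp_lim_integral[OF _ _ _ lK test_in_Lp[OF \<psi>], of 2]) auto
    have b: "(\<lambda>n. LINT x|lborel. v n x * dd (axis i 1) \<psi> x) \<longlonglongrightarrow> (LINT x|lborel. w x * dd (axis i 1) \<psi> x)"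
      by (rule Lp_lim_integral[OF _ _ _ lw test_in_Lp[OF test_dd[OF \<psi> axis_in_Basis4]], of "4/3"]) auto
    have c: "(LINT x|lborel. G n i x * \<psi> x) = - (LINT x|lborel. v n x * dd (axis i 1) \<psi> x)" for n
      using wd[of n i] \<psi> by (simp add: wderiv_def mult.commute)
    have "(LINT x|lborel. K i x * \<psi> x) = - (LINT x|lborel. w x * dd (axis i 1) \<psi> x)"
      by (rule LIMSEQ_unique[OF a]) (unfold c, rule tendsto_minus[OF b])
    then show "(LINT x|lborel. \<psi> x * K i x) = - (LINT x|lborel. dd (axis i 1) \<psi> x * w x)" by (simp add: mult.commute)
  qed
  then have "H1 w K" using w K by (simp add: H1_def)
  then show ?thesis using lw lK by blast
qed

section \<open>Differentiating the solution along a parameter\<close>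

text \<open>The value \<open>a\<close> at the base point is separate from the family
  \<open>A\<close>, as the filters at 0 in use do not see \<open>h = 0\<close>. Keeping the filter
  arbitrary lets one notion cover space shifts and time shifts that are one-sided at the end
  points.\<close>

definition Lp_deriv :: "real filter \<Rightarrow> real \<Rightarrow> (real \<Rightarrow> real^4 \<Rightarrow> real) \<Rightarrow> (real^4 \<Rightarrow> real) \<Rightarrow> (real^4 \<Rightarrow> real) \<Rightarrow> bool" where
  "Lp_deriv F p A a a' \<longleftrightarrow> (\<forall>\<^sub>F h in F. in_Lp p (A h)) \<and> in_Lp p a \<and> Lp_lim F p (\<lambda>h x. (A h x - a x) / h) a'"

lemma at_within_nonzero: "\<forall>\<^sub>F h in at (0::real) within H. h \<noteq> 0"
  by (simp add: eventually_at_filter)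

lemma Lp_deriv_lim:
  assumes p: "p > 1" and A: "Lp_deriv (at 0 within H) p A a a'"
  shows "Lp_lim (at 0 within H) p A a"
proof -
  have l: "Lp_lim (at 0 within H) p (\<lambda>h x. (A h x - a x) / h) a'" and a: "in_Lp p a" using A by (auto simp: Lp_deriv_def)
  have "Lp_lim (at 0 within H) p (\<lambda>h x. h * ((A h x - a x) / h)) (\<lambda>x. 0)"
    by (rule Lp_lim_scale_null[OF p l tendsto_ident_at])
  from Lp_lim_add[OF p Lp_lim_const[OF _ a] this]
  have "Lp_lim (at 0 within H) p (\<lambda>h x. a x + h * ((A h x - a x) / h)) a" using p by simp
  moreover have "\<forall>\<^sub>F h in at 0 within H. (\<lambda>x. a x + h * ((A h x - a x) / h)) = A h"
    using at_within_nonzero by eventually_elim (auto simp: fun_eq_iff)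
  ultimately show ?thesis by (rule Lp_lim_cong[rotated])
qed

lemma Lp_deriv_add:
  assumes p: "p > 1" and A: "Lp_deriv F p A a a'" and B: "Lp_deriv F p B b b'"
  shows "Lp_deriv F p (\<lambda>h x. A h x + B h x) (\<lambda>x. a x + b x) (\<lambda>x. a' x + b' x)"
proof -
  have p0: "p > 0" using p by simp
  note AB = A[unfolded Lp_deriv_def] B[unfolded Lp_deriv_def]
  have "\<forall>\<^sub>F h in F. in_Lp p (\<lambda>x. A h x + B h x)"
    using conjunct1[OF AB(1)] conjunct1[OF AB(2)] by eventually_elim (rule in_Lp_add[OF p0])
  moreover have "Lp_lim F p (\<lambda>h x. (A h x - a x) / h + (B h x - b x) / h) (\<lambda>x. a' x + b' x)"
    using AB by (intro Lp_lim_add[OF p]) auto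
  then have "Lp_lim F p (\<lambda>h x. (A h x + B h x - (a x + b x)) / h) (\<lambda>x. a' x + b' x)"
    by (simp add: add_divide_distrib[symmetric] algebra_simps)
  ultimately show ?thesis using AB in_Lp_add[OF p0, of a b] unfolding Lp_deriv_def by blast
qed

lemma Lp_deriv_mult3:
  assumes A: "Lp_deriv (at 0 within H) 4 A a a'" and B: "Lp_deriv (at 0 within H) 4 B b b'" and V: "Lp_deriv (at 0 within H) 4 V v v'"
  shows "Lp_deriv (at 0 within H) (4/3) (\<lambda>h x. A h x * B h x * V h x) (\<lambda>x. a x * b x * v x)
    (\<lambda>x. a' x * b x * v x + (a x * b' x * v x + a x * b x * v' x))"
proof -
  let ?F = "at 0 within H"
  note ABV = A[unfolded Lp_deriv_def] B[unfolded Lp_deriv_def] V[unfolded Lp_deriv_def]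
  have la: "Lp_lim ?F 4 (\<lambda>h x. (A h x - a x) / h) a'" "Lp_lim ?F 4 (\<lambda>h x. (B h x - b x) / h) b'" "Lp_lim ?F 4 (\<lambda>h x. (V h x - v x) / h) v'"
    and c: "Lp_lim ?F 4 (\<lambda>h. a) a" "Lp_lim ?F 4 (\<lambda>h. b) b"
    using ABV by (auto intro: Lp_lim_const)
  have lB: "Lp_lim ?F 4 B b" and lV: "Lp_lim ?F 4 V v" using Lp_deriv_lim[OF _ B] Lp_deriv_lim[OF _ V] by auto
  have "Lp_lim ?F (4/3) (\<lambda>h x. (A h x - a x) / h * B h x * V h x + (a x * ((B h x - b x) / h) * V h x + a x * b x * ((V h x - v x) / h)))
     (\<lambda>x. a' x * b x * v x + (a x * b' x * v x + a x * b x * v' x))"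
    by (intro Lp_lim_add Lp_lim_mult3 la lB lV c) simp_all
  moreover have "(\<lambda>x. (A h x - a x) / h * B h x * V h x + (a x * ((B h x - b x) / h) * V h x + a x * b x * ((V h x - v x) / h)))
      = (\<lambda>x. (A h x * B h x * V h x - a x * b x * v x) / h)" for h
    by (auto simp: fun_eq_iff add_divide_distrib[symmetric] algebra_simps)
  ultimately have "Lp_lim ?F (4/3) (\<lambda>h x. (A h x * B h x * V h x - a x * b x * v x) / h)
     (\<lambda>x. a' x * b x * v x + (a x * b' x * v x + a x * b x * v' x))" by simp
  moreover have "\<forall>\<^sub>F h in ?F. in_Lp (4/3) (\<lambda>x. A h x * B h x * V h x)"
    using conjunct1[OF ABV(1)] conjunct1[OF ABV(2)] conjunct1[OF ABV(3)] by eventually_elim (rule L4_mult3(1))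
  ultimately show ?thesis using ABV L4_mult3(1)[of a b v] unfolding Lp_deriv_def by blast
qed

text \<open>With \<open>a True\<close> and \<open>a False\<close> the real and imaginary parts of
  \<open>phi\<close> this is \<open>|phi|^2\<close>; see \<open>qf_cpart\<close>.\<close>

definition qf :: "(bool \<Rightarrow> real^4 \<Rightarrow> real) \<Rightarrow> real^4 \<Rightarrow> real" where
  "qf a x = (\<Sum>s\<in>UNIV. a s x * a s x)"

lemma qf_nonneg: "0 \<le> qf a x"
  unfolding qf_def by (intro sum_nonneg) simp

lemma qf_mult_in_Lp:
  assumes "\<And>s. in_Lp 4 (a s)" "in_Lp 4 v"
  shows "in_Lp (4/3) (\<lambda>x. qf a x * v x)"
  unfolding qf_def sum_distrib_right by (intro in_Lp_sum L4_mult3(1) assms) auto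

lemma ell_cmult: "ell q g v \<Longrightarrow> ell q (\<lambda>x. c * g x) (\<lambda>x. c * v x)"
proof -
  assume e: "ell q g v"
  have "(LINT x|lborel. lap \<psi> x * (c * v x)) - (LINT x|lborel. \<psi> x * (q x * (c * v x))) = (LINT x|lborel. \<psi> x * (c * g x))"
    if "test \<psi>" for \<psi>
  proof -
    have "(LINT x|lborel. lap \<psi> x * (c * v x)) = c * (LINT x|lborel. lap \<psi> x * v x)"
      "(LINT x|lborel. \<psi> x * (q x * (c * v x))) = c * (LINT x|lborel. \<psi> x * (q x * v x))"
      "(LINT x|lborel. \<psi> x * (c * g x)) = c * (LINT x|lborel. \<psi> x * g x)"
      by (simp_all add: mult.left_commute[of _ c])
    then show ?thesis using e that unfolding ell_def by (simp add: right_diff_distrib[symmetric])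
  qed
  then show ?thesis by (simp add: ell_def)
qed

text \<open>The term with potential \<open>Q\<close> is rewritten as \<open>q V + (Q - q) V\<close>
  and its second part moved to the right, so that one potential remains on the left.\<close>

lemma ell_diff:
  assumes V: "in_Lp 4 V" "ell Q g1 V" and v: "in_Lp 4 v" "ell q g v"
    and i: "in_Lp (4/3) (\<lambda>x. Q x * V x)" "in_Lp (4/3) (\<lambda>x. q x * V x)" "in_Lp (4/3) (\<lambda>x. q x * v x)" "in_Lp (4/3) g1" "in_Lp (4/3) g"
  shows "ell q (\<lambda>x. g1 x - g x + (Q x - q x) * V x) (\<lambda>x. V x - v x)"
  unfolding ell_def
proof (intro allI impI)
  fix \<psi> :: "real^4 \<Rightarrow> real" assume \<psi>: "test \<psi>"
  have I: "integrable lborel (\<lambda>x. \<psi> x * f x)" if "in_Lp (4/3) f" for f by (rule integrable_mult_test(2)[OF _ that \<psi>]) simp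
  have L: "integrable lborel (\<lambda>x. lap \<psi> x * f x)" if "in_Lp 4 f" for f by (rule integrable_mult_test(2)[OF _ that test_lap[OF \<psi>]]) simp
  have 1: "(LINT x|lborel. lap \<psi> x * (V x - v x)) = (LINT x|lborel. lap \<psi> x * V x) - (LINT x|lborel. lap \<psi> x * v x)"
    unfolding right_diff_distrib by (intro Bochner_Integration.integral_diff L V v)
  have 2: "(LINT x|lborel. \<psi> x * (q x * (V x - v x))) = (LINT x|lborel. \<psi> x * (q x * V x)) - (LINT x|lborel. \<psi> x * (q x * v x))"
    unfolding right_diff_distrib by (intro Bochner_Integration.integral_diff I i)
  have "(LINT x|lborel. \<psi> x * (g1 x - g x + (Q x - q x) * V x))
      = (LINT x|lborel. (\<psi> x * g1 x - \<psi> x * g x) + (\<psi> x * (Q x * V x) - \<psi> x * (q x * V x)))"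
    by (rule Bochner_Integration.integral_cong) (auto simp: algebra_simps)
  also have "\<dots> = (LINT x|lborel. \<psi> x * g1 x) - (LINT x|lborel. \<psi> x * g x) + ((LINT x|lborel. \<psi> x * (Q x * V x)) - (LINT x|lborel. \<psi> x * (q x * V x)))"
    by (simp add: I i)
  finally have 3: "(LINT x|lborel. \<psi> x * (g1 x - g x + (Q x - q x) * V x)) = (LINT x|lborel. \<psi> x * g1 x) - (LINT x|lborel. \<psi> x * g x) + ((LINT x|lborel. \<psi> x * (Q x * V x)) - (LINT x|lborel. \<psi> x * (q x * V x)))" .
  show "(LINT x|lborel. lap \<psi> x * (V x - v x)) - (LINT x|lborel. \<psi> x * (q x * (V x - v x))) = (LINT x|lborel. \<psi> x * (g1 x - g x + (Q x - q x) * V x))"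
  proof -
    have "(LINT x|lborel. lap \<psi> x * V x) - (LINT x|lborel. \<psi> x * (Q x * V x)) = (LINT x|lborel. \<psi> x * g1 x)"
      "(LINT x|lborel. lap \<psi> x * v x) - (LINT x|lborel. \<psi> x * (q x * v x)) = (LINT x|lborel. \<psi> x * g x)"
      using V(2) v(2) \<psi> unfolding ell_def by blast+
    then show ?thesis unfolding 1 2 3 by linarith
  qed
qed

lemma solution_bound:
  assumes "H1 v G" "ell (qf a) g v" "\<And>s. in_Lp 4 (a s)" "in_Lp (4/3) g"
  shows "gnorm G \<le> Lp_norm (4/3) g" "Lp_norm 4 v \<le> Lp_norm (4/3) g"
proof -
  have v: "in_Lp 4 v" using assms by (simp add: H1_def)
  show "gnorm G \<le> Lp_norm (4/3) g"
    by (rule energy_estimate[OF assms(1) qf_nonneg qf_mult_in_Lp[OF assms(3) v] assms(4) assms(2)])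
  with Sobolev_H1[OF assms(1)] show "Lp_norm 4 v \<le> Lp_norm (4/3) g" by linarith
qed

text \<open>The difference of the potentials factors as \<open>(A - a) (A + a)\<close>. Times
  \<open>V\<close> it is a sum of products of three \<open>L^4\<close> functions, each containing a
  difference of coefficients, and the energy estimate applies to the difference of the
  solutions.\<close>

lemma solution_diff:
  assumes V: "H1 V K" "ell (qf A) g1 V" and v: "H1 v G" "ell (qf a) g v"
    and i: "\<And>s. in_Lp 4 (A s)" "\<And>s. in_Lp 4 (a s)" "in_Lp (4/3) g1" "in_Lp (4/3) g"
  defines "r \<equiv> \<lambda>x. g1 x - g x + (\<Sum>s\<in>UNIV. (A s x - a s x) * (A s x + a s x) * V x)"
  shows "in_Lp (4/3) r" "H1 (\<lambda>x. V x - v x) (\<lambda>i x. K i x - G i x)" "ell (qf a) r (\<lambda>x. V x - v x)"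
    "gnorm (\<lambda>i x. K i x - G i x) \<le> Lp_norm (4/3) r" "Lp_norm 4 (\<lambda>x. V x - v x) \<le> Lp_norm (4/3) r"
proof -
  have V4: "in_Lp 4 V" and v4: "in_Lp 4 v" using V v by (auto simp: H1_def)
  show r: "in_Lp (4/3) r" unfolding r_def
    by (intro in_Lp_add in_Lp_sum in_Lp_diff L4_mult3(1) i V4) auto
  show H: "H1 (\<lambda>x. V x - v x) (\<lambda>i x. K i x - G i x)" by (rule H1_diff[OF V(1) v(1)])
  have "r = (\<lambda>x. g1 x - g x + (qf A x - qf a x) * V x)"
    unfolding r_def qf_def sum_subtractf[symmetric] sum_distrib_right by (simp add: algebra_simps)
  then show e: "ell (qf a) r (\<lambda>x. V x - v x)"
    using ell_diff[OF V4 V(2) v4 v(2) qf_mult_in_Lp[OF i(1) V4] qf_mult_in_Lp[OF i(2) V4] qf_mult_in_Lp[OF i(2) v4] i(3,4)] by simp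
  show "gnorm (\<lambda>i x. K i x - G i x) \<le> Lp_norm (4/3) r" "Lp_norm 4 (\<lambda>x. V x - v x) \<le> Lp_norm (4/3) r"
    by (rule solution_bound[OF H e i(2) r])+
qed

text \<open>Continuous dependence on the data. The factor \<open>V h\<close> in the bound of
  \<open>solution_diff\<close> is estimated by its own right-hand side, so that convergence of the
  solutions is a conclusion and boundedness is not presupposed.\<close>

lemma solution_lim:
  assumes A: "\<And>s. Lp_lim F 4 (A s) (a s)" and g: "Lp_lim F (4/3) gh g"
    and V: "\<forall>\<^sub>F h in F. H1 (V h) (K h) \<and> ell (qf (\<lambda>s. A s h)) (gh h) (V h)"
    and v: "H1 v G" "ell (qf a) g v"
  shows "Lp_lim F 4 V v" "((\<lambda>h. gnorm (\<lambda>i x. K h i x - G i x)) \<longlongrightarrow> 0) F"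
proof -
  have a4: "in_Lp 4 (a s)" for s using A[of s] by (simp add: Lp_lim_def)
  have gin: "in_Lp (4/3) g" using g by (simp add: Lp_lim_def)
  have v4: "in_Lp 4 v" using v by (simp add: H1_def)
  have As: "\<forall>\<^sub>F h in F. in_Lp 4 (A s h)" for s using A[of s] by (simp add: Lp_lim_def)
  have ev: "\<forall>\<^sub>F h in F. (\<forall>s. in_Lp 4 (A s h)) \<and> in_Lp (4/3) (gh h) \<and> H1 (V h) (K h) \<and> ell (qf (\<lambda>s. A s h)) (gh h) (V h)"
    using g V by (intro eventually_conj eventually_all_finite As) (auto simp: Lp_lim_def elim: eventually_mono)
  define r where "r h x = gh h x - g x + (\<Sum>s\<in>UNIV. (A s h x - a s x) * (A s h x + a s x) * V h x)" for h x
  let ?b = "\<lambda>h. Lp_norm (4/3) (\<lambda>x. gh h x - g x) + (\<Sum>s\<in>UNIV. Lp_norm 4 (\<lambda>x. A s h x - a s x) * Lp_norm 4 (\<lambda>x. A s h x + a s x) * Lp_norm (4/3) (gh h))"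
  have bl: "(?b \<longlongrightarrow> 0 + (\<Sum>s\<in>UNIV. 0 * Lp_norm 4 (\<lambda>x. a s x + a s x) * Lp_norm (4/3) g)) F"
    using g A by (intro tendsto_add tendsto_sum tendsto_mult Lp_lim_norm Lp_lim_add[OF _ A Lp_lim_const] a4) (auto simp: Lp_lim_def)
  have E: "\<forall>\<^sub>F h in F. in_Lp 4 (V h) \<and> gnorm (\<lambda>i x. K h i x - G i x) \<le> ?b h \<and> Lp_norm 4 (\<lambda>x. V h x - v x) \<le> ?b h"
    using ev
  proof eventually_elim
    case (elim h)
    then have Ah: "\<And>s. in_Lp 4 (A s h)" and gh: "in_Lp (4/3) (gh h)" and Vh: "H1 (V h) (K h)" "ell (qf (\<lambda>s. A s h)) (gh h) (V h)" by auto
    have V4: "in_Lp 4 (V h)" using Vh by (simp add: H1_def)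
    note S = solution_diff[OF Vh v Ah a4 gh gin, folded r_def]
    note T = L4_mult3[OF in_Lp_diff[OF _ Ah a4] in_Lp_add[OF _ Ah a4] V4]
    have "Lp_norm (4/3) (r h) \<le> Lp_norm (4/3) (\<lambda>x. gh h x - g x) + Lp_norm (4/3) (\<lambda>x. \<Sum>s\<in>UNIV. (A s h x - a s x) * (A s h x + a s x) * V h x)"
      unfolding r_def using T(1) gh gin by (intro Minkowski in_Lp_diff in_Lp_sum) auto
    also have "Lp_norm (4/3) (\<lambda>x. \<Sum>s\<in>UNIV. (A s h x - a s x) * (A s h x + a s x) * V h x)
        \<le> (\<Sum>s\<in>UNIV. Lp_norm (4/3) (\<lambda>x. (A s h x - a s x) * (A s h x + a s x) * V h x))"
      using T(1) by (intro Minkowski_sum) auto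
    also have "\<dots> \<le> (\<Sum>s\<in>UNIV. Lp_norm 4 (\<lambda>x. A s h x - a s x) * Lp_norm 4 (\<lambda>x. A s h x + a s x) * Lp_norm (4/3) (gh h))"
    proof (rule sum_mono)
      fix s
      have "Lp_norm (4/3) (\<lambda>x. (A s h x - a s x) * (A s h x + a s x) * V h x) \<le> Lp_norm 4 (\<lambda>x. A s h x - a s x) * Lp_norm 4 (\<lambda>x. A s h x + a s x) * Lp_norm 4 (V h)"
        using T(2) by auto
      also have "\<dots> \<le> Lp_norm 4 (\<lambda>x. A s h x - a s x) * Lp_norm 4 (\<lambda>x. A s h x + a s x) * Lp_norm (4/3) (gh h)"
        by (intro mult_left_mono solution_bound(2)[OF Vh Ah gh] mult_nonneg_nonneg Lp_norm_nonneg)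
      finally show "Lp_norm (4/3) (\<lambda>x. (A s h x - a s x) * (A s h x + a s x) * V h x) \<le> \<dots>" .
    qed
    finally have "Lp_norm (4/3) (r h) \<le> ?b h" by simp
    then show ?case using V4 S(4,5) by linarith
  qed
  have 1: "((\<lambda>h. Lp_norm 4 (\<lambda>x. V h x - v x)) \<longlongrightarrow> 0) F"
    by (rule Lim_null_comparison[of _ ?b]) (use E bl in \<open>auto simp: abs_of_nonneg[OF Lp_norm_nonneg] elim!: eventually_mono\<close>)
  show "((\<lambda>h. gnorm (\<lambda>i x. K h i x - G i x)) \<longlongrightarrow> 0) F"
    by (rule Lim_null_comparison[of _ ?b]) (use E bl in \<open>auto simp: abs_of_nonneg[OF gnorm_nonneg] elim!: eventually_mono\<close>)
  show "Lp_lim F 4 V v" using 1 E v4 by (auto simp: Lp_lim_def elim: eventually_mono)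
qed

lemma ell_lim:
  assumes D: "Lp_lim sequentially 4 D w" and r: "Lp_lim sequentially (4/3) r0 r" and a: "\<And>s. in_Lp 4 (a s)"
    and e: "\<And>n::nat. ell (qf a) (r0 n) (D n)"
  shows "ell (qf a) r w"
  unfolding ell_def
proof (intro allI impI)
  fix \<psi> :: "real^4 \<Rightarrow> real" assume \<psi>: "test \<psi>"
  have p4: "in_Lp 4 \<psi>" by (rule test_in_Lp[OF \<psi>]) simp
  have c: "(4::real) > 1" "(4/3::real) > 1" "1 / 4 + 1 / (4/3) = (1::real)" "1 / (4/3) + 1 / 4 = (1::real)" by auto
  have 1: "(\<lambda>n. LINT x|lborel. D n x * lap \<psi> x) \<longlonglongrightarrow> (LINT x|lborel. w x * lap \<psi> x)"
    by (rule Lp_lim_integral[OF c(1-3) D test_in_Lp[OF test_lap[OF \<psi>]]]) simp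
  have 2: "(\<lambda>n. LINT x|lborel. D n x * (qf a x * \<psi> x)) \<longlonglongrightarrow> (LINT x|lborel. w x * (qf a x * \<psi> x))"
    by (rule Lp_lim_integral[OF c(1-3) D qf_mult_in_Lp[OF a p4]])
  have 3: "(\<lambda>n. LINT x|lborel. r0 n x * \<psi> x) \<longlonglongrightarrow> (LINT x|lborel. r x * \<psi> x)"
    by (rule Lp_lim_integral[OF c(2,1,4) r p4])
  have E: "(LINT x|lborel. D n x * lap \<psi> x) - (LINT x|lborel. D n x * (qf a x * \<psi> x)) = (LINT x|lborel. r0 n x * \<psi> x)" for n
    using e[of n] \<psi> unfolding ell_def by (simp add: mult_ac)
  have "(LINT x|lborel. w x * lap \<psi> x) - (LINT x|lborel. w x * (qf a x * \<psi> x)) = (LINT x|lborel. r x * \<psi> x)"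
    by (rule LIMSEQ_unique[OF tendsto_diff[OF 1 2]]) (unfold E, rule 3)
  then show "(LINT x|lborel. lap \<psi> x * w x) - (LINT x|lborel. \<psi> x * (qf a x * w x)) = (LINT x|lborel. \<psi> x * r x)"
    by (simp add: mult_ac)
qed

text \<open>The difference quotients of the solution solve the equation with convergent right-hand sides; by the
energy estimate they are Cauchy, so that their limit exists without an existence theory for the equation.\<close>

lemma solution_deriv:
  fixes A :: "bool \<Rightarrow> real \<Rightarrow> real^4 \<Rightarrow> real"
  assumes nt: "at (0::real) within H \<noteq> bot"
    and A: "\<And>s. Lp_deriv (at 0 within H) 4 (A s) (a s) (a' s)"
    and g: "Lp_deriv (at 0 within H) (4/3) gh g g'"
    and V: "\<forall>\<^sub>F h in at 0 within H. H1 (V h) (K h) \<and> ell (qf (\<lambda>s. A s h)) (gh h) (V h)"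
    and v: "H1 v G" "ell (qf a) g v"
  shows "\<exists>w W. H1 w W \<and> ell (qf a) (\<lambda>x. g' x + (\<Sum>s\<in>UNIV. a' s x * (a s x + a s x) * v x)) w
    \<and> Lp_deriv (at 0 within H) 4 V v w"
proof -
  let ?F = "at (0::real) within H"
  have Al: "Lp_lim ?F 4 (A s) (a s)" for s by (rule Lp_deriv_lim[OF _ A]) simp
  have gl: "Lp_lim ?F (4/3) gh g" by (rule Lp_deriv_lim[OF _ g]) simp
  have Vl: "Lp_lim ?F 4 V v" by (rule solution_lim(1)[OF Al gl V v])
  have a4: "in_Lp 4 (a s)" for s using Al by (rule Lp_lim_in_Lp)
  have gin: "in_Lp (4/3) g" using gl by (rule Lp_lim_in_Lp)
  have As: "\<forall>\<^sub>F h in ?F. in_Lp 4 (A s h)" for s using Al[of s] by (simp add: Lp_lim_def)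
  define D where "D h x = (V h x - v x) / h" for h x
  define M where "M h i x = (K h i x - G i x) / h" for h i x
  \<comment> \<open>The right-hand side of \<open>solution_diff\<close> divided by \<open>h\<close>;
    in every product the division is given to the coefficient difference, whose quotient
    converges.\<close>
  define R where "R h x = (gh h x - g x) / h + (\<Sum>s\<in>UNIV. (A s h x - a s x) / h * (A s h x + a s x) * V h x)" for h x
  define r where "r x = g' x + (\<Sum>s\<in>UNIV. a' s x * (a s x + a s x) * v x)" for x
  have Rl: "Lp_lim ?F (4/3) R r"
    unfolding R_def r_def using A g
    by (intro Lp_lim_add Lp_lim_sum Lp_lim_mult3 Al Vl Lp_lim_const a4) (auto simp: Lp_deriv_def)
  have rin: "in_Lp (4/3) r" using Rl by (rule Lp_lim_in_Lp)
  have "\<forall>\<^sub>F h in ?F. (\<forall>s. in_Lp 4 (A s h)) \<and> in_Lp (4/3) (gh h) \<and> H1 (V h) (K h) \<and> ell (qf (\<lambda>s. A s h)) (gh h) (V h) \<and> in_Lp (4/3) (R h)"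
    using gl V Rl by (intro eventually_conj eventually_all_finite As) (auto simp: Lp_lim_def elim: eventually_mono)
  then have ev: "\<forall>\<^sub>F h in ?F. H1 (D h) (M h) \<and> ell (qf a) (R h) (D h) \<and> in_Lp (4/3) (R h)"
  proof eventually_elim
    case (elim h)
    then have Ah: "\<And>s. in_Lp 4 (A s h)" and gh: "in_Lp (4/3) (gh h)" and Vh: "H1 (V h) (K h)" "ell (qf (\<lambda>s. A s h)) (gh h) (V h)"
      and Rh: "in_Lp (4/3) (R h)" by auto
    note S = solution_diff[OF Vh v Ah a4 gh gin]
    have "H1 (D h) (M h)" using H1_cmult[OF S(2), of "1/h"] unfolding D_def M_def by simp
    moreover have "(\<lambda>x. 1/h * (gh h x - g x + (\<Sum>s\<in>UNIV. (A s h x - a s x) * (A s h x + a s x) * V h x))) = R h"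
      unfolding R_def by (simp only: times_divide_eq_left mult_1_left add_divide_distrib sum_divide_distrib)
    then have "ell (qf a) (R h) (D h)" using ell_cmult[OF S(3), of "1/h"] by (simp add: D_def[abs_def])
    ultimately show ?case using Rh by blast
  qed
  \<comment> \<open>Completeness is available for sequences, so the candidate limit is first taken
    along a sequence in \<open>H\<close> tending to 0.\<close>
  have "0 islimpt H" using nt by (simp add: trivial_limit_within)
  then obtain \<sigma>0 where \<sigma>0: "\<And>n. \<sigma>0 n \<in> H - {0}" "\<sigma>0 \<longlonglongrightarrow> 0" unfolding islimpt_sequential by auto
  have fl: "filterlim \<sigma>0 ?F sequentially"
    using \<sigma>0 by (auto simp: filterlim_at intro!: always_eventually)
  then have "\<forall>\<^sub>F n in sequentially. H1 (D (\<sigma>0 n)) (M (\<sigma>0 n)) \<and> ell (qf a) (R (\<sigma>0 n)) (D (\<sigma>0 n)) \<and> in_Lp (4/3) (R (\<sigma>0 n))"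
    using ev by (rule eventually_compose_filterlim[rotated])
  then obtain N where N: "\<And>n. n \<ge> N \<Longrightarrow> H1 (D (\<sigma>0 n)) (M (\<sigma>0 n)) \<and> ell (qf a) (R (\<sigma>0 n)) (D (\<sigma>0 n)) \<and> in_Lp (4/3) (R (\<sigma>0 n))"
    by (auto simp: eventually_sequentially)
  define \<sigma> where "\<sigma> n = \<sigma>0 (n + N)" for n
  have sD: "H1 (D (\<sigma> n)) (M (\<sigma> n))" and sE: "ell (qf a) (R (\<sigma> n)) (D (\<sigma> n))" and sR: "in_Lp (4/3) (R (\<sigma> n))" for n
    using N[of "n + N"] by (auto simp: \<sigma>_def)
  have fl2: "filterlim \<sigma> ?F sequentially"
    unfolding \<sigma>_def using fl filterlim_compose filterlim_add_const_nat_at_top by blast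
  have Rs: "Lp_lim sequentially (4/3) (\<lambda>n. R (\<sigma> n)) r"
    using Rl sR filterlim_compose[OF _ fl2, of "\<lambda>h. Lp_norm (4/3) (\<lambda>y. R h y - r y)"] by (auto simp: Lp_lim_def)
  \<comment> \<open>Both quotients solve with the same potential \<open>a\<close>, so the
    coefficient terms of \<open>solution_diff\<close> vanish and only the difference of the
    right-hand sides remains.\<close>
  have est: "gnorm (\<lambda>i x. M (\<sigma> m) i x - M (\<sigma> n) i x) \<le> Lp_norm (4/3) (\<lambda>x. R (\<sigma> m) x - R (\<sigma> n) x)" for m n
    using solution_diff(4)[OF sD sE sD sE a4 a4 sR sR, of m n] by simp
  have "\<exists>N. \<forall>m\<ge>N. \<forall>n\<ge>N. gnorm (\<lambda>i x. M (\<sigma> m) i x - M (\<sigma> n) i x) < e" if e: "e > 0" for e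
  proof -
    have "\<forall>\<^sub>F n in sequentially. Lp_norm (4/3) (\<lambda>x. R (\<sigma> n) x - r x) < e / 2"
      using Rs e unfolding Lp_lim_def by (intro order_tendstoD) auto
    then obtain N where N: "\<And>n. n \<ge> N \<Longrightarrow> Lp_norm (4/3) (\<lambda>x. R (\<sigma> n) x - r x) < e / 2" by (auto simp: eventually_sequentially)
    have "gnorm (\<lambda>i x. M (\<sigma> m) i x - M (\<sigma> n) i x) < e" if "m \<ge> N" "n \<ge> N" for m n
      using est[of m n] Lp_triangle[OF _ sR rin sR, of m n] N[OF that(1)] N[OF that(2)] Lp_norm_minus_commute[of "4/3" r "R (\<sigma> n)"] by simp
    then show ?thesis by blast
  qed
  from H1_complete[OF sD this] obtain w W where w: "H1 w W" "Lp_lim sequentially 4 (\<lambda>n. D (\<sigma> n)) w" by blast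
  have we: "ell (qf a) r w" by (rule ell_lim[OF w(2) Rs a4 sE])
  \<comment> \<open>As \<open>w\<close> solves the limit equation, continuous dependence with the
    fixed potential \<open>a\<close> extends the convergence from the sequence to the whole
    filter.\<close>
  have "Lp_lim ?F 4 D w"
    by (rule solution_lim(1)[OF Lp_lim_const[OF _ a4] Rl _ w(1) we, where K=M]) (use ev in \<open>auto elim: eventually_mono\<close>)
  then have "Lp_deriv ?F 4 V v w"
    using Vl unfolding Lp_deriv_def D_def[abs_def] by (simp add: Lp_lim_def)
  then show ?thesis using w(1) we unfolding r_def by blast
qed

section \<open>Weak derivatives in one variable\<close>

text \<open>A bridge between the gauge integral in time used by \<open>pair\<close> and the Lebesgue
  integral over the line used for translations and almost-everywhere arguments.\<close>

lemma integral_eq_LINT: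
  fixes k :: "real \<Rightarrow> real"
  assumes c: "continuous_on UNIV k" and out: "\<And>t. t \<notin> {a..b} \<Longrightarrow> k t = 0"
  shows "integrable lborel k" "integral {a..b} k = (LINT t|lborel. k t)"
proof -
  have s: "set_integrable lborel {a..b} k"
    by (rule borel_integrable_atLeastAtMost') (rule continuous_on_subset[OF c], simp)
  have e: "(\<lambda>t. indicator {a..b} t *\<^sub>R k t) = k" using out by (auto simp: fun_eq_iff indicator_def)
  show "integrable lborel k" using s unfolding set_integrable_def e .
  show "integral {a..b} k = (LINT t|lborel. k t)"
    using set_borel_integral_eq_integral(2)[OF s] unfolding set_lebesgue_integral_def e by simp
qed

lemma tsupport_subset_interval:
  fixes \<rho> :: "real \<Rightarrow> real"
  assumes "test \<rho>" "tsupport \<rho> \<subseteq> {a<..<b}" "a < b"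
  shows "\<exists>c d. a < c \<and> c \<le> d \<and> d < b \<and> (\<forall>t. t \<notin> {c..d} \<longrightarrow> \<rho> t = 0)"
proof (cases "tsupport \<rho> = {}")
  case True
  show ?thesis
    by (rule exI[of _ "(a+b)/2"], rule exI[of _ "(a+b)/2"]) (use assms(3) True not_in_tsupport[of _ \<rho>] in auto)
next
  case False
  have c: "compact (tsupport \<rho>)" using assms(1) unfolding test_def using compact_tsupportI[of _ \<rho>] by blast
  obtain c where c1: "c \<in> tsupport \<rho>" "\<And>t. t \<in> tsupport \<rho> \<Longrightarrow> c \<le> t" using compact_attains_inf[OF c False] by blast
  obtain d where d1: "d \<in> tsupport \<rho>" "\<And>t. t \<in> tsupport \<rho> \<Longrightarrow> t \<le> d" using compact_attains_sup[OF c False] by blast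
  show ?thesis
  proof (rule exI[of _ c], rule exI[of _ d], intro conjI allI impI)
    show "a < c" "d < b" "c \<le> d" using c1 d1 assms(2) by auto
    show "\<rho> t = 0" if "t \<notin> {c..d}" for t
      by (rule not_in_tsupport) (use that c1(2) d1(2) in auto)
  qed
qed

text \<open>The fundamental lemma of the calculus of variations: around a point with
  \<open>B t0 \<noteq> 0\<close> the product \<open>B t * B t0\<close> is positive, and a bump
  supported there gives it a positive integral.\<close>

lemma continuous_zero_of_weak_zero:
  fixes B :: "real \<Rightarrow> real"
  assumes B: "continuous_on UNIV B"
    and w: "\<And>\<rho>. test \<rho> \<Longrightarrow> tsupport \<rho> \<subseteq> {a<..<b} \<Longrightarrow> (LINT t|lborel. \<rho> t * B t) = 0"
    and t0: "t0 \<in> {a<..<b}"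
  shows "B t0 = 0"
proof (rule ccontr)
  assume nz: "B t0 \<noteq> 0"
  have "isCont B t0" using B by (simp add: continuous_on_eq_continuous_at)
  then have "\<forall>\<^sub>F t in at t0. \<bar>B t - B t0\<bar> < \<bar>B t0\<bar>"
    using nz by (intro order_tendstoD(2)[of _ 0] tendsto_rabs_zero) (auto simp: LIM_zero_iff isCont_def)
  then obtain d1 where d1: "d1 > 0" "\<And>t. t \<noteq> t0 \<Longrightarrow> dist t t0 < d1 \<Longrightarrow> \<bar>B t - B t0\<bar> < \<bar>B t0\<bar>"
    unfolding eventually_at by auto
  define d where "d = min d1 (min (t0 - a) (b - t0)) / 2"
  have d: "d > 0" "d < d1" "a < t0 - d" "t0 + d < b" using d1(1) t0 by (auto simp: d_def min_def field_simps)
  have sgn: "0 < B t * B t0" if "\<bar>t - t0\<bar> \<le> d" for t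
  proof (cases "t = t0")
    case True
    then show ?thesis using nz by (auto simp: zero_less_mult_iff linorder_neq_iff)
  next
    case False
    then have "\<bar>B t - B t0\<bar> < \<bar>B t0\<bar>" using d1(2)[of t] that d(2) by (simp add: dist_real_def)
    then show ?thesis by (cases "B t0 > 0") (auto simp: zero_less_mult_iff)
  qed
  define \<rho> where "\<rho> t = bump d (t - t0)" for t :: real
  have tr: "test \<rho>" using test_affine[of "bump d" 1 "- t0"] test_bump[of d] by (simp add: \<rho>_def[abs_def])
  have pos: "0 < \<rho> t \<longleftrightarrow> \<bar>t - t0\<bar> < d" for t by (simp add: \<rho>_def bump_pos_iff)
  have out: "\<rho> t = 0" if "t \<notin> {t0 - d..t0 + d}" for t
  proof -
    have "\<not> 0 < \<rho> t" unfolding pos using that by auto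
    then show ?thesis using bump_nonneg[of d "t - t0"] by (simp add: \<rho>_def)
  qed
  have "tsupport \<rho> \<subseteq> {t0 - d..t0 + d}" using compact_tsupportI[of "{t0 - d..t0 + d}" \<rho>] out by auto
  then have "tsupport \<rho> \<subseteq> {a<..<b}" using d by auto
  from w[OF tr this] have z: "(LINT t|lborel. \<rho> t * B t * B t0) = 0" by simp
  have nn: "0 \<le> \<rho> t * B t * B t0" for t
  proof (cases "t \<in> {t0 - d..t0 + d}")
    case True
    then have "\<bar>t - t0\<bar> \<le> d" by auto
    then have "0 \<le> B t * B t0" by (rule less_imp_le[OF sgn])
    moreover have "0 \<le> \<rho> t" by (simp add: \<rho>_def bump_nonneg)
    ultimately have "0 \<le> \<rho> t * (B t * B t0)" by (rule mult_nonneg_nonneg[rotated])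
    then show ?thesis by (simp add: mult.assoc)
  qed (simp add: out)
  have i: "integrable lborel (\<lambda>t. \<rho> t * B t * B t0)"
    by (rule integral_eq_LINT(1)[of _ "t0 - d" "t0 + d"]) (auto intro!: continuous_intros B test_continuous[OF tr] simp: out)
  have "AE t in lborel. \<rho> t * B t * B t0 = 0" using integral_nonneg_eq_0_iff_AE[OF i] nn z by simp
  then have "AE t in lborel. t \<notin> ball t0 d"
  proof eventually_elim
    case (elim t)
    show ?case
    proof
      assume "t \<in> ball t0 d"
      then have "\<bar>t - t0\<bar> < d" by (auto simp: dist_real_def)
      then have "0 < \<rho> t * (B t * B t0)" using pos[of t] sgn[of t] mult_pos_pos[of "\<rho> t" "B t * B t0"] by auto
      moreover have "\<rho> t * (B t * B t0) = 0" using elim by (simp only: mult.assoc)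
      ultimately show False by linarith
    qed
  qed
  then have "ball t0 d \<in> null_sets lborel" by (subst AE_iff_null_sets) auto
  then have "measure lborel (ball t0 d) = 0" by (simp add: null_sets_def measure_def)
  then show False using content_ball_pos[OF d(1), of t0] by simp
qed

lemma dd_real_eqI: "(g has_real_derivative D) (at t) \<Longrightarrow> dd (1::real) g t = D"
proof (rule dd_eqI)
  assume "(g has_real_derivative D) (at t)"
  then show "((\<lambda>s. g (t + s *\<^sub>R 1)) has_real_derivative D) (at 0)"
    using DERIV_shift[of g D 0 t] by (simp add: add.commute)
qed

lemma dd_real_deriv: "smooth g \<Longrightarrow> (g has_real_derivative dd (1::real) g t) (at t)"
  using smooth_has_derivative[of g 1 0 t] by simp

text \<open>A function minus its translate has integral zero, so its antiderivative vanishes beyond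
  the supports and is a test function. It serves to compare the values of a function at
  \<open>s\<close> and at \<open>s + h\<close>.\<close>

lemma test_antiderivative_shift:
  fixes \<rho> :: "real \<Rightarrow> real"
  assumes \<rho>: "test \<rho>" "tsupport \<rho> \<subseteq> {0<..<T - h}" and h: "0 < h" "h < T"
  shows "\<exists>\<theta>. test \<theta> \<and> tsupport \<theta> \<subseteq> {0<..<T} \<and> (\<forall>t. dd 1 \<theta> t = \<rho> t - \<rho> (t - h))"
proof -
  obtain c d where cd: "0 < c" "c \<le> d" "d < T - h" "\<And>t. t \<notin> {c..d} \<Longrightarrow> \<rho> t = 0"
    using tsupport_subset_interval[OF \<rho>] h(2) by (metis diff_gt_0_iff_gt)
  define \<kappa> where "\<kappa> t = \<rho> t - \<rho> (t - h)" for t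
  have t\<rho>: "test (\<lambda>t. \<rho> (t - h))" using test_affine[OF \<rho>(1), of 1 "- h"] by simp
  have t\<kappa>: "test \<kappa>" unfolding \<kappa>_def by (rule test_diff[OF \<rho>(1) t\<rho>])
  have \<kappa>0: "\<kappa> t = 0" if "t \<notin> {c..d + h}" for t using that cd(4)[of t] cd(4)[of "t - h"] h by (auto simp: \<kappa>_def)
  have c\<kappa>: "continuous_on UNIV \<kappa>" by (rule test_continuous[OF t\<kappa>])
  \<comment> \<open>Any lower limit left of the support would do; the support begins at
    \<open>c > 0\<close>.\<close>
  define \<theta> where "\<theta> r = integral {-1..r} \<kappa>" for r
  have low: "\<theta> r = 0" if "r < c" for r
  proof -
    have "\<theta> r = integral {-1..r} (\<lambda>_. 0)"
      unfolding \<theta>_def by (rule Henstock_Kurzweil_Integration.integral_cong) (use that \<kappa>0 in auto)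
    then show ?thesis by simp
  qed
  have i1: "integrable lborel \<rho>" by (rule integral_eq_LINT(1)[OF test_continuous[OF \<rho>(1)] cd(4)])
  note tr = lborel_translate[OF borel_measurable_continuous_onI[OF test_continuous[OF \<rho>(1)]], of "- h"]
  have i: "integrable lborel \<rho>" "integrable lborel (\<lambda>t. \<rho> (t - h))" using i1 tr(2) by simp_all
  have k0: "(LINT t|lborel. \<kappa> t) = 0"
    unfolding \<kappa>_def using i tr(1) by simp
  have high: "\<theta> r = 0" if "r > d + h" for r
  proof -
    have "integral {-1..r} \<kappa> = (LINT t|lborel. \<kappa> t)"
      by (rule integral_eq_LINT(2)[OF c\<kappa>], rule \<kappa>0) (use that cd in auto)
    then show ?thesis using k0 by (simp add: \<theta>_def)
  qed
  have D: "(\<theta> has_real_derivative \<kappa> r) (at r)" for r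
  proof (cases "r < c")
    case True
    have "((\<lambda>_. 0) has_real_derivative 0) (at r)" by simp
    then have "(\<theta> has_real_derivative 0) (at r)"
      by (rule has_field_derivative_transform_within_open[of _ _ _ "{..<c}"]) (use True low in auto)
    then show ?thesis using \<kappa>0[of r] True by simp
  next
    case False
    have "((\<lambda>u. integral {-1..u} \<kappa>) has_real_derivative \<kappa> r) (at r within {-1..r+1})"
      by (rule integral_has_real_derivative) (use False cd continuous_on_subset[OF c\<kappa>] in auto)
    then show ?thesis unfolding \<theta>_def[abs_def] using False cd at_within_Icc_at[of "-1" r "r+1"] by simp
  qed
  have dd: "dd 1 \<theta> = \<kappa>" using D by (intro ext dd_real_eqI)
  have "smooth \<theta>"
  proof (rule smooth.intros)
    show "continuous_on UNIV \<theta>" using D DERIV_isCont continuous_at_imp_continuous_on by blast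
    show "\<forall>v\<in>Basis. \<forall>x. (\<lambda>s. \<theta> (x + s *\<^sub>R v)) differentiable at 0"
      using D DERIV_shift[of \<theta> _ 0] by (auto intro!: real_differentiableI simp: add.commute)
    show "\<forall>v\<in>Basis. smooth (dd v \<theta>)" using dd test_smooth[OF t\<kappa>] by simp
  qed
  moreover have out: "\<theta> r = 0" if "r \<notin> {c..d + h}" for r using low[of r] high[of r] that by force
  ultimately have "test \<theta>" unfolding test_def by (meson compact_Icc)
  moreover have "tsupport \<theta> \<subseteq> {c..d + h}" using compact_tsupportI[of "{c..d + h}" \<theta>] out by auto
  ultimately show ?thesis using dd cd h by (intro exI[of _ \<theta>]) (auto simp: \<kappa>_def)
qed

text \<open>With \<open>P\<close> a primitive of \<open>B\<close>, the difference
  \<open>E = A - P\<close> has weak derivative zero. Testing it with the functions of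
  \<open>test_antiderivative_shift\<close> gives \<open>E s = E (s + h)\<close>, so that
  \<open>E\<close> is constant and \<open>A\<close> is as differentiable as
  \<open>P\<close>.\<close>

lemma deriv_of_weak_deriv:
  fixes A B :: "real \<Rightarrow> real"
  assumes A: "continuous_on UNIV A" and B: "continuous_on UNIV B" and T: "T > 0"
    and w: "\<And>\<theta>. test \<theta> \<Longrightarrow> tsupport \<theta> \<subseteq> {0<..<T} \<Longrightarrow> (LINT t|lborel. \<theta> t * B t) = - (LINT t|lborel. dd 1 \<theta> t * A t)"
    and t: "t \<in> {0<..<T}"
  shows "(A has_real_derivative B t) (at t)"
proof -
  define cl where "cl t = max 0 (min T t)" for t
  define P where "P t = integral {0..cl t} B" for t
  have P0: "continuous_on {0..T} (\<lambda>u. integral {0..u} B)"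
    by (intro indefinite_integral_continuous_1 integrable_continuous_interval continuous_on_subset[OF B]) simp
  have Pc: "continuous_on UNIV P" unfolding P_def
    by (rule continuous_on_compose2[OF P0]) (use T in \<open>auto simp: cl_def intro!: continuous_intros\<close>)
  have Pd: "(P has_real_derivative B r) (at r)" if r: "r \<in> {0<..<T}" for r
  proof -
    have "((\<lambda>u. integral {0..u} B) has_real_derivative B r) (at r within {0..T})"
      by (rule integral_has_real_derivative) (use r continuous_on_subset[OF B] in auto)
    then have "((\<lambda>u. integral {0..u} B) has_real_derivative B r) (at r)" using r at_within_Icc_at[of 0 r T] by simp
    then show ?thesis
      by (rule has_field_derivative_transform_within_open[of _ _ _ "{0<..<T}"]) (use r in \<open>auto simp: P_def cl_def\<close>)
  qed
  define E where "E t = A t - P t" for t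
  have Ec: "continuous_on UNIV E" unfolding E_def by (intro continuous_intros A Pc)
  have wE: "(LINT t|lborel. dd 1 \<theta> t * E t) = 0" if \<theta>: "test \<theta>" "tsupport \<theta> \<subseteq> {0<..<T}" for \<theta>
  proof -
    obtain c d where cd: "0 < c" "c \<le> d" "d < T" "\<And>t. t \<notin> {c..d} \<Longrightarrow> \<theta> t = 0"
      using tsupport_subset_interval[OF \<theta> T] by blast
    have d0: "dd 1 \<theta> t = 0" if "t \<notin> {c..d}" for t by (rule dd_eq_0_outside[of "{c..d}"]) (use cd that in auto)
    have cc: "continuous_on UNIV (dd 1 \<theta>)" "continuous_on UNIV \<theta>"
      using test_continuous[OF test_dd[OF \<theta>(1)]] test_continuous[OF \<theta>(1)] by auto
    have i: "integrable lborel (\<lambda>t. dd 1 \<theta> t * P t)" "integrable lborel (\<lambda>t. \<theta> t * B t)" "integrable lborel (\<lambda>t. dd 1 \<theta> t * A t)"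
      by (rule integral_eq_LINT(1)[of _ c d]; use d0 cd(4) in \<open>auto intro!: continuous_intros cc A B Pc\<close>)+
    have "((\<lambda>t. dd 1 \<theta> t * P t + \<theta> t * B t) has_integral (\<theta> T * P T - \<theta> 0 * P 0)) {0..T}"
    proof (rule fundamental_theorem_of_calculus_interior)
      show "continuous_on {0..T} (\<lambda>t. \<theta> t * P t)"
        by (intro continuous_on_mult continuous_on_subset[OF cc(2)] continuous_on_subset[OF Pc]) auto
      fix r assume "r \<in> {0<..<T}"
      then show "((\<lambda>t. \<theta> t * P t) has_vector_derivative dd 1 \<theta> r * P r + \<theta> r * B r) (at r)"
        using DERIV_mult[OF dd_real_deriv[OF test_smooth[OF \<theta>(1)]] Pd, of r]
        by (simp add: has_real_derivative_iff_has_vector_derivative[symmetric] mult_ac add.commute)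
    qed (use T in simp)
    then have "integral {0..T} (\<lambda>t. dd 1 \<theta> t * P t + \<theta> t * B t) = 0" using cd(4)[of T] cd(4)[of 0] cd(1-3) by (simp add: integral_unique)
    moreover have "integral {0..T} (\<lambda>t. dd 1 \<theta> t * P t + \<theta> t * B t) = (LINT t|lborel. dd 1 \<theta> t * P t + \<theta> t * B t)"
      by (rule integral_eq_LINT(2)) (use d0 cd in \<open>auto intro!: continuous_intros cc B Pc\<close>)
    ultimately have "(LINT t|lborel. dd 1 \<theta> t * P t) + (LINT t|lborel. \<theta> t * B t) = 0" using i by simp
    then show ?thesis unfolding E_def right_diff_distrib using i w[OF \<theta>] by simp
  qed
  have const: "E s = E (s + h)" if h: "0 < h" "h < T" and s: "s \<in> {0<..<T - h}" for s h
  proof -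
    have Eh: "continuous_on UNIV (\<lambda>r. E (r + h))" by (rule continuous_on_compose2[OF Ec]) (auto intro: continuous_intros)
    have "E s - E (s + h) = 0"
    proof (rule continuous_zero_of_weak_zero[OF _ _ s])
      show "continuous_on UNIV (\<lambda>s. E s - E (s + h))" by (intro continuous_intros Ec Eh)
      fix \<rho> :: "real \<Rightarrow> real" assume \<rho>: "test \<rho>" "tsupport \<rho> \<subseteq> {0<..<T - h}"
      obtain c d where cd: "\<And>t. t \<notin> {c..d} \<Longrightarrow> \<rho> t = 0" using tsupport_subset_interval[OF \<rho>] h(2) by (metis diff_gt_0_iff_gt)
      have rc: "continuous_on UNIV \<rho>" by (rule test_continuous[OF \<rho>(1)])
      obtain \<theta> where \<theta>: "test \<theta>" "tsupport \<theta> \<subseteq> {0<..<T}" "\<And>t. dd 1 \<theta> t = \<rho> t - \<rho> (t - h)"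
        using test_antiderivative_shift[OF \<rho> h] by blast
      have i1: "integrable lborel (\<lambda>t. \<rho> t * E t)" "integrable lborel (\<lambda>t. \<rho> t * E (t + h))"
        by (rule integral_eq_LINT(1)[of _ c d]; use cd in \<open>auto intro!: continuous_intros rc Ec Eh\<close>)+
      have m: "(\<lambda>t. \<rho> t * E (t + h)) \<in> borel_measurable borel"
        by (rule borel_measurable_continuous_onI) (intro continuous_intros rc Eh)
      have i2: "integrable lborel (\<lambda>t. \<rho> (t - h) * E t)" and e2: "(LINT t|lborel. \<rho> (t - h) * E t) = (LINT t|lborel. \<rho> t * E (t + h))"
        using lborel_translate[OF m, of "- h"] i1(2) by auto
      have "(LINT t|lborel. \<rho> t * E t) - (LINT t|lborel. \<rho> (t - h) * E t) = 0"
        using wE[OF \<theta>(1,2)] i1 i2 unfolding \<theta>(3) left_diff_distrib by simp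
      then show "(LINT t|lborel. \<rho> t * (E t - E (t + h))) = 0" unfolding right_diff_distrib using i1 e2 by simp
    qed
    then show ?thesis by simp
  qed
  have "E r = E t" if "r \<in> {0<..<T}" for r
  proof -
    have r: "0 < r" "r < T" and t': "0 < t" "t < T" using that t by auto
    consider "r < t" | "r = t" | "r > t" by linarith
    then show ?thesis
    proof cases
      case 1
      then show ?thesis using const[of "t - r" r] r t' by simp
    next
      case 3
      then show ?thesis using const[of "r - t" t] r t' by simp
    qed simp
  qed
  then have AP: "P r + E t = A r" if "r \<in> {0<..<T}" for r using that by (simp add: E_def algebra_simps)
  have "((\<lambda>r. P r + E t) has_real_derivative B t) (at t)" using Pd[OF t] by (auto intro!: derivative_eq_intros)
  then show ?thesis
    by (rule has_field_derivative_transform_within_open[of _ _ _ "{0<..<T}"]) (use t AP in auto)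
qed

section \<open>Space-time derivatives\<close>

definition contLp :: "real \<Rightarrow> real \<Rightarrow> (real \<Rightarrow> real^4 \<Rightarrow> real) \<Rightarrow> bool" where
  "contLp T p g \<longleftrightarrow> (\<forall>t\<in>{0..T}. in_Lp p (g t)) \<and>
     (\<forall>t\<in>{0..T}. ((\<lambda>s. Lp_norm p (\<lambda>x. g s x - g t x)) \<longlongrightarrow> 0) (at t within {0..T}))"

text \<open>A single distributional derivative; higher ones are handled as chains of such steps
  along words of directions.\<close>

definition wdst :: "real \<Rightarrow> real \<times> (real^4) \<Rightarrow> (real \<Rightarrow> real^4 \<Rightarrow> real) \<Rightarrow> (real \<Rightarrow> real^4 \<Rightarrow> real) \<Rightarrow> bool" where
  "wdst T e g G \<longleftrightarrow> (\<forall>\<psi>. test_st T \<psi> \<longrightarrow> pair T G \<psi> = - pair T g (dd e \<psi>))"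

lemma eventually_at_within_mem: "\<forall>\<^sub>F s in at t within S. s \<in> S"
  by (simp add: eventually_at_filter)

lemma contLp_lim: "contLp T p g \<Longrightarrow> t \<in> {0..T} \<Longrightarrow> Lp_lim (at t within {0..T}) p g (g t)"
  unfolding contLp_def Lp_lim_def
  by (auto intro: eventually_mono[OF eventually_at_within_mem])

lemma contLp_integral_continuous:
  assumes p: "p > 1" and g: "contLp T p g" and \<rho>: "test \<rho>"
  shows "continuous_on {0..T} (\<lambda>t. LINT x|lborel. \<rho> x * g t x)"
proof -
  define q where "q = p / (p - 1)"
  have q: "q > 1" "1 / p + 1 / q = 1" using p by (auto simp: q_def field_simps)
  have "((\<lambda>s. LINT x|lborel. g s x * \<rho> x) \<longlongrightarrow> (LINT x|lborel. g t x * \<rho> x)) (at t within {0..T})" if "t \<in> {0..T}" for t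
    by (rule Lp_lim_integral[OF p q contLp_lim[OF g that] test_in_Lp[OF \<rho>]]) (use q in simp)
  then show ?thesis by (simp add: continuous_on_def mult.commute)
qed

text \<open>Extends functions on \<open>[0,T]\<close> by constants to continuous functions on the
  line. Test functions in time are supported inside the interval, so the integrals do not
  change.\<close>

definition clamp_t :: "real \<Rightarrow> real \<Rightarrow> real" where
  "clamp_t T t = max 0 (min T t)"

lemma clamp_t: "0 \<le> T \<Longrightarrow> clamp_t T t \<in> {0..T}" "t \<in> {0..T} \<Longrightarrow> clamp_t T t = t" "continuous_on UNIV (clamp_t T)"
  unfolding clamp_t_def by (auto intro!: continuous_intros)

lemma clamp_continuous:
  assumes "0 \<le> T" "continuous_on {0..T} f"
  shows "continuous_on UNIV (\<lambda>t. f (clamp_t T t))"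
  by (rule continuous_on_compose2[OF assms(2) clamp_t(3)]) (use clamp_t(1)[OF assms(1)] in auto)

lemma test_st_product:
  assumes \<theta>: "test \<theta>" "tsupport \<theta> \<subseteq> {0<..<T}" and \<rho>: "test \<rho>"
  shows "test_st T (\<lambda>z. \<theta> (fst z) * \<rho> (snd z))"
proof -
  have s: "smooth (\<lambda>z. \<theta> (fst z) * \<rho> (snd z))"
    by (rule smooth_mult[OF smooth_fst[OF test_smooth[OF \<theta>(1)]] smooth_snd[OF test_smooth[OF \<rho>]]])
  have c: "compact (tsupport \<theta>)" "compact (tsupport \<rho>)"
    using \<theta>(1) \<rho> compact_tsupportI[of _ \<theta>] compact_tsupportI[of _ \<rho>] unfolding test_def by blast+
  have out: "\<theta> (fst z) * \<rho> (snd z) = 0" if "z \<notin> tsupport \<theta> \<times> tsupport \<rho>" for z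
    using that not_in_tsupport[of "fst z" \<theta>] not_in_tsupport[of "snd z" \<rho>] by (cases z) auto
  have "compact (tsupport (\<lambda>z. \<theta> (fst z) * \<rho> (snd z)))" "tsupport (\<lambda>z. \<theta> (fst z) * \<rho> (snd z)) \<subseteq> tsupport \<theta> \<times> tsupport \<rho>"
    using compact_tsupportI[OF compact_Times[OF c], of "\<lambda>z. \<theta> (fst z) * \<rho> (snd z)"] out by blast+
  then show ?thesis using s \<theta>(2) unfolding test_st_def by blast
qed

lemma dd_product:
  fixes \<theta> :: "real \<Rightarrow> real"
  assumes "smooth \<theta>" "smooth \<rho>"
  shows "dd (1, 0) (\<lambda>z. \<theta> (fst z) * \<rho> (snd z)) = (\<lambda>z. dd 1 \<theta> (fst z) * \<rho> (snd z))"
    and "e \<in> Basis \<Longrightarrow> dd (0, e) (\<lambda>z. \<theta> (fst z) * \<rho> (snd z)) = (\<lambda>z. \<theta> (fst z) * dd e \<rho> (snd z))"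
proof -
  have z: "dd 0 f x = 0" for f :: "'c::euclidean_space \<Rightarrow> real" and x by (simp add: dd_def)
  note m = dd_mult[OF smooth_fst[OF assms(1)] smooth_snd[OF assms(2)]]
  show "dd (1, 0) (\<lambda>z. \<theta> (fst z) * \<rho> (snd z)) = (\<lambda>z. dd 1 \<theta> (fst z) * \<rho> (snd z))"
    by (intro ext, subst m) (auto simp: Basis_prod_def dd_fst dd_snd z)
  show "e \<in> Basis \<Longrightarrow> dd (0, e) (\<lambda>z. \<theta> (fst z) * \<rho> (snd z)) = (\<lambda>z. \<theta> (fst z) * dd e \<rho> (snd z))"
    by (intro ext, subst m) (auto simp: Basis_prod_def dd_fst dd_snd z)
qed

lemma pair_product:
  assumes T: "T > 0" and p: "p > 1" and g: "contLp T p g" and \<theta>: "test \<theta>" "tsupport \<theta> \<subseteq> {0<..<T}" and \<rho>: "test \<rho>"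
  shows "pair T g (\<lambda>z. \<theta> (fst z) * \<rho> (snd z)) = (LINT t|lborel. \<theta> t * (LINT x|lborel. \<rho> x * g (clamp_t T t) x))"
    and "integrable lborel (\<lambda>t. \<theta> t * (LINT x|lborel. \<rho> x * g (clamp_t T t) x))"
proof -
  have out: "\<theta> t = 0" if "t \<notin> {0..T}" for t by (rule not_in_tsupport) (use that \<theta>(2) in auto)
  have c: "continuous_on UNIV (\<lambda>t. \<theta> t * (LINT x|lborel. \<rho> x * g (clamp_t T t) x))"
    using T by (intro continuous_intros test_continuous[OF \<theta>(1)] clamp_continuous[OF _ contLp_integral_continuous[OF p g \<rho>]]) simp
  show "integrable lborel (\<lambda>t. \<theta> t * (LINT x|lborel. \<rho> x * g (clamp_t T t) x))"
    by (rule integral_eq_LINT(1)[OF c, of 0 T]) (simp add: out)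
  have "pair T g (\<lambda>z. \<theta> (fst z) * \<rho> (snd z)) = integral {0..T} (\<lambda>t. \<theta> t * (LINT x|lborel. \<rho> x * g (clamp_t T t) x))"
    unfolding pair_def by (rule Henstock_Kurzweil_Integration.integral_cong) (simp add: clamp_t(2) mult.assoc)
  also have "\<dots> = (LINT t|lborel. \<theta> t * (LINT x|lborel. \<rho> x * g (clamp_t T t) x))"
    by (rule integral_eq_LINT(2)[OF c]) (simp add: out)
  finally show "pair T g (\<lambda>z. \<theta> (fst z) * \<rho> (snd z)) = (LINT t|lborel. \<theta> t * (LINT x|lborel. \<rho> x * g (clamp_t T t) x))" .
qed

lemma continuous_zero_closed_interval:
  fixes B :: "real \<Rightarrow> real"
  assumes T: "T > 0" and B: "continuous_on UNIV B"
    and w: "\<And>\<rho>. test \<rho> \<Longrightarrow> tsupport \<rho> \<subseteq> {0<..<T} \<Longrightarrow> (LINT t|lborel. \<rho> t * B t) = 0"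
    and t: "t \<in> {0..T}"
  shows "B t = 0"
proof -
  have "closed (B -` {0})" using B by (intro closed_vimage) (auto simp: continuous_on_closed_vimage)
  moreover have "{0<..<T} \<subseteq> B -` {0}" using continuous_zero_of_weak_zero[OF B w] by auto
  ultimately have "closure {0<..<T} \<subseteq> B -` {0}" by (rule closure_minimal[rotated])
  then show ?thesis using T t by auto
qed

text \<open>Product test functions \<open>\<theta> (t) \<rho> (x)\<close> show that a function of
  time vanishes weakly. Being continuous, it vanishes at every time, the end points
  included.\<close>

lemma slice_weak_deriv:
  assumes T: "T > 0" and p: "p > 1" and g: "contLp T p g" and G: "contLp T p G" and w: "wdst T (0, axis i 1) g G"
    and t: "t \<in> {0..T}"
  shows "wderiv (g t) i (G t)"
  unfolding wderiv_def
proof (intro allI impI)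
  fix \<rho> :: "real^4 \<Rightarrow> real" assume \<rho>: "test \<rho>"
  note d\<rho> = test_dd[OF \<rho> axis_in_Basis4, of i]
  define B where "B t = (LINT x|lborel. \<rho> x * G (clamp_t T t) x) + (LINT x|lborel. dd (axis i 1) \<rho> x * g (clamp_t T t) x)" for t
  have "B t = 0"
  proof (rule continuous_zero_closed_interval[OF T _ _ t])
    show "continuous_on UNIV B" unfolding B_def using T
      by (intro continuous_intros clamp_continuous[OF _ contLp_integral_continuous[OF p G \<rho>]] clamp_continuous[OF _ contLp_integral_continuous[OF p g d\<rho>]]) auto
    fix \<theta> :: "real \<Rightarrow> real" assume \<theta>: "test \<theta>" "tsupport \<theta> \<subseteq> {0<..<T}"
    have "pair T G (\<lambda>z. \<theta> (fst z) * \<rho> (snd z)) = - pair T g (\<lambda>z. \<theta> (fst z) * dd (axis i 1) \<rho> (snd z))"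
      using w[unfolded wdst_def, rule_format, OF test_st_product[OF \<theta> \<rho>]]
      unfolding dd_product(2)[OF test_smooth[OF \<theta>(1)] test_smooth[OF \<rho>] axis_in_Basis4] .
    then show "(LINT t|lborel. \<theta> t * B t) = 0"
      unfolding B_def distrib_left pair_product(1)[OF T p G \<theta> \<rho>] pair_product(1)[OF T p g \<theta> d\<rho>]
      using pair_product(2)[OF T p G \<theta> \<rho>] pair_product(2)[OF T p g \<theta> d\<rho>] by simp
  qed
  then show "(LINT x|lborel. \<rho> x * G t x) = - (LINT x|lborel. dd (axis i 1) \<rho> x * g t x)"
    using clamp_t(2)[OF t] by (simp add: B_def)
qed

text \<open>Tested against \<open>\<rho>\<close>, the quotient is that of a differentiable function
  of one real variable, so by the mean value theorem it equals the pairing of \<open>\<rho>\<close>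
  with \<open>G\<close> shifted by some \<open>r\<close>. The point \<open>r\<close> depends on
  \<open>\<rho>\<close>, but the translation error of \<open>G\<close> is bounded uniformly for
  \<open>|r| \<le> |h|\<close>, and duality turns this into a norm estimate.\<close>

lemma Lp_deriv_spaceI:
  assumes p: "p > 1" and g: "in_Lp p g" and G: "in_Lp p G" and w: "wderiv g i G"
  shows "Lp_deriv (at 0) p (\<lambda>h x. g (x + h *\<^sub>R axis i 1)) g G"
proof -
  define q where "q = p / (p - 1)"
  have q: "q > 1" "1 / p + 1 / q = 1" using p by (auto simp: q_def field_simps)
  have p0: "p > 0" and q0: "q > 0" using p q by auto
  let ?v = "axis i 1 :: real^4"
  let ?D = "\<lambda>h x. (g (x + h *\<^sub>R ?v) - g x) / h"
  have Din: "in_Lp p (?D h)" for h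
    using in_Lp_cmult[OF in_Lp_diff[OF p0 Lp_translate(1)[OF g] g], of "1/h" "h *\<^sub>R ?v"] by simp
  have "((\<lambda>h. Lp_norm p (\<lambda>x. ?D h x - G x)) \<longlongrightarrow> 0) (at 0)"
  proof (rule tendstoI)
    fix e :: real assume e: "e > 0"
    obtain d where d: "d > 0" "\<And>z. norm z < d \<Longrightarrow> Lp_norm p (\<lambda>x. G (x - z) - G x) \<le> e / 2"
      using Lp_translate_small[OF p G, of "e/2"] e by auto
    have est: "Lp_norm p (\<lambda>x. ?D h x - G x) \<le> e / 2" if h: "h \<noteq> 0" "\<bar>h\<bar> < d" for h
    proof (rule Lp_norm_le_dual[OF p q in_Lp_diff[OF p0 Din G]])
      fix \<rho> :: "real^4 \<Rightarrow> real" assume \<rho>: "test \<rho>"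
      have \<rho>q: "in_Lp q \<rho>" by (rule test_in_Lp[OF \<rho> q0])
      \<comment> \<open>With the reflected kernel the pairing of a shifted function with
        \<open>\<rho>\<close> becomes a convolution, so that \<open>conv4_has_derivative\<close>
        applies.\<close>
      define k where "k = (\<lambda>z. \<rho> (- z))"
      have tk: "test k" using test_reflect[OF \<rho>, of 0] by (simp add: k_def)
      have conv: "conv4 f k (s *\<^sub>R ?v) = (LINT x|lborel. f (x + s *\<^sub>R ?v) * \<rho> x)" if "in_Lp p f" for f s
      proof -
        have m: "(\<lambda>x. f x * \<rho> (x - s *\<^sub>R ?v)) \<in> borel_measurable borel"
          using in_Lp_measurable[OF that] test_measurable[OF \<rho>] by measurable
        show ?thesis using lborel_translate(1)[OF m, of "s *\<^sub>R ?v"] by (simp add: conv4_def k_def)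
      qed
      have D: "((\<lambda>s. conv4 g k (s *\<^sub>R ?v)) has_real_derivative conv4 G k (r *\<^sub>R ?v)) (at r)" for r
      proof -
        have "((\<lambda>s. conv4 g k (r *\<^sub>R ?v + s *\<^sub>R ?v)) has_real_derivative conv4 G k (r *\<^sub>R ?v)) (at 0)"
          using conv4_has_derivative[OF p g tk axis_in_Basis4, of "r *\<^sub>R ?v" i] wderiv_conv4[OF w tk] by simp
        then have "((\<lambda>s. conv4 g k ((s + r) *\<^sub>R ?v)) has_real_derivative conv4 G k (r *\<^sub>R ?v)) (at 0)"
          by (simp add: algebra_simps)
        then show ?thesis using DERIV_shift[of "\<lambda>s. conv4 g k (s *\<^sub>R ?v)" "conv4 G k (r *\<^sub>R ?v)" 0 r] by simp
      qed
      obtain r where r: "\<bar>r\<bar> \<le> \<bar>h\<bar>" "conv4 g k (h *\<^sub>R ?v) - conv4 g k 0 = h * conv4 G k (r *\<^sub>R ?v)"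
      proof (cases "h > 0")
        case True
        from MVT2[OF this, of "\<lambda>s. conv4 g k (s *\<^sub>R ?v)" "\<lambda>s. conv4 G k (s *\<^sub>R ?v)"] D
        obtain z where "0 < z" "z < h" "conv4 g k (h *\<^sub>R ?v) - conv4 g k 0 = h * conv4 G k (z *\<^sub>R ?v)" by auto
        then show ?thesis using that[of z] by simp
      next
        case False
        then have "h < 0" using h by simp
        from MVT2[OF this, of "\<lambda>s. conv4 g k (s *\<^sub>R ?v)" "\<lambda>s. conv4 G k (s *\<^sub>R ?v)"] D
        obtain z where "h < z" "z < 0" "conv4 g k 0 - conv4 g k (h *\<^sub>R ?v) = - h * conv4 G k (z *\<^sub>R ?v)" by auto
        then show ?thesis using that[of z] by simp
      qed
      have I: "integrable lborel (\<lambda>x. f x * \<rho> x)" if "in_Lp p f" for f by (rule integrable_mult_test(1)[OF p that \<rho>])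
      have "(LINT x|lborel. (?D h x - G x) * \<rho> x) = (LINT x|lborel. ?D h x * \<rho> x) - (LINT x|lborel. G x * \<rho> x)"
        unfolding left_diff_distrib[of "?D h _"] by (rule Bochner_Integration.integral_diff[OF I[OF Din] I[OF G]])
      also have "(LINT x|lborel. ?D h x * \<rho> x) = (conv4 g k (h *\<^sub>R ?v) - conv4 g k 0) / h"
        using conv[OF g, of h] conv[OF g, of 0] I[OF g] I[OF Lp_translate(1)[OF g, of "h *\<^sub>R ?v"]]
        by (simp add: left_diff_distrib diff_divide_distrib)
      also have "\<dots> = (LINT x|lborel. G (x + r *\<^sub>R ?v) * \<rho> x)" using r h(1) conv[OF G] by simp
      also have "\<dots> - (LINT x|lborel. G x * \<rho> x) = (LINT x|lborel. (G (x + r *\<^sub>R ?v) - G x) * \<rho> x)"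
        using I[OF G] I[OF Lp_translate(1)[OF G, of "r *\<^sub>R ?v"]] by (simp add: left_diff_distrib)
      finally have "\<bar>LINT x|lborel. (?D h x - G x) * \<rho> x\<bar> \<le> Lp_norm p (\<lambda>x. G (x + r *\<^sub>R ?v) - G x) * Lp_norm q \<rho>"
        using Holder(2)[OF p q in_Lp_diff[OF p0 Lp_translate(1)[OF G, of "r *\<^sub>R ?v"] G] \<rho>q] by simp
      also have "\<dots> \<le> e / 2 * Lp_norm q \<rho>"
        using d(2)[of "- (r *\<^sub>R ?v)"] r(1) h(2) Lp_norm_nonneg[of q \<rho>] by (intro mult_right_mono) auto
      finally show "\<bar>LINT x|lborel. (?D h x - G x) * \<rho> x\<bar> \<le> e / 2 * Lp_norm q \<rho>" .
    qed (use e in simp)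
    show "\<forall>\<^sub>F h in at 0. dist (Lp_norm p (\<lambda>x. ?D h x - G x)) 0 < e"
      unfolding eventually_at
    proof (intro exI[of _ d] conjI ballI impI)
      show "d > 0" by (rule d(1))
      fix h :: real assume "h \<noteq> 0 \<and> dist h 0 < d"
      then have "Lp_norm p (\<lambda>x. ?D h x - G x) \<le> e / 2" by (intro est) auto
      then show "dist (Lp_norm p (\<lambda>x. ?D h x - G x)) 0 < e"
        using e Lp_norm_nonneg[of p "\<lambda>x. ?D h x - G x"] by simp
    qed
  qed
  then show ?thesis using g G Din Lp_translate(1)[OF g] by (simp add: Lp_deriv_def Lp_lim_def)
qed

text \<open>The same duality argument as in space: the pairing with \<open>\<rho>\<close> is a
  function of time whose weak derivative is classical inside the interval. The mean value theorem
  needs differentiability only in the interior, which is why the end points are covered.\<close>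

lemma Lp_deriv_timeI:
  assumes T: "T > 0" and p: "p > 1" and g: "contLp T p g" and G: "contLp T p G" and w: "wdst T (1, 0) g G"
    and t: "t \<in> {0..T}"
  shows "Lp_deriv (at 0 within {h. t + h \<in> {0..T}}) p (\<lambda>h. g (t + h)) (g t) (G t)"
proof -
  define q where "q = p / (p - 1)"
  have q: "q > 1" "1 / p + 1 / q = 1" using p by (auto simp: q_def field_simps)
  have p0: "p > 0" and q0: "q > 0" using p q by auto
  let ?F = "at 0 within {h. t + h \<in> {0..T}}"
  have gin: "in_Lp p (g s)" and Gin: "in_Lp p (G s)" if "s \<in> {0..T}" for s using g G that by (auto simp: contLp_def)
  have evF: "\<forall>\<^sub>F h in ?F. t + h \<in> {0..T}" using eventually_at_within_mem[where t=0 and S="{h. t + h \<in> {0..T}}"] by simp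
  have Din: "in_Lp p (\<lambda>x. (g s x - g t x) / h)" if "s \<in> {0..T}" for s h
    using in_Lp_cmult[OF in_Lp_diff[OF p0 gin[OF that] gin[OF t]], of "1/h"] by simp
  have "((\<lambda>h. Lp_norm p (\<lambda>x. (g (t + h) x - g t x) / h - G t x)) \<longlongrightarrow> 0) ?F"
  proof (rule tendstoI)
    fix e :: real assume e: "e > 0"
    have "\<forall>\<^sub>F s in at t within {0..T}. Lp_norm p (\<lambda>x. G s x - G t x) < e / 2"
      using G t e unfolding contLp_def by (intro order_tendstoD(2)[of _ 0]) auto
    then obtain d where d: "d > 0" "\<And>s. s \<in> {0..T} \<Longrightarrow> s \<noteq> t \<Longrightarrow> dist s t < d \<Longrightarrow> Lp_norm p (\<lambda>x. G s x - G t x) < e / 2"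
      unfolding eventually_at by auto
    have est: "Lp_norm p (\<lambda>x. (g (t + h) x - g t x) / h - G t x) \<le> e / 2" if h: "h \<noteq> 0" "\<bar>h\<bar> < d" and th: "t + h \<in> {0..T}" for h
    proof (rule Lp_norm_le_dual[OF p q in_Lp_diff[OF p0 Din[OF th] Gin[OF t]]])
      fix \<rho> :: "real^4 \<Rightarrow> real" assume \<rho>: "test \<rho>"
      have \<rho>q: "in_Lp q \<rho>" by (rule test_in_Lp[OF \<rho> q0])
      define A where "A t = (LINT x|lborel. \<rho> x * g (clamp_t T t) x)" for t
      define B where "B t = (LINT x|lborel. \<rho> x * G (clamp_t T t) x)" for t
      have Ac: "continuous_on UNIV A" and Bc: "continuous_on UNIV B" unfolding A_def B_def using T
        by (auto intro!: clamp_continuous contLp_integral_continuous[OF p g \<rho>] contLp_integral_continuous[OF p G \<rho>])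
      have D: "(A has_real_derivative B s) (at s)" if "s \<in> {0<..<T}" for s
      proof (rule deriv_of_weak_deriv[OF Ac Bc T _ that])
        fix \<theta> :: "real \<Rightarrow> real" assume \<theta>: "test \<theta>" "tsupport \<theta> \<subseteq> {0<..<T}"
        have d\<theta>: "test (dd 1 \<theta>)" by (rule test_dd[OF \<theta>(1)]) simp
        have sd\<theta>: "tsupport (dd 1 \<theta>) \<subseteq> {0<..<T}"
        proof -
          obtain K where K: "compact K" "\<forall>x. x \<notin> K \<longrightarrow> \<theta> x = 0" using \<theta>(1) unfolding test_def by blast
          have c: "compact (tsupport \<theta>)" using compact_tsupportI[OF K(1)] K(2) by simp
          have "closed (tsupport \<theta>)" by (simp add: tsupport_def)
          then have z: "dd 1 \<theta> x = 0" if "x \<notin> tsupport \<theta>" for x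
            by (rule dd_eq_0_outside[OF _ not_in_tsupport that])
          have "tsupport (dd 1 \<theta>) \<subseteq> tsupport \<theta>" using compact_tsupportI[OF c z] by (rule conjunct2)
          then show ?thesis using \<theta>(2) by (rule subset_trans)
        qed
        have "pair T G (\<lambda>z. \<theta> (fst z) * \<rho> (snd z)) = - pair T g (\<lambda>z. dd 1 \<theta> (fst z) * \<rho> (snd z))"
          using w[unfolded wdst_def, rule_format, OF test_st_product[OF \<theta> \<rho>]]
          unfolding dd_product(1)[OF test_smooth[OF \<theta>(1)] test_smooth[OF \<rho>]] .
        then show "(LINT t|lborel. \<theta> t * B t) = - (LINT t|lborel. dd 1 \<theta> t * A t)"
          unfolding A_def B_def pair_product(1)[OF T p G \<theta> \<rho>] pair_product(1)[OF T p g d\<theta> sd\<theta> \<rho>] .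
      qed
      obtain s where s: "s \<in> {0..T}" "\<bar>s - t\<bar> < d" "A (t + h) - A t = h * B s"
      proof (cases "h > 0")
        case True
        have "\<exists>l z. t < z \<and> z < t + h \<and> (A has_real_derivative l) (at z) \<and> A (t + h) - A t = (t + h - t) * l"
        proof (rule MVT)
          show "t < t + h" using True by simp
          show "continuous_on {t..t + h} A" by (rule continuous_on_subset[OF Ac]) simp
          fix z assume "t < z" "z < t + h"
          then have "z \<in> {0<..<T}" using t th by auto
          then show "A differentiable at z" using D real_differentiableI by blast
        qed
        then obtain l z where z: "t < z" "z < t + h" "(A has_real_derivative l) (at z)" "A (t + h) - A t = h * l" by auto
        then have "z \<in> {0<..<T}" using t th by auto
        from DERIV_unique[OF z(3) D[OF this]] show ?thesis using that[of z] z h(2) t th by auto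
      next
        case False
        have "\<exists>l z. t + h < z \<and> z < t \<and> (A has_real_derivative l) (at z) \<and> A t - A (t + h) = (t - (t + h)) * l"
        proof (rule MVT)
          show "t + h < t" using False h by simp
          show "continuous_on {t + h..t} A" by (rule continuous_on_subset[OF Ac]) simp
          fix z assume "t + h < z" "z < t"
          then have "z \<in> {0<..<T}" using t th by auto
          then show "A differentiable at z" using D real_differentiableI by blast
        qed
        then obtain l z where z: "t + h < z" "z < t" "(A has_real_derivative l) (at z)" "A t - A (t + h) = - h * l" by auto
        then have "z \<in> {0<..<T}" using t th by auto
        from DERIV_unique[OF z(3) D[OF this]] show ?thesis using that[of z] z h(2) t th by auto
      qed
      have I: "integrable lborel (\<lambda>x. \<rho> x * f x)" if "in_Lp p f" for f by (rule integrable_mult_test(2)[OF p that \<rho>])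
      have "(LINT x|lborel. ((g (t + h) x - g t x) / h - G t x) * \<rho> x)
         = (LINT x|lborel. (\<rho> x * g (t + h) x - \<rho> x * g t x) / h - \<rho> x * G t x)"
        by (rule Bochner_Integration.integral_cong) (auto simp: algebra_simps diff_divide_distrib)
      also have "\<dots> = (A (t + h) - A t) / h - B t"
        unfolding A_def B_def using I[OF gin[OF th]] I[OF gin[OF t]] I[OF Gin[OF t]] by (simp add: clamp_t(2)[OF th] clamp_t(2)[OF t])
      also have "\<dots> = B s - B t" using s(3) h(1) by simp
      also have "\<dots> = (LINT x|lborel. (G s x - G t x) * \<rho> x)"
        unfolding B_def using I[OF Gin[OF s(1)]] I[OF Gin[OF t]] by (simp add: clamp_t(2)[OF s(1)] clamp_t(2)[OF t] left_diff_distrib mult.commute[of "\<rho> _"])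
      finally have "\<bar>LINT x|lborel. ((g (t + h) x - g t x) / h - G t x) * \<rho> x\<bar> \<le> Lp_norm p (\<lambda>x. G s x - G t x) * Lp_norm q \<rho>"
        using Holder(2)[OF p q in_Lp_diff[OF p0 Gin[OF s(1)] Gin[OF t]] \<rho>q] by simp
      also have "\<dots> \<le> e / 2 * Lp_norm q \<rho>"
        using d(2)[OF s(1)] s(2) e p0 Lp_norm_nonneg[of q \<rho>]
        by (intro mult_right_mono) (cases "s = t", auto simp: dist_real_def Lp_norm_zero)
      finally show "\<bar>LINT x|lborel. ((g (t + h) x - g t x) / h - G t x) * \<rho> x\<bar> \<le> e / 2 * Lp_norm q \<rho>" .
    qed (use e in simp)
    show "\<forall>\<^sub>F h in ?F. dist (Lp_norm p (\<lambda>x. (g (t + h) x - g t x) / h - G t x)) 0 < e"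
      unfolding eventually_at
    proof (intro exI[of _ d] conjI ballI impI)
      show "d > 0" by (rule d(1))
      fix h assume "h \<in> {h. t + h \<in> {0..T}}" "h \<noteq> 0 \<and> dist h 0 < d"
      then have "Lp_norm p (\<lambda>x. (g (t + h) x - g t x) / h - G t x) \<le> e / 2" by (intro est) auto
      then show "dist (Lp_norm p (\<lambda>x. (g (t + h) x - g t x) / h - G t x)) 0 < e"
        using e Lp_norm_nonneg[of p "\<lambda>x. (g (t + h) x - g t x) / h - G t x"] by simp
    qed
  qed
  moreover have "\<forall>\<^sub>F h in ?F. in_Lp p (g (t + h))" using evF by eventually_elim (rule gin)
  moreover have "\<forall>\<^sub>F h in ?F. in_Lp p (\<lambda>x. (g (t + h) x - g t x) / h)" using evF by eventually_elim (rule Din)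
  ultimately show ?thesis using gin[OF t] Gin[OF t] by (simp add: Lp_deriv_def Lp_lim_def)
qed

section \<open>Slices of space-time test functions and the return to distributional
  derivatives\<close>

lemma test_dq_uniform:
  fixes g :: "'a::euclidean_space \<Rightarrow> real"
  assumes g: "test g" and v: "v \<in> Basis" and e: "e > 0"
  shows "\<exists>d>0. \<forall>h. h \<noteq> 0 \<longrightarrow> \<bar>h\<bar> < d \<longrightarrow> (\<forall>x. \<bar>(g (x + h *\<^sub>R v) - g x) / h - dd v g x\<bar> \<le> e)"
proof -
  note s = test_smooth[OF g]
  obtain d where d: "d > 0" "\<And>x y. dist y x < d \<Longrightarrow> dist (dd v g y) (dd v g x) < e"
    using test_uniformly_continuous_ex[OF test_dd[OF g v] e] by auto
  have "\<bar>(g (x + h *\<^sub>R v) - g x) / h - dd v g x\<bar> \<le> e" if h: "h \<noteq> 0" "\<bar>h\<bar> < d" for h x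
  proof -
    obtain r where r: "\<bar>r\<bar> \<le> \<bar>h\<bar>" "g (x + h *\<^sub>R v) - g x = h * dd v g (x + r *\<^sub>R v)"
    proof (cases "h > 0")
      case True
      from MVT2[OF this, of "\<lambda>s. g (x + s *\<^sub>R v)" "\<lambda>s. dd v g (x + s *\<^sub>R v)"] smooth_has_derivative[OF s v, of x]
      obtain z where "0 < z" "z < h" "g (x + h *\<^sub>R v) - g x = h * dd v g (x + z *\<^sub>R v)" by auto
      then show ?thesis using that[of z] by simp
    next
      case False
      then have "h < 0" using h by simp
      from MVT2[OF this, of "\<lambda>s. g (x + s *\<^sub>R v)" "\<lambda>s. dd v g (x + s *\<^sub>R v)"] smooth_has_derivative[OF s v, of x]
      obtain z where "h < z" "z < 0" "g x - g (x + h *\<^sub>R v) = - h * dd v g (x + z *\<^sub>R v)" by auto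
      then show ?thesis using that[of z] by simp
    qed
    then have "(g (x + h *\<^sub>R v) - g x) / h = dd v g (x + r *\<^sub>R v)" using h by simp
    moreover have "dist (x + r *\<^sub>R v) x < d" using r(1) h v by (simp add: dist_norm norm_Basis)
    ultimately show ?thesis using d(2)[of "x + r *\<^sub>R v" x] by (simp add: dist_real_def)
  qed
  then show ?thesis using d(1) by blast
qed

lemma dd_slice: "dd e (\<lambda>x. \<psi> (t, x)) x = dd (0, e) \<psi> (t, x)"
  by (simp add: dd_def)

lemma smooth_slice:
  fixes \<psi> :: "'a::euclidean_space \<times> 'b::euclidean_space \<Rightarrow> real"
  shows "smooth \<psi> \<Longrightarrow> smooth (\<lambda>x. \<psi> (t, x))"
proof (coinduction arbitrary: \<psi> rule: smooth.coinduct)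
  case (smooth \<psi>)
  have c: "continuous_on UNIV (\<lambda>x. \<psi> (t, x))"
    by (rule continuous_on_compose2[OF smooth_continuous[OF smooth]]) (auto intro: continuous_intros)
  have B: "(0, v) \<in> Basis" if "v \<in> Basis" for v :: 'b using that by (simp add: Basis_prod_def)
  have d: "(\<lambda>s. \<psi> (t, x + s *\<^sub>R v)) differentiable at 0" if "v \<in> Basis" for v x
    using real_differentiableI[OF smooth_has_derivative_0[OF smooth B[OF that], of "(t, x)"]] by simp
  have "\<exists>\<psi>'. dd v (\<lambda>x. \<psi> (t, x)) = (\<lambda>x. \<psi>' (t, x)) \<and> smooth \<psi>'" if "v \<in> Basis" for v
    using smooth_dd[OF smooth B[OF that]] by (intro exI[of _ "dd (0, v) \<psi>"]) (simp add: dd_slice fun_eq_iff)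
  then show ?case using c d by (intro exI[of _ "\<lambda>x. \<psi> (t, x)"]) auto
qed

lemma test_support_slices:
  fixes \<psi> :: "'a::euclidean_space \<times> 'b::euclidean_space \<Rightarrow> real"
  assumes "test \<psi>"
  obtains K where "compact K" "\<And>t x. x \<notin> K \<Longrightarrow> \<psi> (t, x) = 0"
proof -
  obtain K where K: "compact K" "\<And>z. z \<notin> K \<Longrightarrow> \<psi> z = 0" using assms by (auto simp: test_def)
  have "compact (snd ` K)" by (rule compact_continuous_image[OF _ K(1)]) (intro continuous_intros)
  moreover have "\<psi> (t, x) = 0" if "x \<notin> snd ` K" for t x using that by (intro K(2)) force
  ultimately show ?thesis using that by blast
qed

lemma test_slice:
  fixes \<psi> :: "'a::euclidean_space \<times> 'b::euclidean_space \<Rightarrow> real"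
  assumes "test \<psi>"
  shows "test (\<lambda>x. \<psi> (t, x))"
  using test_support_slices[OF assms] smooth_slice[OF test_smooth[OF assms]] unfolding test_def by metis

lemma test_st_test: "test_st T \<psi> \<Longrightarrow> test \<psi>"
  unfolding test_st_def test_def using not_in_tsupport[of _ \<psi>] by blast

lemma slice_lim:
  fixes \<psi> :: "real \<times> (real^4) \<Rightarrow> real"
  assumes \<psi>: "test \<psi>" and q: "q > 0" and X: "(X \<longlongrightarrow> t) F"
  shows "Lp_lim F q (\<lambda>h x. \<psi> (X h, x)) (\<lambda>x. \<psi> (t, x))"
proof -
  obtain K where K: "compact K" "\<And>t x. x \<notin> K \<Longrightarrow> \<psi> (t, x) = 0" using test_support_slices[OF \<psi>] by blast
  have m: "(\<lambda>x. \<psi> (s, x)) \<in> borel_measurable borel" for s by (rule test_measurable[OF test_slice[OF \<psi>]])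
  have "((\<lambda>h. Lp_norm q (\<lambda>x. \<psi> (X h, x) - \<psi> (t, x))) \<longlongrightarrow> 0) F"
  proof (rule Lp_tendsto_uniform[OF q K(1)])
    show "\<forall>\<^sub>F h in F. (\<lambda>x. \<psi> (X h, x) - \<psi> (t, x)) \<in> borel_measurable borel \<and> (\<forall>x. x \<notin> K \<longrightarrow> \<psi> (X h, x) - \<psi> (t, x) = 0)"
      using m K(2) by (auto intro!: always_eventually)
    fix e :: real assume "e > 0"
    from test_uniformly_continuous_ex[OF \<psi> this] obtain d where d: "d > 0" "\<And>x y. dist y x < d \<Longrightarrow> dist (\<psi> y) (\<psi> x) < e" by auto
    have "\<forall>\<^sub>F h in F. dist (X h) t < d" by (rule tendstoD[OF X d(1)])
    then show "\<forall>\<^sub>F h in F. \<forall>x. \<bar>\<psi> (X h, x) - \<psi> (t, x)\<bar> \<le> e"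
    proof eventually_elim
      case (elim h)
      have "dist (\<psi> (X h, x)) (\<psi> (t, x)) < e" for x using elim by (intro d(2)) (simp add: dist_Pair_Pair)
      then show ?case by (auto simp: dist_real_def less_imp_le)
    qed
  qed
  then show ?thesis using test_in_Lp[OF test_slice[OF \<psi>] q] by (simp add: Lp_lim_def)
qed

lemma slice_dq_lim:
  fixes \<psi> :: "real \<times> (real^4) \<Rightarrow> real"
  assumes \<psi>: "test \<psi>" and q: "q > 0"
  shows "Lp_lim (at 0 within H) q (\<lambda>h x. (\<psi> (t + h, x) - \<psi> (t, x)) / h) (\<lambda>x. dd (1, 0) \<psi> (t, x))"
proof -
  have B: "(1::real, 0::real^4) \<in> Basis" by (simp add: Basis_prod_def)
  note d\<psi> = test_dd[OF \<psi> B]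
  obtain K where K: "compact K" "\<And>t x. x \<notin> K \<Longrightarrow> \<psi> (t, x) = 0" using test_support_slices[OF \<psi>] by blast
  obtain K' where K': "compact K'" "\<And>t x. x \<notin> K' \<Longrightarrow> dd (1, 0) \<psi> (t, x) = 0" using test_support_slices[OF d\<psi>] by blast
  have m: "(\<lambda>x. \<psi> (s, x)) \<in> borel_measurable borel" "(\<lambda>x. dd (1, 0) \<psi> (s, x)) \<in> borel_measurable borel" for s
    using test_measurable[OF test_slice[OF \<psi>]] test_measurable[OF test_slice[OF d\<psi>]] by auto
  have "((\<lambda>h. Lp_norm q (\<lambda>x. (\<psi> (t + h, x) - \<psi> (t, x)) / h - dd (1, 0) \<psi> (t, x))) \<longlongrightarrow> 0) (at 0 within H)"
  proof (rule Lp_tendsto_uniform[OF q compact_Un[OF K(1) K'(1)]])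
    show "\<forall>\<^sub>F h in at 0 within H. (\<lambda>x. (\<psi> (t + h, x) - \<psi> (t, x)) / h - dd (1, 0) \<psi> (t, x)) \<in> borel_measurable borel \<and>
        (\<forall>x. x \<notin> K \<union> K' \<longrightarrow> (\<psi> (t + h, x) - \<psi> (t, x)) / h - dd (1, 0) \<psi> (t, x) = 0)"
      using m K(2) K'(2) by (auto intro!: always_eventually)
    fix e :: real assume "e > 0"
    from test_dq_uniform[OF \<psi> B this] obtain d where d: "d > 0" "\<And>h x. h \<noteq> 0 \<Longrightarrow> \<bar>h\<bar> < d \<Longrightarrow> \<bar>(\<psi> (x + h *\<^sub>R (1, 0)) - \<psi> x) / h - dd (1, 0) \<psi> x\<bar> \<le> e"
      by auto
    show "\<forall>\<^sub>F h in at 0 within H. \<forall>x. \<bar>(\<psi> (t + h, x) - \<psi> (t, x)) / h - dd (1, 0) \<psi> (t, x)\<bar> \<le> e"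
      unfolding eventually_at
    proof (intro exI[of _ d] conjI ballI impI allI d(1))
      fix h :: real and x assume "h \<noteq> 0 \<and> dist h 0 < d"
      then show "\<bar>(\<psi> (t + h, x) - \<psi> (t, x)) / h - dd (1, 0) \<psi> (t, x)\<bar> \<le> e" using d(2)[of h "(t, x)"] by simp
    qed
  qed
  moreover have "in_Lp q (\<lambda>x. (\<psi> (t + h, x) - \<psi> (t, x)) / h)" for h
    using test_in_Lp[OF test_cmult[OF test_diff[OF test_slice[OF \<psi>] test_slice[OF \<psi>]], of "1/h"] q] by simp
  ultimately show ?thesis using test_in_Lp[OF test_slice[OF d\<psi>] q] by (simp add: Lp_lim_def)
qed

lemma Lp_lim_integral_mult:
  assumes pq: "p > 1" "q > 1" "1 / p + 1 / q = 1" and X: "Lp_lim F p X x" and Y: "Lp_lim F q Y y"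
  shows "((\<lambda>h. LINT z|lborel. X h z * Y h z) \<longlongrightarrow> (LINT z|lborel. x z * y z)) F"
proof -
  note XY = X[unfolded Lp_lim_def] Y[unfolded Lp_lim_def]
  have x: "in_Lp p x" and y: "in_Lp q y" using XY by auto
  have p0: "p > 0" "q > 0" using pq by auto
  have "((\<lambda>h. (LINT z|lborel. X h z * Y h z) - (LINT z|lborel. x z * y z)) \<longlongrightarrow> 0) F"
  proof (rule Lim_null_comparison)
    let ?b = "\<lambda>h. Lp_norm p (\<lambda>z. X h z - x z) * Lp_norm q (Y h) + Lp_norm p x * Lp_norm q (\<lambda>z. Y h z - y z)"
    have "(?b \<longlongrightarrow> 0 * Lp_norm q y + Lp_norm p x * 0) F"
      using XY by (intro tendsto_intros Lp_lim_norm[OF pq(2) Y]) auto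
    then show "(?b \<longlongrightarrow> 0) F" by simp
    show "\<forall>\<^sub>F h in F. norm ((LINT z|lborel. X h z * Y h z) - (LINT z|lborel. x z * y z)) \<le> ?b h"
      using conjunct1[OF XY(1)] conjunct1[OF XY(2)]
    proof eventually_elim
      case (elim h)
      note i1 = Holder[OF pq in_Lp_diff[OF p0(1) elim(1) x] elim(2)]
      note i2 = Holder[OF pq x in_Lp_diff[OF p0(2) elim(2) y]]
      have "(LINT z|lborel. X h z * Y h z) = (LINT z|lborel. x z * y z + ((X h z - x z) * Y h z + x z * (Y h z - y z)))"
        by (rule Bochner_Integration.integral_cong) (auto simp: algebra_simps)
      also have "\<dots> = (LINT z|lborel. x z * y z) + ((LINT z|lborel. (X h z - x z) * Y h z) + (LINT z|lborel. x z * (Y h z - y z)))"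
        by (simp add: i1(1) i2(1) Holder(1)[OF pq x y] del: right_diff_distrib left_diff_distrib)
      finally show ?case using i1(2) i2(2) by simp
    qed
  qed
  then show ?thesis by (simp add: LIM_zero_iff)
qed

lemma tendsto_at_within_shift:
  fixes t :: real
  assumes "(f \<longlongrightarrow> L) (at 0 within {h. t + h \<in> S})"
  shows "((\<lambda>s. f (s - t)) \<longlongrightarrow> L) (at t within S)"
proof (rule filterlim_compose[OF assms])
  have "((\<lambda>s. s - t) \<longlongrightarrow> t - t) (at t within S)" by (intro tendsto_intros)
  moreover have "\<forall>\<^sub>F s in at t within S. s - t \<in> {h. t + h \<in> S} \<and> s - t \<noteq> 0"
    by (simp add: eventually_at_filter)
  ultimately show "filterlim (\<lambda>s. s - t) (at 0 within {h. t + h \<in> S}) (at t within S)"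
    by (simp add: filterlim_at)
qed

text \<open>The pairing \<open>J\<close> of the slices of \<open>g\<close> and \<open>\<psi>\<close>
  is differentiable on \<open>[0,T]\<close> by the product rule. Integrating its derivative gives
  zero, because the support of \<open>\<psi>\<close> makes \<open>J\<close> vanish at both
  ends.\<close>

lemma wdst_timeI:
  assumes T: "T > 0" and p: "p > 1" and g: "contLp T p g" and G: "contLp T p G"
    and d: "\<And>t. t \<in> {0..T} \<Longrightarrow> Lp_deriv (at 0 within {h. t + h \<in> {0..T}}) p (\<lambda>h. g (t + h)) (g t) (G t)"
  shows "wdst T (1, 0) g G"
  unfolding wdst_def
proof (intro allI impI)
  fix \<psi> assume st: "test_st T \<psi>"
  have \<psi>: "test \<psi>" by (rule test_st_test[OF st])
  define q where "q = p / (p - 1)"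
  have q: "q > 1" "1 / p + 1 / q = 1" using p by (auto simp: q_def field_simps)
  have q0: "q > 0" using q by simp
  have B: "(1::real, 0::real^4) \<in> Basis" by (simp add: Basis_prod_def)
  note d\<psi> = test_dd[OF \<psi> B]
  define J where "J t = (LINT x|lborel. g t x * \<psi> (t, x))" for t
  define D1 where "D1 t = (LINT x|lborel. G t x * \<psi> (t, x))" for t
  define D2 where "D2 t = (LINT x|lborel. g t x * dd (1, 0) \<psi> (t, x))" for t
  have gin: "in_Lp p (g t)" if "t \<in> {0..T}" for t using g that by (simp add: contLp_def)
  have "(J has_vector_derivative D1 t + D2 t) (at t within {0..T})" if t: "t \<in> {0..T}" for t
  proof -
    let ?F = "at 0 within {h. t + h \<in> {0..T}}"
    have X: "((\<lambda>h. t + h) \<longlongrightarrow> t) ?F" using tendsto_add[OF tendsto_const tendsto_ident_at, of t 0 "{h. t + h \<in> {0..T}}"] by simp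
    have "((\<lambda>h. LINT x|lborel. (g (t + h) x - g t x) / h * \<psi> (t + h, x)) \<longlongrightarrow> D1 t) ?F"
      unfolding D1_def using d[OF t] by (intro Lp_lim_integral_mult[OF p q] slice_lim[OF \<psi> q0 X]) (simp add: Lp_deriv_def)
    moreover have "((\<lambda>h. LINT x|lborel. g t x * ((\<psi> (t + h, x) - \<psi> (t, x)) / h)) \<longlongrightarrow> D2 t) ?F"
      unfolding D2_def by (intro Lp_lim_integral_mult[OF p q] Lp_lim_const slice_dq_lim[OF \<psi> q0] gin[OF t]) (use p in simp)
    ultimately have "((\<lambda>h. (LINT x|lborel. (g (t + h) x - g t x) / h * \<psi> (t + h, x)) + (LINT x|lborel. g t x * ((\<psi> (t + h, x) - \<psi> (t, x)) / h))) \<longlongrightarrow> D1 t + D2 t) ?F"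
      by (rule tendsto_add)
    moreover have "\<forall>\<^sub>F h in ?F. (LINT x|lborel. (g (t + h) x - g t x) / h * \<psi> (t + h, x)) + (LINT x|lborel. g t x * ((\<psi> (t + h, x) - \<psi> (t, x)) / h)) = (J (t + h) - J t) / h"
      using eventually_at_within_mem[where t=0 and S="{h. t + h \<in> {0..T}}"]
    proof eventually_elim
      case (elim h)
      then have th: "t + h \<in> {0..T}" by simp
      have I: "integrable lborel (\<lambda>x. f x * \<psi> (s, x))" if "in_Lp p f" for f s
        by (rule integrable_mult_test(1)[OF p that test_slice[OF \<psi>]])
      have i1: "integrable lborel (\<lambda>x. (g (t + h) x - g t x) / h * \<psi> (t + h, x))"
        using I[OF in_Lp_cmult[OF in_Lp_diff[OF _ gin[OF th] gin[OF t]], of "1/h"], of "t + h"] p by simp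
      have i2: "integrable lborel (\<lambda>x. g t x * ((\<psi> (t + h, x) - \<psi> (t, x)) / h))"
        using integrable_mult_test(1)[OF p gin[OF t] test_cmult[OF test_diff[OF test_slice[OF \<psi>] test_slice[OF \<psi>]], of "1/h"], of "t + h" t] by simp
      have "(LINT x|lborel. (g (t + h) x - g t x) / h * \<psi> (t + h, x)) + (LINT x|lborel. g t x * ((\<psi> (t + h, x) - \<psi> (t, x)) / h))
          = (LINT x|lborel. (g (t + h) x - g t x) / h * \<psi> (t + h, x) + g t x * ((\<psi> (t + h, x) - \<psi> (t, x)) / h))"
        by (rule Bochner_Integration.integral_add[OF i1 i2, symmetric])
      also have "\<dots> = (LINT x|lborel. (g (t + h) x * \<psi> (t + h, x) - g t x * \<psi> (t, x)) / h)"
        by (rule Bochner_Integration.integral_cong) (auto simp: algebra_simps diff_divide_distrib add_divide_distrib)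
      also have "\<dots> = (J (t + h) - J t) / h"
        unfolding J_def using I[OF gin[OF th], of "t + h"] I[OF gin[OF t], of t] by simp
      finally show ?case .
    qed
    ultimately have "((\<lambda>h. (J (t + h) - J t) / h) \<longlongrightarrow> D1 t + D2 t) ?F" by (rule Lim_transform_eventually)
    from tendsto_at_within_shift[OF this] have "(J has_real_derivative D1 t + D2 t) (at t within {0..T})"
      by (simp add: has_field_derivative_iff)
    then show ?thesis by (simp add: has_real_derivative_iff_has_vector_derivative)
  qed
  then have "((\<lambda>t. D1 t + D2 t) has_integral J T - J 0) {0..T}"
    using T by (intro fundamental_theorem_of_calculus) auto
  moreover have "J t = 0" if "t = 0 \<or> t = T" for t
  proof -
    have "\<psi> (t, x) = 0" for x
      by (rule not_in_tsupport) (use st that in \<open>auto simp: test_st_def\<close>)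
    then show ?thesis by (simp add: J_def)
  qed
  ultimately have "integral {0..T} (\<lambda>t. D1 t + D2 t) = 0" by (simp add: integral_unique)
  moreover have "continuous_on {0..T} D1" "continuous_on {0..T} D2"
    unfolding continuous_on_def D1_def D2_def
    by (intro ballI Lp_lim_integral_mult[OF p q] contLp_lim g G slice_lim[OF \<psi> q0] slice_lim[OF d\<psi> q0] tendsto_ident_at; assumption)+
  then have "integral {0..T} (\<lambda>t. D1 t + D2 t) = integral {0..T} D1 + integral {0..T} D2"
    by (intro Henstock_Kurzweil_Integration.integral_add integrable_continuous_interval)
  ultimately show "pair T G \<psi> = - pair T g (dd (1, 0) \<psi>)"
    unfolding pair_def D1_def D2_def by (simp add: mult.commute)
qed

text \<open>Integration by parts in discrete form: translation invariance moves the quotient of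
  \<open>g\<close> with step \<open>h\<close> onto \<open>\<rho>\<close> with step
  \<open>-h\<close>.\<close>

lemma wderiv_of_Lp_deriv:
  assumes p: "p > 1" and d: "Lp_deriv (at 0) p (\<lambda>h x. g (x + h *\<^sub>R axis i 1)) g G"
  shows "wderiv g i G"
  unfolding wderiv_def
proof (intro allI impI)
  fix \<rho> :: "real^4 \<Rightarrow> real" assume \<rho>: "test \<rho>"
  define q where "q = p / (p - 1)"
  have q: "q > 1" "1 / p + 1 / q = 1" using p by (auto simp: q_def field_simps)
  have q0: "q > 0" using q by simp
  let ?v = "axis i 1 :: real^4"
  have g: "in_Lp p g" using d by (simp add: Lp_deriv_def)
  note d\<rho> = test_dd[OF \<rho> axis_in_Basis4, of i]
  have 1: "((\<lambda>h. LINT x|lborel. (g (x + h *\<^sub>R ?v) - g x) / h * \<rho> x) \<longlongrightarrow> (LINT x|lborel. G x * \<rho> x)) (at 0)"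
    using d by (intro Lp_lim_integral[OF p q _ test_in_Lp[OF \<rho> q0]]) (simp add: Lp_deriv_def)
  have tq: "test (\<lambda>x. (\<rho> (x + h *\<^sub>R ?v) - \<rho> x) / h)" for h
    using test_cmult[OF test_diff[OF test_affine[OF \<rho>, of 1 "h *\<^sub>R ?v"] \<rho>], of "1/h"] by simp
  have L: "Lp_lim (at 0) q (\<lambda>h x. (\<rho> (x + h *\<^sub>R ?v) - \<rho> x) / h) (dd ?v \<rho>)"
    using test_difference_quotient_tendsto[OF q0 \<rho> axis_in_Basis4, of i] test_in_Lp[OF tq q0] test_in_Lp[OF d\<rho> q0]
    by (simp add: Lp_lim_def)
  have "((\<lambda>h. LINT x|lborel. (\<rho> (x + h *\<^sub>R ?v) - \<rho> x) / h * g x) \<longlongrightarrow> (LINT x|lborel. dd ?v \<rho> x * g x)) (at 0)"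
    by (rule Lp_lim_integral[OF q(1) p _ L g]) (use q in simp)
  \<comment> \<open>The quotient of the test function is needed with step \<open>-h\<close>, which
    also tends to 0.\<close>
  moreover have "filterlim uminus (at 0) (at (0::real))"
    using tendsto_minus[OF tendsto_ident_at, of "0::real" UNIV] by (simp add: filterlim_at eventually_at_filter)
  ultimately have L0: "((\<lambda>h. LINT x|lborel. (\<rho> (x + (- h) *\<^sub>R ?v) - \<rho> x) / (- h) * g x) \<longlongrightarrow> (LINT x|lborel. dd ?v \<rho> x * g x)) (at 0)"
    by (rule filterlim_compose)
  have E: "(LINT x|lborel. (\<rho> (x + (- h) *\<^sub>R ?v) - \<rho> x) / (- h) * g x) = - (LINT x|lborel. (g (x + h *\<^sub>R ?v) - g x) / h * \<rho> x)" for h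
  proof -
    have t1: "test (\<lambda>x. \<rho> (x - h *\<^sub>R ?v))" using test_affine[OF \<rho>, of 1 "- (h *\<^sub>R ?v)"] by simp
    have i: "integrable lborel (\<lambda>x. \<rho> (x - h *\<^sub>R ?v) * g x)" "integrable lborel (\<lambda>x. \<rho> x * g x)" "integrable lborel (\<lambda>x. \<rho> x * g (x + h *\<^sub>R ?v))"
      by (rule integrable_mult_test(2)[OF p g t1], rule integrable_mult_test(2)[OF p g \<rho>], rule integrable_mult_test(2)[OF p Lp_translate(1)[OF g] \<rho>])
    have m: "(\<lambda>x. \<rho> (x - h *\<^sub>R ?v) * g x) \<in> borel_measurable borel" using i(1) by (simp add: borel_measurable_integrable)
    have e: "(LINT x|lborel. \<rho> (x - h *\<^sub>R ?v) * g x) = (LINT x|lborel. \<rho> x * g (x + h *\<^sub>R ?v))"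
      using lborel_translate(1)[OF m, of "h *\<^sub>R ?v"] by simp
    have "(LINT x|lborel. (\<rho> (x + (- h) *\<^sub>R ?v) - \<rho> x) / (- h) * g x) = (LINT x|lborel. (\<rho> (x - h *\<^sub>R ?v) * g x - \<rho> x * g x) / (- h))"
      by (rule Bochner_Integration.integral_cong) (auto simp: left_diff_distrib)
    also have "\<dots> = ((LINT x|lborel. \<rho> x * g (x + h *\<^sub>R ?v)) - (LINT x|lborel. \<rho> x * g x)) / (- h)" using i(1,2) e by simp
    also have "\<dots> = - ((LINT x|lborel. (\<rho> x * g (x + h *\<^sub>R ?v) - \<rho> x * g x) / h))" using i(2,3) by simp
    also have "(LINT x|lborel. (\<rho> x * g (x + h *\<^sub>R ?v) - \<rho> x * g x) / h) = (LINT x|lborel. (g (x + h *\<^sub>R ?v) - g x) / h * \<rho> x)"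
      by (rule Bochner_Integration.integral_cong) (auto simp: algebra_simps)
    finally show ?thesis .
  qed
  have "((\<lambda>h. - (LINT x|lborel. (g (x + h *\<^sub>R ?v) - g x) / h * \<rho> x)) \<longlongrightarrow> (LINT x|lborel. dd ?v \<rho> x * g x)) (at 0)"
    using L0 unfolding E .
  from tendsto_unique[OF _ this tendsto_minus[OF 1]]
  show "(LINT x|lborel. \<rho> x * G x) = - (LINT x|lborel. dd ?v \<rho> x * g x)" by (simp add: mult.commute)
qed

lemma wdst_spaceI:
  assumes "\<And>t. t \<in> {0..T} \<Longrightarrow> wderiv (g t) i (G t)"
  shows "wdst T (0, axis i 1) g G"
  unfolding wdst_def
proof (intro allI impI)
  fix \<psi> assume "test_st T \<psi>"
  then have \<psi>: "test \<psi>" by (rule test_st_test)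
  have "pair T G \<psi> = integral {0..T} (\<lambda>t. - (LINT x|lborel. dd (0, axis i 1) \<psi> (t, x) *\<^sub>R g t x))"
    unfolding pair_def
  proof (rule Henstock_Kurzweil_Integration.integral_cong)
    fix t assume "t \<in> {0..T}"
    then have "wderiv (g t) i (G t)" by (rule assms)
    then show "(LINT x|lborel. \<psi> (t, x) *\<^sub>R G t x) = - (LINT x|lborel. dd (0, axis i 1) \<psi> (t, x) *\<^sub>R g t x)"
      using test_slice[OF \<psi>, of t] unfolding wderiv_def dd_slice[symmetric] by simp
  qed
  then show "pair T G \<psi> = - pair T g (dd (0, axis i 1) \<psi>)" by (simp add: pair_def)
qed

section \<open>Translation invariance of the equation\<close>

lemma lap_translate:
  assumes \<psi>: "test \<psi>"
  shows "lap (\<lambda>x. \<psi> (x + a)) x = lap \<psi> (x + a)"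
proof -
  have d: "dd (axis i 1) (\<lambda>x. f (x + a)) = (\<lambda>x. dd (axis i 1) f (x + a))" if "smooth f" for f i
    using dd_affine[OF that axis_in_Basis4, of i 1 a] by (simp add: fun_eq_iff)
  show ?thesis unfolding lap_def using test_smooth[OF \<psi>] test_smooth[OF test_dd[OF \<psi> axis_in_Basis4]] by (simp add: d)
qed

lemma test_translate: "test \<psi> \<Longrightarrow> test (\<lambda>x. \<psi> (x + a))"
  using test_affine[of \<psi> 1 a] by simp

lemma integral_test_translate:
  fixes f :: "real^4 \<Rightarrow> real"
  assumes "f \<in> borel_measurable borel" "test \<psi>"
  shows "(LINT x|lborel. \<psi> x * f (x + a)) = (LINT x|lborel. \<psi> (x - a) * f x)"
proof -
  have "(\<lambda>x. \<psi> (x - a) * f x) \<in> borel_measurable borel"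
    using assms test_measurable[OF test_translate[OF assms(2), of "- a"]] by simp
  from lborel_translate(1)[OF this, of a] show ?thesis by simp
qed

lemma ell_translate:
  assumes e: "ell q g v" and m: "v \<in> borel_measurable borel" "(\<lambda>x. q x * v x) \<in> borel_measurable borel" "g \<in> borel_measurable borel"
  shows "ell (\<lambda>x. q (x + a)) (\<lambda>x. g (x + a)) (\<lambda>x. v (x + a))"
  unfolding ell_def
proof (intro allI impI)
  fix \<psi> :: "real^4 \<Rightarrow> real" assume \<psi>: "test \<psi>"
  have t: "test (\<lambda>x. \<psi> (x - a))" using test_translate[OF \<psi>, of "- a"] by simp
  have l: "lap (\<lambda>x. \<psi> (x - a)) x = lap \<psi> (x - a)" for x using lap_translate[OF \<psi>, of "- a"] by simp
  show "(LINT x|lborel. lap \<psi> x * v (x + a)) - (LINT x|lborel. \<psi> x * (q (x + a) * v (x + a))) = (LINT x|lborel. \<psi> x * g (x + a))"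
    unfolding integral_test_translate[OF m(1) test_lap[OF \<psi>]] integral_test_translate[OF m(2) \<psi>] integral_test_translate[OF m(3) \<psi>]
    using e t unfolding ell_def l[symmetric] by blast
qed

lemma H1_translate:
  assumes H: "H1 v G"
  shows "H1 (\<lambda>x. v (x + a)) (\<lambda>i x. G i (x + a))"
proof -
  have v: "in_Lp 4 v" and G: "in_Lp 2 (G i)" and w: "wderiv v i (G i)" for i using H by (auto simp: H1_def)
  have "wderiv (\<lambda>x. v (x + a)) i (\<lambda>x. G i (x + a))" for i
    unfolding wderiv_def
  proof (intro allI impI)
    fix \<psi> :: "real^4 \<Rightarrow> real" assume \<psi>: "test \<psi>"
    have t: "test (\<lambda>x. \<psi> (x - a))" using test_translate[OF \<psi>, of "- a"] by simp
    have d: "dd (axis i 1) (\<lambda>x. \<psi> (x - a)) x = dd (axis i 1) \<psi> (x - a)" for x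
      using dd_affine[OF test_smooth[OF \<psi>] axis_in_Basis4, of i 1 "- a" x] by simp
    show "(LINT x|lborel. \<psi> x * G i (x + a)) = - (LINT x|lborel. dd (axis i 1) \<psi> x * v (x + a))"
      unfolding integral_test_translate[OF in_Lp_measurable[OF G] \<psi>]
        integral_test_translate[OF in_Lp_measurable[OF v] test_dd[OF \<psi> axis_in_Basis4]]
      using w[of i] t unfolding wderiv_def d[symmetric] by blast
  qed
  then show ?thesis using Lp_translate(1)[OF v] Lp_translate(1)[OF G] by (simp add: H1_def)
qed

section \<open>Iterated derivatives of the solution\<close>

text \<open>Directions are coded by natural numbers: 0 is time and \<open>d\<close> from 1 to 4 is
  the space axis of index \<open>d - 1\<close>. Numbers, unlike vectors, can be ordered, and the
  words below are decreasing lists of them.\<close>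

definition dv :: "nat \<Rightarrow> real \<times> (real^4)" where
  "dv d = (if d = 0 then (1, 0) else (0, axis (of_nat (d - 1)) 1))"

definition sh :: "nat \<Rightarrow> real \<Rightarrow> (real \<Rightarrow> real^4 \<Rightarrow> real) \<Rightarrow> real \<Rightarrow> real^4 \<Rightarrow> real" where
  "sh d h g t = (if d = 0 then g (t + h) else (\<lambda>x. g t (x + h *\<^sub>R axis (of_nat (d - 1)) 1)))"

definition adm :: "real \<Rightarrow> nat \<Rightarrow> real \<Rightarrow> real set" where
  "adm T d t = (if d = 0 then {h. t + h \<in> {0..T}} else UNIV)"

definition sder :: "real \<Rightarrow> nat \<Rightarrow> real \<Rightarrow> (real \<Rightarrow> real^4 \<Rightarrow> real) \<Rightarrow> (real \<Rightarrow> real^4 \<Rightarrow> real) \<Rightarrow> bool" where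
  "sder T d p g G \<longleftrightarrow> (\<forall>t\<in>{0..T}. Lp_deriv (at 0 within adm T d t) p (\<lambda>h. sh d h g t) (g t) (G t))"

text \<open>Together with its converse \<open>wdst_of_sder\<close> this permits working with limits
  of shifts, which obey product rules and suit the equation, while hypotheses and conclusion are
  about distributions.\<close>

lemma sder_of_wdst:
  assumes "T > 0" "p > 1" "contLp T p g" "contLp T p G" "wdst T (dv d) g G"
  shows "sder T d p g G"
proof (cases "d = 0")
  case True
  then show ?thesis using Lp_deriv_timeI[OF assms(1-4)] assms(5) by (simp add: sder_def sh_def adm_def dv_def)
next
  case False
  have "wderiv (g t) (of_nat (d - 1)) (G t)" if "t \<in> {0..T}" for t
    by (rule slice_weak_deriv[OF assms(1-4) _ that]) (use assms(5) False in \<open>simp add: dv_def\<close>)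
  then show ?thesis using False assms(2-4) by (auto simp: sder_def sh_def adm_def contLp_def intro!: Lp_deriv_spaceI)
qed

lemma wdst_of_sder:
  assumes "T > 0" "p > 1" "contLp T p g" "contLp T p G" "sder T d p g G"
  shows "wdst T (dv d) g G"
proof (cases "d = 0")
  case True
  then show ?thesis using assms(5) by (auto simp: sder_def sh_def adm_def dv_def intro!: wdst_timeI[OF assms(1-4)])
next
  case False
  then show ?thesis using assms(5)
    by (auto simp: sder_def sh_def adm_def dv_def intro!: wdst_spaceI wderiv_of_Lp_deriv[OF assms(2)])
qed

lemma adm_nontrivial:
  assumes "T > 0" "t \<in> {0..T}"
  shows "at 0 within adm T d t \<noteq> bot"
proof (cases "d = 0")
  case True
  have e: "adm T d t = {- t..T - t}" using True by (auto simp: adm_def)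
  have "0 islimpt {- t..T - t}"
  proof (rule connected_imp_perfect)
    fix x
    show "{- t..T - t} \<noteq> {x}"
    proof
      assume e: "{- t..T - t} = {x}"
      have "- t \<in> {x}" "T - t \<in> {x}" using assms unfolding e[symmetric] by auto
      then show False using assms by simp
    qed
  qed (use assms in auto)
  then show ?thesis unfolding e by (simp add: trivial_limit_within)
qed (simp add: adm_def)

lemma sder_add:
  assumes "p > 1" "sder T d p g G" "sder T d p k K"
  shows "sder T d p (\<lambda>t x. g t x + k t x) (\<lambda>t x. G t x + K t x)"
  unfolding sder_def
proof
  fix t assume t: "t \<in> {0..T}"
  have "(\<lambda>h. sh d h (\<lambda>t x. g t x + k t x) t) = (\<lambda>h x. sh d h g t x + sh d h k t x)"
    by (auto simp: sh_def fun_eq_iff)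
  then show "Lp_deriv (at 0 within adm T d t) p (\<lambda>h. sh d h (\<lambda>t x. g t x + k t x) t) (\<lambda>x. g t x + k t x) (\<lambda>x. G t x + K t x)"
    using Lp_deriv_add[OF assms(1), of "at 0 within adm T d t"] assms(2,3) t unfolding sder_def by simp
qed

lemma sder_mult3:
  assumes "sder T d 4 a a'" "sder T d 4 b b'" "sder T d 4 v v'"
  shows "sder T d (4/3) (\<lambda>t x. a t x * b t x * v t x) (\<lambda>t x. a' t x * b t x * v t x + (a t x * b' t x * v t x + a t x * b t x * v' t x))"
  unfolding sder_def
proof
  fix t assume t: "t \<in> {0..T}"
  have "(\<lambda>h. sh d h (\<lambda>t x. a t x * b t x * v t x) t) = (\<lambda>h x. sh d h a t x * sh d h b t x * sh d h v t x)"
    by (auto simp: sh_def fun_eq_iff)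
  then show "Lp_deriv (at 0 within adm T d t) (4/3) (\<lambda>h. sh d h (\<lambda>t x. a t x * b t x * v t x) t) (\<lambda>x. a t x * b t x * v t x)
      (\<lambda>x. a' t x * b t x * v t x + (a t x * b' t x * v t x + a t x * b t x * v' t x))"
    using Lp_deriv_mult3[of "adm T d t"] assms t unfolding sder_def by simp
qed

lemma sder_zero: "p > 1 \<Longrightarrow> sder T d p (\<lambda>t x. 0) (\<lambda>t x. 0)"
  by (simp add: sder_def Lp_deriv_def sh_def in_Lp_zero Lp_lim_const)

lemma sder_sum_list:
  assumes "p > 1" "\<And>i. i \<in> set L \<Longrightarrow> sder T d p (g i) (G i)"
  shows "sder T d p (\<lambda>t x. \<Sum>i\<leftarrow>L. g i t x) (\<lambda>t x. \<Sum>i\<leftarrow>L. G i t x)"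
  using assms(2)
proof (induction L)
  case Nil
  then show ?case by (simp add: sder_zero[OF assms(1)])
next
  case (Cons i L)
  then show ?case using sder_add[OF assms(1), of T d "g i" "G i"] by simp
qed

lemma sder_sum_bool:
  assumes "p > 1" "\<And>s::bool. sder T d p (g s) (G s)"
  shows "sder T d p (\<lambda>t x. \<Sum>s\<in>UNIV. g s t x) (\<lambda>t x. \<Sum>s\<in>UNIV. G s t x)"
  using sder_add[OF assms(1) assms(2)[of False] assms(2)[of True]] by (simp add: UNIV_bool)

lemma contLpI:
  assumes "\<And>t. t \<in> {0..T} \<Longrightarrow> Lp_lim (at t within {0..T}) p g (g t)"
  shows "contLp T p g"
  using assms unfolding contLp_def Lp_lim_def by blast

lemma contLp_add: "p > 1 \<Longrightarrow> contLp T p g \<Longrightarrow> contLp T p k \<Longrightarrow> contLp T p (\<lambda>t x. g t x + k t x)"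
  by (rule contLpI, rule Lp_lim_add[OF _ contLp_lim contLp_lim])

lemma contLp_mult3: "contLp T 4 a \<Longrightarrow> contLp T 4 b \<Longrightarrow> contLp T 4 v \<Longrightarrow> contLp T (4/3) (\<lambda>t x. a t x * b t x * v t x)"
  by (rule contLpI, rule Lp_lim_mult3[OF contLp_lim contLp_lim contLp_lim])

lemma contLp_sum_list:
  assumes "p > 1" "\<And>i. i \<in> set L \<Longrightarrow> contLp T p (g i)"
  shows "contLp T p (\<lambda>t x. \<Sum>i\<leftarrow>L. g i t x)"
  using assms(2)
proof (induction L)
  case Nil
  then show ?case using assms(1) by (intro contLpI) (simp add: Lp_lim_const in_Lp_zero)
next
  case (Cons i L)
  then show ?case using contLp_add[OF assms(1), of T "g i"] by simp
qed

lemma contLp_sum_bool: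
  assumes "p > 1" "\<And>s::bool. contLp T p (g s)"
  shows "contLp T p (\<lambda>t x. \<Sum>s\<in>UNIV. g s t x)"
  using contLp_add[OF assms(1) assms(2)[of False] assms(2)[of True]] by (simp add: UNIV_bool)

text \<open>Time and space differ only in why the shifted data solve an equation again: in time it
  is the equation of another slice, in space the equation is invariant under translation. The rest
  is \<open>solution_deriv\<close> at each time.\<close>

lemma solution_step:
  assumes T: "T > 0" and a: "\<And>s. sder T d 4 (a s) (a' s)" and g: "sder T d (4/3) g g'"
    and v: "\<And>t. t \<in> {0..T} \<Longrightarrow> H1 (v t) (G t) \<and> ell (qf (\<lambda>s. a s t)) (g t) (v t)"
  shows "\<exists>w W. (\<forall>t\<in>{0..T}. H1 (w t) (W t) \<and>
      ell (qf (\<lambda>s. a s t)) (\<lambda>x. g' t x + (\<Sum>s\<in>UNIV. a' s t x * (a s t x + a s t x) * v t x)) (w t)) \<and> sder T d 4 v w"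
proof -
  have "\<exists>w W. H1 w W \<and> ell (qf (\<lambda>s. a s t)) (\<lambda>x. g' t x + (\<Sum>s\<in>UNIV. a' s t x * (a s t x + a s t x) * v t x)) w
      \<and> Lp_deriv (at 0 within adm T d t) 4 (\<lambda>h. sh d h v t) (v t) w" if t: "t \<in> {0..T}" for t
  proof (rule solution_deriv[OF adm_nontrivial[OF T t]])
    show "Lp_deriv (at 0 within adm T d t) 4 (\<lambda>h. sh d h (a s) t) (a s t) (a' s t)" for s using a t by (simp add: sder_def)
    show "Lp_deriv (at 0 within adm T d t) (4/3) (\<lambda>h. sh d h g t) (g t) (g' t)" using g t by (simp add: sder_def)
    show "H1 (v t) (G t)" "ell (qf (\<lambda>s. a s t)) (g t) (v t)" using v[OF t] by auto
    let ?e = "axis (of_nat (d - 1)) 1 :: real^4"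
    let ?K = "\<lambda>h. if d = 0 then G (t + h) else (\<lambda>i x. G t i (x + h *\<^sub>R ?e))"
    show "\<forall>\<^sub>F h in at 0 within adm T d t. H1 (sh d h v t) (?K h) \<and> ell (qf (\<lambda>s. sh d h (a s) t)) (sh d h g t) (sh d h v t)"
      using eventually_at_within_mem[where t=0 and S="adm T d t"]
    proof eventually_elim
      case (elim h)
      show ?case
      proof (cases "d = 0")
        case True
        then show ?thesis using elim v[of "t + h"] by (simp add: sh_def adm_def)
      next
        case False
        have a4: "in_Lp 4 (a s t)" for s using a[of s] t by (simp add: sder_def Lp_deriv_def)
        have g4: "in_Lp (4/3) (g t)" using g t by (simp add: sder_def Lp_deriv_def)
        have v4: "in_Lp 4 (v t)" using v[OF t] by (simp add: H1_def)
        have "ell (\<lambda>x. qf (\<lambda>s. a s t) (x + h *\<^sub>R ?e)) (\<lambda>x. g t (x + h *\<^sub>R ?e)) (\<lambda>x. v t (x + h *\<^sub>R ?e))"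
          using v[OF t] by (intro ell_translate in_Lp_measurable[OF v4] in_Lp_measurable[OF g4] in_Lp_measurable[OF qf_mult_in_Lp[OF a4 v4]]) auto
        moreover have "(\<lambda>x. qf (\<lambda>s. a s t) (x + h *\<^sub>R ?e)) = qf (\<lambda>s x. a s t (x + h *\<^sub>R ?e))" by (simp add: qf_def fun_eq_iff)
        ultimately show ?thesis using False H1_translate[of "v t" "G t" "h *\<^sub>R ?e"] v[OF t] by (simp add: sh_def)
      qed
    qed
  qed
  then have "\<forall>t\<in>{0..T}. \<exists>w. \<exists>W. H1 w W \<and> ell (qf (\<lambda>s. a s t)) (\<lambda>x. g' t x + (\<Sum>s\<in>UNIV. a' s t x * (a s t x + a s t x) * v t x)) w
      \<and> Lp_deriv (at 0 within adm T d t) 4 (\<lambda>h. sh d h v t) (v t) w" by (rule ballI)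
  from bchoice[OF this] obtain w where w: "\<forall>t\<in>{0..T}. \<exists>W. H1 (w t) W \<and> ell (qf (\<lambda>s. a s t)) (\<lambda>x. g' t x + (\<Sum>s\<in>UNIV. a' s t x * (a s t x + a s t x) * v t x)) (w t)
      \<and> Lp_deriv (at 0 within adm T d t) 4 (\<lambda>h. sh d h v t) (v t) (w t)" ..
  from bchoice[OF this] obtain W where "\<forall>t\<in>{0..T}. H1 (w t) (W t) \<and> ell (qf (\<lambda>s. a s t)) (\<lambda>x. g' t x + (\<Sum>s\<in>UNIV. a' s t x * (a s t x + a s t x) * v t x)) (w t)
      \<and> Lp_deriv (at 0 within adm T d t) 4 (\<lambda>h. sh d h v t) (v t) (w t)" ..
  then show ?thesis by (intro exI[of _ w] exI[of _ W]) (simp add: sder_def)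
qed

lemma solution_continuous:
  assumes a: "\<And>s. contLp T 4 (a s)" and r: "contLp T (4/3) r"
    and w: "\<And>t. t \<in> {0..T} \<Longrightarrow> H1 (w t) (W t) \<and> ell (qf (\<lambda>s. a s t)) (r t) (w t)"
  shows "contLp T 4 w" "\<And>t. t \<in> {0..T} \<Longrightarrow> ((\<lambda>s. gnorm (\<lambda>i x. W s i x - W t i x)) \<longlongrightarrow> 0) (at t within {0..T})"
proof -
  have ev: "\<forall>\<^sub>F s in at t within {0..T}. H1 (w s) (W s) \<and> ell (qf (\<lambda>\<sigma>. a \<sigma> s)) (r s) (w s)" for t
    using eventually_at_within_mem[where t=t and S="{0..T}"] by eventually_elim (rule w)
  have L: "Lp_lim (at t within {0..T}) 4 w (w t) \<and> ((\<lambda>s. gnorm (\<lambda>i x. W s i x - W t i x)) \<longlongrightarrow> 0) (at t within {0..T})" if t: "t \<in> {0..T}" for t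
    using solution_lim[OF contLp_lim[OF a t] contLp_lim[OF r t] ev] w[OF t] by blast
  then show "contLp T 4 w" by (intro contLpI) blast
  show "\<And>t. t \<in> {0..T} \<Longrightarrow> ((\<lambda>s. gnorm (\<lambda>i x. W s i x - W t i x)) \<longlongrightarrow> 0) (at t within {0..T})" using L by blast
qed

text \<open>The triples of words that index the terms produced by applying the derivatives of a word to the
product \<open>|\<phi>|\<^sup>2 u\<close>, without the term in which every derivative falls on \<open>u\<close>.\<close>

primrec leib :: "nat list \<Rightarrow> (nat list \<times> nat list \<times> nat list) list" where
  "leib [] = []"
| "leib (d # w) = concat (map (\<lambda>(a, b, c). [(d # a, b, c), (a, d # b, c), (a, b, d # c)]) (leib w))
     @ [([d], [], w), ([], [d], w)]"

lemma leib_mset: "(a, b, c) \<in> set (leib w) \<Longrightarrow> mset a + mset b + mset c = mset w"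
  by (induction w arbitrary: a b c) auto

text \<open>Strict because of the omitted term, the only one in which all derivatives fall on
  \<open>u\<close>. Hence the right-hand sides involve lower derivatives of \<open>u\<close> only,
  and the inductions on word length are well founded.\<close>

lemma leib_length: "(a, b, c) \<in> set (leib w) \<Longrightarrow> length c < length w"
  by (induction w arbitrary: a b c) (fastforce+)

text \<open>New letters enter at the front of a subword and are at least as large as all letters
  already distributed.\<close>

lemma leib_sorted:
  "(a, b, c) \<in> set (leib w) \<Longrightarrow> sorted_wrt (\<ge>) w \<Longrightarrow> sorted_wrt (\<ge>) a \<and> sorted_wrt (\<ge>) b \<and> sorted_wrt (\<ge>) c"
proof (induction w arbitrary: a b c)
  case (Cons d w)
  have *: "(\<forall>x\<in>set a. x \<le> d) \<and> (\<forall>x\<in>set b. x \<le> d) \<and> (\<forall>x\<in>set c. x \<le> d)" if "(a, b, c) \<in> set (leib w)" for a b c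
  proof -
    have "set_mset (mset a + mset b + mset c) = set w" using leib_mset[OF that] by simp
    then have "set a \<union> set b \<union> set c = set w" by simp
    then show ?thesis using Cons.prems(2) by auto
  qed
  have s: "sorted_wrt (\<ge>) w" using Cons.prems by simp
  from Cons.prems(1) consider a' b' c' where "(a', b', c') \<in> set (leib w)"
      "(a, b, c) = (d # a', b', c') \<or> (a, b, c) = (a', d # b', c') \<or> (a, b, c) = (a', b', d # c')"
    | "(a, b, c) = ([d], [], w) \<or> (a, b, c) = ([], [d], w)" by auto
  then show ?case
  proof cases
    case 1
    then show ?thesis using Cons.IH[OF 1(1) s] *[OF 1(1)] by auto
  next
    case 2
    then show ?thesis using s by auto
  qed
qed simp

text \<open>The right-hand side of the equation for the derivative of \<open>u\<close> along
  \<open>w\<close>, the term \<open>|phi|^2\<close> times that derivative staying on the left.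
  Values of \<open>v\<close> enter only at words shorter than \<open>w\<close>.\<close>

definition rhs :: "(bool \<Rightarrow> nat list \<Rightarrow> real \<Rightarrow> real^4 \<Rightarrow> real) \<Rightarrow> (nat list \<Rightarrow> real \<Rightarrow> real^4 \<Rightarrow> real) \<Rightarrow>
    (nat list \<Rightarrow> real \<Rightarrow> real^4 \<Rightarrow> real) \<Rightarrow> nat list \<Rightarrow> real \<Rightarrow> real^4 \<Rightarrow> real" where
  "rhs ph f v w t x = f w t x + (\<Sum>i\<leftarrow>leib w. \<Sum>s\<in>UNIV. ph s (fst i) t x * ph s (fst (snd i)) t x * v (snd (snd i)) t x)"

lemma rhs_cong:
  assumes "\<And>a b c. (a, b, c) \<in> set (leib w) \<Longrightarrow> v c = v' c"
  shows "rhs ph f v w = rhs ph f v' w"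
proof -
  have e: "v (snd (snd i)) = v' (snd (snd i))" if "i \<in> set (leib w)" for i using assms[of "fst i" "fst (snd i)" "snd (snd i)"] that by simp
  have m: "map (\<lambda>i. \<Sum>s\<in>UNIV. ph s (fst i) t x * ph s (fst (snd i)) t x * v (snd (snd i)) t x) (leib w)
    = map (\<lambda>i. \<Sum>s\<in>UNIV. ph s (fst i) t x * ph s (fst (snd i)) t x * v' (snd (snd i)) t x) (leib w)" for t x
    by (rule map_cong) (simp_all add: e)
  show ?thesis by (intro ext) (simp only: rhs_def m)
qed

text \<open>The sum over \<open>leib w\<close> is the termwise derivative of the previous right-hand
  side. The last sum comes from differentiating the potential on the left of the equation for
  \<open>w\<close>; it accounts for the two terms that \<open>leib\<close> appends.\<close>

lemma rhs_Cons:
  "rhs ph f v (d # w) t x = f (d # w) t x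
     + (\<Sum>i\<leftarrow>leib w. \<Sum>s\<in>UNIV. ph s (d # fst i) t x * ph s (fst (snd i)) t x * v (snd (snd i)) t x
        + (ph s (fst i) t x * ph s (d # fst (snd i)) t x * v (snd (snd i)) t x
        + ph s (fst i) t x * ph s (fst (snd i)) t x * v (d # snd (snd i)) t x))
     + (\<Sum>s\<in>UNIV. ph s [d] t x * (ph s [] t x + ph s [] t x) * v w t x)"
proof -
  have "(\<Sum>i\<leftarrow>concat (map (\<lambda>(a, b, c). [(d # a, b, c), (a, d # b, c), (a, b, d # c)]) L). \<Sum>s\<in>UNIV. ph s (fst i) t x * ph s (fst (snd i)) t x * v (snd (snd i)) t x)
     = (\<Sum>i\<leftarrow>L. \<Sum>s\<in>UNIV. ph s (d # fst i) t x * ph s (fst (snd i)) t x * v (snd (snd i)) t x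
        + (ph s (fst i) t x * ph s (d # fst (snd i)) t x * v (snd (snd i)) t x
        + ph s (fst i) t x * ph s (fst (snd i)) t x * v (d # snd (snd i)) t x))" for L
    by (induction L) (auto simp: sum.distrib)
  then show ?thesis by (simp add: rhs_def sum.distrib distrib_left distrib_right mult_ac sum_distrib_left)
qed

lemma Minkowski_sum_list:
  assumes "p > 1" "\<And>i. i \<in> set L \<Longrightarrow> in_Lp p (g i)"
  shows "in_Lp p (\<lambda>x. \<Sum>i\<leftarrow>L. g i x) \<and> Lp_norm p (\<lambda>x. \<Sum>i\<leftarrow>L. g i x) \<le> (\<Sum>i\<leftarrow>L. Lp_norm p (g i))"
  using assms(2)
proof (induction L)
  case Nil
  then show ?case using assms(1) by (simp add: in_Lp_zero Lp_norm_zero)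
next
  case (Cons i L)
  then have "in_Lp p (g i)" and L: "in_Lp p (\<lambda>x. \<Sum>i\<leftarrow>L. g i x)" "Lp_norm p (\<lambda>x. \<Sum>i\<leftarrow>L. g i x) \<le> (\<Sum>i\<leftarrow>L. Lp_norm p (g i))" by auto
  then show ?case using Minkowski[OF assms(1), of "g i"] in_Lp_add[of p "g i"] assms(1) by force
qed

text \<open>Assumptions are made only for decreasing words whose letters form a sub-multiset of
  \<open>W0\<close>. All Leibniz factors for \<open>W0\<close> are of this kind, and for these words
  the given derivatives provide one-step relations.\<close>

locale elliptic_data =
  fixes T :: real and ph :: "bool \<Rightarrow> nat list \<Rightarrow> real \<Rightarrow> real^4 \<Rightarrow> real" and f :: "nat list \<Rightarrow> real \<Rightarrow> real^4 \<Rightarrow> real"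
    and u :: "real \<Rightarrow> real^4 \<Rightarrow> real" and Gu :: "real \<Rightarrow> 4 \<Rightarrow> real^4 \<Rightarrow> real" and W0 :: "nat list"
  fixes ok :: "nat list \<Rightarrow> bool"
  defines "ok w \<equiv> sorted_wrt (\<ge>) w \<and> mset w \<subseteq># mset W0"
  assumes T: "T > 0"
    and ph_cont: "ok w \<Longrightarrow> contLp T 4 (ph s w)" and ph_der: "ok (d # w) \<Longrightarrow> wdst T (dv d) (ph s w) (ph s (d # w))"
    and f_cont: "ok w \<Longrightarrow> contLp T (4/3) (f w)" and f_der: "ok (d # w) \<Longrightarrow> wdst T (dv d) (f w) (f (d # w))"
    and u: "t \<in> {0..T} \<Longrightarrow> H1 (u t) (Gu t) \<and> ell (qf (\<lambda>s. ph s [] t)) (f [] t) (u t)"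
begin

lemma ok_Nil: "ok []"
  by (simp add: ok_def)

lemma ok_ConsD: "ok (d # w) \<Longrightarrow> ok w"
  unfolding ok_def by (auto dest: mset_subset_eq_insertD simp: subset_mset.less_imp_le)

lemma ok_mono: "sorted_wrt (\<ge>) a \<Longrightarrow> mset a \<subseteq># mset w \<Longrightarrow> ok w \<Longrightarrow> ok a"
  unfolding ok_def by (meson subset_mset.order_trans)

lemma ok_leib:
  assumes "ok w" "(a, b, c) \<in> set (leib w)"
  shows "ok a" "ok b" "ok c"
proof -
  have "mset a \<subseteq># mset w" "mset b \<subseteq># mset w" "mset c \<subseteq># mset w"
    unfolding leib_mset[OF assms(2), symmetric]
    by (rule subset_mset.order_trans[OF mset_subset_eq_add_left mset_subset_eq_add_left],
        rule subset_mset.order_trans[OF mset_subset_eq_add_right mset_subset_eq_add_left], rule mset_subset_eq_add_right)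
  moreover have "sorted_wrt (\<ge>) w" using assms(1) by (simp add: ok_def)
  ultimately show "ok a" "ok b" "ok c" using leib_sorted[OF assms(2)] ok_mono[OF _ _ assms(1)] by blast+
qed

lemma ok_leib_Cons:
  assumes "ok (d # w)" "(a, b, c) \<in> set (leib w)"
  shows "ok (d # a)" "ok (d # b)" "ok (d # c)"
proof -
  have "(d # a, b, c) \<in> set (leib (d # w))" "(a, d # b, c) \<in> set (leib (d # w))" "(a, b, d # c) \<in> set (leib (d # w))"
    using assms(2) by force+
  then show "ok (d # a)" "ok (d # b)" "ok (d # c)" using ok_leib[OF assms(1)] by blast+
qed

lemma ph_sder: "ok (d # w) \<Longrightarrow> sder T d 4 (ph s w) (ph s (d # w))"
  using ok_ConsD[of d w] by (intro sder_of_wdst[OF T]) (auto intro: ph_cont ph_der)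

lemma f_sder: "ok (d # w) \<Longrightarrow> sder T d (4/3) (f w) (f (d # w))"
  using ok_ConsD[of d w] by (intro sder_of_wdst[OF T]) (auto intro: f_cont f_der)

definition good :: "(nat list \<Rightarrow> real \<Rightarrow> real^4 \<Rightarrow> real) \<Rightarrow> nat list \<Rightarrow> bool" where
  "good v w \<longleftrightarrow> (\<exists>G. \<forall>t\<in>{0..T}. H1 (v w t) (G t) \<and> ell (qf (\<lambda>s. ph s [] t)) (rhs ph f v w t) (v w t))
     \<and> (\<forall>d w'. w = d # w' \<longrightarrow> sder T d 4 (v w') (v w))"

text \<open>The right-hand side for \<open>w\<close> is differentiated term by term. It contains
  \<open>v c\<close> with \<open>c\<close> shorter than \<open>w\<close>, so \<open>d # c\<close>
  has length at most \<open>n\<close> and the derivative of \<open>v c\<close> is already in the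
  family; the only new object is the derivative of \<open>v w\<close>.\<close>

lemma good_step:
  assumes v: "\<And>w. ok w \<Longrightarrow> length w \<le> n \<Longrightarrow> good v w" and w: "ok (d # w)" "length w = n"
  shows "\<exists>V. (\<exists>G. \<forall>t\<in>{0..T}. H1 (V t) (G t) \<and> ell (qf (\<lambda>s. ph s [] t)) (rhs ph f v (d # w) t) (V t)) \<and> sder T d 4 (v w) V"
proof -
  obtain G where G: "\<And>t. t \<in> {0..T} \<Longrightarrow> H1 (v w t) (G t) \<and> ell (qf (\<lambda>s. ph s [] t)) (rhs ph f v w t) (v w t)"
    using v[OF ok_ConsD[OF w(1)]] w(2) unfolding good_def by blast
  have od: "ok [d]" using ok_mono[OF _ _ w(1), of "[d]"] by simp
  have vd: "sder T d 4 (v c) (v (d # c))" if "(a, b, c) \<in> set (leib w)" for a b c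
  proof -
    have "good v (d # c)" using ok_leib_Cons(3)[OF w(1) that] leib_length[OF that] w(2) by (intro v) auto
    then show ?thesis by (simp add: good_def)
  qed
  let ?D = "\<lambda>t x. f (d # w) t x
     + (\<Sum>i\<leftarrow>leib w. \<Sum>s\<in>UNIV. ph s (d # fst i) t x * ph s (fst (snd i)) t x * v (snd (snd i)) t x
        + (ph s (fst i) t x * ph s (d # fst (snd i)) t x * v (snd (snd i)) t x
        + ph s (fst i) t x * ph s (fst (snd i)) t x * v (d # snd (snd i)) t x))"
  have "sder T d (4/3) (\<lambda>t x. f w t x + (\<Sum>i\<leftarrow>leib w. \<Sum>s\<in>UNIV. ph s (fst i) t x * ph s (fst (snd i)) t x * v (snd (snd i)) t x)) ?D"
  proof (intro sder_add sder_sum_list sder_sum_bool sder_mult3 f_sder[OF w(1)])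
    fix i s assume "i \<in> set (leib w)"
    then have i: "(fst i, fst (snd i), snd (snd i)) \<in> set (leib w)" by simp
    show "sder T d 4 (ph s (fst i)) (ph s (d # fst i))" "sder T d 4 (ph s (fst (snd i))) (ph s (d # fst (snd i)))"
      "sder T d 4 (v (snd (snd i))) (v (d # snd (snd i)))"
      by (rule ph_sder[OF ok_leib_Cons(1)[OF w(1) i]], rule ph_sder[OF ok_leib_Cons(2)[OF w(1) i]], rule vd[OF i])
  qed auto
  then have "sder T d (4/3) (rhs ph f v w) ?D" by (simp add: rhs_def[abs_def])
  from solution_step[OF T ph_sder[OF od] this G]
  obtain V W where "\<forall>t\<in>{0..T}. H1 (V t) (W t) \<and> ell (qf (\<lambda>s. ph s [] t)) (\<lambda>x. ?D t x + (\<Sum>s\<in>UNIV. ph s [d] t x * (ph s [] t x + ph s [] t x) * v w t x)) (V t)"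
    "sder T d 4 (v w) V" by blast
  moreover have "(\<lambda>x. ?D t x + (\<Sum>s\<in>UNIV. ph s [d] t x * (ph s [] t x + ph s [] t x) * v w t x)) = rhs ph f v (d # w) t" for t
    by (simp add: fun_eq_iff rhs_Cons)
  ultimately show ?thesis by auto
qed

text \<open>The derivatives of \<open>u\<close> are chosen level by level in the word length.
  Redefining the family at length \<open>Suc n\<close> leaves the right-hand sides up to that length
  unchanged, since they involve strictly shorter words.\<close>

lemma good_exists_upto: "\<exists>v. v [] = u \<and> (\<forall>w. ok w \<longrightarrow> length w \<le> n \<longrightarrow> good v w)"
proof (induction n)
  case 0
  have "rhs ph f (\<lambda>_. u) [] = f []" by (simp add: rhs_def fun_eq_iff)
  then have "good (\<lambda>_. u) []" unfolding good_def using u by (auto intro!: exI[of _ Gu])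
  then show ?case by (intro exI[of _ "\<lambda>_. u"]) simp
next
  case (Suc n)
  then obtain v where v0: "v [] = u" and v: "\<And>w. ok w \<Longrightarrow> length w \<le> n \<Longrightarrow> good v w" by blast
  have "\<forall>w. \<exists>V. ok w \<longrightarrow> length w = Suc n \<longrightarrow>
     (\<exists>G. \<forall>t\<in>{0..T}. H1 (V t) (G t) \<and> ell (qf (\<lambda>s. ph s [] t)) (rhs ph f v w t) (V t)) \<and> (\<forall>d w'. w = d # w' \<longrightarrow> sder T d 4 (v w') V)"
  proof
    fix w
    show "\<exists>V. ok w \<longrightarrow> length w = Suc n \<longrightarrow>
       (\<exists>G. \<forall>t\<in>{0..T}. H1 (V t) (G t) \<and> ell (qf (\<lambda>s. ph s [] t)) (rhs ph f v w t) (V t)) \<and> (\<forall>d w'. w = d # w' \<longrightarrow> sder T d 4 (v w') V)"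
    proof (cases "ok w \<and> length w = Suc n")
      case True
      then obtain d w' where dw: "w = d # w'" "length w' = n" by (cases w) auto
      then show ?thesis using good_step[of n v d w', OF v] True by auto
    qed auto
  qed
  from choice[OF this] obtain V where V: "\<And>w. ok w \<Longrightarrow> length w = Suc n \<Longrightarrow>
     (\<exists>G. \<forall>t\<in>{0..T}. H1 (V w t) (G t) \<and> ell (qf (\<lambda>s. ph s [] t)) (rhs ph f v w t) (V w t)) \<and> (\<forall>d w'. w = d # w' \<longrightarrow> sder T d 4 (v w') (V w))" by blast
  define v' where "v' w = (if length w = Suc n then V w else v w)" for w
  have same: "v' c = v c" if "length c \<le> n" for c using that by (simp add: v'_def)
  have r: "rhs ph f v' w = rhs ph f v w" if "length w \<le> Suc n" for w
    by (rule rhs_cong, rule same) (use that leib_length in fastforce)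
  have "good v' w" if w: "ok w" "length w \<le> Suc n" for w
  proof (cases "length w = Suc n")
    case True
    then have e1: "v' w = V w" by (simp add: v'_def)
    have e2: "v' w' = v w'" if "w = d # w'" for d w' using that True by (intro same) simp
    show ?thesis unfolding good_def
    proof (intro conjI allI impI)
      show "\<exists>G. \<forall>t\<in>{0..T}. H1 (v' w t) (G t) \<and> ell (qf (\<lambda>s. ph s [] t)) (rhs ph f v' w t) (v' w t)"
        unfolding e1 r[OF w(2)] using V[OF w(1) True] by blast
      fix d w' assume "w = d # w'"
      then show "sder T d 4 (v' w') (v' w)" unfolding e1 e2[OF \<open>w = d # w'\<close>] using V[OF w(1) True] by blast
    qed
  next
    case False
    then have wn: "length w \<le> n" using w by simp
    have e2: "v' w' = v w'" if "w = d # w'" for d w' using that wn by (intro same) simp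
    have g: "good v w" by (rule v[OF w(1) wn])
    show ?thesis unfolding good_def
    proof (intro conjI allI impI)
      show "\<exists>G. \<forall>t\<in>{0..T}. H1 (v' w t) (G t) \<and> ell (qf (\<lambda>s. ph s [] t)) (rhs ph f v' w t) (v' w t)"
        unfolding same[OF wn] r[OF w(2)] using g unfolding good_def by blast
      fix d w' assume "w = d # w'"
      then show "sder T d 4 (v' w') (v' w)" unfolding same[OF wn] e2[OF \<open>w = d # w'\<close>] using g unfolding good_def by blast
    qed
  qed
  moreover have "v' [] = u" using v0 by (simp add: v'_def)
  ultimately show ?case by blast
qed

lemma ok_length: "ok w \<Longrightarrow> length w \<le> length W0"
  unfolding ok_def using size_mset_mono[of "mset w" "mset W0"] by simp

lemma rhs_contLp:
  assumes w: "ok w" and v: "\<And>a b c. (a, b, c) \<in> set (leib w) \<Longrightarrow> contLp T 4 (v c)"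
  shows "contLp T (4/3) (rhs ph f v w)"
proof -
  have "contLp T (4/3) (\<lambda>t x. f w t x + (\<Sum>i\<leftarrow>leib w. \<Sum>s\<in>UNIV. ph s (fst i) t x * ph s (fst (snd i)) t x * v (snd (snd i)) t x))"
  proof (rule contLp_add[OF _ f_cont[OF w]], simp, rule contLp_sum_list, simp)
    fix i assume "i \<in> set (leib w)"
    then have i: "(fst i, fst (snd i), snd (snd i)) \<in> set (leib w)" by simp
    show "contLp T (4/3) (\<lambda>t x. \<Sum>s\<in>UNIV. ph s (fst i) t x * ph s (fst (snd i)) t x * v (snd (snd i)) t x)"
      by (rule contLp_sum_bool, simp, rule contLp_mult3[OF ph_cont[OF ok_leib(1)[OF w i]] ph_cont[OF ok_leib(2)[OF w i]] v[OF i]])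
  qed
  then show ?thesis by (simp add: rhs_def[abs_def])
qed

lemma rhs_bound:
  assumes w: "ok w" and t: "t \<in> {0..T}" and v: "\<And>a b c. (a, b, c) \<in> set (leib w) \<Longrightarrow> in_Lp 4 (v c t)"
  shows "Lp_norm (4/3) (rhs ph f v w t) \<le> Lp_norm (4/3) (f w t)
    + (\<Sum>i\<leftarrow>leib w. \<Sum>s\<in>UNIV. Lp_norm 4 (ph s (fst i) t) * Lp_norm 4 (ph s (fst (snd i)) t) * Lp_norm 4 (v (snd (snd i)) t))"
proof -
  let ?g = "\<lambda>i x. \<Sum>s\<in>UNIV. ph s (fst i) t x * ph s (fst (snd i)) t x * v (snd (snd i)) t x"
  have f4: "in_Lp (4/3) (f w t)" using f_cont[OF w] t by (simp add: contLp_def)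
  have tm: "in_Lp (4/3) (?g i) \<and> Lp_norm (4/3) (?g i) \<le> (\<Sum>s\<in>UNIV. Lp_norm 4 (ph s (fst i) t) * Lp_norm 4 (ph s (fst (snd i)) t) * Lp_norm 4 (v (snd (snd i)) t))"
    if "i \<in> set (leib w)" for i
  proof -
    have i: "(fst i, fst (snd i), snd (snd i)) \<in> set (leib w)" using that by simp
    have p: "in_Lp 4 (ph s (fst i) t)" "in_Lp 4 (ph s (fst (snd i)) t)" for s
      using ph_cont[OF ok_leib(1)[OF w i]] ph_cont[OF ok_leib(2)[OF w i]] t by (auto simp: contLp_def)
    note m = L4_mult3[OF p v[OF i]]
    have "Lp_norm (4/3) (?g i) \<le> (\<Sum>s\<in>UNIV. Lp_norm (4/3) (\<lambda>x. ph s (fst i) t x * ph s (fst (snd i)) t x * v (snd (snd i)) t x))"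
      using m(1) by (intro Minkowski_sum) auto
    also have "\<dots> \<le> (\<Sum>s\<in>UNIV. Lp_norm 4 (ph s (fst i) t) * Lp_norm 4 (ph s (fst (snd i)) t) * Lp_norm 4 (v (snd (snd i)) t))"
      by (intro sum_mono m(2))
    finally show ?thesis using m(1) by (auto intro!: in_Lp_sum)
  qed
  have S: "in_Lp (4/3) (\<lambda>x. \<Sum>i\<leftarrow>leib w. ?g i x)" "Lp_norm (4/3) (\<lambda>x. \<Sum>i\<leftarrow>leib w. ?g i x) \<le> (\<Sum>i\<leftarrow>leib w. Lp_norm (4/3) (?g i))"
    using Minkowski_sum_list[of "4/3" "leib w" ?g] tm by auto
  have "Lp_norm (4/3) (rhs ph f v w t) \<le> Lp_norm (4/3) (f w t) + Lp_norm (4/3) (\<lambda>x. \<Sum>i\<leftarrow>leib w. ?g i x)"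
    unfolding rhs_def by (rule Minkowski[OF _ f4 S(1)]) simp
  also have "Lp_norm (4/3) (\<lambda>x. \<Sum>i\<leftarrow>leib w. ?g i x) \<le> (\<Sum>i\<leftarrow>leib w. Lp_norm (4/3) (?g i))" by (rule S(2))
  also have "\<dots> \<le> (\<Sum>i\<leftarrow>leib w. \<Sum>s\<in>UNIV. Lp_norm 4 (ph s (fst i) t) * Lp_norm 4 (ph s (fst (snd i)) t) * Lp_norm 4 (v (snd (snd i)) t))"
    using tm by (intro sum_list_mono) blast
  finally show ?thesis by simp
qed

lemma solution_family:
  "\<exists>v G. v [] = u \<and> (\<forall>w. ok w \<longrightarrow> contLp T 4 (v w)
     \<and> (\<forall>t\<in>{0..T}. H1 (v w t) (G w t) \<and> gnorm (G w t) \<le> Lp_norm (4/3) (rhs ph f v w t)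
         \<and> ((\<lambda>s. gnorm (\<lambda>i x. G w s i x - G w t i x)) \<longlongrightarrow> 0) (at t within {0..T}))
     \<and> (\<forall>d w'. w = d # w' \<longrightarrow> wdst T (dv d) (v w') (v w)))"
proof -
  obtain v where v0: "v [] = u" and v: "\<And>w. ok w \<Longrightarrow> good v w"
    using good_exists_upto[of "length W0"] ok_length by blast
  have "\<forall>w. \<exists>G. ok w \<longrightarrow> (\<forall>t\<in>{0..T}. H1 (v w t) (G t) \<and> ell (qf (\<lambda>s. ph s [] t)) (rhs ph f v w t) (v w t))"
    using v unfolding good_def by blast
  from choice[OF this] obtain G where G: "\<And>w t. ok w \<Longrightarrow> t \<in> {0..T} \<Longrightarrow> H1 (v w t) (G w t) \<and> ell (qf (\<lambda>s. ph s [] t)) (rhs ph f v w t) (v w t)"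
    by blast
  note p0 = ph_cont[OF ok_Nil]
  have vc: "contLp T 4 (v w)" if "ok w" for w
    using that
  proof (induction w rule: measure_induct_rule[of length])
    case (less w)
    have "contLp T (4/3) (rhs ph f v w)"
      by (rule rhs_contLp[OF less.prems], rule less.IH[OF leib_length ok_leib(3)[OF less.prems]])
    from solution_continuous(1)[OF p0 this G[OF less.prems]] show ?case by blast
  qed
  have rc: "contLp T (4/3) (rhs ph f v w)" if "ok w" for w
    by (rule rhs_contLp[OF that], rule vc, rule ok_leib(3)[OF that])
  have "contLp T 4 (v w)
     \<and> (\<forall>t\<in>{0..T}. H1 (v w t) (G w t) \<and> gnorm (G w t) \<le> Lp_norm (4/3) (rhs ph f v w t)
         \<and> ((\<lambda>s. gnorm (\<lambda>i x. G w s i x - G w t i x)) \<longlongrightarrow> 0) (at t within {0..T}))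
     \<and> (\<forall>d w'. w = d # w' \<longrightarrow> wdst T (dv d) (v w') (v w))" if w: "ok w" for w
  proof (intro conjI ballI allI impI)
    show "contLp T 4 (v w)" by (rule vc[OF w])
    fix t assume t: "t \<in> {0..T}"
    show "H1 (v w t) (G w t)" using G[OF w t] by blast
    have pin: "in_Lp 4 (ph s [] t)" for s using p0 t by (auto simp: contLp_def)
    have rin: "in_Lp (4/3) (rhs ph f v w t)" using rc[OF w] t by (auto simp: contLp_def)
    show "gnorm (G w t) \<le> Lp_norm (4/3) (rhs ph f v w t)"
      using solution_bound(1)[of "v w t" "G w t" "\<lambda>s. ph s [] t", OF _ _ pin rin] G[OF w t] by blast
    show "((\<lambda>s. gnorm (\<lambda>i x. G w s i x - G w t i x)) \<longlongrightarrow> 0) (at t within {0..T})"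
      by (rule solution_continuous(2)[OF p0 rc[OF w] G[OF w] t])
  next
    fix d w' assume e: "w = d # w'"
    have "sder T d 4 (v w') (v w)" using v[OF w] e by (simp add: good_def)
    then show "wdst T (dv d) (v w') (v w)"
      using w e ok_ConsD[of d w'] by (intro wdst_of_sder[OF T _ vc vc]) auto
  qed
  then show ?thesis using v0 by blast
qed

end

section \<open>Complex-valued functions\<close>

definition cpart :: "bool \<Rightarrow> complex \<Rightarrow> real" where
  "cpart s z = (if s then Re z else Im z)"

lemma bounded_linear_cpart: "bounded_linear (cpart s)"
  unfolding cpart_def[abs_def] by (cases s) (simp_all add: bounded_linear_Re bounded_linear_Im)

lemma cpart_le: "\<bar>cpart s z\<bar> \<le> norm z"
  by (simp add: cpart_def abs_Re_le_cmod abs_Im_le_cmod)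

lemma cpart_diff: "cpart s (z - w) = cpart s z - cpart s w"
  by (simp add: cpart_def)

lemma cpart_eqI: "(\<And>s. cpart s z = cpart s w) \<Longrightarrow> z = w"
  unfolding cpart_def by (metis complex_eqI)

lemma cpart_scaleR: "cpart s (r *\<^sub>R z) = r * cpart s z"
  by (simp add: cpart_def)

lemma cpart_measurable:
  fixes g :: "real^4 \<Rightarrow> complex"
  shows "g \<in> borel_measurable borel \<Longrightarrow> (\<lambda>x. cpart s (g x)) \<in> borel_measurable borel"
  by (cases s) (simp_all add: cpart_def)

lemma Lp_cpart:
  assumes "p > 0" "in_Lp p g"
  shows "in_Lp p (\<lambda>x. cpart s (g x))" "Lp_norm p (\<lambda>x. cpart s (g x)) \<le> Lp_norm p g"
  using Lp_mono[OF assms cpart_measurable[OF in_Lp_measurable[OF assms(2)]]] cpart_le by auto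

lemma integral_cpart:
  fixes g :: "real^4 \<Rightarrow> complex"
  assumes p: "p > 1" and g: "in_Lp p g" and \<psi>: "test \<psi>"
  shows "integrable lborel (\<lambda>x. \<psi> x *\<^sub>R g x)" "cpart s (LINT x|lborel. \<psi> x *\<^sub>R g x) = (LINT x|lborel. \<psi> x * cpart s (g x))"
proof -
  define q where "q = p / (p - 1)"
  have q: "q > 1" "1 / p + 1 / q = 1" using p by (auto simp: q_def field_simps)
  have "in_Lp q \<psi>" by (rule test_in_Lp[OF \<psi>]) (use q in simp)
  note H = Holder_norm(1)[OF p q g this]
  show i: "integrable lborel (\<lambda>x. \<psi> x *\<^sub>R g x)"
    by (rule Bochner_Integration.integrable_bound[OF H])
      (use in_Lp_measurable[OF g] test_measurable[OF \<psi>] in \<open>auto simp: mult.commute\<close>)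
  show "cpart s (LINT x|lborel. \<psi> x *\<^sub>R g x) = (LINT x|lborel. \<psi> x * cpart s (g x))"
    using integral_bounded_linear[OF bounded_linear_cpart i, of s] by (simp add: cpart_scaleR)
qed

lemma wderiv_cpart:
  assumes "in_Lp 4 g" "wgrad_ok g i G"
  shows "wderiv (\<lambda>x. cpart s (g x)) i (\<lambda>x. cpart s (G x))"
  unfolding wderiv_def
proof (intro allI impI)
  fix \<psi> :: "real^4 \<Rightarrow> real" assume \<psi>: "test \<psi>"
  have G: "in_Lp 2 G" using assms(2) by (simp add: wgrad_ok_def)
  have "(LINT x|lborel. \<psi> x *\<^sub>R G x) = - (LINT x|lborel. dd (axis i 1) \<psi> x *\<^sub>R g x)"
    using assms(2) \<psi> unfolding wgrad_ok_def test_x_iff by blast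
  then have "cpart s (LINT x|lborel. \<psi> x *\<^sub>R G x) = - cpart s (LINT x|lborel. dd (axis i 1) \<psi> x *\<^sub>R g x)"
    by (simp add: cpart_def)
  then show "(LINT x|lborel. \<psi> x * cpart s (G x)) = - (LINT x|lborel. dd (axis i 1) \<psi> x * cpart s (g x))"
    unfolding integral_cpart(2)[OF _ G \<psi>, of s, simplified] integral_cpart(2)[OF _ assms(1) test_dd[OF \<psi> axis_in_Basis4], of s, simplified] .
qed

text \<open>Weak gradients agree almost everywhere, so the choice made inside \<open>hnorm\<close>
  does not matter and any weak gradient computes it.\<close>

lemma wgrad_ok_unique:
  assumes g: "in_Lp 4 g" and "wgrad_ok g i G" "wgrad_ok g i K"
  shows "Lp_norm 2 G = Lp_norm 2 K"
proof -
  have G: "in_Lp 2 G" and K: "in_Lp 2 K" using assms by (auto simp: wgrad_ok_def)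
  have "AE x in lborel. cpart s (G x) = cpart s (K x)" for s
    using wderiv_unique[OF wderiv_cpart[OF g assms(2)] wderiv_cpart[OF g assms(3)]] Lp_cpart(1)[OF _ G] Lp_cpart(1)[OF _ K] by simp
  then have "AE x in lborel. \<forall>s. cpart s (G x) = cpart s (K x)" by (simp add: AE_all_countable)
  then have "AE x in lborel. G x = K x" by eventually_elim (auto intro: cpart_eqI)
  then show ?thesis using Lp_cong_AE(2)[OF _ K in_Lp_measurable[OF G]] by simp
qed

lemma hnorm_eq:
  assumes "in_Lp 4 g" "\<And>i. wgrad_ok g i (G i)"
  shows "hnorm g = sqrt (\<Sum>i\<in>UNIV. (Lp_norm 2 (G i))\<^sup>2)"
proof -
  have "wgrad_ok g i (SOME G. wgrad_ok g i G)" for i by (rule someI[of "\<lambda>G. wgrad_ok g i G", OF assms(2)])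
  then have "Lp_norm 2 (SOME G. wgrad_ok g i G) = Lp_norm 2 (G i)" for i using wgrad_ok_unique[OF assms(1)] assms(2) by blast
  then show ?thesis by (simp add: hnorm_def)
qed

lemma Hdot1E:
  assumes "Hdot1 g"
  obtains G where "\<And>i. wgrad_ok g i (G i)" "hnorm g = sqrt (\<Sum>i\<in>UNIV. (Lp_norm 2 (G i))\<^sup>2)"
proof -
  have "\<forall>i. \<exists>G. wgrad_ok g i G" using assms by (simp add: Hdot1_def)
  from choice[OF this] obtain G where G: "\<And>i. wgrad_ok g i (G i)" by blast
  have "in_Lp 4 g" using assms by (simp add: Hdot1_def)
  from that[OF G hnorm_eq[OF this G]] show ?thesis .
qed

lemma Hdot1_cpart:
  assumes "Hdot1 g"
  shows "\<exists>G. H1 (\<lambda>x. cpart s (g x)) G" "Lp_norm 4 (\<lambda>x. cpart s (g x)) \<le> hnorm g"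
proof -
  have g: "in_Lp 4 g" using assms by (simp add: Hdot1_def)
  obtain G where G: "\<And>i. wgrad_ok g i (G i)" "hnorm g = sqrt (\<Sum>i\<in>UNIV. (Lp_norm 2 (G i))\<^sup>2)" using Hdot1E[OF assms] by blast
  have G2: "in_Lp 2 (G i)" for i using G(1)[of i] by (simp add: wgrad_ok_def)
  have H: "H1 (\<lambda>x. cpart s (g x)) (\<lambda>i x. cpart s (G i x))"
    unfolding H1_def using Lp_cpart(1)[OF _ g] Lp_cpart(1)[OF _ G2] wderiv_cpart[OF g G(1)] by simp
  then show "\<exists>G. H1 (\<lambda>x. cpart s (g x)) G" by blast
  have "Lp_norm 4 (\<lambda>x. cpart s (g x)) \<le> gnorm (\<lambda>i x. cpart s (G i x))" by (rule Sobolev_H1[OF H])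
  also have "\<dots> \<le> hnorm g" unfolding gnorm_def G(2)
    using Lp_cpart(2)[OF _ G2] Lp_norm_nonneg by (intro real_sqrt_le_mono sum_mono power_mono) auto
  finally show "Lp_norm 4 (\<lambda>x. cpart s (g x)) \<le> hnorm g" .
qed

lemma wgrad_ok_diff:
  assumes g: "in_Lp 4 g" "wgrad_ok g i G" and k: "in_Lp 4 k" "wgrad_ok k i K"
  shows "wgrad_ok (\<lambda>x. g x - k x) i (\<lambda>x. G x - K x)"
proof -
  have G: "in_Lp 2 G" and K: "in_Lp 2 K" using g k by (auto simp: wgrad_ok_def)
  have "(LINT x|lborel. \<psi> x *\<^sub>R (G x - K x)) = - (LINT x|lborel. dd (axis i 1) \<psi> x *\<^sub>R (g x - k x))" if \<psi>: "test \<psi>" for \<psi>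
  proof -
    note t = test_dd[OF \<psi> axis_in_Basis4, of i]
    have "(LINT x|lborel. \<psi> x *\<^sub>R G x) = - (LINT x|lborel. dd (axis i 1) \<psi> x *\<^sub>R g x)"
      "(LINT x|lborel. \<psi> x *\<^sub>R K x) = - (LINT x|lborel. dd (axis i 1) \<psi> x *\<^sub>R k x)"
      using g(2) k(2) \<psi> unfolding wgrad_ok_def test_x_iff by blast+
    then show ?thesis
      using integral_cpart(1)[OF _ G \<psi>] integral_cpart(1)[OF _ K \<psi>] integral_cpart(1)[OF _ g(1) t] integral_cpart(1)[OF _ k(1) t]
      by (simp add: scaleR_diff_right)
  qed
  then show ?thesis using in_Lp_diff[OF _ G K] by (simp add: wgrad_ok_def test_x_iff)
qed

lemma Hdot1_diff:
  assumes g: "Hdot1 g" and k: "Hdot1 k"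
  shows "Hdot1 (\<lambda>x. g x - k x)" "\<bar>hnorm g - hnorm k\<bar> \<le> hnorm (\<lambda>x. g x - k x)"
proof -
  have g4: "in_Lp 4 g" and k4: "in_Lp 4 k" using g k by (auto simp: Hdot1_def)
  obtain G where G: "\<And>i. wgrad_ok g i (G i)" "hnorm g = sqrt (\<Sum>i\<in>UNIV. (Lp_norm 2 (G i))\<^sup>2)" using Hdot1E[OF g] by blast
  obtain K where K: "\<And>i. wgrad_ok k i (K i)" "hnorm k = sqrt (\<Sum>i\<in>UNIV. (Lp_norm 2 (K i))\<^sup>2)" using Hdot1E[OF k] by blast
  have G2: "in_Lp 2 (G i)" "in_Lp 2 (K i)" for i using G(1)[of i] K(1)[of i] by (auto simp: wgrad_ok_def)
  have w: "wgrad_ok (\<lambda>x. g x - k x) i (\<lambda>x. G i x - K i x)" for i by (rule wgrad_ok_diff[OF g4 G(1) k4 K(1)])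
  have d4: "in_Lp 4 (\<lambda>x. g x - k x)" using in_Lp_diff[OF _ g4 k4] by simp
  show "Hdot1 (\<lambda>x. g x - k x)" using d4 w unfolding Hdot1_def by blast
  have h: "hnorm (\<lambda>x. g x - k x) = sqrt (\<Sum>i\<in>UNIV. (Lp_norm 2 (\<lambda>x. G i x - K i x))\<^sup>2)" by (rule hnorm_eq[OF d4 w])
  have tri: "sqrt (\<Sum>i\<in>UNIV. (a i)\<^sup>2) \<le> sqrt (\<Sum>i\<in>UNIV. (b i)\<^sup>2) + sqrt (\<Sum>i\<in>UNIV. (c i)\<^sup>2)"
    if "\<And>i. a i \<le> b i + c i" "\<And>i. 0 \<le> a i" for a b c :: "4 \<Rightarrow> real"
  proof -
    have "sqrt (\<Sum>i\<in>UNIV. (a i)\<^sup>2) \<le> sqrt (\<Sum>i\<in>UNIV. (b i + c i)\<^sup>2)"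
      using that by (intro real_sqrt_le_mono sum_mono power_mono) auto
    also have "\<dots> \<le> sqrt (\<Sum>i\<in>UNIV. (b i)\<^sup>2) + sqrt (\<Sum>i\<in>UNIV. (c i)\<^sup>2)"
      using L2_set_triangle_ineq[of b c UNIV] by (simp add: L2_set_def)
    finally show ?thesis .
  qed
  have "hnorm g \<le> hnorm k + hnorm (\<lambda>x. g x - k x)" unfolding h G(2) K(2)
    by (rule tri) (use Lp_norm_le_add_diff[OF _ G2] Lp_norm_nonneg in auto)
  moreover have "hnorm k \<le> hnorm g + hnorm (\<lambda>x. g x - k x)" unfolding h G(2) K(2)
  proof (rule tri)
    show "Lp_norm 2 (K i) \<le> Lp_norm 2 (G i) + Lp_norm 2 (\<lambda>x. G i x - K i x)" for i
      using Lp_norm_le_add_diff[OF _ G2(2,1), of i i] Lp_norm_minus_commute[of 2 "K i" "G i"] by simp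
  qed (rule Lp_norm_nonneg)
  ultimately show "\<bar>hnorm g - hnorm k\<bar> \<le> hnorm (\<lambda>x. g x - k x)" by linarith
qed

lemma cont_H_contLp:
  assumes "cont_H T G"
  shows "contLp T 4 (\<lambda>t x. cpart s (G t x))"
  unfolding contLp_def
proof (intro conjI ballI)
  fix t assume t: "t \<in> {0..T}"
  have H: "Hdot1 (G t)" if "t \<in> {0..T}" for t using assms that by (simp add: cont_H_def)
  then show "in_Lp 4 (\<lambda>x. cpart s (G t x))" using Lp_cpart(1)[of 4 "G t"] t by (auto simp: Hdot1_def)
  show "((\<lambda>r. Lp_norm 4 (\<lambda>x. cpart s (G r x) - cpart s (G t x))) \<longlongrightarrow> 0) (at t within {0..T})"
  proof (rule Lim_null_comparison)
    show "((\<lambda>r. hnorm (\<lambda>x. G r x - G t x)) \<longlongrightarrow> 0) (at t within {0..T})" using assms t by (simp add: cont_H_def)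
    show "\<forall>\<^sub>F r in at t within {0..T}. norm (Lp_norm 4 (\<lambda>x. cpart s (G r x) - cpart s (G t x))) \<le> hnorm (\<lambda>x. G r x - G t x)"
      using eventually_at_within_mem[where t=t and S="{0..T}"]
    proof eventually_elim
      case (elim r)
      from Hdot1_cpart(2)[OF Hdot1_diff(1)[OF H[OF elim] H[OF t]], of s]
      show ?case by (simp add: cpart_diff Lp_norm_nonneg)
    qed
  qed
qed

text \<open>A real supremum is an upper bound only for a set bounded above. Here \<open>N\<close> is
  continuous on a compact interval, hence bounded.\<close>

lemma le_sup_of_null:
  fixes N :: "real \<Rightarrow> real"
  assumes "\<And>t. t \<in> {0..T} \<Longrightarrow> (d t \<longlongrightarrow> 0) (at t within {0..T})"
    and "\<And>s t. s \<in> {0..T} \<Longrightarrow> t \<in> {0..T} \<Longrightarrow> \<bar>N s - N t\<bar> \<le> d t s" and t: "t \<in> {0..T}"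
  shows "N t \<le> (SUP t\<in>{0..T}. N t)"
proof -
  have "(N \<longlongrightarrow> N t) (at t within {0..T})" if t: "t \<in> {0..T}" for t
  proof -
    have "((\<lambda>s. N s - N t) \<longlongrightarrow> 0) (at t within {0..T})"
      by (rule Lim_null_comparison[OF _ assms(1)[OF t]])
        (use eventually_at_within_mem[where t=t and S="{0..T}"] assms(2)[OF _ t] in \<open>auto elim: eventually_mono\<close>)
    then show ?thesis by (simp add: LIM_zero_iff)
  qed
  then have "continuous_on {0..T} N" by (simp add: continuous_on_def)
  then have "bounded (N ` {0..T})" by (intro compact_imp_bounded compact_continuous_image) auto
  then show ?thesis using t by (intro cSUP_upper bounded_imp_bdd_above)
qed

lemma hnorm_le_supH:
  assumes "cont_H T G" "t \<in> {0..T}"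
  shows "hnorm (G t) \<le> supH T G"
  unfolding supH_def
  by (rule le_sup_of_null[where d="\<lambda>t s. hnorm (\<lambda>x. G s x - G t x)", OF _ _ assms(2)])
    (use assms Hdot1_diff(2) in \<open>auto simp: cont_H_def\<close>)

lemma cont_L_contLp: "cont_L T F \<longleftrightarrow> contLp T (4/3) F"
  by (simp add: cont_L_def contLp_def)

lemma Lp_norm_le_supL:
  assumes "contLp T (4/3) F" "t \<in> {0..T}"
  shows "Lp_norm (4/3) (F t) \<le> supL T F"
  unfolding supL_def
proof (rule le_sup_of_null[where d="\<lambda>t s. Lp_norm (4/3) (\<lambda>x. F s x - F t x)", OF _ _ assms(2)])
  fix s t assume "s \<in> {0..T}" "t \<in> {0..T}"
  then have st: "in_Lp (4/3) (F s)" "in_Lp (4/3) (F t)" using assms by (auto simp: contLp_def)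
  show "\<bar>Lp_norm (4/3) (F s) - Lp_norm (4/3) (F t)\<bar> \<le> Lp_norm (4/3) (\<lambda>x. F s x - F t x)"
    using Lp_norm_le_add_diff[OF _ st] Lp_norm_le_add_diff[OF _ st(2,1)] Lp_norm_minus_commute[of "4/3" "F s" "F t"] by simp
qed (use assms in \<open>auto simp: contLp_def\<close>)

lemma H1_of_real:
  assumes H: "H1 v G"
  shows "Hdot1 (\<lambda>x. complex_of_real (v x))" "hnorm (\<lambda>x. complex_of_real (v x)) = gnorm G"
proof -
  have n: "Lp_norm p (\<lambda>x. complex_of_real (k x)) = Lp_norm p k" for p k by (simp add: Lp_norm_def)
  have i: "in_Lp p (\<lambda>x. complex_of_real (k x))" if "in_Lp p k" for p k
    using that unfolding in_Lp_def by (auto intro: borel_measurable_of_real)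
  have v: "in_Lp 4 v" and G: "in_Lp 2 (G i)" and w: "wderiv v i (G i)" for i using H by (auto simp: H1_def)
  have wg: "wgrad_ok (\<lambda>x. complex_of_real (v x)) i (\<lambda>x. complex_of_real (G i x))" for i
    unfolding wgrad_ok_def test_x_iff using i[OF G] w[of i]
    by (auto simp: wderiv_def scaleR_conv_of_real simp flip: of_real_mult of_real_minus)
  show "Hdot1 (\<lambda>x. complex_of_real (v x))" unfolding Hdot1_def using i[OF v] wg by blast
  show "hnorm (\<lambda>x. complex_of_real (v x)) = gnorm G"
    using hnorm_eq[OF i[OF v] wg] by (simp add: n gnorm_def)
qed

lemma pair_integrand_continuous:
  fixes \<psi> :: "real \<times> (real^4) \<Rightarrow> real"
  assumes p: "p > 1" and g: "contLp T p g" and \<psi>: "test \<psi>"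
  shows "continuous_on {0..T} (\<lambda>t. LINT x|lborel. \<psi> (t, x) * g t x)"
proof -
  define q where "q = p / (p - 1)"
  have q: "q > 1" "1 / p + 1 / q = 1" using p by (auto simp: q_def field_simps)
  have q0: "q > 0" using q by simp
  have "((\<lambda>s. LINT x|lborel. g s x * \<psi> (s, x)) \<longlongrightarrow> (LINT x|lborel. g t x * \<psi> (t, x))) (at t within {0..T})" if "t \<in> {0..T}" for t
    by (rule Lp_lim_integral_mult[OF p q contLp_lim[OF g that] slice_lim[OF \<psi> q0 tendsto_ident_at]])
  then show ?thesis by (simp add: continuous_on_def mult.commute)
qed

text \<open>Taking parts commutes with the time integral once the integrand is known to be
  integrable; this follows from continuity of its real and imaginary parts.\<close>

lemma pair_cpart:
  fixes g :: "real \<Rightarrow> real^4 \<Rightarrow> complex"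
  assumes p: "p > 1" and g: "\<And>t. t \<in> {0..T} \<Longrightarrow> in_Lp p (g t)" and c: "\<And>s. contLp T p (\<lambda>t x. cpart s (g t x))" and \<psi>: "test \<psi>"
  shows "cpart s (pair T g \<psi>) = pair T (\<lambda>t x. cpart s (g t x)) \<psi>"
proof -
  define J where "J t = (LINT x|lborel. \<psi> (t, x) *\<^sub>R g t x)" for t
  define A where "A s t = (LINT x|lborel. \<psi> (t, x) * cpart s (g t x))" for s t
  have JA: "cpart s (J t) = A s t" if "t \<in> {0..T}" for s t
    unfolding J_def A_def by (rule integral_cpart(2)[OF p g[OF that] test_slice[OF \<psi>]])
  have "continuous_on {0..T} (A s)" for s unfolding A_def by (rule pair_integrand_continuous[OF p c \<psi>])
  then have "continuous_on {0..T} (\<lambda>t. complex_of_real (A True t) + \<i> * complex_of_real (A False t))"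
    by (intro continuous_intros)
  moreover have "complex_of_real (A True t) + \<i> * complex_of_real (A False t) = J t" if "t \<in> {0..T}" for t
    using JA[OF that, of True] JA[OF that, of False] by (simp add: complex_eq_iff cpart_def)
  ultimately have "continuous_on {0..T} J" by (rule continuous_on_eq)
  then have "J integrable_on {0..T}" by (rule integrable_continuous_interval)
  from integral_linear[OF this bounded_linear_cpart, of s]
  have "cpart s (integral {0..T} J) = integral {0..T} (\<lambda>t. cpart s (J t))" by (simp add: o_def)
  also have "\<dots> = integral {0..T} (A s)" by (rule Henstock_Kurzweil_Integration.integral_cong) (rule JA)
  finally show ?thesis by (simp add: pair_def J_def[abs_def] A_def[abs_def])
qed

text \<open>Product test functions and continuity in time reduce equality of distributions to
  equality of the pairings with each \<open>\<rho>\<close> on every slice.\<close>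

lemma pair_eq_AE:
  assumes T: "T > 0" and p: "p > 1" and g: "contLp T p g" and G: "contLp T p G"
    and e: "\<And>\<psi>. test_st T \<psi> \<Longrightarrow> pair T G \<psi> = pair T g \<psi>" and t: "t \<in> {0..T}"
  shows "AE x in lborel. G t x = g t x"
proof -
  have gin: "in_Lp p (g t)" "in_Lp p (G t)" using g G t by (auto simp: contLp_def)
  have "AE x in lborel. G t x - g t x = 0"
  proof (rule Lp_weak_zero_AE[OF p])
    show "in_Lp p (\<lambda>x. G t x - g t x)" using in_Lp_diff[OF _ gin(2,1)] p by simp
    fix \<rho> :: "real^4 \<Rightarrow> real" assume \<rho>: "test \<rho>"
    define B where "B t = (LINT x|lborel. \<rho> x * G (clamp_t T t) x) - (LINT x|lborel. \<rho> x * g (clamp_t T t) x)" for t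
    have "B t = 0"
    proof (rule continuous_zero_closed_interval[OF T _ _ t])
      show "continuous_on UNIV B" unfolding B_def using T
        by (intro continuous_intros clamp_continuous[OF _ contLp_integral_continuous[OF p G \<rho>]] clamp_continuous[OF _ contLp_integral_continuous[OF p g \<rho>]]) auto
      fix \<theta> :: "real \<Rightarrow> real" assume \<theta>: "test \<theta>" "tsupport \<theta> \<subseteq> {0<..<T}"
      show "(LINT t|lborel. \<theta> t * B t) = 0"
        using e[OF test_st_product[OF \<theta> \<rho>]] pair_product(2)[OF T p G \<theta> \<rho>] pair_product(2)[OF T p g \<theta> \<rho>]
        unfolding B_def right_diff_distrib pair_product(1)[OF T p G \<theta> \<rho>] pair_product(1)[OF T p g \<theta> \<rho>] by simp
    qed
    moreover have "(\<lambda>x. (G t x - g t x) * \<rho> x) = (\<lambda>x. \<rho> x * G t x - \<rho> x * g t x)"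
      by (simp add: fun_eq_iff algebra_simps)
    moreover have "(LINT x|lborel. \<rho> x * G t x - \<rho> x * g t x) = (LINT x|lborel. \<rho> x * G t x) - (LINT x|lborel. \<rho> x * g t x)"
      by (rule Bochner_Integration.integral_diff)
        (use integrable_mult_test(2)[OF p gin(1) \<rho>] integrable_mult_test(2)[OF p gin(2) \<rho>] in \<open>simp_all add: mult.commute\<close>)
    ultimately show "(LINT x|lborel. (G t x - g t x) * \<rho> x) = 0"
      using clamp_t(2)[OF t] by (simp add: B_def)
  qed
  then show ?thesis by simp
qed

section \<open>Words of directions and multi-indices\<close>

definition tj :: "nat list \<Rightarrow> nat" where
  "tj w = length (filter (\<lambda>d. d = 0) w)"

definition mi :: "nat list \<Rightarrow> 4 \<Rightarrow> nat" where
  "mi w i = length (filter (\<lambda>d. d \<noteq> 0 \<and> of_nat (d - 1) = i) w)"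

lemma tj_mi_Nil: "tj [] = 0" "mi [] = (\<lambda>_. 0)"
  by (simp_all add: tj_def mi_def fun_eq_iff)

lemma tj_mi_Cons:
  "tj (d # w) = (if d = 0 then Suc (tj w) else tj w)"
  "mi (d # w) = (if d = 0 then mi w else (mi w)(of_nat (d - 1) := Suc (mi w (of_nat (d - 1)))))"
  by (auto simp: tj_def mi_def fun_eq_iff)

lemma mabs_upd: "mabs (\<beta>(i := Suc (\<beta> i))) = Suc (mabs \<beta>)"
proof -
  have "mabs (\<beta>(i := Suc (\<beta> i))) = (\<Sum>k\<in>UNIV. \<beta> k + (if k = i then 1 else 0))"
    unfolding mabs_def by (rule sum.cong) auto
  then show ?thesis by (simp add: sum.distrib mabs_def)
qed

lemma tj_plus_mabs: "tj w + mabs (mi w) = length w"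
proof (induction w)
  case Nil
  then show ?case by (simp add: tj_mi_Nil mabs_def)
next
  case (Cons d w)
  show ?case
  proof (cases "d = 0")
    case True
    then show ?thesis using Cons by (simp add: tj_mi_Cons)
  next
    case False
    then have "tj (d # w) = tj w" "mabs (mi (d # w)) = Suc (mabs (mi w))"
      unfolding tj_mi_Cons by (simp_all only: if_False mabs_upd)
    then show ?thesis using Cons by simp
  qed
qed

lemma length_filter_mset: "length (filter P a) = size (filter_mset P (mset a))"
  by (simp flip: mset_filter)

lemma tj_mi_mset:
  "mset a = mset b \<Longrightarrow> tj a = tj b" "mset a = mset b \<Longrightarrow> mi a = mi b"
  by (simp_all only: tj_def mi_def fun_eq_iff length_filter_mset simp_thms)

lemma tj_mi_mono:
  assumes "mset a \<subseteq># mset b"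
  shows "tj a \<le> tj b" "mabs (mi a) \<le> mabs (mi b)"
proof -
  have *: "length (filter P a) \<le> length (filter P b)" for P
    unfolding length_filter_mset by (rule size_mset_mono[OF multiset_filter_mono[OF assms]])
  show "tj a \<le> tj b" unfolding tj_def by (rule *)
  show "mabs (mi a) \<le> mabs (mi b)" unfolding mabs_def mi_def by (intro sum_mono *)
qed

text \<open>The decreasing word of the derivative of time order \<open>j\<close> and spatial
  multi-index \<open>\<alpha>\<close>. The letter 4, that is the axis of index 3, stands first
  because \<open>Dtx\<close> applies that derivative first; time, which \<open>Dtx\<close> applies
  last, stands at the end.\<close>

definition canon :: "nat \<Rightarrow> (4 \<Rightarrow> nat) \<Rightarrow> nat list" where
  "canon j \<alpha> = replicate (\<alpha> 3) 4 @ replicate (\<alpha> 2) 3 @ replicate (\<alpha> 1) 2 @ replicate (\<alpha> 0) 1 @ replicate j 0"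

lemma cases4: "(i::4) = 0 \<or> i = 1 \<or> i = 2 \<or> i = 3"
  using exhaust_4[of i] by auto

lemma canon_sorted: "sorted_wrt (\<ge>) (canon j \<alpha>)"
proof -
  have "sorted_wrt (\<ge>) (replicate n d)" for n and d :: nat by (induction n) auto
  then show ?thesis unfolding canon_def by (auto simp: sorted_wrt_append)
qed

lemma canon_le: "d \<in> set (canon j \<alpha>) \<Longrightarrow> d \<le> 4"
  unfolding canon_def by (auto split: if_splits)

lemma tj_mi_canon: "tj (canon j \<alpha>) = j" "mi (canon j \<alpha>) = \<alpha>"
proof -
  show "tj (canon j \<alpha>) = j" by (simp add: canon_def tj_def)
  have "mi (canon j \<alpha>) i = \<alpha> i" for i
    using cases4[of i] by (auto simp: canon_def mi_def)
  then show "mi (canon j \<alpha>) = \<alpha>" by blast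
qed

text \<open>The largest direction is the innermost one in \<open>Dtx\<close>, so a derivative in it can be moved onto the test
function without commuting partial derivatives.\<close>

lemma Dtx_Cons:
  assumes "d \<le> 4" "\<And>e. e \<in> set w \<Longrightarrow> e \<le> d"
  shows "Dtx (tj (d # w)) (mi (d # w)) \<psi> = Dtx (tj w) (mi w) (dd (dv d) \<psi>)"
proof -
  \<comment> \<open>Axes with a code above \<open>d\<close> do not occur in \<open>w\<close>, so the
    iterates of \<open>Dtx\<close> inside that of direction \<open>d\<close> are trivial; what is
    left is to take one factor out of a power from the inside.\<close>
  have z: "mi w i = 0" if "\<And>e. e \<in> set w \<Longrightarrow> e \<noteq> 0 \<Longrightarrow> of_nat (e - 1) \<noteq> i" for i
    unfolding mi_def by (simp only: length_0_conv filter_empty_conv) (use that in blast)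
  have le: "e \<noteq> 0 \<Longrightarrow> e \<in> set w \<Longrightarrow> e \<in> {1..d}" for e using assms(2) by force
  consider "d = 0" | "d = 1" | "d = 2" | "d = 3" | "d = 4" using assms(1) by linarith
  then show ?thesis
  proof cases
    case 1
    have "mi w i = 0" for i by (rule z) (use le 1 in auto)
    then show ?thesis using 1 by (simp add: Dtx_def tj_mi_Cons dv_def funpow_swap1)
  next
    case 2
    have "mi w i = 0" if "i \<noteq> 0" for i
    proof (rule z)
      fix e assume "e \<in> set w" "e \<noteq> 0"
      then have "e = 1" using le[of e] 2 by auto
      then show "of_nat (e - 1) \<noteq> i" using that by simp
    qed
    then show ?thesis using 2 by (simp add: Dtx_def tj_mi_Cons dv_def funpow_swap1)
  next
    case 3
    have "mi w i = 0" if "i = 2 \<or> i = 3" for i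
    proof (rule z)
      fix e assume "e \<in> set w" "e \<noteq> 0"
      then have "e = 1 \<or> e = 2" using le[of e] 3 by auto
      then show "of_nat (e - 1) \<noteq> i" using that by auto
    qed
    then show ?thesis using 3 by (simp add: Dtx_def tj_mi_Cons dv_def funpow_swap1)
  next
    case 4
    have "mi w 3 = 0"
    proof (rule z)
      fix e assume "e \<in> set w" "e \<noteq> 0"
      then have "e = 1 \<or> e = 2 \<or> e = 3" using le[of e] 4 by auto
      then show "of_nat (e - 1) \<noteq> (3::4)" by auto
    qed
    then show ?thesis using 4 by (simp add: Dtx_def tj_mi_Cons dv_def funpow_swap1)
  next
    case 5
    then show ?thesis by (simp add: Dtx_def tj_mi_Cons dv_def funpow_swap1)
  qed
qed

lemma dv_Basis: "dv d \<in> Basis"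
  by (auto simp: dv_def Basis_prod_def axis_in_Basis4)

lemma test_st_dd:
  assumes "test_st T \<psi>" "e \<in> Basis"
  shows "test_st T (dd e \<psi>)"
proof -
  have c: "compact (tsupport \<psi>)" and s: "smooth \<psi>" and i: "tsupport \<psi> \<subseteq> {0<..<T} \<times> UNIV" using assms by (auto simp: test_st_def)
  have z: "dd e \<psi> x = 0" if "x \<notin> tsupport \<psi>" for x
    by (rule dd_eq_0_outside[OF compact_imp_closed[OF c] not_in_tsupport that])
  have t: "compact (tsupport (dd e \<psi>))" "tsupport (dd e \<psi>) \<subseteq> tsupport \<psi>" using compact_tsupportI[OF c z] by simp_all
  show ?thesis unfolding test_st_def by (intro conjI smooth_dd[OF s assms(2)] t(1) subset_trans[OF t(2) i])
qed

section \<open>The regularity theorem\<close>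

lemma Dtx_0: "Dtx 0 (\<lambda>_. 0) \<psi> = \<psi>"
  by (simp add: Dtx_def)

lemma test_st_Dtx:
  assumes "test_st T \<psi>"
  shows "test_st T (Dtx j \<alpha> \<psi>)"
proof -
  have *: "test_st T ((dd e ^^ n) \<rho>)" if "test_st T \<rho>" "e \<in> Basis" for e n \<rho>
    using that by (induction n) (auto intro: test_st_dd)
  have b: "((1::real), (0::real^4)) \<in> Basis" using dv_Basis[of 0] by (simp add: dv_def)
  have b': "((0::real), axis i 1 :: real^4) \<in> Basis" for i by (auto simp: Basis_prod_def axis_in_Basis4)
  show ?thesis unfolding Dtx_def using assms by (auto intro!: * b b')
qed

text \<open>\<open>G\<close> and \<open>G'\<close> are each related to \<open>g\<close> only;
  comparing the two identities by \<open>Dtx_Cons\<close> relates them to each other by one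
  derivative, the sign being the quotient of the two signs.\<close>

lemma is_dtx_Cons:
  assumes "is_dtx T (tj (d # w)) (mi (d # w)) g G'" "is_dtx T (tj w) (mi w) g G"
    and "d \<le> 4" "\<And>e. e \<in> set w \<Longrightarrow> e \<le> d" and \<psi>: "test_st T \<psi>"
  shows "pair T G' \<psi> = - pair T G (dd (dv d) \<psi>)"
proof -
  have 1: "pair T G' \<psi> = ((-1) ^ length (d # w)) *\<^sub>R pair T g (Dtx (tj (d # w)) (mi (d # w)) \<psi>)"
    using assms(1) \<psi> unfolding is_dtx_def tj_plus_mabs by blast
  have 2: "pair T G (dd (dv d) \<psi>) = ((-1) ^ length w) *\<^sub>R pair T g (Dtx (tj w) (mi w) (dd (dv d) \<psi>))"
    using assms(2) test_st_dd[OF \<psi> dv_Basis] unfolding is_dtx_def tj_plus_mabs by blast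
  have 3: "Dtx (tj (d # w)) (mi (d # w)) \<psi> = Dtx (tj w) (mi w) (dd (dv d) \<psi>)"
    by (rule Dtx_Cons[OF assms(3)]) (rule assms(4))
  show ?thesis unfolding 1 2 3 by simp
qed

lemma is_dtx_0: "is_dtx T 0 (\<lambda>_. 0) g G \<Longrightarrow> test_st T \<psi> \<Longrightarrow> pair T G \<psi> = pair T g \<psi>"
  by (simp add: is_dtx_def Dtx_0 mabs_def)

lemma cont_H_pair_cpart:
  assumes "cont_H T g" "test \<psi>"
  shows "cpart s (pair T g \<psi>) = pair T (\<lambda>t x. cpart s (g t x)) \<psi>"
  by (rule pair_cpart[of 4]) (use assms in \<open>auto simp: cont_H_def Hdot1_def intro: cont_H_contLp\<close>)

lemma cont_H_AE:
  assumes T: "T > 0" and g: "cont_H T g" and G: "cont_H T G"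
    and e: "\<And>\<psi>. test_st T \<psi> \<Longrightarrow> pair T G \<psi> = pair T g \<psi>" and t: "t \<in> {0..T}"
  shows "AE x in lborel. G t x = g t x"
proof -
  have "AE x in lborel. cpart s (G t x) = cpart s (g t x)" for s
  proof (rule pair_eq_AE[OF T _ cont_H_contLp[OF g] cont_H_contLp[OF G] _ t])
    show "pair T (\<lambda>t x. cpart s (G t x)) \<psi> = pair T (\<lambda>t x. cpart s (g t x)) \<psi>" if "test_st T \<psi>" for \<psi>
      using cont_H_pair_cpart[OF g test_st_test[OF that]] cont_H_pair_cpart[OF G test_st_test[OF that]] e[OF that] by metis
  qed simp
  then have "AE x in lborel. \<forall>s. cpart s (G t x) = cpart s (g t x)" by (simp add: AE_all_countable)
  then show ?thesis by eventually_elim (auto intro: cpart_eqI)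
qed

lemma hnorm_cong_AE:
  fixes g k :: "real^4 \<Rightarrow> complex"
  assumes "g \<in> borel_measurable borel" "k \<in> borel_measurable borel" "AE x in lborel. g x = k x"
  shows "hnorm g = hnorm k"
proof -
  have "(LINT x|lborel. dd (axis i 1) \<psi> x *\<^sub>R g x) = (LINT x|lborel. dd (axis i 1) \<psi> x *\<^sub>R k x)" if "test \<psi>" for \<psi> i
    using test_measurable[OF test_dd[OF that axis_in_Basis4]] assms by (intro integral_cong_AE) auto
  then have "wgrad_ok g i G = wgrad_ok k i G" for i G unfolding wgrad_ok_def test_x_iff by simp
  then show ?thesis by (simp add: hnorm_def)
qed

lemma ell_cong_AE:
  assumes "ell q g v" and [measurable]: "(\<lambda>x. q x * v x) \<in> borel_measurable borel" "(\<lambda>x. q' x * v x) \<in> borel_measurable borel"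
      "g \<in> borel_measurable borel" "g' \<in> borel_measurable borel"
    and "AE x in lborel. q' x = q x" "AE x in lborel. g' x = g x"
  shows "ell q' g' v"
  unfolding ell_def
proof (intro allI impI)
  fix \<psi> :: "real^4 \<Rightarrow> real" assume \<psi>: "test \<psi>"
  note [measurable] = test_measurable[OF \<psi>]
  have "(LINT x|lborel. \<psi> x * (q' x * v x)) = (LINT x|lborel. \<psi> x * (q x * v x))"
    by (rule integral_cong_AE) (use assms(6) in \<open>auto elim: eventually_mono\<close>)
  moreover have "(LINT x|lborel. \<psi> x * g' x) = (LINT x|lborel. \<psi> x * g x)"
    by (rule integral_cong_AE) (use assms(7) in \<open>auto elim: eventually_mono\<close>)
  ultimately show "(LINT x|lborel. lap \<psi> x * v x) - (LINT x|lborel. \<psi> x * (q' x * v x)) = (LINT x|lborel. \<psi> x * g' x)"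
    using assms(1) \<psi> by (simp add: ell_def)
qed

lemma qf_cpart: "qf (\<lambda>s x. cpart s (\<phi> x)) x = (cmod (\<phi> x))\<^sup>2"
  unfolding qf_def by (simp add: UNIV_bool cpart_def cmod_power2) (simp add: power2_eq_square)

lemma solves_ell_cpart:
  assumes \<phi>: "in_Lp 4 \<phi>" and e: "solves_ell \<phi> f u"
  shows "ell (qf (\<lambda>s x. cpart s (\<phi> x))) (if s then f else (\<lambda>_. 0)) (\<lambda>x. cpart s (u x))"
  unfolding ell_def
proof (intro allI impI)
  fix \<psi> :: "real^4 \<Rightarrow> real" assume \<psi>: "test \<psi>"
  have u: "in_Lp 4 u" using e by (simp add: solves_ell_def Hdot1_def)
  \<comment> \<open>The product \<open>|phi|^2 u\<close> is regrouped as one function in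
    \<open>L^(4/3)\<close>, so that its pairing with \<open>\<psi>\<close> can be split into parts
    like the others.\<close>
  define K where "K x = (cmod (\<phi> x))\<^sup>2 *\<^sub>R u x" for x
  have mu: "u \<in> borel_measurable borel" and m\<phi>: "\<phi> \<in> borel_measurable borel" using in_Lp_measurable u \<phi> by auto
  have nu: "in_Lp 4 (\<lambda>x. cmod (u x))" using Lp_mono(1)[OF _ u, of "\<lambda>x. cmod (u x)"] mu by simp
  have q: "in_Lp (4/3) (\<lambda>x. qf (\<lambda>s x. cpart s (\<phi> x)) x * cmod (u x))" by (rule qf_mult_in_Lp[OF Lp_cpart(1)[OF _ \<phi>] nu]) simp
  have K: "in_Lp (4/3) K"
    by (rule Lp_mono(1)[OF _ q]) (use mu m\<phi> in \<open>auto simp: K_def[abs_def] qf_cpart\<close>)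
  have "(LINT x|lborel. lap \<psi> x *\<^sub>R u x) - (LINT x|lborel. (\<psi> x * (cmod (\<phi> x))\<^sup>2) *\<^sub>R u x) = complex_of_real (LINT x|lborel. \<psi> x * f x)"
    using e \<psi> unfolding solves_ell_def test_x_iff by blast
  then have "(LINT x|lborel. lap \<psi> x *\<^sub>R u x) - (LINT x|lborel. \<psi> x *\<^sub>R K x) = complex_of_real (LINT x|lborel. \<psi> x * f x)"
    by (simp add: K_def)
  from arg_cong[OF this, of "cpart s"]
  have "cpart s (LINT x|lborel. lap \<psi> x *\<^sub>R u x) - cpart s (LINT x|lborel. \<psi> x *\<^sub>R K x) = (if s then LINT x|lborel. \<psi> x * f x else 0)"
    by (simp add: cpart_diff) (simp add: cpart_def)
  moreover have "cpart s (LINT x|lborel. lap \<psi> x *\<^sub>R u x) = (LINT x|lborel. lap \<psi> x * cpart s (u x))"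
    by (rule integral_cpart(2)[OF _ u test_lap[OF \<psi>]]) simp
  moreover have "cpart s (LINT x|lborel. \<psi> x *\<^sub>R K x) = (LINT x|lborel. \<psi> x * cpart s (K x))"
    by (rule integral_cpart(2)[OF _ K \<psi>]) simp
  moreover have "cpart s (K x) = qf (\<lambda>s x. cpart s (\<phi> x)) x * cpart s (u x)" for x
    by (simp add: K_def cpart_scaleR qf_cpart)
  ultimately show "(LINT x|lborel. lap \<psi> x * cpart s (u x)) - (LINT x|lborel. \<psi> x * (qf (\<lambda>s x. cpart s (\<phi> x)) x * cpart s (u x)))
      = (LINT x|lborel. \<psi> x * (if s then f else (\<lambda>_. 0)) x)"
    by (cases s) simp_all
qed

section \<open>Polynomial bounds in the lower-order norms\<close>

definition idx :: "nat list \<Rightarrow> nat \<times> (4 \<Rightarrow> nat)" where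
  "idx w = (tj w, mi w)"

type_synonym norms = "(nat \<times> (4 \<Rightarrow> nat) \<Rightarrow> real) \<times> (nat \<times> (4 \<Rightarrow> nat) \<Rightarrow> real)"

text \<open>Bounds the derivatives of \<open>u\<close> along words of length at most the first argument.\<close>

primrec norm_bound :: "nat \<Rightarrow> norms \<Rightarrow> nat list \<Rightarrow> real" where
  "norm_bound 0 x w = snd x (idx w)"
| "norm_bound (Suc n) x w = snd x (idx w)
     + (\<Sum>i\<leftarrow>leib w. 2 * fst x (idx (fst i)) * fst x (idx (fst (snd i))) * norm_bound n x (snd (snd i)))"

text \<open>The Leibniz terms in which neither factor of \<open>phi\<close> receives the whole word.
  They involve only norms of order below that of \<open>W\<close>, so truncating the argument to
  lower-order norms does not change the value. The 2 counts the real and the imaginary part.\<close>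

definition low_bound :: "nat list \<Rightarrow> norms \<Rightarrow> real" where
  "low_bound W x = (\<Sum>i\<leftarrow>leib W. if length (fst i) < length W \<and> length (fst (snd i)) < length W
     then 2 * fst x (idx (fst i)) * fst x (idx (fst (snd i))) * norm_bound (length W) x (snd (snd i)) else 0)"

lemma continuous_on_sum_list:
  fixes g :: "'i \<Rightarrow> 'a::topological_space \<Rightarrow> real"
  assumes "\<And>i. continuous_on S (g i)"
  shows "continuous_on S (\<lambda>x. \<Sum>i\<leftarrow>L. g i x)"
  by (induction L) (auto intro: continuous_intros assms)

lemma continuous_on_coord:
  "continuous_on UNIV (\<lambda>x::norms. fst x k)" "continuous_on UNIV (\<lambda>x::norms. snd x k)"
  by (rule continuous_on_product_then_coordinatewise, rule continuous_on_fst, rule continuous_on_id)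
    (rule continuous_on_product_then_coordinatewise, rule continuous_on_snd, rule continuous_on_id)

lemma continuous_on_norm_bound: "continuous_on UNIV (\<lambda>x. norm_bound n x w)"
proof (induction n arbitrary: w)
  case 0
  then show ?case by (simp add: continuous_on_coord)
next
  case (Suc n)
  show ?case unfolding norm_bound.simps
    by (intro continuous_on_add continuous_on_coord continuous_on_sum_list continuous_on_mult continuous_on_const Suc)
qed

lemma continuous_on_low_bound: "continuous_on UNIV (low_bound W)"
proof -
  have "continuous_on UNIV (\<lambda>x. if P then 2 * fst x a * fst x b * norm_bound n x c else 0)" for P a b n c
    by (cases P) (auto intro!: continuous_on_coord continuous_on_norm_bound continuous_on_mult continuous_on_const)
  then show ?thesis unfolding low_bound_def[abs_def] by (intro continuous_on_sum_list)
qed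

lemma (in elliptic_data) rhs_bound_le:
  assumes w: "ok w" and t: "t \<in> {0..T}" and v: "\<And>a b c. (a, b, c) \<in> set (leib w) \<Longrightarrow> in_Lp 4 (v c t) \<and> Lp_norm 4 (v c t) \<le> B c"
    and P: "\<And>s a. ok a \<Longrightarrow> Lp_norm 4 (ph s a t) \<le> P a" and Q: "Lp_norm (4/3) (f w t) \<le> Q"
  shows "Lp_norm (4/3) (rhs ph f v w t) \<le> Q + (\<Sum>i\<leftarrow>leib w. 2 * P (fst i) * P (fst (snd i)) * B (snd (snd i)))"
proof -
  have "(\<Sum>s\<in>UNIV. Lp_norm 4 (ph s (fst i) t) * Lp_norm 4 (ph s (fst (snd i)) t) * Lp_norm 4 (v (snd (snd i)) t))
      \<le> 2 * P (fst i) * P (fst (snd i)) * B (snd (snd i))" if "i \<in> set (leib w)" for i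
  proof -
    have i: "(fst i, fst (snd i), snd (snd i)) \<in> set (leib w)" using that by simp
    have "Lp_norm 4 (ph s (fst i) t) * Lp_norm 4 (ph s (fst (snd i)) t) * Lp_norm 4 (v (snd (snd i)) t) \<le> P (fst i) * P (fst (snd i)) * B (snd (snd i))" for s
      using P[OF ok_leib(1)[OF w i], of s] P[OF ok_leib(2)[OF w i], of s] v[OF i]
        Lp_norm_nonneg[of 4 "ph s (fst i) t"] Lp_norm_nonneg[of 4 "ph s (fst (snd i)) t"] Lp_norm_nonneg[of 4 "v (snd (snd i)) t"]
      by (intro mult_mono mult_nonneg_nonneg) linarith+
    from this[of True] this[of False] show ?thesis by (simp add: UNIV_bool)
  qed
  then have "(\<Sum>i\<leftarrow>leib w. \<Sum>s\<in>UNIV. Lp_norm 4 (ph s (fst i) t) * Lp_norm 4 (ph s (fst (snd i)) t) * Lp_norm 4 (v (snd (snd i)) t))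
      \<le> (\<Sum>i\<leftarrow>leib w. 2 * P (fst i) * P (fst (snd i)) * B (snd (snd i)))" by (rule sum_list_mono)
  moreover have "Lp_norm (4/3) (rhs ph f v w t) \<le> Lp_norm (4/3) (f w t)
    + (\<Sum>i\<leftarrow>leib w. \<Sum>s\<in>UNIV. Lp_norm 4 (ph s (fst i) t) * Lp_norm 4 (ph s (fst (snd i)) t) * Lp_norm 4 (v (snd (snd i)) t))"
    by (rule rhs_bound[OF w t]) (use v in blast)
  ultimately show ?thesis using Q by linarith
qed

text \<open>The energy estimate bounds the derivative along \<open>w\<close> by lower derivatives of
  \<open>u\<close>, and induction on \<open>n\<close> unrolls this into the recursion of
  \<open>norm_bound\<close>. The vector \<open>x\<close> has to carry the true norms only for words
  shorter than \<open>W0\<close>, as the truncated argument in the theorem does.\<close>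

lemma (in elliptic_data) family_norm_bound:
  assumes v: "\<And>w. ok w \<Longrightarrow> H1 (v w t) (G w t) \<and> gnorm (G w t) \<le> Lp_norm (4/3) (rhs ph f v w t)" and t: "t \<in> {0..T}"
    and P: "\<And>s a. ok a \<Longrightarrow> Lp_norm 4 (ph s a t) \<le> P a" and Q: "\<And>w. ok w \<Longrightarrow> Lp_norm (4/3) (f w t) \<le> Q w"
    and x: "\<And>w. ok w \<Longrightarrow> length w < length W0 \<Longrightarrow> fst x (idx w) = P w \<and> snd x (idx w) = Q w"
    and w: "ok w" "length w \<le> n" "length w < length W0"
  shows "gnorm (G w t) \<le> norm_bound n x w"
  using w
proof (induction n arbitrary: w)
  case 0
  then have w: "w = []" "snd x (idx w) = Q w" using x[of w] by auto
  have "Lp_norm (4/3) (rhs ph f v w t) \<le> Q w"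
    using Q[OF 0(1)] unfolding w(1) by (simp add: rhs_def[abs_def])
  then show ?case using v[OF 0(1)] w(2) by simp
next
  case (Suc n)
  have "Lp_norm (4/3) (rhs ph f v w t) \<le> Q w + (\<Sum>i\<leftarrow>leib w. 2 * P (fst i) * P (fst (snd i)) * norm_bound n x (snd (snd i)))"
  proof (rule rhs_bound_le[OF Suc.prems(1) t _ P Q[OF Suc.prems(1)]])
    fix a b c assume i: "(a, b, c) \<in> set (leib w)"
    have c: "ok c" by (rule ok_leib(3)[OF Suc.prems(1) i])
    have "gnorm (G c t) \<le> norm_bound n x c" using leib_length[OF i] Suc.prems by (intro Suc.IH c) auto
    moreover have "Lp_norm 4 (v c t) \<le> gnorm (G c t)" using v[OF c] by (auto intro: Sobolev_H1)
    moreover have "in_Lp 4 (v c t)" using v[OF c] by (simp add: H1_def)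
    ultimately show "in_Lp 4 (v c t) \<and> Lp_norm 4 (v c t) \<le> norm_bound n x c" by linarith
  qed
  moreover have "(\<Sum>i\<leftarrow>leib w. 2 * P (fst i) * P (fst (snd i)) * norm_bound n x (snd (snd i)))
      = (\<Sum>i\<leftarrow>leib w. 2 * fst x (idx (fst i)) * fst x (idx (fst (snd i))) * norm_bound n x (snd (snd i)))"
  proof (rule arg_cong[where f=sum_list], rule map_cong[OF refl])
    fix i assume "i \<in> set (leib w)"
    then have i: "(fst i, fst (snd i), snd (snd i)) \<in> set (leib w)" by simp
    from arg_cong[OF leib_mset[OF i], of size] have "length (fst i) \<le> length w" "length (fst (snd i)) \<le> length w" by auto
    then have "fst x (idx (fst i)) = P (fst i)" "fst x (idx (fst (snd i))) = P (fst (snd i))"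
      using x[OF ok_leib(1)[OF Suc.prems(1) i]] x[OF ok_leib(2)[OF Suc.prems(1) i]] Suc.prems(3) by auto
    then show "2 * P (fst i) * P (fst (snd i)) * norm_bound n x (snd (snd i))
        = 2 * fst x (idx (fst i)) * fst x (idx (fst (snd i))) * norm_bound n x (snd (snd i))" by simp
  qed
  ultimately show ?case using v[OF Suc.prems(1)] x[OF Suc.prems(1,3)] by simp
qed

text \<open>The Leibniz terms for \<open>W0\<close> are split: if one factor of \<open>phi\<close>
  carries the whole word, the term is at most \<open>R\<close>, which gives the product in the
  estimate; the others form \<open>low_bound\<close>.\<close>

lemma (in elliptic_data) top_norm_bound:
  assumes v: "\<And>w. ok w \<Longrightarrow> H1 (v w t) (G w t) \<and> gnorm (G w t) \<le> Lp_norm (4/3) (rhs ph f v w t)" and t: "t \<in> {0..T}"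
    and P: "\<And>s a. ok a \<Longrightarrow> Lp_norm 4 (ph s a t) \<le> P a" and Q: "\<And>w. ok w \<Longrightarrow> Lp_norm (4/3) (f w t) \<le> Q w"
    and x: "\<And>w. ok w \<Longrightarrow> length w < length W0 \<Longrightarrow> fst x (idx w) = P w \<and> snd x (idx w) = Q w"
    and Pm: "\<And>w. mset w = mset W0 \<Longrightarrow> P w = P W0" and W0: "ok W0"
  shows "gnorm (G W0 t) \<le> real (2 * length (leib W0)) * P W0 * P [] * Q [] + Q W0 + low_bound W0 x"
proof -
  define R where "R = 2 * P W0 * P [] * Q []"
  define S where "S i = (if length (fst i) < length W0 \<and> length (fst (snd i)) < length W0
     then 2 * fst x (idx (fst i)) * fst x (idx (fst (snd i))) * norm_bound (length W0) x (snd (snd i)) else 0)" for i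
  have P0: "0 \<le> P a" if "ok a" for a using P[OF that, of True] Lp_norm_nonneg[of 4 "ph True a t"] by linarith
  have Q0: "0 \<le> Q a" if "ok a" for a using Q[OF that] Lp_norm_nonneg[of "4/3" "f a t"] by linarith
  have R: "0 \<le> R" unfolding R_def using P0[OF W0] P0[OF ok_Nil] Q0[OF ok_Nil] by simp
  have "Lp_norm (4/3) (rhs ph f v W0 t) \<le> Q W0 + (\<Sum>i\<leftarrow>leib W0. 2 * P (fst i) * P (fst (snd i)) * norm_bound (length W0) x (snd (snd i)))"
  proof (rule rhs_bound_le[OF W0 t _ P Q[OF W0]])
    fix a b c assume i: "(a, b, c) \<in> set (leib W0)"
    have c: "ok c" by (rule ok_leib(3)[OF W0 i])
    have "gnorm (G c t) \<le> norm_bound (length W0) x c"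
      by (rule family_norm_bound[where v=v and P=P and Q=Q, OF _ t _ _ _ c])
        ((rule v P Q x; assumption) | use leib_length[OF i] in simp)+
    moreover have "Lp_norm 4 (v c t) \<le> gnorm (G c t)" using v[OF c] by (auto intro: Sobolev_H1)
    moreover have "in_Lp 4 (v c t)" using v[OF c] by (simp add: H1_def)
    ultimately show "in_Lp 4 (v c t) \<and> Lp_norm 4 (v c t) \<le> norm_bound (length W0) x c" by linarith
  qed
  \<comment> \<open>Adding \<open>R\<close> to every term, of top order or not, spares counting the
    top-order ones and is the source of the constant \<open>2 * length (leib W0)\<close>.\<close>
  also have "(\<Sum>i\<leftarrow>leib W0. 2 * P (fst i) * P (fst (snd i)) * norm_bound (length W0) x (snd (snd i))) \<le> (\<Sum>i\<leftarrow>leib W0. S i + R)"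
  proof (rule sum_list_mono)
    fix i assume "i \<in> set (leib W0)"
    then have i: "(fst i, fst (snd i), snd (snd i)) \<in> set (leib W0)" by simp
    note ms = leib_mset[OF i]
    from arg_cong[OF ms, of size] have l: "length (fst i) + length (fst (snd i)) + length (snd (snd i)) = length W0" by simp
    show "2 * P (fst i) * P (fst (snd i)) * norm_bound (length W0) x (snd (snd i)) \<le> S i + R"
    proof (cases "length (fst i) < length W0 \<and> length (fst (snd i)) < length W0")
      case True
      then show ?thesis using x[OF ok_leib(1)[OF W0 i]] x[OF ok_leib(2)[OF W0 i]] R by (simp add: S_def)
    next
      case False
      \<comment> \<open>The lengths add up to that of \<open>W0\<close>, so once one factor of
        \<open>phi\<close> takes all letters, the other factor and \<open>u\<close> are
        undifferentiated.\<close>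
      then have c: "snd (snd i) = []" and ab: "(fst i = [] \<and> mset (fst (snd i)) = mset W0) \<or> (fst (snd i) = [] \<and> mset (fst i) = mset W0)"
      proof -
        have "length (fst (snd i)) = 0 \<and> length (snd (snd i)) = 0 \<or> length (fst i) = 0 \<and> length (snd (snd i)) = 0"
          using False l by linarith
        then consider "fst (snd i) = []" "snd (snd i) = []" | "fst i = []" "snd (snd i) = []" unfolding length_0_conv by blast
        then show "snd (snd i) = []" "(fst i = [] \<and> mset (fst (snd i)) = mset W0) \<or> (fst (snd i) = [] \<and> mset (fst i) = mset W0)"
          using ms by (cases; simp)+
      qed
      \<comment> \<open>Since \<open>leib []\<close> is empty, the bound for the empty word is the
        norm of \<open>f\<close> at every recursion depth; its coordinate is correct because
        \<open>W0\<close> is not empty here.\<close>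
      have n: "norm_bound (length W0) x [] = Q []"
      proof -
        have "length W0 > 0" using leib_length[OF i] by linarith
        then have "snd x (idx []) = Q []" using x[OF ok_Nil] by simp
        then show ?thesis by (cases "length W0") simp_all
      qed
      have S: "S i = 0" using False unfolding S_def by (rule if_not_P)
      have "P (fst i) * P (fst (snd i)) = P W0 * P []"
        using ab
      proof
        assume *: "fst i = [] \<and> mset (fst (snd i)) = mset W0"
        then have "P (fst (snd i)) = P W0" by (intro Pm) simp
        then show ?thesis using * by (simp add: mult.commute)
      next
        assume *: "fst (snd i) = [] \<and> mset (fst i) = mset W0"
        then have "P (fst i) = P W0" by (intro Pm) simp
        then show ?thesis using * by simp
      qed
      then show ?thesis unfolding c n S R_def by (simp add: mult.assoc)
    qed
  qed
  also have "(\<Sum>i\<leftarrow>leib W0. S i + R) = low_bound W0 x + real (length (leib W0)) * R"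
    by (simp add: sum_list_addf sum_list_triv low_bound_def S_def)
  finally show ?thesis using v[OF W0] by (simp add: R_def algebra_simps)
qed

text \<open>The imaginary part solves the equation with zero right-hand side, so the energy estimate
  makes it vanish. The derivatives of order zero in the data agree with \<open>phi\<close> and
  \<open>f\<close> only almost everywhere, hence the passage to \<open>\<Phi>\<close> and
  \<open>g\<close>.\<close>

lemma real_part_solution:
  assumes \<phi>: "in_Lp 4 \<phi>" and \<Phi>: "in_Lp 4 \<Phi>" "AE x in lborel. \<Phi> x = \<phi> x" and f: "in_Lp (4/3) f"
    and g: "in_Lp (4/3) g" "AE x in lborel. g x = f x" and e: "solves_ell \<phi> f u"
  shows "ell (qf (\<lambda>s x. cpart s (\<Phi> x))) g (\<lambda>x. cpart True (u x))" "AE x in lborel. cpart False (u x) = 0"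
proof -
  have H: "Hdot1 u" and u: "in_Lp 4 u" using e by (auto simp: solves_ell_def Hdot1_def)
  have c4: "(4::real) > 0" by simp
  show "ell (qf (\<lambda>s x. cpart s (\<Phi> x))) g (\<lambda>x. cpart True (u x))"
  proof (rule ell_cong_AE[of "qf (\<lambda>s x. cpart s (\<phi> x))" f])
    show "ell (qf (\<lambda>s x. cpart s (\<phi> x))) f (\<lambda>x. cpart True (u x))" using solves_ell_cpart[OF \<phi> e, of True] by simp
    show "AE x in lborel. qf (\<lambda>s x. cpart s (\<Phi> x)) x = qf (\<lambda>s x. cpart s (\<phi> x)) x"
      using \<Phi>(2) by eventually_elim (simp add: qf_cpart)
  qed (rule in_Lp_measurable[OF qf_mult_in_Lp[OF Lp_cpart(1)[OF c4 \<phi>] Lp_cpart(1)[OF c4 u]]]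
      in_Lp_measurable[OF qf_mult_in_Lp[OF Lp_cpart(1)[OF c4 \<Phi>(1)] Lp_cpart(1)[OF c4 u]]]
      in_Lp_measurable[OF f] in_Lp_measurable[OF g(1)] g(2))+
  obtain G where G: "H1 (\<lambda>x. cpart False (u x)) G" using Hdot1_cpart(1)[OF H] by blast
  have "Lp_norm 4 (\<lambda>x. cpart False (u x)) \<le> Lp_norm (4/3) (\<lambda>x::real^4. 0::real)"
    by (rule solution_bound(2)[OF G _ Lp_cpart(1)[OF c4 \<phi>]]) (use solves_ell_cpart[OF \<phi> e, of False] in \<open>simp_all add: in_Lp_zero\<close>)
  then have "Lp_norm 4 (\<lambda>x. cpart False (u x)) = 0"
    using Lp_norm_nonneg[of 4 "\<lambda>x. cpart False (u x)"] by (simp add: Lp_norm_zero)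
  then show "AE x in lborel. cpart False (u x) = 0" by (rule Lp_norm_eq_0_AE[OF c4 Lp_cpart(1)[OF c4 u]])
qed

lemma cont_H_of_real:
  assumes "\<And>t. t \<in> {0..T} \<Longrightarrow> H1 (v t) (G t)"
    and "\<And>t. t \<in> {0..T} \<Longrightarrow> ((\<lambda>s. gnorm (\<lambda>i x. G s i x - G t i x)) \<longlongrightarrow> 0) (at t within {0..T})"
  shows "cont_H T (\<lambda>t x. complex_of_real (v t x))"
  unfolding cont_H_def
proof (intro conjI ballI)
  fix t assume t: "t \<in> {0..T}"
  show "Hdot1 (\<lambda>x. complex_of_real (v t x))" by (rule H1_of_real(1)[OF assms(1)[OF t]])
  have "hnorm (\<lambda>x. complex_of_real (v s x) - complex_of_real (v t x)) = gnorm (\<lambda>i x. G s i x - G t i x)" if "s \<in> {0..T}" for s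
    using H1_of_real(2)[OF H1_diff[OF assms(1)[OF that] assms(1)[OF t]]] by simp
  then have "\<forall>\<^sub>F s in at t within {0..T}. gnorm (\<lambda>i x. G s i x - G t i x) = hnorm (\<lambda>x. complex_of_real (v s x) - complex_of_real (v t x))"
    using eventually_at_within_mem[where t=t and S="{0..T}"] by (auto elim: eventually_mono)
  from Lim_transform_eventually[OF assms(2)[OF t] this]
  show "((\<lambda>s. hnorm (\<lambda>x. complex_of_real (v s x) - complex_of_real (v t x))) \<longlongrightarrow> 0) (at t within {0..T})" .
qed

lemma pair_zero:
  assumes "\<And>t. t \<in> {0..T} \<Longrightarrow> AE x in lborel. g t x = 0"
  shows "pair T g \<psi> = 0"
proof -
  have "(LINT x|lborel. \<psi> (t, x) *\<^sub>R g t x) = 0" if "t \<in> {0..T}" for t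
    by (rule integral_eq_zero_AE) (use assms[OF that] in \<open>auto elim: eventually_mono\<close>)
  then have "integral {0..T} (\<lambda>t. LINT x|lborel. \<psi> (t, x) *\<^sub>R g t x) = integral {0..T} (\<lambda>t. 0)"
    by (rule Henstock_Kurzweil_Integration.integral_cong)
  then show ?thesis by (simp add: pair_def)
qed

text \<open>Each letter moves one derivative onto the test function with one sign change; as the
  head of a decreasing word is innermost in \<open>Dtx\<close>, the accumulated operator is exactly
  \<open>Dtx\<close>.\<close>

lemma (in elliptic_data) pair_word:
  assumes v: "v [] = u" "\<And>d w. ok (d # w) \<Longrightarrow> wdst T (dv d) (v w) (v (d # w))"
    and W: "\<And>d. d \<in> set W0 \<Longrightarrow> d \<le> 4" and w: "ok w" and \<psi>: "test_st T \<psi>"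
  shows "pair T (v w) \<psi> = (-1) ^ length w * pair T u (Dtx (tj w) (mi w) \<psi>)"
  using w \<psi>
proof (induction w arbitrary: \<psi>)
  case Nil
  then show ?case by (simp add: v(1) tj_mi_Nil Dtx_0)
next
  case (Cons d w)
  have "d \<in># mset W0" using Cons.prems(1) unfolding ok_def by (auto dest: mset_subset_eq_insertD)
  then have d: "d \<le> 4" using W by simp
  have e: "e \<le> d" if "e \<in> set w" for e using Cons.prems(1) that by (simp add: ok_def)
  have D: "Dtx (tj (d # w)) (mi (d # w)) \<psi> = Dtx (tj w) (mi w) (dd (dv d) \<psi>)" by (rule Dtx_Cons[OF d e])
  have "pair T (v (d # w)) \<psi> = - pair T (v w) (dd (dv d) \<psi>)"
    using v(2)[OF Cons.prems(1)] Cons.prems(2) by (simp add: wdst_def)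
  also have "pair T (v w) (dd (dv d) \<psi>) = (-1) ^ length w * pair T u (Dtx (tj w) (mi w) (dd (dv d) \<psi>))"
    by (rule Cons.IH[OF ok_ConsD[OF Cons.prems(1)] test_st_dd[OF Cons.prems(2) dv_Basis]])
  finally show ?case unfolding D by simp
qed

theorem mainTheorem12:
  fixes m M j :: nat and \<alpha> :: "4 \<Rightarrow> nat"
  assumes "j \<le> m" and "mabs \<alpha> \<le> M"
  shows "\<exists>(C::real) (F :: ((nat \<times> (4 \<Rightarrow> nat) \<Rightarrow> real) \<times> (nat \<times> (4 \<Rightarrow> nat) \<Rightarrow> real)) \<Rightarrow> real).
    continuous_on UNIV F \<and>
    (\<forall>(T::real) (\<phi>::real \<Rightarrow> real^4 \<Rightarrow> complex) (f::real \<Rightarrow> real^4 \<Rightarrow> real)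
        (u::real \<Rightarrow> real^4 \<Rightarrow> complex)
        (\<Phi>::nat \<Rightarrow> (4 \<Rightarrow> nat) \<Rightarrow> real \<Rightarrow> real^4 \<Rightarrow> complex)
        (Fd::nat \<Rightarrow> (4 \<Rightarrow> nat) \<Rightarrow> real \<Rightarrow> real^4 \<Rightarrow> real).
      T > 0 \<and> cont_H T \<phi> \<and> cont_L T f \<and> cont_H T u \<and>
      (\<forall>t\<in>{0..T}. solves_ell (\<phi> t) (f t) (u t)) \<and>
      (\<forall>k \<beta>. k \<le> m \<and> mabs \<beta> \<le> M \<longrightarrow>
         is_dtx T k \<beta> \<phi> (\<Phi> k \<beta>) \<and> cont_H T (\<Phi> k \<beta>) \<and>
         is_dtx T k \<beta> f (Fd k \<beta>) \<and> cont_L T (Fd k \<beta>))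
      \<longrightarrow>
      (\<exists>U. is_dtx T j \<alpha> u U \<and> cont_H T U \<and>
         supH T U \<le> C * supH T (\<Phi> j \<alpha>) * supH T \<phi> * supL T f + supL T (Fd j \<alpha>)
           + F ((\<lambda>(k, \<beta>). if k \<le> j \<and> mabs \<beta> \<le> mabs \<alpha> \<and> k + mabs \<beta> < j + mabs \<alpha>
                            then supH T (\<Phi> k \<beta>) else 0),
                (\<lambda>(k, \<beta>). if k \<le> j \<and> mabs \<beta> \<le> mabs \<alpha> \<and> k + mabs \<beta> < j + mabs \<alpha>
                            then supL T (Fd k \<beta>) else 0))))"
proof -
  define W where "W = canon j \<alpha>"
  define ok where "ok w \<longleftrightarrow> sorted_wrt (\<ge>) w \<and> mset w \<subseteq># mset W" for w
  have W: "tj W = j" "mi W = \<alpha>" "\<And>d. d \<in> set W \<Longrightarrow> d \<le> 4" "ok W" "length W = j + mabs \<alpha>"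
    using tj_mi_canon canon_le canon_sorted tj_plus_mabs[of W] by (auto simp: W_def ok_def)
  have okle: "tj w \<le> j" "mabs (mi w) \<le> mabs \<alpha>" if "ok w" for w
    using tj_mi_mono[of w W] that W by (auto simp: ok_def)
  have okm: "tj w \<le> m" "mabs (mi w) \<le> M" if "ok w" for w
    using okle[OF that] assms by auto
  have okC: "d \<le> 4" "\<And>e. e \<in> set w \<Longrightarrow> e \<le> d" "ok w" if "ok (d # w)" for d w
  proof -
    have "d \<in># mset W" using that unfolding ok_def by (auto dest: mset_subset_eq_insertD)
    then show "d \<le> 4" using W(3) by simp
    show "\<And>e. e \<in> set w \<Longrightarrow> e \<le> d" using that by (simp add: ok_def)
    show "ok w" using that unfolding ok_def by (auto dest: mset_subset_eq_insertD simp: subset_mset.less_imp_le)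
  qed
  have zero: "tj [] = 0" "mi [] = (\<lambda>_. 0)" "mabs (\<lambda>_. 0) = 0" by (simp_all add: tj_mi_Nil mabs_def)
  show ?thesis
  \<comment> \<open>Both witnesses depend on \<open>j\<close> and \<open>\<alpha>\<close> only. For
    the empty word there are no Leibniz terms and both vanish, which leaves the bare energy
    estimate.\<close>
  proof (rule exI[of _ "real (2 * length (leib W))"], rule exI[of _ "low_bound W"], intro conjI allI impI, rule continuous_on_low_bound, elim conjE)
    fix T :: real and \<phi> u :: "real \<Rightarrow> real^4 \<Rightarrow> complex" and f :: "real \<Rightarrow> real^4 \<Rightarrow> real"
      and \<Phi> :: "nat \<Rightarrow> (4 \<Rightarrow> nat) \<Rightarrow> real \<Rightarrow> real^4 \<Rightarrow> complex" and Fd :: "nat \<Rightarrow> (4 \<Rightarrow> nat) \<Rightarrow> real \<Rightarrow> real^4 \<Rightarrow> real"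
    assume T: "0 < T" and \<phi>: "cont_H T \<phi>" and f: "cont_L T f" and u: "cont_H T u"
      and e: "\<forall>t\<in>{0..T}. solves_ell (\<phi> t) (f t) (u t)"
      and D: "\<forall>k \<beta>. k \<le> m \<and> mabs \<beta> \<le> M \<longrightarrow> is_dtx T k \<beta> \<phi> (\<Phi> k \<beta>) \<and> cont_H T (\<Phi> k \<beta>) \<and>
         is_dtx T k \<beta> f (Fd k \<beta>) \<and> cont_L T (Fd k \<beta>)"
    let ?x = "((\<lambda>(k, \<beta>). if k \<le> j \<and> mabs \<beta> \<le> mabs \<alpha> \<and> k + mabs \<beta> < j + mabs \<alpha> then supH T (\<Phi> k \<beta>) else 0),
      (\<lambda>(k, \<beta>). if k \<le> j \<and> mabs \<beta> \<le> mabs \<alpha> \<and> k + mabs \<beta> < j + mabs \<alpha> then supL T (Fd k \<beta>) else 0))"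
    define ph where "ph s w t x = cpart s (\<Phi> (tj w) (mi w) t x)" for s w t x
    define g where "g w = Fd (tj w) (mi w)" for w
    define ur where "ur t x = cpart True (u t x)" for t x
    have Dw: "is_dtx T (tj w) (mi w) \<phi> (\<Phi> (tj w) (mi w))" "cont_H T (\<Phi> (tj w) (mi w))"
        "is_dtx T (tj w) (mi w) f (g w)" "contLp T (4/3) (g w)" if "ok w" for w
      using D okm[OF that] by (auto simp: g_def cont_L_contLp[symmetric])
    have fc: "contLp T (4/3) f" using f by (simp add: cont_L_contLp)
    have okN: "ok []" by (simp add: ok_def)
    note D0 = Dw[OF okN, unfolded zero]
    have Hin: "in_Lp 4 (h t)" if "cont_H T h" "t \<in> {0..T}" for h t using that by (simp add: cont_H_def Hdot1_def)
    \<comment> \<open>The derivative of order zero is known only as a distribution, which determines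
      each slice up to a null set; the supremum norms in \<open>sH\<close> and \<open>sL\<close> do
      not see the difference.\<close>
    have \<Phi>0: "AE x in lborel. \<Phi> 0 (\<lambda>_. 0) t x = \<phi> t x" if "t \<in> {0..T}" for t
      by (rule cont_H_AE[OF T \<phi> D0(2) is_dtx_0[OF D0(1)] that])
    have g0: "AE x in lborel. g [] t x = f t x" if "t \<in> {0..T}" for t
      by (rule pair_eq_AE[OF T _ fc D0(4) is_dtx_0[OF D0(3)] that]) simp_all
    have gin: "in_Lp (4/3) (g [] t)" "in_Lp (4/3) (f t)" if "t \<in> {0..T}" for t
      using D0(4) fc that by (auto simp: contLp_def)
    have sH: "supH T (\<Phi> 0 (\<lambda>_. 0)) = supH T \<phi>" unfolding supH_def
      by (rule SUP_cong[OF refl], rule hnorm_cong_AE[OF in_Lp_measurable[OF Hin[OF D0(2)]] in_Lp_measurable[OF Hin[OF \<phi>]] \<Phi>0])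
    have sL: "supL T (g []) = supL T f" unfolding supL_def
      by (rule SUP_cong[OF refl], rule Lp_cong_AE(2)[OF _ gin(2) in_Lp_measurable[OF gin(1)] g0]) simp_all
    have part: "ell (qf (\<lambda>s. ph s [] t)) (g [] t) (ur t)" "AE x in lborel. cpart False (u t x) = 0" if t: "t \<in> {0..T}" for t
    proof -
      note R = real_part_solution[OF Hin[OF \<phi> t] Hin[OF D0(2) t] \<Phi>0[OF t] gin(2,1)[OF t] g0[OF t] e[rule_format, OF t]]
      show "ell (qf (\<lambda>s. ph s [] t)) (g [] t) (ur t)" using R(1) by (simp add: ph_def[abs_def] ur_def[abs_def] zero)
      show "AE x in lborel. cpart False (u t x) = 0" by (rule R(2))
    qed
    have "\<forall>t\<in>{0..T}. \<exists>G. H1 (ur t) G"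
      using Hdot1_cpart(1)[of _ True] u by (simp add: ur_def[abs_def] cont_H_def)
    from bchoice[OF this] obtain Gu where Gu: "\<forall>t\<in>{0..T}. H1 (ur t) (Gu t)" ..
    have ED: "elliptic_data T ph g ur Gu W"
    proof (intro elliptic_data.intro, fold ok_def)
      show "0 < T" by (rule T)
      show "contLp T 4 (ph s w)" if "ok w" for s w
        using cont_H_contLp[OF Dw(2)[OF that], of s] by (simp add: ph_def[abs_def])
      show "contLp T (4/3) (g w)" if "ok w" for w by (rule Dw(4)[OF that])
      show "wdst T (dv d) (ph s w) (ph s (d # w))" if "ok (d # w)" for s d w
        unfolding wdst_def
      proof (intro allI impI)
        fix \<psi> assume \<psi>: "test_st T \<psi>"
        have w: "ok w" by (rule okC(3)[OF that])
        have "pair T (\<Phi> (tj (d # w)) (mi (d # w))) \<psi> = - pair T (\<Phi> (tj w) (mi w)) (dd (dv d) \<psi>)"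
          by (rule is_dtx_Cons[OF Dw(1)[OF that] Dw(1)[OF w] okC(1)[OF that] okC(2)[OF that] \<psi>])
        from arg_cong[OF this, of "cpart s"]
        have "cpart s (pair T (\<Phi> (tj (d # w)) (mi (d # w))) \<psi>) = - cpart s (pair T (\<Phi> (tj w) (mi w)) (dd (dv d) \<psi>))"
          by (simp add: cpart_def)
        then show "pair T (ph s (d # w)) \<psi> = - pair T (ph s w) (dd (dv d) \<psi>)"
          unfolding cont_H_pair_cpart[OF Dw(2)[OF that] test_st_test[OF \<psi>]]
            cont_H_pair_cpart[OF Dw(2)[OF w] test_st_test[OF test_st_dd[OF \<psi> dv_Basis]]]
          by (simp only: ph_def[abs_def])
      qed
      show "wdst T (dv d) (g w) (g (d # w))" if "ok (d # w)" for d w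
        unfolding wdst_def
      proof (intro allI impI)
        fix \<psi> assume \<psi>: "test_st T \<psi>"
        show "pair T (g (d # w)) \<psi> = - pair T (g w) (dd (dv d) \<psi>)"
          by (rule is_dtx_Cons[OF Dw(3)[OF that] Dw(3)[OF okC(3)[OF that]] okC(1)[OF that] okC(2)[OF that] \<psi>])
      qed
      show "H1 (ur t) (Gu t) \<and> ell (qf (\<lambda>s. ph s [] t)) (g [] t) (ur t)" if "t \<in> {0..T}" for t
        using Gu part(1)[OF that] that by blast
    qed
    interpret E: elliptic_data T ph g ur Gu W ok by (rule ED) (simp only: ok_def)
    obtain v G where v0: "v [] = ur" and v: "\<And>w. ok w \<Longrightarrow> contLp T 4 (v w)
     \<and> (\<forall>t\<in>{0..T}. H1 (v w t) (G w t) \<and> gnorm (G w t) \<le> Lp_norm (4/3) (rhs ph g v w t)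
         \<and> ((\<lambda>s. gnorm (\<lambda>i x. G w s i x - G w t i x)) \<longlongrightarrow> 0) (at t within {0..T}))
     \<and> (\<forall>d w'. w = d # w' \<longrightarrow> wdst T (dv d) (v w') (v w))"
      using E.solution_family by blast
    have vd: "wdst T (dv d) (v w) (v (d # w))" if "ok (d # w)" for d w
      by (rule v[OF that, THEN conjunct2, THEN conjunct2, rule_format, OF refl])
    have gW: "g W = Fd j \<alpha>" by (simp add: g_def W)
    define U where "U t x = complex_of_real (v W t x)" for t x
    have vW: "H1 (v w t) (G w t)" "gnorm (G w t) \<le> Lp_norm (4/3) (rhs ph g v w t)" if "ok w" "t \<in> {0..T}" for w t
      using v[OF that(1)] that(2) by blast+
    have UH: "cont_H T U" unfolding U_def[abs_def]
      by (rule cont_H_of_real[of T "v W" "G W"]) (use v[OF W(4)] in blast)+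
    have "is_dtx T j \<alpha> u U" unfolding is_dtx_def
    proof (intro allI impI, rule cpart_eqI)
      fix \<psi> s assume \<psi>: "test_st T \<psi>"
      have s: "cpart s (c *\<^sub>R pair T u (Dtx j \<alpha> \<psi>)) = c * pair T (\<lambda>t x. cpart s (u t x)) (Dtx j \<alpha> \<psi>)" for c
        unfolding cpart_scaleR cont_H_pair_cpart[OF u test_st_test[OF test_st_Dtx[OF \<psi>]]] ..
      have p: "cpart s (pair T U \<psi>) = pair T (\<lambda>t x. cpart s (U t x)) \<psi>" by (rule cont_H_pair_cpart[OF UH test_st_test[OF \<psi>]])
      show "cpart s (pair T U \<psi>) = cpart s (((-1) ^ (j + mabs \<alpha>)) *\<^sub>R pair T u (Dtx j \<alpha> \<psi>))"
      proof (cases s)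
        case True
        have "pair T (v W) \<psi> = (-1) ^ length W * pair T ur (Dtx (tj W) (mi W) \<psi>)"
          by (rule E.pair_word[where v=v, OF v0 vd W(3,4) \<psi>])
        then show ?thesis unfolding s p using True by (simp add: U_def cpart_def ur_def[abs_def] W)
      next
        \<comment> \<open>The imaginary part of \<open>u\<close> vanishes almost everywhere and
          \<open>U\<close> is real by construction, so both sides are zero.\<close>
        case False
        have "pair T (\<lambda>t x. cpart False (u t x)) (Dtx j \<alpha> \<psi>) = 0" by (rule pair_zero[OF part(2)])
        moreover have "pair T (\<lambda>t x. cpart False (U t x)) \<psi> = 0" by (rule pair_zero) (simp add: U_def cpart_def)
        ultimately show ?thesis unfolding s p using False by simp
      qed
    qed
    moreover have "supH T U \<le> real (2 * length (leib W)) * supH T (\<Phi> j \<alpha>) * supH T \<phi> * supL T f + supL T (Fd j \<alpha>) + low_bound W ?x"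
      unfolding supH_def[of T U]
    proof (rule cSUP_least)
      show "{0..T} \<noteq> {}" using T by simp
      fix t assume t: "t \<in> {0..T}"
      have "gnorm (G W t) \<le> real (2 * length (leib W)) * supH T (\<Phi> (tj W) (mi W)) * supH T (\<Phi> (tj []) (mi [])) * supL T (g []) + supL T (g W) + low_bound W ?x"
      proof (rule E.top_norm_bound[where v=v and P="\<lambda>w. supH T (\<Phi> (tj w) (mi w))" and Q="\<lambda>w. supL T (g w)", OF _ t _ _ _ _ W(4)])
        show "H1 (v w t) (G w t) \<and> gnorm (G w t) \<le> Lp_norm (4/3) (rhs ph g v w t)" if "ok w" for w using vW[OF that t] by blast
        show "Lp_norm 4 (ph s a t) \<le> supH T (\<Phi> (tj a) (mi a))" if "ok a" for s a
        proof -
          have "Hdot1 (\<Phi> (tj a) (mi a) t)" using Dw(2)[OF that] t by (simp add: cont_H_def)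
          from Hdot1_cpart(2)[OF this, of s] hnorm_le_supH[OF Dw(2)[OF that] t]
          show ?thesis by (simp add: ph_def[abs_def])
        qed
        show "Lp_norm (4/3) (g w t) \<le> supL T (g w)" if "ok w" for w by (rule Lp_norm_le_supL[OF Dw(4)[OF that] t])
        \<comment> \<open>A word with letters from \<open>W\<close> satisfies the first two
          conditions of the truncation, and being shorter than \<open>W\<close> it satisfies the
          third.\<close>
        show "fst ?x (idx w) = supH T (\<Phi> (tj w) (mi w)) \<and> snd ?x (idx w) = supL T (g w)" if "ok w" "length w < length W" for w
          using okle[OF that(1)] that(2) tj_plus_mabs[of w] W(5) by (simp add: idx_def g_def)
        show "supH T (\<Phi> (tj w) (mi w)) = supH T (\<Phi> (tj W) (mi W))" if "mset w = mset W" for w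
          using tj_mi_mset[OF that] by simp
      qed
      moreover have "hnorm (U t) = gnorm (G W t)" unfolding U_def[abs_def] by (rule H1_of_real(2)[OF vW(1)[OF W(4) t]])
      ultimately show "hnorm (U t) \<le> real (2 * length (leib W)) * supH T (\<Phi> j \<alpha>) * supH T \<phi> * supL T f + supL T (Fd j \<alpha>) + low_bound W ?x"
        unfolding W zero sH sL gW by simp
    qed
    ultimately show "\<exists>U. is_dtx T j \<alpha> u U \<and> cont_H T U \<and>
         supH T U \<le> real (2 * length (leib W)) * supH T (\<Phi> j \<alpha>) * supH T \<phi> * supL T f + supL T (Fd j \<alpha>) + low_bound W ?x"
      using UH by blast
  qed
qed

end
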